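(* Let $K$ be a perfectoid field with $t \in K^\circ$ as in the context, let $A$ be an integral perfectoid $K^\circ$-algebra, and let $X := \mathrm{Spa}(A[\frac1t], A)$ be the associated perfectoid space. Let $g \in A$ be an element that admits a compatible system of $p$-power roots $g^{1/p^k}$, and assume that $g$ is a nonzerodivisor modulo $t^m$ in the almost sense (with respect to $t^{1/p^\infty}$). For $n \ge 1$ put $A\langle \frac{t^n}{g}\rangle := \mathcal{O}_X^+(X\langle \frac{t^n}{g}\rangle)$. For each $m \ge 0$, consider the natural projective system of maps $$\Big\{ f_n : A/t^m \to A\big\langle \tfrac{t^n}{g}\big\rangle/t^m \Big\}_{n \ge 1}$$ in almost mathematics with respect to $t^{1/p^\infty}$. Then: 1. Each $\ker(f_n)$ is almost zero. 2. The pro-system $\{\mathrm{coker}(f_n)\}_{n \ge 1}$ is uniformly almost-pro-zero with respect to $g^{1/p^\infty}$: for any $k \ge 0$ there exists some $c \ge 0$ such that for every $n \ge 1$ the image of the $c$-fold transition map $\mathrm{coker}(f_{n+c}) \to \mathrm{coker}(f_n)$ is killed by $g^{1/p^k}$ (in the almost sense with respect to $t^{1/p^\infty}$). In fact, $c = p^k m$ works. In particular, the projective system $\{f_n\}_{n \ge 1}$ is an almost-pro-isomorphism with respect to $(tg)^{1/p^\infty}$.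
   Context: $p$ is a prime, $K$ is a perfectoid field (of residue characteristic $p$) with ring of integers $K^\circ$. A nonzero topologically nilpotent element $t \in K^\circ$ is fixed, together with a compatible system of $p$-power roots $t^{1/p^k}$, such that $|t| = |p|$ if $K$ has characteristic $0$. A $K^\circ$-algebra $A$ is integral perfectoid if it is flat, $t$-adically complete, Frobenius induces an isomorphism $A/t^{1/p} \simeq A/t$, and $A = A_*$, i.e. any $f \in A[\frac1t]$ with $t^{1/p^k} f \in A$ for all $k \ge 0$ lies in $A$. $X\langle \frac{t^n}{g}\rangle$ is the rational subset $\{x \in X : |t^n(x)| \le |g(x)|\}$. Since $X\langle \frac{t^n}{g}\rangle \subset X\langle\frac{t^{n+1}}{g}\rangle$, restriction gives the transition maps $A\langle \frac{t^{n+1}}{g}\rangle \to A\langle \frac{t^n}{g}\rangle$; the maps $f_n$ are induced by restriction of functions, with the constant system $A/t^m$ as source. Almost mathematics with respect to $t^{1/p^\infty}$: an $A$-module is almost zero if it is killed by $t^{1/p^k}$ for all $k \ge 0$, and statements are understood up to almost zero modules. "$g$ is a nonzerodivisor modulo $t^m$ in the almost sense" means the kernel of multiplication by $g$ on $A/t^m$ is almost zero. For an element $h$ with compatible $p$-power roots $h^{1/p^k}$, a projective system $\{M_n\}_{n\ge 1}$ of $A$-modules is almost-pro-zero with respect to $h^{1/p^\infty}$ if for any $k \ge 0$ and $n \ge 1$ there is $m' = m'(n,k) \ge n$ such that $\mathrm{im}(M_{m'} \to M_n)$ is killed by $h^{1/p^k}$. A map of projective systems of modules is an almost-pro-isomorphism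 with respect to $h^{1/p^\infty}$ if the systems of kernels and cokernels are almost-pro-zero with respect to $h^{1/p^\infty}$. Here $(tg)^{1/p^k} := t^{1/p^k} g^{1/p^k}$. *)

theory Defs
  imports
    "HOL-Algebra.Module"
    "HOL-Algebra.QuotRing"
    "HOL-Algebra.Generated_Rings"
    "HOL-Algebra.Free_Abelian_Groups"
    "HOL-Analysis.Isolated"
    "HOL-Computational_Algebra.Primes"
begin

section \<open>Perfectoid fields\<close>

definition ultrametric_abs_val :: "('k, 'm) ring_scheme \<Rightarrow> ('k \<Rightarrow> real) \<Rightarrow> bool" where
  "ultrametric_abs_val K nrm \<longleftrightarrow>
     (\<forall>x\<in>carrier K. 0 \<le> nrm x \<and> (nrm x = 0 \<longleftrightarrow> x = \<zero>\<^bsub>K\<^esub>)) \<and>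
     (\<forall>x\<in>carrier K. \<forall>y\<in>carrier K. nrm (x \<otimes>\<^bsub>K\<^esub> y) = nrm x * nrm y) \<and>
     (\<forall>x\<in>carrier K. \<forall>y\<in>carrier K. nrm (x \<oplus>\<^bsub>K\<^esub> y) \<le> max (nrm x) (nrm y))"

definition complete_abs_val :: "('k, 'm) ring_scheme \<Rightarrow> ('k \<Rightarrow> real) \<Rightarrow> bool" where
  "complete_abs_val K nrm \<longleftrightarrow>
     (\<forall>s. (\<forall>i. s i \<in> carrier K) \<and>
          (\<forall>e>0. \<exists>M::nat. \<forall>i\<ge>M. \<forall>j\<ge>M. nrm (s i \<ominus>\<^bsub>K\<^esub> s j) < e) \<longrightarrow>
          (\<exists>x\<in>carrier K. (\<lambda>i. nrm (s i \<ominus>\<^bsub>K\<^esub> x)) \<longlonglongrightarrow> 0))"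

definition int_ring :: "'k ring \<Rightarrow> ('k \<Rightarrow> real) \<Rightarrow> 'k ring" where
  "int_ring K nrm = K\<lparr>carrier := {x \<in> carrier K. nrm x \<le> 1}\<rparr>"

definition nat_elem :: "('k, 'm) ring_scheme \<Rightarrow> nat \<Rightarrow> 'k" where
  "nat_elem R p = [p] \<cdot>\<^bsub>R\<^esub> \<one>\<^bsub>R\<^esub>"

definition char_zero :: "('k, 'm) ring_scheme \<Rightarrow> bool" where
  "char_zero R \<longleftrightarrow> (\<forall>n::nat. n > 0 \<longrightarrow> [n] \<cdot>\<^bsub>R\<^esub> \<one>\<^bsub>R\<^esub> \<noteq> \<zero>\<^bsub>R\<^esub>)"

text \<open>The last clause is surjectivity of Frobenius on the quotient of the ring of integers
  by \<open>p\<close>; the clause \<open>nrm p < 1\<close> says that the residue characteristic is \<open>p\<close>.\<close>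

definition perfectoid_field :: "nat \<Rightarrow> 'k ring \<Rightarrow> ('k \<Rightarrow> real) \<Rightarrow> bool" where
  "perfectoid_field p K nrm \<longleftrightarrow>
     field K \<and> ultrametric_abs_val K nrm \<and> complete_abs_val K nrm \<and>
     \<not> discrete (nrm ` (carrier K - {\<zero>\<^bsub>K\<^esub>})) \<and>
     nrm (nat_elem K p) < 1 \<and>
     (let V = int_ring K nrm; Q = V Quot (PIdl\<^bsub>V\<^esub> (nat_elem V p))
      in (\<lambda>x. x [^]\<^bsub>Q\<^esub> p) ` carrier Q = carrier Q)"

definition topologically_nilpotent :: "'k ring \<Rightarrow> ('k \<Rightarrow> real) \<Rightarrow> 'k \<Rightarrow> bool" where
  "topologically_nilpotent K nrm x \<longleftrightarrow> (\<lambda>n::nat. nrm (x [^]\<^bsub>K\<^esub> n)) \<longlonglongrightarrow> 0"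

definition compatible_roots :: "('a, 'm) ring_scheme \<Rightarrow> nat \<Rightarrow> 'a \<Rightarrow> (nat \<Rightarrow> 'a) \<Rightarrow> bool" where
  "compatible_roots R p h r \<longleftrightarrow>
     r 0 = h \<and> (\<forall>k. r k \<in> carrier R \<and> r (Suc k) [^]\<^bsub>R\<^esub> p = r k)"


section \<open>Flatness\<close>

definition tensor_relations ::
  "('r, 'm) ring_scheme \<Rightarrow> ('r, 'x) module \<Rightarrow> ('r, 'y) module \<Rightarrow> ('x \<times> 'y \<Rightarrow>\<^sub>0 int) set" where
  "tensor_relations R M N =
     {frag_of (x \<oplus>\<^bsub>M\<^esub> x', y) - frag_of (x, y) - frag_of (x', y) | x x' y.
        x \<in> carrier M \<and> x' \<in> carrier M \<and> y \<in> carrier N} \<union>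
     {frag_of (x, y \<oplus>\<^bsub>N\<^esub> y') - frag_of (x, y) - frag_of (x, y') | x y y'.
        x \<in> carrier M \<and> y \<in> carrier N \<and> y' \<in> carrier N} \<union>
     {frag_of (r \<odot>\<^bsub>M\<^esub> x, y) - frag_of (x, r \<odot>\<^bsub>N\<^esub> y) | r x y.
        r \<in> carrier R \<and> x \<in> carrier M \<and> y \<in> carrier N}"

definition tensor_subgroup ::
  "('r, 'm) ring_scheme \<Rightarrow> ('r, 'x) module \<Rightarrow> ('r, 'y) module \<Rightarrow> ('x \<times> 'y \<Rightarrow>\<^sub>0 int) set" where
  "tensor_subgroup R M N =
     generate (free_Abelian_group (carrier M \<times> carrier N)) (tensor_relations R M N)"

definition tensor_product ::
  "('r, 'm) ring_scheme \<Rightarrow> ('r, 'x) module \<Rightarrow> ('r, 'y) module \<Rightarrow> ('x \<times> 'y \<Rightarrow>\<^sub>0 int) set monoid" where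
  "tensor_product R M N =
     free_Abelian_group (carrier M \<times> carrier N) Mod tensor_subgroup R M N"

definition tensor_map_id ::
  "('r, 'm) ring_scheme \<Rightarrow> ('r, 'x) module \<Rightarrow> ('r, 'y) module \<Rightarrow> ('w \<Rightarrow> 'x) \<Rightarrow>
   ('w \<times> 'y \<Rightarrow>\<^sub>0 int) set \<Rightarrow> ('x \<times> 'y \<Rightarrow>\<^sub>0 int) set" where
  "tensor_map_id R M N f Z =
     (\<Union>z\<in>Z. tensor_subgroup R M N #>\<^bsub>free_Abelian_group (carrier M \<times> carrier N)\<^esub>
               frag_extend (\<lambda>(x, y). frag_of (f x, y)) z)"

definition module_homs :: "('r, 'm) ring_scheme \<Rightarrow> ('r, 'x) module \<Rightarrow> ('r, 'y) module \<Rightarrow> ('x \<Rightarrow> 'y) set" where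
  "module_homs R M N =
     {f. (\<forall>x\<in>carrier M. f x \<in> carrier N) \<and>
         (\<forall>x\<in>carrier M. \<forall>y\<in>carrier M. f (x \<oplus>\<^bsub>M\<^esub> y) = f x \<oplus>\<^bsub>N\<^esub> f y) \<and>
         (\<forall>r\<in>carrier R. \<forall>x\<in>carrier M. f (r \<odot>\<^bsub>M\<^esub> x) = r \<odot>\<^bsub>N\<^esub> f x)}"

text \<open>Tensoring preserves injections. A definition can only quantify over modules carried by a
  fixed type; the type of \<open>R\<close> itself suffices, because flatness is already detected by the
  inclusions of the ideals of \<open>R\<close> into \<open>R\<close>.\<close>

definition flat_module :: "('r, 'm) ring_scheme \<Rightarrow> ('r, 'a) module \<Rightarrow> bool" where
  "flat_module R A \<longleftrightarrow>
     Module.module R A \<and>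
     (\<forall>(M :: ('r, 'r) module) (N :: ('r, 'r) module) f.
        Module.module R M \<and> Module.module R N \<and> f \<in> module_homs R M N \<and> inj_on f (carrier M) \<longrightarrow>
        inj_on (tensor_map_id R N A f) (carrier (tensor_product R M A)))"


section \<open>Localization\<close>

type_synonym 'a loc = "('a \<times> 'a) set"

definition powers :: "('a, 'm) ring_scheme \<Rightarrow> 'a \<Rightarrow> 'a set" where
  "powers R h = range (\<lambda>n::nat. h [^]\<^bsub>R\<^esub> n)"

definition loc_rel :: "('a, 'm) ring_scheme \<Rightarrow> 'a set \<Rightarrow> (('a \<times> 'a) \<times> ('a \<times> 'a)) set" where
  "loc_rel R S = {((a, s), (b, u)). a \<in> carrier R \<and> b \<in> carrier R \<and> s \<in> S \<and> u \<in> S \<and>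
     (\<exists>w\<in>S. w \<otimes>\<^bsub>R\<^esub> (u \<otimes>\<^bsub>R\<^esub> a) = w \<otimes>\<^bsub>R\<^esub> (s \<otimes>\<^bsub>R\<^esub> b))}"

definition loc_frac :: "('a, 'm) ring_scheme \<Rightarrow> 'a set \<Rightarrow> 'a \<Rightarrow> 'a \<Rightarrow> 'a loc" where
  "loc_frac R S a s = loc_rel R S `` {(a, s)}"

definition localization :: "('a, 'm) ring_scheme \<Rightarrow> 'a set \<Rightarrow> 'a loc ring" where
  "localization R S =
     \<lparr>carrier = (carrier R \<times> S) // loc_rel R S,
      monoid.mult = (\<lambda>X Y. \<Union>(a, s)\<in>X. \<Union>(b, u)\<in>Y. loc_frac R S (a \<otimes>\<^bsub>R\<^esub> b) (s \<otimes>\<^bsub>R\<^esub> u)),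
      monoid.one = loc_frac R S \<one>\<^bsub>R\<^esub> \<one>\<^bsub>R\<^esub>,
      ring.zero = loc_frac R S \<zero>\<^bsub>R\<^esub> \<one>\<^bsub>R\<^esub>,
      ring.add = (\<lambda>X Y. \<Union>(a, s)\<in>X. \<Union>(b, u)\<in>Y.
               loc_frac R S ((a \<otimes>\<^bsub>R\<^esub> u) \<oplus>\<^bsub>R\<^esub> (b \<otimes>\<^bsub>R\<^esub> s)) (s \<otimes>\<^bsub>R\<^esub> u))\<rparr>"

definition to_loc :: "('a, 'm) ring_scheme \<Rightarrow> 'a set \<Rightarrow> 'a \<Rightarrow> 'a loc" where
  "to_loc R S a = loc_frac R S a \<one>\<^bsub>R\<^esub>"


section \<open>Integral perfectoid algebras\<close>

definition alg_map :: "('k, 'a) module \<Rightarrow> 'k \<Rightarrow> 'a" where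
  "alg_map A c = c \<odot>\<^bsub>A\<^esub> \<one>\<^bsub>A\<^esub>"

text \<open>Bijectivity of \<open>A \<rightarrow> lim A/t\<^sup>n\<close>: every coherent sequence of residues comes from a unique
  element of \<open>A\<close>.\<close>

definition adically_complete :: "('a, 'm) ring_scheme \<Rightarrow> 'a \<Rightarrow> bool" where
  "adically_complete A t \<longleftrightarrow>
     (\<forall>s. (\<forall>n. s n \<in> carrier A \<and> s (Suc n) \<ominus>\<^bsub>A\<^esub> s n \<in> PIdl\<^bsub>A\<^esub> (t [^]\<^bsub>A\<^esub> (n::nat))) \<longrightarrow>
          (\<exists>!x. x \<in> carrier A \<and> (\<forall>n. x \<ominus>\<^bsub>A\<^esub> s n \<in> PIdl\<^bsub>A\<^esub> (t [^]\<^bsub>A\<^esub> n))))"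

definition frobenius_map :: "('a, 'm) ring_scheme \<Rightarrow> nat \<Rightarrow> 'a \<Rightarrow> 'a set \<Rightarrow> 'a set" where
  "frobenius_map A p t X = (\<Union>x\<in>X. (PIdl\<^bsub>A\<^esub> t) +>\<^bsub>A\<^esub> (x [^]\<^bsub>A\<^esub> p))"

text \<open>In \<open>integral_perfectoid p R t tr A\<close>, \<open>R\<close> is the ring of integers of the perfectoid field and
  \<open>tr k\<close> is the chosen root \<open>t^(1/p^k)\<close>.\<close>

definition integral_perfectoid ::
  "nat \<Rightarrow> 'k ring \<Rightarrow> 'k \<Rightarrow> (nat \<Rightarrow> 'k) \<Rightarrow> ('k, 'a) module \<Rightarrow> bool" where
  "integral_perfectoid p R t tr A \<longleftrightarrow>
     Module.algebra R A \<and>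
     flat_module R A \<and>
     adically_complete A (alg_map A t) \<and>
     frobenius_map A p (alg_map A t)
       \<in> ring_iso (A Quot (PIdl\<^bsub>A\<^esub> (alg_map A (tr 1)))) (A Quot (PIdl\<^bsub>A\<^esub> (alg_map A t))) \<and>
     (let S = powers A (alg_map A t); B = to_loc A S ` carrier A
      in \<forall>f\<in>carrier (localization A S).
           (\<forall>k. to_loc A S (alg_map A (tr k)) \<otimes>\<^bsub>localization A S\<^esub> f \<in> B) \<longrightarrow> f \<in> B)"


section \<open>Topologies and completions\<close>

text \<open>A ring topology is given by a basis \<open>N 0, N 1, \<dots>\<close> of neighbourhoods of \<open>0\<close> consisting
  of additive subgroups.\<close>

definition lin_open :: "('a, 'm) ring_scheme \<Rightarrow> (nat \<Rightarrow> 'a set) \<Rightarrow> 'a set \<Rightarrow> bool" where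
  "lin_open R N S \<longleftrightarrow> S \<subseteq> carrier R \<and> (\<forall>a\<in>S. \<exists>k. \<forall>b\<in>N k. a \<oplus>\<^bsub>R\<^esub> b \<in> S)"

text \<open>The \<open>w\<close>-adic topology defined by a ring of definition \<open>B\<close>.\<close>

definition adic_nbhd :: "('a, 'm) ring_scheme \<Rightarrow> 'a set \<Rightarrow> 'a \<Rightarrow> nat \<Rightarrow> 'a set" where
  "adic_nbhd R B w k = (\<lambda>b. w [^]\<^bsub>R\<^esub> k \<otimes>\<^bsub>R\<^esub> b) ` B"

type_synonym 'a compl = "(nat \<Rightarrow> 'a) set"

definition cauchy_seqs :: "('a, 'm) ring_scheme \<Rightarrow> (nat \<Rightarrow> 'a set) \<Rightarrow> (nat \<Rightarrow> 'a) set" where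
  "cauchy_seqs R N = {s. (\<forall>i. s i \<in> carrier R) \<and>
     (\<forall>k. \<exists>M. \<forall>i\<ge>M. \<forall>j\<ge>M. s i \<ominus>\<^bsub>R\<^esub> s j \<in> N k)}"

definition null_seqs :: "('a, 'm) ring_scheme \<Rightarrow> (nat \<Rightarrow> 'a set) \<Rightarrow> (nat \<Rightarrow> 'a) set" where
  "null_seqs R N = {s. (\<forall>i. s i \<in> carrier R) \<and> (\<forall>k. \<exists>M. \<forall>i\<ge>M. s i \<in> N k)}"

definition cauchy_ring :: "('a, 'm) ring_scheme \<Rightarrow> (nat \<Rightarrow> 'a set) \<Rightarrow> (nat \<Rightarrow> 'a) ring" where
  "cauchy_ring R N =
     \<lparr>carrier = cauchy_seqs R N,
      monoid.mult = (\<lambda>s u i. s i \<otimes>\<^bsub>R\<^esub> u i),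
      monoid.one = (\<lambda>i. \<one>\<^bsub>R\<^esub>),
      ring.zero = (\<lambda>i. \<zero>\<^bsub>R\<^esub>),
      ring.add = (\<lambda>s u i. s i \<oplus>\<^bsub>R\<^esub> u i)\<rparr>"

definition completion :: "('a, 'm) ring_scheme \<Rightarrow> (nat \<Rightarrow> 'a set) \<Rightarrow> 'a compl ring" where
  "completion R N = cauchy_ring R N Quot null_seqs R N"

definition compl_class :: "('a, 'm) ring_scheme \<Rightarrow> (nat \<Rightarrow> 'a set) \<Rightarrow> (nat \<Rightarrow> 'a) \<Rightarrow> 'a compl" where
  "compl_class R N s = null_seqs R N +>\<^bsub>cauchy_ring R N\<^esub> s"

definition compl_nbhd :: "('a, 'm) ring_scheme \<Rightarrow> (nat \<Rightarrow> 'a set) \<Rightarrow> nat \<Rightarrow> 'a compl set" where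
  "compl_nbhd R N k =
     compl_class R N ` {s \<in> cauchy_seqs R N. \<exists>M. \<forall>i\<ge>M. s i \<in> N k}"

text \<open>The extension of the identity of \<open>R\<close> to the completion for a coarser topology \<open>N'\<close>.\<close>

definition compl_coarsen :: "('a, 'm) ring_scheme \<Rightarrow> (nat \<Rightarrow> 'a set) \<Rightarrow> 'a compl \<Rightarrow> 'a compl" where
  "compl_coarsen R N' X = (\<Union>s\<in>X. compl_class R N' s)"


section \<open>Valuations and adic spectra\<close>

definition ordered_abelian_group :: "'v monoid \<Rightarrow> ('v \<times> 'v) set \<Rightarrow> bool" where
  "ordered_abelian_group G L \<longleftrightarrow>
     comm_group G \<and> linear_order_on (carrier G) L \<and>
     (\<forall>a\<in>carrier G. \<forall>b\<in>carrier G. \<forall>c\<in>carrier G.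
        (a, b) \<in> L \<longrightarrow> (a \<otimes>\<^bsub>G\<^esub> c, b \<otimes>\<^bsub>G\<^esub> c) \<in> L)"

text \<open>Values lie in the value group (written multiplicatively) with a least element \<open>0\<close>
  adjoined, which is \<open>None\<close>.\<close>

fun val_le :: "('v \<times> 'v) set \<Rightarrow> 'v option \<Rightarrow> 'v option \<Rightarrow> bool" where
  "val_le L None y = True"
| "val_le L (Some a) None = False"
| "val_le L (Some a) (Some b) = ((a, b) \<in> L)"

definition val_less :: "('v \<times> 'v) set \<Rightarrow> 'v option \<Rightarrow> 'v option \<Rightarrow> bool" where
  "val_less L x y \<longleftrightarrow> val_le L x y \<and> x \<noteq> y"

fun val_mult :: "'v monoid \<Rightarrow> 'v option \<Rightarrow> 'v option \<Rightarrow> 'v option" where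
  "val_mult G (Some a) (Some b) = Some (a \<otimes>\<^bsub>G\<^esub> b)"
| "val_mult G _ _ = None"

definition is_valuation ::
  "('a, 'm) ring_scheme \<Rightarrow> 'v monoid \<Rightarrow> ('v \<times> 'v) set \<Rightarrow> ('a \<Rightarrow> 'v option) \<Rightarrow> bool" where
  "is_valuation R G L v \<longleftrightarrow>
     ordered_abelian_group G L \<and>
     (\<forall>a\<in>carrier R. v a \<in> insert None (Some ` carrier G)) \<and>
     v \<zero>\<^bsub>R\<^esub> = None \<and> v \<one>\<^bsub>R\<^esub> = Some \<one>\<^bsub>G\<^esub> \<and>
     (\<forall>a\<in>carrier R. \<forall>b\<in>carrier R. v (a \<otimes>\<^bsub>R\<^esub> b) = val_mult G (v a) (v b)) \<and>
     (\<forall>a\<in>carrier R. \<forall>b\<in>carrier R.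
        val_le L (v (a \<oplus>\<^bsub>R\<^esub> b)) (v a) \<or> val_le L (v (a \<oplus>\<^bsub>R\<^esub> b)) (v b))"

text \<open>Continuity refers to the value group proper, that is, to the subgroup generated by the
  nonzero values.\<close>

definition continuous_valuation ::
  "('a, 'm) ring_scheme \<Rightarrow> (nat \<Rightarrow> 'a set) \<Rightarrow> 'v monoid \<Rightarrow> ('v \<times> 'v) set \<Rightarrow>
   ('a \<Rightarrow> 'v option) \<Rightarrow> bool" where
  "continuous_valuation R N G L v \<longleftrightarrow>
     is_valuation R G L v \<and>
     (\<forall>c \<in> generate G {c. Some c \<in> v ` carrier R}.
        lin_open R N {a \<in> carrier R. val_less L (v a) (Some c)})"

text \<open>Valuations \<open>v\<close>, \<open>v'\<close> are equivalent iff \<open>v a \<le> v b \<longleftrightarrow> v' a \<le> v' b\<close> for all \<open>a\<close>, \<open>b\<close>.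
  The point represented by \<open>v\<close>, i.e. its equivalence class, is therefore encoded by the
  relation \<open>v a \<le> v b\<close>, so that \<open>(a, b) \<in> x\<close> stands for \<open>|a(x)| \<le> |b(x)|\<close>.\<close>

definition val_point :: "('a, 'm) ring_scheme \<Rightarrow> ('v \<times> 'v) set \<Rightarrow> ('a \<Rightarrow> 'v option) \<Rightarrow> 'a rel" where
  "val_point R L v = {(a, b) \<in> carrier R \<times> carrier R. val_le L (v a) (v b)}"

text \<open>Each value of the value group of a valuation on a ring of type \<open>'a\<close> is determined by the
  set of pairs \<open>(a, b)\<close> such that it equals \<open>v a / v b\<close>. So the type \<open>('a \<times> 'a) set\<close> is large
  enough to represent all valuations up to equivalence.\<close>

definition spa :: "('a, 'm) ring_scheme \<Rightarrow> (nat \<Rightarrow> 'a set) \<Rightarrow> 'a set \<Rightarrow> 'a rel set" where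
  "spa R N Rplus =
     {val_point R L v | (G :: ('a \<times> 'a) set monoid) L v.
        continuous_valuation R N G L v \<and> (\<forall>a\<in>Rplus. val_le L (v a) (Some \<one>\<^bsub>G\<^esub>))}"

definition rational_subset :: "'a rel set \<Rightarrow> 'a \<Rightarrow> 'a \<Rightarrow> 'a rel set" where
  "rational_subset X f s = {x \<in> X. (f, s) \<in> x}"


section \<open>The structure presheaf on rational subsets\<close>

text \<open>Let \<open>R\<close> be a Tate ring with ring of definition \<open>B\<close> and topologically nilpotent unit \<open>w\<close>,
  and let \<open>f\<close> be a unit of \<open>R\<close>. The ring of sections over \<open>{x. |f(x)| \<le> |s(x)|}\<close> is the
  completion of \<open>R[1/s]\<close> for the topology in which \<open>B[f/s]\<close>, with its \<open>w\<close>-adic topology, is a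
  ring of definition.\<close>

definition rat_loc :: "('a, 'm) ring_scheme \<Rightarrow> 'a \<Rightarrow> 'a loc ring" where
  "rat_loc R s = localization R (powers R s)"

definition rat_nbhd ::
  "('a, 'm) ring_scheme \<Rightarrow> 'a set \<Rightarrow> 'a \<Rightarrow> 'a \<Rightarrow> 'a \<Rightarrow> nat \<Rightarrow> 'a loc set" where
  "rat_nbhd R B w f s =
     adic_nbhd (rat_loc R s)
       (generate_ring (rat_loc R s)
          (to_loc R (powers R s) ` B \<union> {loc_frac R (powers R s) f s}))
       (to_loc R (powers R s) w)"

definition sections ::
  "('a, 'm) ring_scheme \<Rightarrow> 'a set \<Rightarrow> 'a \<Rightarrow> 'a \<Rightarrow> 'a \<Rightarrow> 'a loc compl ring" where
  "sections R B w f s = completion (rat_loc R s) (rat_nbhd R B w f s)"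

definition to_sections ::
  "('a, 'm) ring_scheme \<Rightarrow> 'a set \<Rightarrow> 'a \<Rightarrow> 'a \<Rightarrow> 'a \<Rightarrow> 'a \<Rightarrow> 'a loc compl" where
  "to_sections R B w f s a =
     compl_class (rat_loc R s) (rat_nbhd R B w f s) (\<lambda>i. to_loc R (powers R s) a)"

text \<open>Sections \<open>F\<close> with \<open>|F(x)| \<le> 1\<close> at all points \<open>x\<close> of the rational subset: the value at
  \<open>F\<close> of a point \<open>x\<close> is that of the (unique) continuous extension of \<open>x\<close> to the ring of sections,
  so \<open>v\<close> ranges over the continuous valuations of that ring restricting to a point of the
  rational subset.\<close>

definition sections_plus ::
  "('a, 'm) ring_scheme \<Rightarrow> 'a set \<Rightarrow> 'a \<Rightarrow> 'a set \<Rightarrow> 'a \<Rightarrow> 'a \<Rightarrow> 'a loc compl set" where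
  "sections_plus R B w Rplus f s =
     {F \<in> carrier (sections R B w f s).
        \<forall>(G :: ('a loc compl \<times> 'a loc compl) set monoid) L v.
          continuous_valuation (sections R B w f s)
            (compl_nbhd (rat_loc R s) (rat_nbhd R B w f s)) G L v \<and>
          val_point R L (v \<circ> to_sections R B w f s)
            \<in> rational_subset (spa R (adic_nbhd R B w) Rplus) f s \<longrightarrow>
          val_le L (v F) (Some \<one>\<^bsub>G\<^esub>)}"


section \<open>Modules, almost mathematics and pro-systems\<close>

definition as_module :: "('a \<Rightarrow> 'b) \<Rightarrow> ('b, 'm) ring_scheme \<Rightarrow> ('a, 'b) module" where
  "as_module h B =
     \<lparr>carrier = carrier B, monoid.mult = monoid.mult B, monoid.one = monoid.one B,
      ring.zero = ring.zero B, ring.add = ring.add B,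
      smult = (\<lambda>a x. h a \<otimes>\<^bsub>B\<^esub> x)\<rparr>"

text \<open>The fields \<open>mult\<close> and \<open>one\<close> of a module record play no role in a module.\<close>

definition quot_module :: "('a, 'b) module \<Rightarrow> 'b set \<Rightarrow> ('a, 'b set) module" where
  "quot_module M H =
     \<lparr>carrier = a_rcosets\<^bsub>M\<^esub> H, monoid.mult = undefined, monoid.one = undefined,
      ring.zero = H, ring.add = set_add M,
      smult = (\<lambda>a X. \<Union>x\<in>X. H +>\<^bsub>M\<^esub> (a \<odot>\<^bsub>M\<^esub> x))\<rparr>"

definition quot_map :: "('a, 'c) module \<Rightarrow> 'c set \<Rightarrow> ('b \<Rightarrow> 'c) \<Rightarrow> 'b set \<Rightarrow> 'c set" where
  "quot_map M' H' f X = (\<Union>x\<in>X. H' +>\<^bsub>M'\<^esub> f x)"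

definition multiples :: "('a, 'b) module \<Rightarrow> 'a \<Rightarrow> 'b set" where
  "multiples M c = (\<lambda>x. c \<odot>\<^bsub>M\<^esub> x) ` carrier M"

definition reduction :: "('a, 'b) module \<Rightarrow> 'a \<Rightarrow> ('a, 'b set) module" where
  "reduction M c = quot_module M (multiples M c)"

definition ker_module :: "('a, 'b) module \<Rightarrow> ('a, 'c) module \<Rightarrow> ('b \<Rightarrow> 'c) \<Rightarrow> ('a, 'b) module" where
  "ker_module M M' f = M\<lparr>carrier := a_kernel M M' f\<rparr>"

definition coker_module :: "('a, 'b) module \<Rightarrow> ('a, 'c) module \<Rightarrow> ('b \<Rightarrow> 'c) \<Rightarrow> ('a, 'c set) module" where
  "coker_module M M' f = quot_module M' (f ` carrier M)"

text \<open>Below, \<open>h k\<close> stands for the root \<open>h^(1/p^k)\<close>.\<close>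

definition almost_zero :: "(nat \<Rightarrow> 'a) \<Rightarrow> ('a, 'b) module \<Rightarrow> bool" where
  "almost_zero h M \<longleftrightarrow> (\<forall>k. \<forall>x\<in>carrier M. h k \<odot>\<^bsub>M\<^esub> x = \<zero>\<^bsub>M\<^esub>)"

text \<open>A projective system indexed by \<open>n \<ge> 1\<close> consists of modules \<open>M n\<close> and maps
  \<open>d n : M (n + 1) \<rightarrow> M n\<close>; \<open>transition d n c\<close> is the \<open>c\<close>-fold transition map
  \<open>M (n + c) \<rightarrow> M n\<close>.\<close>

fun transition :: "(nat \<Rightarrow> 'b \<Rightarrow> 'b) \<Rightarrow> nat \<Rightarrow> nat \<Rightarrow> 'b \<Rightarrow> 'b" where
  "transition d n 0 = id"
| "transition d n (Suc c) = transition d n c \<circ> d (n + c)"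

definition almost_pro_zero ::
  "(nat \<Rightarrow> 'a) \<Rightarrow> (nat \<Rightarrow> ('a, 'b) module) \<Rightarrow> (nat \<Rightarrow> 'b \<Rightarrow> 'b) \<Rightarrow> bool" where
  "almost_pro_zero h M d \<longleftrightarrow>
     (\<forall>k. \<forall>n\<ge>1. \<exists>n'\<ge>n. \<forall>x\<in>carrier (M n').
        h k \<odot>\<^bsub>M n\<^esub> transition d n (n' - n) x = \<zero>\<^bsub>M n\<^esub>)"

text \<open>The image of every \<open>c\<close>-fold transition map is killed by \<open>a\<close> up to \<open>h\<close>-almost zero modules.\<close>

definition shift_almost_killed ::
  "(nat \<Rightarrow> 'a) \<Rightarrow> 'a \<Rightarrow> (nat \<Rightarrow> ('a, 'b) module) \<Rightarrow> (nat \<Rightarrow> 'b \<Rightarrow> 'b) \<Rightarrow> nat \<Rightarrow> bool" where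
  "shift_almost_killed h a M d c \<longleftrightarrow>
     (\<forall>n\<ge>1. almost_zero h
        ((M n)\<lparr>carrier := (\<lambda>x. a \<odot>\<^bsub>M n\<^esub> transition d n c x) ` carrier (M (n + c))\<rparr>))"

definition uniformly_almost_pro_zero ::
  "(nat \<Rightarrow> 'a) \<Rightarrow> (nat \<Rightarrow> 'a) \<Rightarrow> (nat \<Rightarrow> ('a, 'b) module) \<Rightarrow> (nat \<Rightarrow> 'b \<Rightarrow> 'b) \<Rightarrow> bool" where
  "uniformly_almost_pro_zero h r M d \<longleftrightarrow> (\<forall>k. \<exists>c. shift_almost_killed h (r k) M d c)"

text \<open>Maps between the cokernels of \<open>f (n + 1) : M (n + 1) \<rightarrow> M' (n + 1)\<close> and of
  \<open>f n : M n \<rightarrow> M' n\<close> induced by \<open>d'\<close>; on kernels one restricts \<open>d\<close>.\<close>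

definition coker_transition ::
  "(nat \<Rightarrow> ('a, 'b) module) \<Rightarrow> (nat \<Rightarrow> ('a, 'c) module) \<Rightarrow> (nat \<Rightarrow> 'b \<Rightarrow> 'c) \<Rightarrow>
   (nat \<Rightarrow> 'c \<Rightarrow> 'c) \<Rightarrow> nat \<Rightarrow> 'c set \<Rightarrow> 'c set" where
  "coker_transition M M' f d' n = quot_map (M' n) (f n ` carrier (M n)) (d' n)"

definition almost_pro_iso ::
  "(nat \<Rightarrow> 'a) \<Rightarrow> (nat \<Rightarrow> ('a, 'b) module) \<Rightarrow> (nat \<Rightarrow> 'b \<Rightarrow> 'b) \<Rightarrow>
   (nat \<Rightarrow> ('a, 'c) module) \<Rightarrow> (nat \<Rightarrow> 'c \<Rightarrow> 'c) \<Rightarrow> (nat \<Rightarrow> 'b \<Rightarrow> 'c) \<Rightarrow> bool" where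
  "almost_pro_iso h M d M' d' f \<longleftrightarrow>
     almost_pro_zero h (\<lambda>n. ker_module (M n) (M' n) (f n)) d \<and>
     almost_pro_zero h (\<lambda>n. coker_module (M n) (M' n) (f n)) (coker_transition M M' f d')"


section \<open>The rings \<open>A\<langle>t\<^sup>n/g\<rangle>\<close>\<close>

text \<open>Here \<open>t\<close> denotes the image in \<open>A\<close> of the chosen element of the ring of integers. The Huber
  pair is \<open>(A[1/t], A)\<close>, topologized by the ring of definition \<open>A\<close>.\<close>

type_synonym 'a sect = "'a loc loc compl"

definition invert :: "('a, 'm) ring_scheme \<Rightarrow> 'a \<Rightarrow> 'a loc ring" where
  "invert A t = localization A (powers A t)"

definition invert_map :: "('a, 'm) ring_scheme \<Rightarrow> 'a \<Rightarrow> 'a \<Rightarrow> 'a loc" where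
  "invert_map A t = to_loc A (powers A t)"

text \<open>\<open>A\<langle>t\<^sup>n/g\<rangle>\<close> is the ring of integral sections over \<open>{x. |t\<^sup>n(x)| \<le> |g(x)|}\<close>.\<close>

definition rat_map :: "('a, 'm) ring_scheme \<Rightarrow> 'a \<Rightarrow> 'a \<Rightarrow> nat \<Rightarrow> 'a \<Rightarrow> 'a sect" where
  "rat_map A t g n a =
     to_sections (invert A t) (invert_map A t ` carrier A) (invert_map A t t)
       (invert_map A t (t [^]\<^bsub>A\<^esub> n)) (invert_map A t g) (invert_map A t a)"

definition rat_ring :: "('a, 'm) ring_scheme \<Rightarrow> 'a \<Rightarrow> 'a \<Rightarrow> nat \<Rightarrow> 'a sect ring" where
  "rat_ring A t g n =
     (let R = invert A t; \<iota> = invert_map A t; B = \<iota> ` carrier A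
      in sections R B (\<iota> t) (\<iota> (t [^]\<^bsub>A\<^esub> n)) (\<iota> g)
           \<lparr>carrier := sections_plus R B (\<iota> t) B (\<iota> (t [^]\<^bsub>A\<^esub> n)) (\<iota> g)\<rparr>)"

definition rat_module :: "('a, 'm) ring_scheme \<Rightarrow> 'a \<Rightarrow> 'a \<Rightarrow> nat \<Rightarrow> ('a, 'a sect) module" where
  "rat_module A t g n = as_module (rat_map A t g n) (rat_ring A t g n)"

text \<open>Restriction of functions \<open>A\<langle>t^(n+1)/g\<rangle> \<rightarrow> A\<langle>t^n/g\<rangle>\<close>: both are made of completions of the same
  ring \<open>A[1/t][1/g]\<close>, and restriction is the continuous extension of its identity.\<close>

definition rat_restrict :: "('a, 'm) ring_scheme \<Rightarrow> 'a \<Rightarrow> 'a \<Rightarrow> nat \<Rightarrow> 'a sect \<Rightarrow> 'a sect" where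
  "rat_restrict A t g n =
     compl_coarsen (rat_loc (invert A t) (invert_map A t g))
       (rat_nbhd (invert A t) (invert_map A t ` carrier A) (invert_map A t t)
          (invert_map A t (t [^]\<^bsub>A\<^esub> n)) (invert_map A t g))"

definition source_module :: "('a, 'm) ring_scheme \<Rightarrow> 'a \<Rightarrow> nat \<Rightarrow> ('a, 'a set) module" where
  "source_module A t m = reduction (as_module id A) (t [^]\<^bsub>A\<^esub> m)"

definition target_module ::
  "('a, 'm) ring_scheme \<Rightarrow> 'a \<Rightarrow> 'a \<Rightarrow> nat \<Rightarrow> nat \<Rightarrow> ('a, 'a sect set) module" where
  "target_module A t g m n = reduction (rat_module A t g n) (t [^]\<^bsub>A\<^esub> m)"

definition comparison_map ::
  "('a, 'm) ring_scheme \<Rightarrow> 'a \<Rightarrow> 'a \<Rightarrow> nat \<Rightarrow> nat \<Rightarrow> 'a set \<Rightarrow> 'a sect set" where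
  "comparison_map A t g m n =
     quot_map (rat_module A t g n) (multiples (rat_module A t g n) (t [^]\<^bsub>A\<^esub> m)) (rat_map A t g n)"

definition target_transition ::
  "('a, 'm) ring_scheme \<Rightarrow> 'a \<Rightarrow> 'a \<Rightarrow> nat \<Rightarrow> nat \<Rightarrow> 'a sect set \<Rightarrow> 'a sect set" where
  "target_transition A t g m n =
     quot_map (rat_module A t g n) (multiples (rat_module A t g n) (t [^]\<^bsub>A\<^esub> m)) (rat_restrict A t g n)"

definition almost_nonzerodivisor_mod ::
  "('a, 'm) ring_scheme \<Rightarrow> (nat \<Rightarrow> 'a) \<Rightarrow> 'a \<Rightarrow> 'a \<Rightarrow> bool" where
  "almost_nonzerodivisor_mod A h c g \<longleftrightarrow>
     (let M = reduction (as_module id A) c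
      in almost_zero h (ker_module M M (\<lambda>x. g \<odot>\<^bsub>M\<^esub> x)))"

end

theory Submission
  imports Defs
begin

text \<open>
  Almost, \<open>A\<langle>t^n/g\<rangle>\<close> is the \<open>t\<close>-adic completion of \<open>B\<^sub>n = A[(t^n/g)^(1/p^k) | k \<ge> 0]\<close>, a subring of \<open>A[1/tg]\<close>.

  That \<open>O\<^sup>+\<close> is not larger: if \<open>s \<in> A[1/tg]\<close> is not integral over \<open>A\<langle>t^n/g\<rangle>\<close>, Chevalley's theorem provides a
  continuous valuation, bounded on the ring of definition, at which \<open>s\<close> exceeds 1; so sections in \<open>A[1/tg]\<close> are
  integral, hence their powers are bounded. On the other hand \<open>B\<^sub>n\<close> is almost closed under \<open>p\<close>-th roots, as Frobenius
  is almost injective from \<open>B\<^sub>n/t^(1/p)\<close> to \<open>B\<^sub>n/t\<close>. This is checked on coefficients: since \<open>g\<close> is almost a nonzerodivisor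
  modulo powers of \<open>t\<close>, the relations satisfied by \<open>X = (t^n/g)^(1/p^l)\<close> are almost generated by
  \<open>g^(1/p^l) X - t^(n/p^l)\<close>, and these have approximate \<open>p\<close>-th roots of the same shape.

  If \<open>a \<in> A\<close> is \<open>t^m s\<close> with \<open>s\<close> almost in \<open>B\<^sub>n\<close>, a power of \<open>g\<close> multiplies \<open>s\<close> almost into \<open>A\<close>, so \<open>s\<close> is almost in \<open>A\<close>.
  For the cokernel, \<open>g^(1/p^k)\<close> times a monomial \<open>(t^(n + c)/g)^e\<close>, \<open>c = p^k m\<close>, lies in \<open>A\<close> if \<open>e \<le> 1/p^k\<close> and in \<open>t^m B\<^sub>n\<close>
  if \<open>e \<ge> 1/p^k\<close>.
\<close>

section \<open>Localization\<close>

text \<open>Modulo \<open>t^m\<close> the completion can be avoided: a section differs from some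
  \<open>r\<close> in \<open>A[1/tg]\<close> by \<open>t^m\<close> times an element of the completed
  ring of definition, which lies in \<open>O^+\<close>. So the question becomes which
  \<open>r\<close> are integral sections. The obstacle is that \<open>B_n\<close> is given by
  generators and only almost has the expected relations, so \<open>B_n/t\<close> cannot be read off
  a presentation. This is why the Frobenius argument works with chosen coefficients. Roots are then
  taken as follows. If \<open>x^p\<close> is in \<open>B_n\<close>, some \<open>t^(c/p) x\<close> is
  in \<open>B_n\<close>, and each use of almost injectivity lowers \<open>c\<close> by one at an
  arbitrarily small cost. If \<open>t^N\<close> bounds all powers of \<open>s\<close>, taking
  \<open>p^j\<close>-th roots puts \<open>t^((N+1)/p^j) s\<close> in \<open>B_n\<close>, and this
  exponent tends to 0. The shift \<open>c = p^k m\<close> is the least with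
  \<open>c e \<ge> m\<close> for all \<open>e \<ge> 1/p^k\<close>, where
  \<open>(t^(n+c)/g)^e = t^(c e) (t^n/g)^e\<close>. Finitely many almost statements combine because
  the square of \<open>t^(1/p^(k+1))\<close> divides \<open>t^(1/p^k)\<close>.\<close>

locale localizing_set = cring R for R (structure) +
  fixes S
  assumes S_carrier: "S \<subseteq> carrier R"
    and S_one: "\<one> \<in> S"
    and S_mult: "\<lbrakk>s \<in> S; u \<in> S\<rbrakk> \<Longrightarrow> s \<otimes> u \<in> S"
begin

lemma S_closed: "s \<in> S \<Longrightarrow> s \<in> carrier R"
  using S_carrier by auto

lemma equiv_loc_rel: "equiv (carrier R \<times> S) (loc_rel R S)"
proof (rule equivI)
  show "loc_rel R S \<subseteq> (carrier R \<times> S) \<times> (carrier R \<times> S)"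
    by (auto simp: loc_rel_def)
  show "refl_on (carrier R \<times> S) (loc_rel R S)"
    using S_one by (auto simp: refl_on_def loc_rel_def)
  show "sym (loc_rel R S)"
    by (rule symI) (force simp: loc_rel_def)
  show "trans (loc_rel R S)"
  proof (rule transI, clarsimp simp: loc_rel_def)
    fix a s b u c x w w'
    assume c: "a \<in> carrier R" "b \<in> carrier R" "c \<in> carrier R"
      and S: "s \<in> S" "u \<in> S" "x \<in> S" "w \<in> S" "w' \<in> S"
      and e: "w \<otimes> (u \<otimes> a) = w \<otimes> (s \<otimes> b)" "w' \<otimes> (x \<otimes> b) = w' \<otimes> (u \<otimes> c)"
    have sc: "s \<in> carrier R" "u \<in> carrier R" "x \<in> carrier R" "w \<in> carrier R" "w' \<in> carrier R"
      using S S_closed by auto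
    have "(w \<otimes> w' \<otimes> u) \<otimes> (x \<otimes> a) = (w' \<otimes> x) \<otimes> (w \<otimes> (u \<otimes> a))"
      using c sc by algebra
    also have "\<dots> = (w \<otimes> s) \<otimes> (w' \<otimes> (x \<otimes> b))"
      unfolding e(1) using c sc by algebra
    also have "\<dots> = (w \<otimes> w' \<otimes> u) \<otimes> (s \<otimes> c)"
      unfolding e(2) using c sc by algebra
    finally show "\<exists>w\<in>S. w \<otimes> (x \<otimes> a) = w \<otimes> (s \<otimes> c)"
      using S S_mult by blast
  qed
qed

abbreviation fr where "fr \<equiv> loc_frac R S"
abbreviation L where "L \<equiv> localization R S"

lemma frac_eq_iff:
  assumes "a \<in> carrier R" "b \<in> carrier R" "s \<in> S" "u \<in> S"
  shows "fr a s = fr b u \<longleftrightarrow> (\<exists>w\<in>S. w \<otimes> (u \<otimes> a) = w \<otimes> (s \<otimes> b))"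
  using eq_equiv_class_iff[OF equiv_loc_rel, of "(a, s)" "(b, u)"] assms
  by (auto simp: loc_frac_def loc_rel_def)

lemma frac_eqI:
  assumes "a \<in> carrier R" "b \<in> carrier R" "s \<in> S" "u \<in> S" "u \<otimes> a = s \<otimes> b"
  shows "fr a s = fr b u"
  using frac_eq_iff[of a b s u] assms S_one by auto

lemma loc_carrierE:
  assumes "X \<in> carrier L"
  obtains a s where "a \<in> carrier R" "s \<in> S" "X = fr a s"
  using assms unfolding localization_def loc_frac_def by (auto elim!: quotientE)

lemma frac_closed [simp, intro]: "\<lbrakk>a \<in> carrier R; s \<in> S\<rbrakk> \<Longrightarrow> fr a s \<in> carrier L"
  unfolding localization_def loc_frac_def by (auto intro!: quotientI)

text \<open>The product in the record is a union over all representatives. It collapses because the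
  resulting fraction does not depend on the representative of either argument.\<close>

lemma loc_mult:
  assumes "a \<in> carrier R" "s \<in> S" "b \<in> carrier R" "u \<in> S"
  shows "fr a s \<otimes>\<^bsub>L\<^esub> fr b u = fr (a \<otimes> b) (s \<otimes> u)"
proof -
  have "congruent2 (loc_rel R S) (loc_rel R S) (\<lambda>x y. fr (fst x \<otimes> fst y) (snd x \<otimes> snd y))"
  proof (rule congruent2I[OF equiv_loc_rel equiv_loc_rel]; clarsimp simp: loc_rel_def)
    fix a s b u c x w
    assume h: "a \<in> carrier R" "b \<in> carrier R" "c \<in> carrier R" "s \<in> S" "u \<in> S" "x \<in> S" "w \<in> S"
      and e: "w \<otimes> (u \<otimes> a) = w \<otimes> (s \<otimes> b)"
    note hc = h S_closed[OF h(4)] S_closed[OF h(5)] S_closed[OF h(6)] S_closed[OF h(7)]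
    have "w \<otimes> ((u \<otimes> x) \<otimes> (a \<otimes> c)) = (x \<otimes> c) \<otimes> (w \<otimes> (u \<otimes> a))" using hc by algebra
    also have "\<dots> = w \<otimes> ((s \<otimes> x) \<otimes> (b \<otimes> c))" unfolding e using hc by algebra
    finally show "fr (a \<otimes> c) (s \<otimes> x) = fr (b \<otimes> c) (u \<otimes> x)"
      using h S_mult by (subst frac_eq_iff) auto
    then show "fr (c \<otimes> a) (x \<otimes> s) = fr (c \<otimes> b) (x \<otimes> u)"
      using hc by (simp add: m_comm)
  qed
  from UN_equiv_class2[OF equiv_loc_rel equiv_loc_rel this, of "(a,s)" "(b,u)"] assms
  show ?thesis by (simp add: localization_def loc_frac_def case_prod_unfold)
qed

lemma loc_add:
  assumes "a \<in> carrier R" "s \<in> S" "b \<in> carrier R" "u \<in> S"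
  shows "fr a s \<oplus>\<^bsub>L\<^esub> fr b u = fr (a \<otimes> u \<oplus> b \<otimes> s) (s \<otimes> u)"
proof -
  have "congruent2 (loc_rel R S) (loc_rel R S)
          (\<lambda>x y. fr ((fst x \<otimes> snd y) \<oplus> (fst y \<otimes> snd x)) (snd x \<otimes> snd y))"
  proof (rule congruent2I[OF equiv_loc_rel equiv_loc_rel]; clarsimp simp: loc_rel_def)
    fix a s b u c x w
    assume h: "a \<in> carrier R" "b \<in> carrier R" "c \<in> carrier R" "s \<in> S" "u \<in> S" "x \<in> S" "w \<in> S"
      and e: "w \<otimes> (u \<otimes> a) = w \<otimes> (s \<otimes> b)"
    note hc = h S_closed[OF h(4)] S_closed[OF h(5)] S_closed[OF h(6)] S_closed[OF h(7)]
    have "w \<otimes> ((u \<otimes> x) \<otimes> (a \<otimes> x \<oplus> c \<otimes> s)) = (x \<otimes> x) \<otimes> (w \<otimes> (u \<otimes> a)) \<oplus> w \<otimes> u \<otimes> x \<otimes> c \<otimes> s"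
      using hc by algebra
    also have "\<dots> = w \<otimes> ((s \<otimes> x) \<otimes> (b \<otimes> x \<oplus> c \<otimes> u))" unfolding e using hc by algebra
    finally show "fr (a \<otimes> x \<oplus> c \<otimes> s) (s \<otimes> x) = fr (b \<otimes> x \<oplus> c \<otimes> u) (u \<otimes> x)"
      using hc S_mult by (subst frac_eq_iff) auto
    then show "fr (c \<otimes> s \<oplus> a \<otimes> x) (x \<otimes> s) = fr (c \<otimes> u \<oplus> b \<otimes> x) (x \<otimes> u)"
      using hc by (simp add: m_comm a_comm)
  qed
  from UN_equiv_class2[OF equiv_loc_rel equiv_loc_rel this, of "(a,s)" "(b,u)"] assms
  show ?thesis by (simp add: localization_def loc_frac_def case_prod_unfold)
qed

lemma loc_one: "\<one>\<^bsub>L\<^esub> = fr \<one> \<one>" and loc_zero: "\<zero>\<^bsub>L\<^esub> = fr \<zero> \<one>"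
  by (simp_all add: localization_def)

lemma localization_cring: "cring L"
proof (rule cringI)
  show "abelian_group L"
  proof (rule abelian_groupI)
    fix X Y assume "X \<in> carrier L" "Y \<in> carrier L"
    then show "X \<oplus>\<^bsub>L\<^esub> Y \<in> carrier L"
      by (elim loc_carrierE) (simp add: loc_add S_mult S_closed)
    from \<open>X \<in> carrier L\<close> \<open>Y \<in> carrier L\<close> show "X \<oplus>\<^bsub>L\<^esub> Y = Y \<oplus>\<^bsub>L\<^esub> X"
      by (elim loc_carrierE) (simp add: loc_add S_mult S_closed m_comm a_comm)
  next
    show "\<zero>\<^bsub>L\<^esub> \<in> carrier L" by (simp add: loc_zero S_one)
  next
    fix X Y Z assume "X \<in> carrier L" "Y \<in> carrier L" "Z \<in> carrier L"
    obtain a s where h1: "a \<in> carrier R" "s \<in> S" "X = fr a s" using \<open>X \<in> carrier L\<close> by (rule loc_carrierE)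
    obtain b u where h2: "b \<in> carrier R" "u \<in> S" "Y = fr b u" using \<open>Y \<in> carrier L\<close> by (rule loc_carrierE)
    obtain c x where h3: "c \<in> carrier R" "x \<in> S" "Z = fr c x" using \<open>Z \<in> carrier L\<close> by (rule loc_carrierE)
    have sc: "s \<in> carrier R" "u \<in> carrier R" "x \<in> carrier R" using h1 h2 h3 S_closed by auto
    have "(a \<otimes> u \<oplus> b \<otimes> s) \<otimes> x \<oplus> c \<otimes> (s \<otimes> u) = a \<otimes> (u \<otimes> x) \<oplus> (b \<otimes> x \<oplus> c \<otimes> u) \<otimes> s"
      using h1(1) h2(1) h3(1) sc by algebra
    moreover have "(s \<otimes> u) \<otimes> x = s \<otimes> (u \<otimes> x)" using sc by algebra
    ultimately show "(X \<oplus>\<^bsub>L\<^esub> Y) \<oplus>\<^bsub>L\<^esub> Z = X \<oplus>\<^bsub>L\<^esub> (Y \<oplus>\<^bsub>L\<^esub> Z)"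
      using h1 h2 h3 sc by (simp add: loc_add S_mult)
  next
    fix X assume "X \<in> carrier L"
    then obtain a s where h: "a \<in> carrier R" "s \<in> S" and e: "X = fr a s" by (elim loc_carrierE) blast
    note hc = h S_closed[OF h(2)]
    show "\<zero>\<^bsub>L\<^esub> \<oplus>\<^bsub>L\<^esub> X = X"
      unfolding e loc_zero using hc S_one by (simp add: loc_add)
    have "fr (\<ominus> a) s \<oplus>\<^bsub>L\<^esub> X = fr (\<ominus> a \<otimes> s \<oplus> a \<otimes> s) (s \<otimes> s)"
      unfolding e using hc by (simp add: loc_add)
    also have "\<dots> = \<zero>\<^bsub>L\<^esub>"
      unfolding loc_zero using hc S_one S_mult
      by (intro frac_eqI) (simp_all add: l_minus l_neg)
    finally show "\<exists>Y\<in>carrier L. Y \<oplus>\<^bsub>L\<^esub> X = \<zero>\<^bsub>L\<^esub>"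
      using hc by (intro bexI[of _ "fr (\<ominus> a) s"]) auto
  qed
next
  show "comm_monoid L"
  proof (rule comm_monoidI)
    fix X Y assume "X \<in> carrier L" "Y \<in> carrier L"
    then show "X \<otimes>\<^bsub>L\<^esub> Y \<in> carrier L"
      by (elim loc_carrierE) (simp add: loc_mult S_mult S_closed)
    from \<open>X \<in> carrier L\<close> \<open>Y \<in> carrier L\<close> show "X \<otimes>\<^bsub>L\<^esub> Y = Y \<otimes>\<^bsub>L\<^esub> X"
      by (elim loc_carrierE) (simp add: loc_mult S_mult S_closed m_comm a_comm)
  next
    fix X Y Z assume "X \<in> carrier L" "Y \<in> carrier L" "Z \<in> carrier L"
    then show "(X \<otimes>\<^bsub>L\<^esub> Y) \<otimes>\<^bsub>L\<^esub> Z = X \<otimes>\<^bsub>L\<^esub> (Y \<otimes>\<^bsub>L\<^esub> Z)"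
      by (elim loc_carrierE) (simp add: loc_mult S_mult S_closed m_assoc)
  next
    fix X assume "X \<in> carrier L"
    then show "\<one>\<^bsub>L\<^esub> \<otimes>\<^bsub>L\<^esub> X = X"
      by (elim loc_carrierE) (simp add: loc_mult S_mult S_closed S_one loc_one)
  qed (simp add: loc_one S_one)
next
  fix X Y Z assume "X \<in> carrier L" "Y \<in> carrier L" "Z \<in> carrier L"
  obtain a s where h1: "a \<in> carrier R" "s \<in> S" "X = fr a s" using \<open>X \<in> carrier L\<close> by (rule loc_carrierE)
  obtain b u where h2: "b \<in> carrier R" "u \<in> S" "Y = fr b u" using \<open>Y \<in> carrier L\<close> by (rule loc_carrierE)
  obtain c x where h3: "c \<in> carrier R" "x \<in> S" "Z = fr c x" using \<open>Z \<in> carrier L\<close> by (rule loc_carrierE)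
  have sc: "s \<in> carrier R" "u \<in> carrier R" "x \<in> carrier R" using h1 h2 h3 S_closed by auto
  \<comment> \<open>The right-hand side is the left-hand fraction expanded by \<open>x\<close>;
    \<open>y\<close> is the left numerator.\<close>
  define y where "y = (a \<otimes> u \<oplus> b \<otimes> s) \<otimes> c"
  have y: "y \<in> carrier R" using h1(1) h2(1) h3(1) sc by (simp add: y_def)
  have "a \<otimes> c \<otimes> (u \<otimes> x) \<oplus> b \<otimes> c \<otimes> (s \<otimes> x) = x \<otimes> y"
    unfolding y_def using h1(1) h2(1) h3(1) sc by algebra
  then have "((s \<otimes> x) \<otimes> (u \<otimes> x)) \<otimes> y
      = ((s \<otimes> u) \<otimes> x) \<otimes> (a \<otimes> c \<otimes> (u \<otimes> x) \<oplus> b \<otimes> c \<otimes> (s \<otimes> x))"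
    using y sc by (simp add: m_assoc m_lcomm)
  then have "fr y ((s \<otimes> u) \<otimes> x) = fr (a \<otimes> c \<otimes> (u \<otimes> x) \<oplus> b \<otimes> c \<otimes> (s \<otimes> x)) ((s \<otimes> x) \<otimes> (u \<otimes> x))"
    using h1 h2 h3 sc y by (intro frac_eqI) (simp_all add: S_mult)
  then show "(X \<oplus>\<^bsub>L\<^esub> Y) \<otimes>\<^bsub>L\<^esub> Z = X \<otimes>\<^bsub>L\<^esub> Z \<oplus>\<^bsub>L\<^esub> Y \<otimes>\<^bsub>L\<^esub> Z"
    using h1 h2 h3 sc by (simp add: loc_add loc_mult S_mult y_def)
qed

abbreviation to where "to \<equiv> to_loc R S"

lemma to_loc_hom: "to \<in> ring_hom R L"
  by (rule ring_hom_memI) (auto simp: to_loc_def S_one loc_mult loc_add loc_one)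

lemma to_loc_cring_hom: "ring_hom_cring R L to"
  by (intro ring_hom_cring.intro ring_hom_cring_axioms.intro is_cring localization_cring to_loc_hom)

lemma to_loc_Units: assumes "s \<in> S" shows "to s \<in> Units L"
proof -
  interpret L: cring L by (rule localization_cring)
  have "fr s \<one> \<otimes>\<^bsub>L\<^esub> fr \<one> s = \<one>\<^bsub>L\<^esub>"
    using assms S_one S_closed by (simp add: loc_mult loc_one frac_eqI)
  then show ?thesis unfolding to_loc_def Units_def
    using assms S_one S_closed L.m_comm[of "fr s \<one>" "fr \<one> s"] by force
qed

lemma to_loc_inj: assumes "\<And>s a. \<lbrakk>s \<in> S; a \<in> carrier R; s \<otimes> a = \<zero>\<rbrakk> \<Longrightarrow> a = \<zero>"
  shows "inj_on to (carrier R)"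
proof (rule inj_onI)
  fix a b assume h: "a \<in> carrier R" "b \<in> carrier R" "to a = to b"
  then obtain w where w: "w \<in> S" "w \<otimes> a = w \<otimes> b"
    using S_one S_closed by (auto simp: to_loc_def frac_eq_iff)
  have "w \<otimes> (a \<ominus> b) = w \<otimes> a \<ominus> w \<otimes> b"
    using h w S_closed[of w] by algebra
  also have "\<dots> = \<zero>" using w h S_closed by (simp add: a_minus_def r_neg)
  finally have "a \<ominus> b = \<zero>" using assms[OF w(1)] h by simp
  then show "a = b" using h by simp
qed

lemma frac_eq_to: assumes "a \<in> carrier R" "s \<in> S" shows "to s \<otimes>\<^bsub>L\<^esub> fr a s = to a"
proof -
  have "s \<in> carrier R" using assms S_closed by auto
  then have "fr (s \<otimes> a) (\<one> \<otimes> s) = fr a \<one>"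
    using assms S_one by (intro frac_eqI) auto
  then show ?thesis using assms S_one S_closed by (simp add: to_loc_def loc_mult)
qed

end

lemma (in cring) localizing_set_powers: assumes "h \<in> carrier R"
  shows "localizing_set R (powers R h)"
proof
  show "powers R h \<subseteq> carrier R" using assms by (auto simp: powers_def)
  show "\<one> \<in> powers R h" unfolding powers_def by (metis nat_pow_0 rangeI)
  show "s \<otimes> u \<in> powers R h" if "s \<in> powers R h" "u \<in> powers R h" for s u
    using that assms unfolding powers_def by (auto simp: nat_pow_mult)
qed

section \<open>Adic completion\<close>

text \<open>The algebraic data of a Tate ring; \<open>absorb\<close> says that \<open>R\<close> is
  \<open>B[1/w]\<close>. The locale is instantiated by \<open>A[1/t]\<close>, by
  \<open>A[1/tg]\<close> with the ring of definition of a rational subset, and again by the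
  completion of the latter.\<close>

locale adic_ring = cring R for R (structure) +
  fixes B w
  assumes subB: "subring B R"
    and w_B: "w \<in> B"
    and w_unit: "w \<in> Units R"
    and absorb: "r \<in> carrier R \<Longrightarrow> \<exists>k::nat. w [^] k \<otimes> r \<in> B"
begin

lemmas B_sub = subringE(1)[OF subB]
lemmas B_zero = subringE(2)[OF subB]
lemmas B_one = subringE(3)[OF subB]
lemmas B_neg = subringE(5)[OF subB]
lemmas B_mult = subringE(6)[OF subB]
lemmas B_add = subringE(7)[OF subB]

lemma B_closed: "b \<in> B \<Longrightarrow> b \<in> carrier R" using B_sub by auto

lemma w_closed [simp]: "w \<in> carrier R" using w_unit by auto

lemma B_pow: "b \<in> B \<Longrightarrow> b [^] (n::nat) \<in> B"
  by (induction n) (auto simp: B_one B_mult)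

abbreviation N where "N \<equiv> adic_nbhd R B w"

lemma N_I: "b \<in> B \<Longrightarrow> w [^] k \<otimes> b \<in> N k" by (auto simp: adic_nbhd_def)

lemma N_E: assumes "x \<in> N k" obtains b where "b \<in> B" "b \<in> carrier R" "x = w [^] k \<otimes> b"
  using assms B_closed by (auto simp: adic_nbhd_def)

lemma N_closed: "x \<in> N k \<Longrightarrow> x \<in> carrier R"
  by (erule N_E) simp

lemma N_0: "N 0 = B" using B_closed by (force simp: adic_nbhd_def)

lemma N_zero: "\<zero> \<in> N k" using N_I[OF B_zero, of k] by simp

lemma N_neg: "x \<in> N k \<Longrightarrow> \<ominus> x \<in> N k"
  by (erule N_E) (metis N_I B_neg r_minus nat_pow_closed w_closed)

lemma N_add: "\<lbrakk>x \<in> N k; y \<in> N k\<rbrakk> \<Longrightarrow> x \<oplus> y \<in> N k"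
  by (elim N_E) (metis N_I B_add r_distr nat_pow_closed w_closed)

lemma N_diff: "\<lbrakk>x \<in> N k; y \<in> N k\<rbrakk> \<Longrightarrow> x \<ominus> y \<in> N k"
  by (simp add: a_minus_def N_add N_neg)

lemma N_mult: assumes "x \<in> N j" "y \<in> N k" shows "x \<otimes> y \<in> N (j + k)"
proof -
  obtain b where b: "b \<in> B" "b \<in> carrier R" "x = w [^] j \<otimes> b" using assms(1) by (rule N_E)
  obtain d where d: "d \<in> B" "d \<in> carrier R" "y = w [^] k \<otimes> d" using assms(2) by (rule N_E)
  have "x \<otimes> y = (w [^] j \<otimes> w [^] k) \<otimes> (b \<otimes> d)" unfolding b d using b d by (simp add: m_assoc m_lcomm)
  then show ?thesis using b d N_I[of "b \<otimes> d" "j + k"] by (simp add: B_mult nat_pow_mult)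
qed

lemma N_mult_B: "\<lbrakk>b \<in> B; y \<in> N k\<rbrakk> \<Longrightarrow> b \<otimes> y \<in> N k"
  using N_mult[of b 0 y k] by (simp add: N_0)

lemma N_mono: assumes "j \<le> k" "x \<in> N k" shows "x \<in> N j"
proof -
  obtain b where b: "b \<in> B" "b \<in> carrier R" "x = w [^] k \<otimes> b" using assms(2) by (rule N_E)
  have "x = w [^] j \<otimes> (w [^] (k - j) \<otimes> b)"
    using b assms(1) by (simp add: m_assoc[symmetric] nat_pow_mult)
  then show ?thesis using b N_I[of "w [^] (k - j) \<otimes> b" j] by (simp add: B_mult B_pow w_B)
qed

lemma w_pow_cancel: "\<lbrakk>x \<in> carrier R; y \<in> carrier R; w [^] (k::nat) \<otimes> x = w [^] k \<otimes> y\<rbrakk> \<Longrightarrow> x = y"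
  using Units_l_cancel[OF Units_pow_closed[OF w_unit]] by blast

lemma N_shift: "\<lbrakk>x \<in> carrier R; w [^] j \<otimes> x \<in> N (j + k)\<rbrakk> \<Longrightarrow> x \<in> N k"
proof -
  assume h: "x \<in> carrier R" "w [^] j \<otimes> x \<in> N (j + k)"
  then obtain b where b: "b \<in> B" "b \<in> carrier R" "w [^] j \<otimes> x = w [^] (j+k) \<otimes> b" by (elim N_E)
  then have "w [^] j \<otimes> x = w [^] j \<otimes> (w [^] k \<otimes> b)" by (simp add: m_assoc[symmetric] nat_pow_mult)
  then show ?thesis using w_pow_cancel[of x "w [^] k \<otimes> b" j] h b N_I by auto
qed

text \<open>Continuity of multiplication by a fixed element: the loss of precision is the power of
  \<open>w\<close> that brings \<open>r\<close> into \<open>B\<close>.\<close>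

lemma N_mult_bounded:
  assumes "r \<in> carrier R" "w [^] j \<otimes> r \<in> B" "x \<in> N (k + j)" shows "r \<otimes> x \<in> N k"
proof -
  have x: "x \<in> carrier R" using assms N_closed by auto
  have "(w [^] j \<otimes> r) \<otimes> x \<in> N (j + k)" using N_mult_B[OF assms(2,3)] by (simp add: add.commute)
  then show ?thesis using N_shift[of "r \<otimes> x" j k] assms(1) x by (simp add: m_assoc)
qed

section \<open>Cauchy sequences modulo null sequences\<close>

abbreviation CS where "CS \<equiv> cauchy_seqs R N"
abbreviation NS where "NS \<equiv> null_seqs R N"
abbreviation CR where "CR \<equiv> cauchy_ring R N"
abbreviation S where "S \<equiv> completion R N"
abbreviation cls where "cls \<equiv> compl_class R N"

lemma CS_D: "s \<in> CS \<Longrightarrow> s i \<in> carrier R" by (auto simp: cauchy_seqs_def)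
lemma NS_D: "s \<in> NS \<Longrightarrow> s i \<in> carrier R" by (auto simp: null_seqs_def)

lemma CS_ex: "s \<in> CS \<Longrightarrow> \<exists>M. \<forall>i\<ge>M. \<forall>j\<ge>M. s i \<ominus> s j \<in> N k"
  unfolding cauchy_seqs_def by blast
lemma NS_ex: "s \<in> NS \<Longrightarrow> \<exists>M. \<forall>i\<ge>M. s i \<in> N k"
  unfolding null_seqs_def by blast

lemma const_CS: "r \<in> carrier R \<Longrightarrow> (\<lambda>i. r) \<in> CS"
  by (auto simp: cauchy_seqs_def a_minus_def r_neg N_zero)

lemma NS_CS: assumes "s \<in> NS" shows "s \<in> CS"
proof -
  have "\<exists>M. \<forall>i\<ge>M. \<forall>j\<ge>M. s i \<ominus> s j \<in> N k" for k
  proof -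
    obtain M where "\<forall>i\<ge>M. s i \<in> N k" using assms CS_ex NS_ex by meson
    then show ?thesis by (meson N_diff)
  qed
  then show ?thesis using assms by (auto simp: cauchy_seqs_def null_seqs_def)
qed

text \<open>The tail of the sequence stays in \<open>s M + B\<close>, and \<open>absorb\<close>
  bounds the single element \<open>s M\<close>.\<close>

lemma CS_bounded: assumes "s \<in> CS" obtains j M where "\<And>i. i \<ge> M \<Longrightarrow> w [^] (j::nat) \<otimes> s i \<in> B"
proof -
  obtain M where M: "\<And>i j. \<lbrakk>i \<ge> M; j \<ge> M\<rbrakk> \<Longrightarrow> s i \<ominus> s j \<in> N 0"
    using assms unfolding cauchy_seqs_def by blast
  obtain j where j: "w [^] (j::nat) \<otimes> s M \<in> B" using absorb CS_D[OF assms] by blast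
  have "w [^] j \<otimes> s i \<in> B" if "i \<ge> M" for i
  proof -
    have "w [^] j \<otimes> (s i \<ominus> s M) \<in> B" using M[of i M] that by (simp add: N_0 B_mult B_pow w_B)
    then have "w [^] j \<otimes> (s i \<ominus> s M) \<oplus> w [^] j \<otimes> s M \<in> B" using j B_add by blast
    moreover have "w [^] j \<otimes> (s i \<ominus> s M) \<oplus> w [^] j \<otimes> s M = w [^] j \<otimes> s i"
    proof -
      have "w [^] j \<in> carrier R" by simp
      then show ?thesis using CS_D[OF assms, of i] CS_D[OF assms, of M] by algebra
    qed
    ultimately show ?thesis by simp
  qed
  then show ?thesis using that by blast
qed

lemma CS_add: assumes "s \<in> CS" "u \<in> CS" shows "(\<lambda>i. s i \<oplus> u i) \<in> CS"
proof -
  have "\<exists>M. \<forall>i\<ge>M. \<forall>j\<ge>M. (s i \<oplus> u i) \<ominus> (s j \<oplus> u j) \<in> N k" for k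
  proof -
    obtain M where M: "\<forall>i\<ge>M. \<forall>j\<ge>M. s i \<ominus> s j \<in> N k" using assms CS_ex NS_ex by meson
    obtain M' where M': "\<forall>i\<ge>M'. \<forall>j\<ge>M'. u i \<ominus> u j \<in> N k" using assms CS_ex NS_ex by meson
    have "(s i \<oplus> u i) \<ominus> (s j \<oplus> u j) = (s i \<ominus> s j) \<oplus> (u i \<ominus> u j)" for i j
      using CS_D[OF assms(1), of i] CS_D[OF assms(1), of j] CS_D[OF assms(2), of i] CS_D[OF assms(2), of j]
      by algebra
    then show ?thesis using M M' by (intro exI[of _ "max M M'"]) (auto intro: N_add)
  qed
  then show ?thesis using CS_D[OF assms(1)] CS_D[OF assms(2)] by (auto simp: cauchy_seqs_def)
qed

lemma CS_neg: assumes "s \<in> CS" shows "(\<lambda>i. \<ominus> s i) \<in> CS"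
proof -
  have "(\<ominus> s i) \<ominus> (\<ominus> s j) = \<ominus> (s i \<ominus> s j)" for i j
    using CS_D[OF assms(1), of i] CS_D[OF assms(1), of j] by algebra
  then show ?thesis using assms unfolding cauchy_seqs_def by (auto intro: N_neg) (meson N_neg)
qed

lemma CS_mult: assumes "s \<in> CS" "u \<in> CS" shows "(\<lambda>i. s i \<otimes> u i) \<in> CS"
proof -
  obtain a M1 where a: "\<And>i. i \<ge> M1 \<Longrightarrow> w [^] (a::nat) \<otimes> s i \<in> B" using CS_bounded[OF assms(1)] by blast
  obtain b M2 where b: "\<And>i. i \<ge> M2 \<Longrightarrow> w [^] (b::nat) \<otimes> u i \<in> B" using CS_bounded[OF assms(2)] by blast
  have "\<exists>M. \<forall>i\<ge>M. \<forall>j\<ge>M. (s i \<otimes> u i) \<ominus> (s j \<otimes> u j) \<in> N k" for k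
  proof -
    \<comment> \<open>Each difference is made finer by the bound on the denominators of the other
      factor.\<close>
    obtain M where M: "\<forall>i\<ge>M. \<forall>j\<ge>M. s i \<ominus> s j \<in> N (k + b)" using assms CS_ex NS_ex by meson
    obtain M' where M': "\<forall>i\<ge>M'. \<forall>j\<ge>M'. u i \<ominus> u j \<in> N (k + a)" using assms CS_ex NS_ex by meson
    have "(s i \<otimes> u i) \<ominus> (s j \<otimes> u j) \<in> N k" if "i \<ge> max (max M M') (max M1 M2)" "j \<ge> max (max M M') (max M1 M2)" for i j
    proof -
      have c: "s i \<in> carrier R" "s j \<in> carrier R" "u i \<in> carrier R" "u j \<in> carrier R"
        using CS_D assms by auto
      have "(s i \<otimes> u i) \<ominus> (s j \<otimes> u j) = s i \<otimes> (u i \<ominus> u j) \<oplus> u j \<otimes> (s i \<ominus> s j)"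
        using c by algebra
      moreover have "s i \<otimes> (u i \<ominus> u j) \<in> N k" using N_mult_bounded[of "s i" a "u i \<ominus> u j" k] a c M' that by auto
      moreover have "u j \<otimes> (s i \<ominus> s j) \<in> N k" using N_mult_bounded[of "u j" b "s i \<ominus> s j" k] b c M that by auto
      ultimately show ?thesis by (simp add: N_add)
    qed
    then show ?thesis by blast
  qed
  then show ?thesis using CS_D[OF assms(1)] CS_D[OF assms(2)] by (auto simp: cauchy_seqs_def)
qed

lemma CR_simps: "carrier CR = CS" "s \<otimes>\<^bsub>CR\<^esub> u = (\<lambda>i. s i \<otimes> u i)" "s \<oplus>\<^bsub>CR\<^esub> u = (\<lambda>i. s i \<oplus> u i)"
  "\<one>\<^bsub>CR\<^esub> = (\<lambda>i. \<one>)" "\<zero>\<^bsub>CR\<^esub> = (\<lambda>i. \<zero>)"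
  by (simp_all add: cauchy_ring_def)

lemma CR_cring: "cring CR"
proof (rule cringI)
  show "abelian_group CR"
  proof (rule abelian_groupI, unfold CR_simps)
    fix s assume s: "s \<in> CS"
    show "\<exists>y\<in>CS. (\<lambda>i. y i \<oplus> s i) = (\<lambda>i. \<zero>)"
      by (rule bexI[OF _ CS_neg[OF s]]) (simp add: CS_D[OF s] l_neg)
  qed (auto simp: CS_add const_CS CS_D a_assoc intro!: ext a_comm)
  show "comm_monoid CR"
    by (rule comm_monoidI, unfold CR_simps) (auto simp: CS_mult const_CS CS_D m_assoc intro!: ext m_comm)
  show "(x \<oplus>\<^bsub>CR\<^esub> y) \<otimes>\<^bsub>CR\<^esub> z = x \<otimes>\<^bsub>CR\<^esub> z \<oplus>\<^bsub>CR\<^esub> y \<otimes>\<^bsub>CR\<^esub> z"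
    if "x \<in> carrier CR" "y \<in> carrier CR" "z \<in> carrier CR" for x y z
    using that unfolding CR_simps by (auto simp: CS_D l_distr)
qed

lemma CR_neg: assumes "s \<in> CS" shows "\<ominus>\<^bsub>CR\<^esub> s = (\<lambda>i. \<ominus> s i)"
proof -
  interpret CR: cring CR by (rule CR_cring)
  show ?thesis using assms CS_neg[OF assms]
    by (intro CR.sum_zero_eq_neg[symmetric]) (auto simp: CR_simps CS_D l_neg)
qed

lemma NS_add: assumes "s \<in> NS" "u \<in> NS" shows "(\<lambda>i. s i \<oplus> u i) \<in> NS"
proof -
  have "\<exists>M. \<forall>i\<ge>M. s i \<oplus> u i \<in> N k" for k
  proof -
    obtain M where M: "\<forall>i\<ge>M. s i \<in> N k" using assms CS_ex NS_ex by meson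
    obtain M' where M': "\<forall>i\<ge>M'. u i \<in> N k" using assms CS_ex NS_ex by meson
    show ?thesis using M M' by (intro exI[of _ "max M M'"]) (auto intro: N_add)
  qed
  then show ?thesis using NS_D assms by (auto simp: null_seqs_def)
qed

lemma NS_mult: assumes "s \<in> CS" "u \<in> NS" shows "(\<lambda>i. s i \<otimes> u i) \<in> NS"
proof -
  obtain a M1 where a: "\<And>i. i \<ge> M1 \<Longrightarrow> w [^] (a::nat) \<otimes> s i \<in> B" using CS_bounded[OF assms(1)] by blast
  have "\<exists>M. \<forall>i\<ge>M. s i \<otimes> u i \<in> N k" for k
  proof -
    obtain M where M: "\<forall>i\<ge>M. u i \<in> N (k + a)" using assms CS_ex NS_ex by meson
    have "s i \<otimes> u i \<in> N k" if "i \<ge> max M M1" for i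
      using N_mult_bounded[OF CS_D[OF assms(1)] a] M that by auto
    then show ?thesis by blast
  qed
  then show ?thesis using NS_D[OF assms(2)] CS_D[OF assms(1)] by (auto simp: null_seqs_def)
qed

lemma NS_ideal: "ideal NS CR"
proof -
  interpret CR: cring CR by (rule CR_cring)
  have neg: "(\<lambda>i. \<ominus> s i) \<in> NS" if "s \<in> NS" for s
    using that N_neg unfolding null_seqs_def by auto meson
  have zero: "(\<lambda>i. \<zero>) \<in> NS" by (auto simp: null_seqs_def N_zero)
  show ?thesis
  proof (rule idealI[OF CR.ring_axioms])
    show "subgroup NS (add_monoid CR)"
    proof (rule CR.add.subgroupI)
      show "NS \<subseteq> carrier CR" using NS_CS by (auto simp: CR_simps)
      show "NS \<noteq> {}" using zero by auto
      show "\<ominus>\<^bsub>CR\<^esub> a \<in> NS" if "a \<in> NS" for a using that neg by (simp add: CR_neg NS_CS)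
      show "a \<oplus>\<^bsub>CR\<^esub> b \<in> NS" if "a \<in> NS" "b \<in> NS" for a b using that NS_add by (simp add: CR_simps)
    qed
    show "x \<otimes>\<^bsub>CR\<^esub> a \<in> NS" if "a \<in> NS" "x \<in> carrier CR" for a x
      using that NS_mult by (simp add: CR_simps)
    then show "a \<otimes>\<^bsub>CR\<^esub> x \<in> NS" if "a \<in> NS" "x \<in> carrier CR" for a x
      using that NS_CS by (simp add: CR.m_comm CR_simps(1))
  qed
qed

lemma completion_cring: "cring S"
  unfolding completion_def by (rule ideal.quotient_is_cring[OF NS_ideal CR_cring])

lemma cls_hom: "cls \<in> ring_hom CR S"
proof -
  have "cls = (+>\<^bsub>CR\<^esub>) NS" by (rule ext) (simp add: compl_class_def)
  then show ?thesis unfolding completion_def using ideal.rcos_ring_hom[OF NS_ideal] by simp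
qed

lemma S_carrierE: assumes "F \<in> carrier S" obtains s where "s \<in> CS" "F = cls s"
  using assms unfolding completion_def FactRing_def A_RCOSETS_def' compl_class_def by (auto simp: CR_simps)

lemma cls_closed: "s \<in> CS \<Longrightarrow> cls s \<in> carrier S"
  using ring_hom_closed[OF cls_hom] by (simp add: CR_simps)

lemma cls_eq_iff: assumes "s \<in> CS" "u \<in> CS" shows "cls s = cls u \<longleftrightarrow> (\<lambda>i. s i \<ominus> u i) \<in> NS"
proof -
  interpret CR: cring CR by (rule CR_cring)
  interpret I: ideal NS CR by (rule NS_ideal)
  have "s \<ominus>\<^bsub>CR\<^esub> u = (\<lambda>i. s i \<ominus> u i)" using assms by (simp add: a_minus_def CR_neg CR_simps)
  moreover have "cls s = cls u \<longleftrightarrow> s \<ominus>\<^bsub>CR\<^esub> u \<in> NS"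
    unfolding compl_class_def using CR.quotient_eq_iff_same_a_r_cos[OF NS_ideal, of s u] assms
    by (auto simp: CR_simps(1))
  ultimately show ?thesis by simp
qed

lemma cls_add: "\<lbrakk>s \<in> CS; u \<in> CS\<rbrakk> \<Longrightarrow> cls s \<oplus>\<^bsub>S\<^esub> cls u = cls (\<lambda>i. s i \<oplus> u i)"
  using ring_hom_add[OF cls_hom, of s u] by (simp add: CR_simps)
lemma cls_mult: "\<lbrakk>s \<in> CS; u \<in> CS\<rbrakk> \<Longrightarrow> cls s \<otimes>\<^bsub>S\<^esub> cls u = cls (\<lambda>i. s i \<otimes> u i)"
  using ring_hom_mult[OF cls_hom, of s u] by (simp add: CR_simps)
lemma cls_one: "\<one>\<^bsub>S\<^esub> = cls (\<lambda>i. \<one>)"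
  using ring_hom_one[OF cls_hom] by (simp add: CR_simps)

lemma cls_zero: "\<zero>\<^bsub>S\<^esub> = cls (\<lambda>i. \<zero>)"
proof -
  interpret CR: cring CR by (rule CR_cring)
  interpret S: cring S by (rule completion_cring)
  interpret h: ring_hom_ring CR S cls
    using CR.ring_axioms S.ring_axioms cls_hom by (rule ring_hom_ringI2)
  show ?thesis using h.hom_zero by (simp add: CR_simps)
qed

lemma cls_neg: assumes "s \<in> CS" shows "\<ominus>\<^bsub>S\<^esub> cls s = cls (\<lambda>i. \<ominus> s i)"
proof -
  interpret S: cring S by (rule completion_cring)
  show ?thesis
    using assms CS_neg[OF assms] by (intro S.sum_zero_eq_neg[symmetric])
      (simp_all add: cls_closed cls_add CS_D l_neg cls_zero)
qed

abbreviation \<iota> where "\<iota> r \<equiv> cls (\<lambda>i. r)"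

lemma \<iota>_hom: "\<iota> \<in> ring_hom R S"
  by (rule ring_hom_memI) (auto simp: cls_closed const_CS cls_mult cls_add cls_one)

lemma \<iota>_cring_hom: "ring_hom_cring R S \<iota>"
  by (intro ring_hom_cring.intro ring_hom_cring_axioms.intro is_cring completion_cring \<iota>_hom)

section \<open>The topology of the completion\<close>

abbreviation CN where "CN \<equiv> compl_nbhd R N"

text \<open>\<open>compl_nbhd\<close> asks for one representative with tail in \<open>N k\<close>. A
  null sequence is eventually in the subgroup \<open>N k\<close>, so every representative will
  do.\<close>

lemma cls_CN_iff: assumes "s \<in> CS" shows "cls s \<in> CN k \<longleftrightarrow> (\<exists>M. \<forall>i\<ge>M. s i \<in> N k)"
proof
  assume "cls s \<in> CN k"
  then obtain u M where u: "u \<in> CS" "cls s = cls u" "\<forall>i\<ge>M. u i \<in> N k" unfolding compl_nbhd_def by auto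
  then have "(\<lambda>i. s i \<ominus> u i) \<in> NS" using cls_eq_iff assms by simp
  then obtain M' where M': "\<forall>i\<ge>M'. s i \<ominus> u i \<in> N k" using NS_ex by blast
  have "s i \<in> N k" if "i \<ge> max M M'" for i
  proof -
    have "(s i \<ominus> u i) \<oplus> u i \<in> N k" using that u M' by (auto intro: N_add)
    moreover have "(s i \<ominus> u i) \<oplus> u i = s i" using CS_D[OF assms, of i] CS_D[OF u(1), of i] by algebra
    ultimately show ?thesis by simp
  qed
  then show "\<exists>M. \<forall>i\<ge>M. s i \<in> N k" by blast
qed (use assms in \<open>auto simp: compl_nbhd_def\<close>)

text \<open>Together with \<open>dense\<close> this identifies the groups \<open>R / N k\<close> and
  \<open>S / CN k\<close>, which is how statements modulo \<open>t^m\<close> are moved from the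
  completion to \<open>A[1/tg]\<close>.\<close>

lemma \<iota>_CN_iff: "r \<in> carrier R \<Longrightarrow> \<iota> r \<in> CN k \<longleftrightarrow> r \<in> N k"
  by (subst cls_CN_iff) (auto simp: const_CS)

lemma CN_closed: "F \<in> CN k \<Longrightarrow> F \<in> carrier S"
  unfolding compl_nbhd_def by (auto intro: cls_closed)

lemma dense: assumes "F \<in> carrier S" obtains r where "r \<in> carrier R" "F \<ominus>\<^bsub>S\<^esub> \<iota> r \<in> CN k"
proof -
  obtain s where s: "s \<in> CS" "F = cls s" using assms by (rule S_carrierE)
  obtain M where M: "\<And>i j. \<lbrakk>i \<ge> M; j \<ge> M\<rbrakk> \<Longrightarrow> s i \<ominus> s j \<in> N k"
    using s(1) unfolding cauchy_seqs_def by blast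
  have sM: "s M \<in> carrier R" using s CS_D by auto
  have "F \<ominus>\<^bsub>S\<^esub> \<iota> (s M) = cls (\<lambda>i. s i \<ominus> s M)"
    unfolding s a_minus_def using s sM by (simp add: cls_neg const_CS cls_add CS_neg)
  moreover have "(\<lambda>i. s i \<ominus> s M) \<in> CS"
    unfolding a_minus_def using s sM by (intro CS_add const_CS) auto
  ultimately show ?thesis using that[OF sM] cls_CN_iff M by force
qed

lemma CN_add: assumes "F \<in> CN k" "G \<in> CN k" shows "F \<oplus>\<^bsub>S\<^esub> G \<in> CN k"
proof -
  obtain s where s: "s \<in> CS" "F = cls s" using CN_closed[OF assms(1)] by (rule S_carrierE)
  obtain u where u: "u \<in> CS" "G = cls u" using CN_closed[OF assms(2)] by (rule S_carrierE)
  obtain M where M: "\<forall>i\<ge>M. s i \<in> N k" using assms s cls_CN_iff by blast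
  obtain M' where M': "\<forall>i\<ge>M'. u i \<in> N k" using assms u cls_CN_iff by blast
  have "\<forall>i\<ge>max M M'. s i \<oplus> u i \<in> N k" using M M' N_add by auto
  then have "cls (\<lambda>i. s i \<oplus> u i) \<in> CN k" unfolding cls_CN_iff[OF CS_add[OF s(1) u(1)]] by blast
  then show ?thesis using s u cls_add by simp
qed

lemma CN_neg: assumes "F \<in> CN k" shows "\<ominus>\<^bsub>S\<^esub> F \<in> CN k"
proof -
  obtain s where s: "s \<in> CS" "F = cls s" using CN_closed[OF assms(1)] by (rule S_carrierE)
  obtain M where M: "\<forall>i\<ge>M. s i \<in> N k" using assms s cls_CN_iff by blast
  then have "\<forall>i\<ge>M. \<ominus> s i \<in> N k" using N_neg by auto
  then have "cls (\<lambda>i. \<ominus> s i) \<in> CN k" unfolding cls_CN_iff[OF CS_neg[OF s(1)]] by blast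
  then show ?thesis using s cls_neg by simp
qed

lemma CN_mult: assumes "F \<in> CN j" "G \<in> CN k" shows "F \<otimes>\<^bsub>S\<^esub> G \<in> CN (j + k)"
proof -
  obtain s where s: "s \<in> CS" "F = cls s" using CN_closed[OF assms(1)] by (rule S_carrierE)
  obtain u where u: "u \<in> CS" "G = cls u" using CN_closed[OF assms(2)] by (rule S_carrierE)
  obtain M where M: "\<forall>i\<ge>M. s i \<in> N j" using assms s cls_CN_iff by blast
  obtain M' where M': "\<forall>i\<ge>M'. u i \<in> N k" using assms u cls_CN_iff by blast
  have "\<forall>i\<ge>max M M'. s i \<otimes> u i \<in> N (j + k)" using M M' N_mult by auto
  then have "cls (\<lambda>i. s i \<otimes> u i) \<in> CN (j + k)" unfolding cls_CN_iff[OF CS_mult[OF s(1) u(1)]] by blast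
  then show ?thesis using s u cls_mult by simp
qed

lemma CN_0_subring: "subring (CN 0) S"
proof -
  interpret S: cring S by (rule completion_cring)
  show ?thesis
  proof (rule S.subringI)
    show "CN 0 \<subseteq> carrier S" using CN_closed by auto
    show "\<one>\<^bsub>S\<^esub> \<in> CN 0" using cls_one \<iota>_CN_iff[of \<one> 0] B_one N_0 by simp
  qed (use CN_add[of _ 0] CN_mult[of _ 0 _ 0] CN_neg[of _ 0] in auto)
qed

lemma \<iota>_pow: "r \<in> carrier R \<Longrightarrow> \<iota> r [^]\<^bsub>S\<^esub> (k::nat) = \<iota> (r [^] k)"
proof -
  interpret h: ring_hom_cring R S \<iota> by (rule \<iota>_cring_hom)
  assume "r \<in> carrier R" then show ?thesis using h.hom_pow by simp
qed

lemma \<iota>_w_unit: "\<iota> w \<in> Units S"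
proof -
  interpret S: cring S by (rule completion_cring)
  interpret h: ring_hom_cring R S \<iota> by (rule \<iota>_cring_hom)
  have "w \<otimes> inv w = \<one>" "inv w \<in> carrier R" using w_unit by auto
  then have "\<iota> w \<otimes>\<^bsub>S\<^esub> \<iota> (inv w) = \<one>\<^bsub>S\<^esub>" "\<iota> (inv w) \<in> carrier S" "\<iota> w \<in> carrier S"
    using h.hom_mult[of w "inv w"] h.hom_one by (auto simp: cls_closed const_CS)
  moreover from this have "\<iota> (inv w) \<otimes>\<^bsub>S\<^esub> \<iota> w = \<one>\<^bsub>S\<^esub>" using S.m_comm by metis
  ultimately show ?thesis unfolding Units_def by blast
qed

text \<open>\<open>O^+\<close> is defined by valuations on the completion, so Chevalley's theorem
  has to be applied there; this makes the completion an instance of the same locale. For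
  \<open>absorb\<close>, \<open>F\<close> is approximated by an element of \<open>R\<close> up to an
  error already in \<open>CN 0\<close>.\<close>

lemma adic_completion: "adic_ring S (CN 0) (\<iota> w)"
proof -
  interpret S: cring S by (rule completion_cring)
  interpret h: ring_hom_cring R S \<iota> by (rule \<iota>_cring_hom)
  show ?thesis
  proof (intro adic_ring.intro adic_ring_axioms.intro completion_cring CN_0_subring \<iota>_w_unit)
    show "\<iota> w \<in> CN 0" using \<iota>_CN_iff[of w 0] w_B N_0 by simp
    fix F assume F: "F \<in> carrier S"
    obtain r where r: "r \<in> carrier R" "F \<ominus>\<^bsub>S\<^esub> \<iota> r \<in> CN 0" using F by (rule dense)
    obtain k :: nat where k: "w [^] k \<otimes> r \<in> B" using absorb r by blast
    have c: "\<iota> w [^]\<^bsub>S\<^esub> k = \<iota> (w [^] k)" "w [^] k \<in> B" "w [^] k \<in> carrier R"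
      using \<iota>_pow w_B by (auto intro: B_pow)
    define d where "d = \<iota> (w [^] k)"
    have d: "d \<in> CN 0" "d \<in> carrier S"
      using \<iota>_CN_iff[OF c(3), of 0] c(2) N_0 CN_closed unfolding d_def by auto
    have "d \<otimes>\<^bsub>S\<^esub> (F \<ominus>\<^bsub>S\<^esub> \<iota> r) \<in> CN 0"
      using CN_mult[OF d(1) r(2)] by simp
    moreover have "d \<otimes>\<^bsub>S\<^esub> \<iota> r \<in> CN 0"
      using k r \<iota>_CN_iff[of "w [^] k \<otimes> r" 0] h.hom_mult[OF c(3) r(1)] N_0 unfolding d_def by auto
    ultimately have "d \<otimes>\<^bsub>S\<^esub> (F \<ominus>\<^bsub>S\<^esub> \<iota> r) \<oplus>\<^bsub>S\<^esub> d \<otimes>\<^bsub>S\<^esub> \<iota> r \<in> CN 0"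
      by (rule CN_add)
    moreover have "d \<otimes>\<^bsub>S\<^esub> (F \<ominus>\<^bsub>S\<^esub> \<iota> r) \<oplus>\<^bsub>S\<^esub> d \<otimes>\<^bsub>S\<^esub> \<iota> r = d \<otimes>\<^bsub>S\<^esub> F"
    proof -
      have r': "\<iota> r \<in> carrier S" using r by (simp add: cls_closed const_CS)
      then have "(F \<ominus>\<^bsub>S\<^esub> \<iota> r) \<oplus>\<^bsub>S\<^esub> \<iota> r = F" using F by (simp add: S.minus_eq S.a_assoc S.l_neg)
      then show ?thesis using F d(2) r' S.r_distr[of "F \<ominus>\<^bsub>S\<^esub> \<iota> r" "\<iota> r" d] by simp
    qed
    ultimately have "\<iota> w [^]\<^bsub>S\<^esub> k \<otimes>\<^bsub>S\<^esub> F \<in> CN 0"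
      unfolding c(1) d_def by argo
    then show "\<exists>k::nat. \<iota> w [^]\<^bsub>S\<^esub> k \<otimes>\<^bsub>S\<^esub> F \<in> CN 0" by blast
  qed
qed

text \<open>Dividing a sequence with tail in \<open>N k\<close> by the unit \<open>w^k\<close> gives
  one with tail in \<open>B\<close>. This matches the neighbourhoods used in
  \<open>sections_plus\<close> with the adic ones of the locale, and later lets a factor
  \<open>t^m\<close> be split off from a small section.\<close>

lemma CN_eq: "CN k = adic_nbhd S (CN 0) (\<iota> w) k"
proof
  have wk: "\<iota> w [^]\<^bsub>S\<^esub> k \<in> CN k"
    using \<iota>_CN_iff[of "w [^] k" k] N_I[OF B_one, of k] by (simp add: \<iota>_pow)
  show "adic_nbhd S (CN 0) (\<iota> w) k \<subseteq> CN k"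
    using CN_mult[OF wk, of _ 0] by (auto simp: adic_nbhd_def)
  show "CN k \<subseteq> adic_nbhd S (CN 0) (\<iota> w) k"
  proof
    fix F assume F: "F \<in> CN k"
    obtain s where s: "s \<in> CS" "F = cls s" using CN_closed[OF F] by (rule S_carrierE)
    obtain M where M: "\<forall>i\<ge>M. s i \<in> N k" using F s cls_CN_iff by blast
    define u where "u = (\<lambda>i. inv (w [^] k) \<otimes> s i)"
    have wu: "w [^] k \<in> Units R" using w_unit Units_pow_closed by auto
    then have inv: "inv (w [^] k) \<in> carrier R" by simp
    have u: "u \<in> CS" unfolding u_def using s inv by (intro CS_mult const_CS) auto
    have eq: "w [^] k \<otimes> u i = s i" for i
      unfolding u_def using wu inv s CS_D[OF s(1), of i] by (simp add: m_assoc[symmetric])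
    have "\<iota> w [^]\<^bsub>S\<^esub> k \<otimes>\<^bsub>S\<^esub> cls u = F"
      using cls_mult[OF const_CS[of "w [^] k"] u] eq s by (simp add: \<iota>_pow)
    moreover have "cls u \<in> CN 0"
      unfolding cls_CN_iff[OF u] using M N_shift[of "u _" k 0] eq CS_D[OF u] by fastforce
    ultimately show "F \<in> adic_nbhd S (CN 0) (\<iota> w) k" unfolding adic_nbhd_def by blast
  qed
qed

end

text \<open>Models restriction to a smaller rational subset: the ring stays the same, the ring of
  definition grows, and so the topology gets coarser.\<close>

locale adic_coarsening = adic_ring R B w + coarse: adic_ring R B' w for R (structure) and B w B' +
  assumes B_le: "B \<subseteq> B'"
begin

abbreviation \<rho> where "\<rho> \<equiv> compl_coarsen R (adic_nbhd R B' w)"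

lemma N_le: "x \<in> N k \<Longrightarrow> x \<in> coarse.N k"
  using B_le by (auto simp: adic_nbhd_def)

lemma CS_le: "s \<in> CS \<Longrightarrow> s \<in> coarse.CS"
  unfolding cauchy_seqs_def using N_le by blast

lemma NS_le: "s \<in> NS \<Longrightarrow> s \<in> coarse.NS"
  unfolding null_seqs_def using N_le by blast

lemma coarsen_cls: assumes "s \<in> CS" shows "\<rho> (cls s) = coarse.cls s"
proof -
  interpret CR: cring CR by (rule CR_cring)
  interpret I: ideal NS CR by (rule NS_ideal)
  have "s \<in> cls s" unfolding compl_class_def using assms I.a_rcos_self[of s] by (simp add: CR_simps)
  moreover have "coarse.cls u = coarse.cls s" if uc: "u \<in> cls s" for u
  proof -
    obtain z where z: "z \<in> NS" "u = z \<oplus>\<^bsub>CR\<^esub> s" using uc unfolding compl_class_def a_r_coset_def' by auto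
    have u: "u \<in> CS" using z CS_add assms NS_CS by (auto simp: CR_simps)
    have "(\<lambda>i. u i \<ominus> s i) = z"
    proof
      fix i show "u i \<ominus> s i = z i"
        using z(2) NS_D[OF z(1), of i] CS_D[OF assms, of i] unfolding CR_simps z(2) by algebra
    qed
    then show ?thesis using u z assms CS_le NS_le by (simp add: coarse.cls_eq_iff)
  qed
  ultimately show ?thesis unfolding compl_coarsen_def by blast
qed

lemma coarsen_hom: "\<rho> \<in> ring_hom S coarse.S"
proof (rule ring_hom_memI)
  fix F assume "F \<in> carrier S"
  then show "\<rho> F \<in> carrier coarse.S" by (elim S_carrierE) (simp add: coarsen_cls CS_le coarse.cls_closed)
next
  fix F G assume "F \<in> carrier S" "G \<in> carrier S"
  then show "\<rho> (F \<otimes>\<^bsub>S\<^esub> G) = \<rho> F \<otimes>\<^bsub>coarse.S\<^esub> \<rho> G" "\<rho> (F \<oplus>\<^bsub>S\<^esub> G) = \<rho> F \<oplus>\<^bsub>coarse.S\<^esub> \<rho> G"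
    by (elim S_carrierE, simp add: cls_mult cls_add coarsen_cls CS_le CS_mult CS_add coarse.cls_mult coarse.cls_add)+
next
  show "\<rho> \<one>\<^bsub>S\<^esub> = \<one>\<^bsub>coarse.S\<^esub>" by (simp add: cls_one coarse.cls_one coarsen_cls const_CS)
qed

lemma coarsen_CN: assumes "F \<in> CN k" shows "\<rho> F \<in> coarse.CN k"
proof -
  obtain s where s: "s \<in> CS" "F = cls s" using CN_closed[OF assms] by (rule S_carrierE)
  then show ?thesis using assms cls_CN_iff coarse.cls_CN_iff CS_le N_le coarsen_cls by metis
qed

end

section \<open>Valuations as relations\<close>

text \<open>\<open>le a b\<close> stands for \<open>|a| \<le> |b|\<close>. The value group rebuilt from the relation consists of classes of
  pairs of ring elements, so it has the type over which \<open>sections_plus\<close> quantifies.\<close>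

locale val_relation = cring R for R (structure) +
  fixes le :: "'a \<Rightarrow> 'a \<Rightarrow> bool"
  assumes le_total: "\<lbrakk>a \<in> carrier R; b \<in> carrier R\<rbrakk> \<Longrightarrow> le a b \<or> le b a"
    and le_trans: "\<lbrakk>le a b; le b c; a \<in> carrier R; b \<in> carrier R; c \<in> carrier R\<rbrakk> \<Longrightarrow> le a c"
    and le_add: "\<lbrakk>le a c; le b c; a \<in> carrier R; b \<in> carrier R; c \<in> carrier R\<rbrakk> \<Longrightarrow> le (a \<oplus> b) c"
    and le_mult_right: "\<lbrakk>le a b; a \<in> carrier R; b \<in> carrier R; c \<in> carrier R\<rbrakk> \<Longrightarrow> le (a \<otimes> c) (b \<otimes> c)"
    and le_cancel: "\<lbrakk>le (a \<otimes> c) (b \<otimes> c); \<not> le c \<zero>; a \<in> carrier R; b \<in> carrier R; c \<in> carrier R\<rbrakk> \<Longrightarrow> le a b"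
    and not_one_le_zero: "\<not> le \<one> \<zero>"
begin

lemma le_refl: "a \<in> carrier R \<Longrightarrow> le a a" using le_total by blast

lemma zero_le: assumes "a \<in> carrier R" shows "le \<zero> a"
  using le_mult_right[of \<zero> \<one> a] le_total[of \<zero> \<one>] not_one_le_zero assms by auto

lemma le_mult_mono: assumes "le a b" "le c d" "a \<in> carrier R" "b \<in> carrier R" "c \<in> carrier R" "d \<in> carrier R"
  shows "le (a \<otimes> c) (b \<otimes> d)"
proof -
  have "le (a \<otimes> c) (b \<otimes> c)" using le_mult_right assms by auto
  moreover have "le (b \<otimes> c) (b \<otimes> d)" using le_mult_right[of c d b] assms by (simp add: m_comm)
  ultimately show ?thesis using le_trans[of "a \<otimes> c" "b \<otimes> c" "b \<otimes> d"] assms by auto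
qed

lemma le_one_mult: "\<lbrakk>le a \<one>; le b \<one>; a \<in> carrier R; b \<in> carrier R\<rbrakk> \<Longrightarrow> le (a \<otimes> b) \<one>"
  using le_mult_mono[of a \<one> b \<one>] by simp

lemma le_one_neg: assumes "le a \<one>" "a \<in> carrier R" shows "le (\<ominus> a) \<one>"
proof -
  have "le (\<ominus> \<one>) \<one>"
    using le_total[of "\<ominus> \<one>" \<one>] le_mult_right[of \<one> "\<ominus> \<one>" "\<ominus> \<one>"] by (auto simp: l_minus r_minus)
  from le_one_mult[OF this assms(1)] show ?thesis using assms(2) by (simp add: l_minus)
qed

lemma one_le_pow: assumes "le \<one> a" "a \<in> carrier R" shows "le \<one> (a [^] (n::nat))"
proof (induction n)
  case (Suc n) then show ?case using le_mult_mono[of \<one> "a [^] n" \<one> a] assms by auto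
qed (simp add: le_refl)

text \<open>If \<open>|a|\<close> exceeded 1, then \<open>|a| \<le> |a^n|\<close>. Used to pass from
  \<open>t^n/g\<close> to its \<open>p\<close>-power roots.\<close>

lemma le_one_root: assumes "le (a [^] (n::nat)) \<one>" "n > 0" "a \<in> carrier R" shows "le a \<one>"
proof (rule ccontr)
  assume n: "\<not> le a \<one>"
  then have 1: "le \<one> a" using le_total assms by blast
  obtain m where m: "n = Suc m" using assms(2) gr0_implies_Suc by blast
  have "le (\<one> \<otimes> a) (a [^] m \<otimes> a)"
    using le_mult_right[OF one_le_pow[OF 1, of m], of a] assms by auto
  then have "le a (a [^] n)" using m assms by simp
  then show False using n assms le_trans[of a "a [^] n" \<one>] by auto
qed

section \<open>The value group of a relation\<close>

definition nz where "nz = {c \<in> carrier R. \<not> le c \<zero>}"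

lemma nz_closed: "a \<in> nz \<Longrightarrow> a \<in> carrier R" by (simp add: nz_def)
lemma nz_one: "\<one> \<in> nz" using not_one_le_zero by (simp add: nz_def)
lemma nz_mult: "\<lbrakk>a \<in> nz; b \<in> nz\<rbrakk> \<Longrightarrow> a \<otimes> b \<in> nz"
  using le_cancel[of a b \<zero>] by (auto simp: nz_def)
lemma nz_multD: "\<lbrakk>a \<otimes> b \<in> nz; a \<in> carrier R; b \<in> carrier R\<rbrakk> \<Longrightarrow> a \<in> nz"
  using le_mult_right[of a \<zero> b] by (auto simp: nz_def)

definition ratio where
  "ratio a b = {(c, d). c \<in> nz \<and> d \<in> nz \<and> le (a \<otimes> d) (c \<otimes> b) \<and> le (c \<otimes> b) (a \<otimes> d)}"

text \<open>Transitivity for \<open>|a|/|b| \<le> |c|/|d| \<le> |e|/|f|\<close> with denominators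
  cleared; what gets cancelled is the middle denominator \<open>d\<close>, which therefore must not
  have value zero.\<close>

lemma le_cross_trans:
  assumes "le (a \<otimes> d) (c \<otimes> b)" "le (c \<otimes> f) (e \<otimes> d)" "d \<in> nz"
    "a \<in> carrier R" "b \<in> carrier R" "c \<in> carrier R" "e \<in> carrier R" "f \<in> carrier R"
  shows "le (a \<otimes> f) (e \<otimes> b)"
proof -
  have d: "d \<in> carrier R" using assms nz_closed by auto
  have "le ((a \<otimes> d) \<otimes> f) ((c \<otimes> b) \<otimes> f)" using assms d by (intro le_mult_right) auto
  then have 1: "le ((a \<otimes> f) \<otimes> d) ((c \<otimes> f) \<otimes> b)" using assms d by (simp add: m_assoc m_comm m_lcomm)
  have "le ((c \<otimes> f) \<otimes> b) ((e \<otimes> d) \<otimes> b)" using assms d by (intro le_mult_right) auto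
  then have 2: "le ((c \<otimes> f) \<otimes> b) ((e \<otimes> b) \<otimes> d)" using assms d by (simp add: m_assoc m_comm m_lcomm)
  have "le ((a \<otimes> f) \<otimes> d) ((e \<otimes> b) \<otimes> d)" using le_trans[OF 1 2] assms d by simp
  then show ?thesis using le_cancel[of "a \<otimes> f" d "e \<otimes> b"] assms d by (auto simp: nz_def)
qed

lemma ratio_subset:
  assumes "a \<in> nz" "b \<in> nz" "c \<in> nz" "d \<in> nz" "le (a \<otimes> d) (c \<otimes> b)" "le (c \<otimes> b) (a \<otimes> d)"
  shows "ratio a b \<subseteq> ratio c d"
proof
  fix z assume "z \<in> ratio a b"
  then obtain e f where z: "z = (e, f)" "e \<in> nz" "f \<in> nz" "le (a \<otimes> f) (e \<otimes> b)" "le (e \<otimes> b) (a \<otimes> f)"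
    by (auto simp: ratio_def)
  note cl = assms(1-4)[THEN nz_closed] z(2,3)[THEN nz_closed]
  have "le (c \<otimes> f) (e \<otimes> d)" using le_cross_trans[OF assms(6) z(4) assms(2)] cl by simp
  moreover have "le (e \<otimes> d) (c \<otimes> f)" using le_cross_trans[OF z(5) assms(5) assms(2)] cl by simp
  ultimately show "z \<in> ratio c d" using z by (simp add: ratio_def)
qed

lemma ratio_eq_iff:
  assumes "a \<in> nz" "b \<in> nz" "c \<in> nz" "d \<in> nz"
  shows "ratio a b = ratio c d \<longleftrightarrow> le (a \<otimes> d) (c \<otimes> b) \<and> le (c \<otimes> b) (a \<otimes> d)"
proof
  assume "ratio a b = ratio c d"
  moreover have "(c, d) \<in> ratio c d" using assms nz_closed by (auto simp: ratio_def intro: le_refl)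
  ultimately show "le (a \<otimes> d) (c \<otimes> b) \<and> le (c \<otimes> b) (a \<otimes> d)" by (auto simp: ratio_def)
next
  assume h: "le (a \<otimes> d) (c \<otimes> b) \<and> le (c \<otimes> b) (a \<otimes> d)"
  show "ratio a b = ratio c d"
    using h assms ratio_subset[of a b c d] ratio_subset[of c d a b] by blast
qed

definition value_group :: "('a \<times> 'a) set monoid" where
  "value_group = \<lparr>carrier = {ratio a b | a b. a \<in> nz \<and> b \<in> nz},
     monoid.mult = (\<lambda>X Y. \<Union>(a, b)\<in>X. \<Union>(c, d)\<in>Y. ratio (a \<otimes> c) (b \<otimes> d)),
     monoid.one = ratio \<one> \<one>\<rparr>"

definition value_order :: "(('a \<times> 'a) set \<times> ('a \<times> 'a) set) set" where
  "value_order = {(ratio a b, ratio c d) | a b c d.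
     a \<in> nz \<and> b \<in> nz \<and> c \<in> nz \<and> d \<in> nz \<and> le (a \<otimes> d) (c \<otimes> b)}"

definition val :: "'a \<Rightarrow> ('a \<times> 'a) set option" where
  "val a = (if a \<in> nz then Some (ratio a \<one>) else None)"

lemma ratio_mult:
  assumes "a \<in> nz" "b \<in> nz" "c \<in> nz" "d \<in> nz"
  shows "ratio a b \<otimes>\<^bsub>value_group\<^esub> ratio c d = ratio (a \<otimes> c) (b \<otimes> d)"
proof -
  have *: "ratio (x \<otimes> z) (y \<otimes> u) = ratio (a \<otimes> c) (b \<otimes> d)"
    if "(x, y) \<in> ratio a b" "(z, u) \<in> ratio c d" for x y z u
  proof -
    have n: "x \<in> nz" "y \<in> nz" "z \<in> nz" "u \<in> nz"
      and l: "le (a \<otimes> y) (x \<otimes> b)" "le (x \<otimes> b) (a \<otimes> y)" "le (c \<otimes> u) (z \<otimes> d)" "le (z \<otimes> d) (c \<otimes> u)"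
      using that by (auto simp: ratio_def)
    note cl = n[THEN nz_closed] assms[THEN nz_closed]
    have "le ((a \<otimes> y) \<otimes> (c \<otimes> u)) ((x \<otimes> b) \<otimes> (z \<otimes> d))" "le ((x \<otimes> b) \<otimes> (z \<otimes> d)) ((a \<otimes> y) \<otimes> (c \<otimes> u))"
      using l cl by (auto intro!: le_mult_mono)
    moreover have "(a \<otimes> y) \<otimes> (c \<otimes> u) = (a \<otimes> c) \<otimes> (y \<otimes> u)" "(x \<otimes> b) \<otimes> (z \<otimes> d) = (x \<otimes> z) \<otimes> (b \<otimes> d)"
      using cl by (simp_all add: m_assoc m_lcomm)
    ultimately show ?thesis using n assms by (subst ratio_eq_iff) (auto intro: nz_mult)
  qed
  have "(a, b) \<in> ratio a b" "(c, d) \<in> ratio c d"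
    using assms nz_closed by (auto simp: ratio_def intro: le_refl)
  then have "(\<Union>p\<in>ratio a b. \<Union>q\<in>ratio c d. ratio (a \<otimes> c) (b \<otimes> d)) = ratio (a \<otimes> c) (b \<otimes> d)" by blast
  moreover have "(\<Union>(x, y)\<in>ratio a b. \<Union>(z, u)\<in>ratio c d. ratio (x \<otimes> z) (y \<otimes> u))
      = (\<Union>p\<in>ratio a b. \<Union>q\<in>ratio c d. ratio (a \<otimes> c) (b \<otimes> d))"
    by (intro SUP_cong refl) (auto simp: * split: prod.split)
  ultimately show ?thesis unfolding value_group_def by simp
qed

lemma value_order_iff:
  assumes "a \<in> nz" "b \<in> nz" "c \<in> nz" "d \<in> nz"
  shows "(ratio a b, ratio c d) \<in> value_order \<longleftrightarrow> le (a \<otimes> d) (c \<otimes> b)"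
proof
  assume "(ratio a b, ratio c d) \<in> value_order"
  then obtain x y z u where n: "x \<in> nz" "y \<in> nz" "z \<in> nz" "u \<in> nz"
    and e: "ratio a b = ratio x y" "ratio c d = ratio z u" and l: "le (x \<otimes> u) (z \<otimes> y)"
    unfolding value_order_def by blast
  note cl = n[THEN nz_closed] assms[THEN nz_closed]
  have "le (a \<otimes> y) (x \<otimes> b)" "le (z \<otimes> d) (c \<otimes> u)" using e n assms ratio_eq_iff by blast+
  then have "le (a \<otimes> u) (z \<otimes> b)" using l n cl le_cross_trans by blast
  then show "le (a \<otimes> d) (c \<otimes> b)" using \<open>le (z \<otimes> d) (c \<otimes> u)\<close> n cl le_cross_trans by blast
qed (use assms in \<open>auto simp: value_order_def\<close>)

lemma value_group_carrierE:
  assumes "X \<in> carrier value_group" obtains a b where "a \<in> nz" "b \<in> nz" "X = ratio a b"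
  using assms by (auto simp: value_group_def)

lemma ratio_closed: "\<lbrakk>a \<in> nz; b \<in> nz\<rbrakk> \<Longrightarrow> ratio a b \<in> carrier value_group"
  by (auto simp: value_group_def)

lemma value_one: "\<one>\<^bsub>value_group\<^esub> = ratio \<one> \<one>" by (simp add: value_group_def)

lemma ratio_self: "a \<in> nz \<Longrightarrow> ratio a a = ratio \<one> \<one>"
  by (subst ratio_eq_iff) (auto simp: nz_one nz_closed intro: le_refl)

lemma value_group_comm: "comm_group value_group"
proof (rule comm_groupI)
  fix X Y assume "X \<in> carrier value_group" "Y \<in> carrier value_group"
  then show "X \<otimes>\<^bsub>value_group\<^esub> Y \<in> carrier value_group"
    by (elim value_group_carrierE) (simp add: ratio_mult ratio_closed nz_mult)
  from \<open>X \<in> carrier value_group\<close> \<open>Y \<in> carrier value_group\<close>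
  show "X \<otimes>\<^bsub>value_group\<^esub> Y = Y \<otimes>\<^bsub>value_group\<^esub> X"
    by (elim value_group_carrierE) (simp add: ratio_mult m_comm nz_closed)
next
  show "\<one>\<^bsub>value_group\<^esub> \<in> carrier value_group" by (simp add: value_one ratio_closed nz_one)
next
  fix X Y Z assume "X \<in> carrier value_group" "Y \<in> carrier value_group" "Z \<in> carrier value_group"
  then show "(X \<otimes>\<^bsub>value_group\<^esub> Y) \<otimes>\<^bsub>value_group\<^esub> Z = X \<otimes>\<^bsub>value_group\<^esub> (Y \<otimes>\<^bsub>value_group\<^esub> Z)"
    by (elim value_group_carrierE) (simp add: ratio_mult nz_mult m_assoc nz_closed)
next
  fix X assume "X \<in> carrier value_group"
  then obtain a b where X: "a \<in> nz" "b \<in> nz" "X = ratio a b" by (rule value_group_carrierE)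
  then show "\<one>\<^bsub>value_group\<^esub> \<otimes>\<^bsub>value_group\<^esub> X = X"
    by (simp add: value_one ratio_mult nz_one nz_closed)
  have "ratio b a \<otimes>\<^bsub>value_group\<^esub> X = \<one>\<^bsub>value_group\<^esub>"
    using X by (simp add: value_one ratio_mult nz_mult m_comm[of b a] nz_closed ratio_self)
  then show "\<exists>y\<in>carrier value_group. y \<otimes>\<^bsub>value_group\<^esub> X = \<one>\<^bsub>value_group\<^esub>"
    using X ratio_closed by blast
qed

lemma value_group_ordered: "ordered_abelian_group value_group value_order"
proof -
  have "linear_order_on (carrier value_group) value_order"
    unfolding linear_order_on_def partial_order_on_def preorder_on_def
  proof (intro conjI)
    show "value_order \<subseteq> carrier value_group \<times> carrier value_group"
      unfolding value_order_def by (auto intro: ratio_closed)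
    show "refl_on (carrier value_group) value_order"
      unfolding refl_on_def
      by (auto elim!: value_group_carrierE simp: value_order_iff nz_closed intro!: le_refl)
    show "trans value_order"
    proof (rule transI)
      fix X Y Z assume h: "(X, Y) \<in> value_order" "(Y, Z) \<in> value_order"
      obtain a b c d where 1: "a \<in> nz" "b \<in> nz" "c \<in> nz" "d \<in> nz" "X = ratio a b" "Y = ratio c d" "le (a \<otimes> d) (c \<otimes> b)"
        using h(1) unfolding value_order_def by blast
      obtain e f where 2: "e \<in> nz" "f \<in> nz" "Z = ratio e f" using h(2) unfolding value_order_def by blast
      have "le (c \<otimes> f) (e \<otimes> d)" using h(2) 1 2 by (simp add: value_order_iff)
      then have "le (a \<otimes> f) (e \<otimes> b)" using 1 2 nz_closed le_cross_trans by metis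
      then show "(X, Z) \<in> value_order" using 1 2 by (simp add: value_order_iff)
    qed
    show "antisym value_order"
    proof (rule antisymI)
      fix X Y assume h: "(X, Y) \<in> value_order" "(Y, X) \<in> value_order"
      obtain a b c d where 1: "a \<in> nz" "b \<in> nz" "c \<in> nz" "d \<in> nz" "X = ratio a b" "Y = ratio c d" "le (a \<otimes> d) (c \<otimes> b)"
        using h(1) unfolding value_order_def by blast
      then show "X = Y" using h(2) by (simp add: value_order_iff ratio_eq_iff)
    qed
    show "total_on (carrier value_group) value_order"
      unfolding total_on_def
    proof (intro ballI impI)
      fix X Y assume "X \<in> carrier value_group" "Y \<in> carrier value_group"
      then obtain a b c d where "a \<in> nz" "b \<in> nz" "c \<in> nz" "d \<in> nz" "X = ratio a b" "Y = ratio c d"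
        by (metis value_group_carrierE)
      then show "(X, Y) \<in> value_order \<or> (Y, X) \<in> value_order"
        using le_total[of "a \<otimes> d" "c \<otimes> b"] by (simp add: value_order_iff nz_closed)
    qed
  qed
  moreover have "(X \<otimes>\<^bsub>value_group\<^esub> Z, Y \<otimes>\<^bsub>value_group\<^esub> Z) \<in> value_order"
    if h: "X \<in> carrier value_group" "Y \<in> carrier value_group" "Z \<in> carrier value_group" "(X, Y) \<in> value_order" for X Y Z
  proof -
    obtain a b where X: "a \<in> nz" "b \<in> nz" "X = ratio a b" using h(1) by (rule value_group_carrierE)
    obtain c d where Y: "c \<in> nz" "d \<in> nz" "Y = ratio c d" using h(2) by (rule value_group_carrierE)
    obtain e f where Z: "e \<in> nz" "f \<in> nz" "Z = ratio e f" using h(3) by (rule value_group_carrierE)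
    note cl = X(1,2)[THEN nz_closed] Y(1,2)[THEN nz_closed] Z(1,2)[THEN nz_closed]
    have "le (a \<otimes> d) (c \<otimes> b)" using h X Y by (simp add: value_order_iff)
    then have "le ((a \<otimes> d) \<otimes> (e \<otimes> f)) ((c \<otimes> b) \<otimes> (e \<otimes> f))" using cl by (intro le_mult_right) auto
    moreover have "(a \<otimes> d) \<otimes> (e \<otimes> f) = (a \<otimes> e) \<otimes> (d \<otimes> f)" "(c \<otimes> b) \<otimes> (e \<otimes> f) = (c \<otimes> e) \<otimes> (b \<otimes> f)"
      using cl by (simp_all add: m_assoc m_lcomm)
    ultimately show ?thesis using X Y Z by (simp add: ratio_mult value_order_iff nz_mult)
  qed
  ultimately show ?thesis unfolding ordered_abelian_group_def using value_group_comm by blast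
qed

lemma val_le_iff: assumes "a \<in> carrier R" "b \<in> carrier R"
  shows "val_le value_order (val a) (val b) \<longleftrightarrow> le a b"
proof (cases "a \<in> nz")
  case True
  show ?thesis
  proof (cases "b \<in> nz")
    case False
    then have "le b \<zero>" using assms by (auto simp: nz_def)
    then show ?thesis using True False assms le_trans[of a b \<zero>] by (auto simp: val_def nz_def)
  qed (use True assms in \<open>simp add: val_def value_order_iff nz_one\<close>)
next
  case False
  then have "le a \<zero>" using assms by (auto simp: nz_def)
  then have "le a b" using le_trans[of a \<zero> b] zero_le assms by auto
  then show ?thesis using False by (simp add: val_def)
qed

lemma val_is_valuation: "is_valuation R value_group value_order val"
  unfolding is_valuation_def
proof (intro conjI ballI)
  show "ordered_abelian_group value_group value_order" by (rule value_group_ordered)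
  show "val a \<in> insert None (Some ` carrier value_group)" for a
    by (auto simp: val_def ratio_closed nz_one)
  show "val \<zero> = None" using le_refl by (auto simp: val_def nz_def)
  show "val \<one> = Some \<one>\<^bsub>value_group\<^esub>" by (simp add: val_def nz_one value_one)
  fix a b assume ab: "a \<in> carrier R" "b \<in> carrier R"
  show "val (a \<otimes> b) = val_mult value_group (val a) (val b)"
    using ab nz_multD[of a b] nz_multD[of b a] nz_mult[of a b]
    by (auto simp: val_def ratio_mult nz_one m_comm)
  show "val_le value_order (val (a \<oplus> b)) (val a) \<or> val_le value_order (val (a \<oplus> b)) (val b)"
    using ab le_total[of a b] le_add[of a a b] le_add[of a b b] le_refl by (auto simp: val_le_iff)
qed

lemma val_point_val: "val_point R value_order val = {(a, b) \<in> carrier R \<times> carrier R. le a b}"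
  by (auto simp: val_point_def val_le_iff)

lemma val_le_one_iff: "a \<in> carrier R \<Longrightarrow> val_le value_order (val a) (Some \<one>\<^bsub>value_group\<^esub>) \<longleftrightarrow> le a \<one>"
  using val_le_iff[of a \<one>] by (simp add: val_def nz_one value_one)

end

text \<open>The passage back from valuations, with a value group of any type, to relations: bounds
  on an arbitrary point can then be proved without touching its value group.\<close>

lemma (in cring) val_relation_of_valuation:
  assumes v: "is_valuation R G L v"
  shows "val_relation R (\<lambda>a b. val_le L (v a) (v b))"
proof -
  interpret G: comm_group G using v by (auto simp: is_valuation_def ordered_abelian_group_def)
  have lin: "linear_order_on (carrier G) L"
    and mono: "\<And>a b c. \<lbrakk>a \<in> carrier G; b \<in> carrier G; c \<in> carrier G; (a, b) \<in> L\<rbrakk> \<Longrightarrow> (a \<otimes>\<^bsub>G\<^esub> c, b \<otimes>\<^bsub>G\<^esub> c) \<in> L"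
    and vc: "\<And>a. a \<in> carrier R \<Longrightarrow> v a \<in> insert None (Some ` carrier G)"
    and v0: "v \<zero> = None" and v1: "v \<one> = Some \<one>\<^bsub>G\<^esub>"
    and vm: "\<And>a b. \<lbrakk>a \<in> carrier R; b \<in> carrier R\<rbrakk> \<Longrightarrow> v (a \<otimes> b) = val_mult G (v a) (v b)"
    and va: "\<And>a b. \<lbrakk>a \<in> carrier R; b \<in> carrier R\<rbrakk> \<Longrightarrow>
        val_le L (v (a \<oplus> b)) (v a) \<or> val_le L (v (a \<oplus> b)) (v b)"
    using v unfolding is_valuation_def ordered_abelian_group_def by auto
  have tot: "(x, y) \<in> L \<or> (y, x) \<in> L" if "x \<in> carrier G" "y \<in> carrier G" for x y
    using lin that unfolding linear_order_on_def partial_order_on_def preorder_on_def total_on_def refl_on_def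
    by metis
  have tr: "(x, z) \<in> L" if "(x, y) \<in> L" "(y, z) \<in> L" for x y z
    using lin that unfolding linear_order_on_def partial_order_on_def preorder_on_def trans_def by blast
  have tr': "val_le L x z" if "val_le L x y" "val_le L y z" for x y z
    using that by (cases x; cases y; cases z; simp) (blast intro: tr)
  show ?thesis
  proof
    fix a b assume "a \<in> carrier R" "b \<in> carrier R"
    then show "val_le L (v a) (v b) \<or> val_le L (v b) (v a)"
      using vc[of a] vc[of b] by (auto dest: tot)
  next
    fix a b c assume "val_le L (v a) (v b)" "val_le L (v b) (v c)"
    then show "val_le L (v a) (v c)" by (rule tr')
  next
    fix a b c assume "val_le L (v a) (v c)" "val_le L (v b) (v c)" "a \<in> carrier R" "b \<in> carrier R"
    then show "val_le L (v (a \<oplus> b)) (v c)" using va tr' by blast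
  next
    fix a b c assume "val_le L (v a) (v b)" "a \<in> carrier R" "b \<in> carrier R" "c \<in> carrier R"
    then show "val_le L (v (a \<otimes> c)) (v (b \<otimes> c))"
      using vc[of a] vc[of b] vc[of c] by (auto simp: vm intro: mono)
  next
    fix a b c assume h: "val_le L (v (a \<otimes> c)) (v (b \<otimes> c))" "\<not> val_le L (v c) (v \<zero>)"
      "a \<in> carrier R" "b \<in> carrier R" "c \<in> carrier R"
    then obtain z where z: "v c = Some z" "z \<in> carrier G" using vc[of c] v0 by auto
    have can: "(x, y) \<in> L" if "(x \<otimes>\<^bsub>G\<^esub> z, y \<otimes>\<^bsub>G\<^esub> z) \<in> L" "x \<in> carrier G" "y \<in> carrier G" for x y
      using mono[OF _ _ _ that(1), of "inv\<^bsub>G\<^esub> z"] that z by (simp add: G.m_assoc)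
    show "val_le L (v a) (v b)" using h z vc[of a] vc[of b] by (auto simp: vm dest: can)
  next
    show "\<not> val_le L (v \<one>) (v \<zero>)" by (simp add: v0 v1)
  qed
qed

text \<open>\<open>cofinal\<close> is continuity at zero: the powers of \<open>w\<close> fall below
  every nonzero value.\<close>

locale adic_val_relation = adic_ring R B w + val_relation R le for R (structure) and B w le +
  assumes B_le_one: "b \<in> B \<Longrightarrow> le b \<one>"
    and cofinal: "\<lbrakk>x \<in> carrier R; \<not> le x \<zero>\<rbrakk> \<Longrightarrow> \<exists>n::nat. \<not> le x (w [^] n)"
begin

lemma val_continuous: "continuous_valuation R N value_group value_order val"
  unfolding continuous_valuation_def
proof (intro conjI ballI val_is_valuation)
  interpret G: comm_group value_group by (rule value_group_comm)
  fix c assume "c \<in> generate value_group {c. Some c \<in> val ` carrier R}"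
  moreover have "{c. Some c \<in> val ` carrier R} \<subseteq> carrier value_group"
    by (auto simp: val_def ratio_closed nz_one split: if_splits)
  ultimately have "c \<in> carrier value_group" using G.generate_in_carrier by blast
  then obtain x y where xy: "x \<in> nz" "y \<in> nz" "c = ratio x y" by (rule value_group_carrierE)
  note cl = xy(1,2)[THEN nz_closed]
  have less_iff: "val_less value_order (val a) (Some c) \<longleftrightarrow> \<not> le x (a \<otimes> y)" if a: "a \<in> carrier R" for a
  proof (cases "a \<in> nz")
    case True
    have "val_less value_order (val a) (Some c) \<longleftrightarrow> le (a \<otimes> y) x \<and> \<not> (le (a \<otimes> y) x \<and> le x (a \<otimes> y))"
      using True xy cl a by (simp add: val_less_def val_def value_order_iff ratio_eq_iff nz_one)
    then show ?thesis using le_total[of x "a \<otimes> y"] a cl by auto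
  next
    case False
    have "le (a \<otimes> y) \<zero>" using False a cl le_mult_right[of a \<zero> y] by (auto simp: nz_def)
    then have "\<not> le x (a \<otimes> y)" using xy cl a le_trans[of x "a \<otimes> y" \<zero>] by (auto simp: nz_def)
    then show ?thesis using False by (simp add: val_less_def val_def)
  qed
  \<comment> \<open>The set is given by \<open>|a| < |x|/|y|\<close>. The number \<open>n\<close>
    makes \<open>w^n\<close> smaller than \<open>x\<close>, and \<open>j\<close> compensates the
    multiplication by \<open>y\<close>, so that any \<open>b\<close> in \<open>N (n + j)\<close>
    satisfies \<open>|b y| \<le> |w^n| < |x|\<close>.\<close>
  obtain n :: nat where n: "\<not> le x (w [^] n)" using cofinal xy by (auto simp: nz_def)
  obtain j :: nat where j: "w [^] j \<otimes> y \<in> B" using absorb cl by blast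
  have "\<not> le x ((a \<oplus> b) \<otimes> y)" if a: "a \<in> carrier R" "\<not> le x (a \<otimes> y)" and b: "b \<in> N (n + j)" for a b
  proof
    assume h: "le x ((a \<oplus> b) \<otimes> y)"
    have bc: "b \<in> carrier R" using b N_closed by auto
    have "y \<otimes> b \<in> N n" using N_mult_bounded[OF cl(2) j, of b n] b by simp
    then obtain d where d: "d \<in> B" "d \<in> carrier R" "y \<otimes> b = w [^] n \<otimes> d" by (rule N_E)
    have "le (b \<otimes> y) (w [^] n)"
      using le_mult_right[OF B_le_one[OF d(1)], of "w [^] n"] d cl bc by (simp add: m_comm)
    have eq: "(a \<oplus> b) \<otimes> y = a \<otimes> y \<oplus> b \<otimes> y" using a bc cl by (simp add: l_distr)
    show False
    proof (cases "le (a \<otimes> y) (b \<otimes> y)")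
      case True
      then have "le ((a \<oplus> b) \<otimes> y) (b \<otimes> y)" unfolding eq using a bc cl by (intro le_add le_refl) auto
      then have "le x (w [^] n)"
        using h \<open>le (b \<otimes> y) (w [^] n)\<close> a bc cl
        by (meson le_trans a_closed m_closed nat_pow_closed w_closed)
      then show False using n by simp
    next
      case False
      then have "le (b \<otimes> y) (a \<otimes> y)" using le_total[of "a \<otimes> y" "b \<otimes> y"] a bc cl by auto
      then have "le ((a \<oplus> b) \<otimes> y) (a \<otimes> y)" unfolding eq using a bc cl by (intro le_add le_refl) auto
      then have "le x (a \<otimes> y)" using h a bc cl by (meson le_trans a_closed m_closed)
      then show False using a by simp
    qed
  qed
  then show "lin_open R N {a \<in> carrier R. val_less value_order (val a) (Some c)}"
    unfolding lin_open_def using less_iff N_closed by (auto intro!: exI[of _ "n + j"])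
qed

lemma relation_in_spa:
  assumes "\<And>a. a \<in> Rp \<Longrightarrow> a \<in> carrier R \<and> le a \<one>"
  shows "{(a, b) \<in> carrier R \<times> carrier R. le a b} \<in> spa R N Rp"
proof -
  have "\<forall>a\<in>Rp. val_le value_order (val a) (Some \<one>\<^bsub>value_group\<^esub>)"
    using assms val_le_one_iff by blast
  then show ?thesis unfolding spa_def using val_continuous val_point_val by blast
qed

end

section \<open>Chevalley's extension theorem\<close>

text \<open>Values at \<open>x\<close> of polynomials of degree at most \<open>n\<close> over
  \<open>W\<close>. The degree bound carries the induction in Chevalley's theorem, and it lets
  \<open>x^(k+1) \<in> poly_vals R W x k\<close> express integrality of \<open>x\<close> over
  \<open>W\<close>.\<close>

primrec poly_vals :: "('a, 'm) ring_scheme \<Rightarrow> 'a set \<Rightarrow> 'a \<Rightarrow> nat \<Rightarrow> 'a set" where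
  "poly_vals R W x 0 = W"
| "poly_vals R W x (Suc n) = {w \<oplus>\<^bsub>R\<^esub> x \<otimes>\<^bsub>R\<^esub> y | w y. w \<in> W \<and> y \<in> poly_vals R W x n}"

declare poly_vals.simps(2) [simp del]

section \<open>Polynomial expressions in one element\<close>

locale subring_elem = cring R for R (structure) +
  fixes W x
  assumes subW: "subring W R" and x_closed [simp]: "x \<in> carrier R"
begin

lemmas W_sub = subringE(1)[OF subW]
lemmas W_zero = subringE(2)[OF subW]
lemmas W_one = subringE(3)[OF subW]
lemmas W_neg = subringE(5)[OF subW]
lemmas W_mult = subringE(6)[OF subW]
lemmas W_add = subringE(7)[OF subW]

lemma W_closed: "w \<in> W \<Longrightarrow> w \<in> carrier R" using W_sub by auto

abbreviation P where "P \<equiv> poly_vals R W x"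

lemma P_closed: "y \<in> P n \<Longrightarrow> y \<in> carrier R"
  by (induction n arbitrary: y) (auto simp: W_closed poly_vals.simps(2))

lemma P_SucI: "\<lbrakk>w \<in> W; y \<in> P n\<rbrakk> \<Longrightarrow> w \<oplus> x \<otimes> y \<in> P (Suc n)" by (auto simp: poly_vals.simps(2))

lemma P_SucE: assumes "z \<in> P (Suc n)"
  obtains w y where "w \<in> W" "y \<in> P n" "w \<in> carrier R" "y \<in> carrier R" "z = w \<oplus> x \<otimes> y"
  using assms W_closed P_closed by (auto simp: poly_vals.simps(2))

lemma P_add: "\<lbrakk>y \<in> P n; z \<in> P n\<rbrakk> \<Longrightarrow> y \<oplus> z \<in> P n"
proof (induction n arbitrary: y z)
  case (Suc n)
  obtain w y' where y: "w \<in> W" "y' \<in> P n" "w \<in> carrier R" "y' \<in> carrier R" "y = w \<oplus> x \<otimes> y'"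
    using Suc.prems(1) by (rule P_SucE)
  obtain v z' where z: "v \<in> W" "z' \<in> P n" "v \<in> carrier R" "z' \<in> carrier R" "z = v \<oplus> x \<otimes> z'"
    using Suc.prems(2) by (rule P_SucE)
  have "y \<oplus> z = (w \<oplus> v) \<oplus> x \<otimes> (y' \<oplus> z')" unfolding y z using y z x_closed by algebra
  then show ?case using P_SucI[of "w \<oplus> v" "y' \<oplus> z'" n] Suc.IH y z W_add by simp
qed (simp add: W_add)

lemma P_scale: "\<lbrakk>v \<in> W; y \<in> P n\<rbrakk> \<Longrightarrow> v \<otimes> y \<in> P n"
proof (induction n arbitrary: y)
  case (Suc n)
  obtain w y' where y: "w \<in> W" "y' \<in> P n" "w \<in> carrier R" "y' \<in> carrier R" "y = w \<oplus> x \<otimes> y'"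
    using Suc.prems(2) by (rule P_SucE)
  have "v \<otimes> y = v \<otimes> w \<oplus> x \<otimes> (v \<otimes> y')"
    unfolding y using y W_closed[OF Suc.prems(1)] x_closed by algebra
  then show ?case using P_SucI[of "v \<otimes> w" "v \<otimes> y'" n] Suc.IH Suc.prems y W_mult by simp
qed (simp add: W_mult)

lemma P_neg: assumes "y \<in> P n" shows "\<ominus> y \<in> P n"
proof -
  have "\<ominus> y = \<ominus> \<one> \<otimes> y" using P_closed[OF assms] by (simp add: l_minus)
  then show ?thesis using P_scale[OF W_neg[OF W_one] assms] by simp
qed

lemma W_P: "w \<in> W \<Longrightarrow> w \<in> P n"
proof (induction n)
  case (Suc n)
  have "\<zero> \<in> P n" for n by (induction n) (use W_zero P_SucI[OF W_zero] in fastforce)+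
  from P_SucI[OF Suc.prems this] show ?case using W_closed[OF Suc.prems] by simp
qed simp

lemma P_Suc: "y \<in> P n \<Longrightarrow> y \<in> P (Suc n)"
proof (induction n arbitrary: y)
  case 0
  then show ?case using W_P[of y "Suc 0"] by simp
next
  case (Suc n)
  obtain w y' where y: "w \<in> W" "y' \<in> P n" "w \<in> carrier R" "y' \<in> carrier R" "y = w \<oplus> x \<otimes> y'"
    using Suc.prems(1) by (rule P_SucE)
  then show ?case using P_SucI Suc.IH by blast
qed

lemma P_mono: "\<lbrakk>m \<le> n; y \<in> P m\<rbrakk> \<Longrightarrow> y \<in> P n"
  by (induction n rule: dec_induct) (auto intro: P_Suc)

lemma P_x: "y \<in> P n \<Longrightarrow> x \<otimes> y \<in> P (Suc n)"
  using P_SucI[OF W_zero, of y n] P_closed by simp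

lemma P_mult: "\<lbrakk>y \<in> P m; z \<in> P n\<rbrakk> \<Longrightarrow> y \<otimes> z \<in> P (m + n)"
proof (induction m arbitrary: y)
  case (Suc m)
  obtain w y' where y: "w \<in> W" "y' \<in> P m" "w \<in> carrier R" "y' \<in> carrier R" "y = w \<oplus> x \<otimes> y'"
    using Suc.prems(1) by (rule P_SucE)
  have "y \<otimes> z = w \<otimes> z \<oplus> x \<otimes> (y' \<otimes> z)"
    unfolding y using y P_closed[OF Suc.prems(2)] x_closed by algebra
  moreover have "w \<otimes> z \<in> P (Suc m + n)" using P_mono[of n "Suc m + n"] P_scale y Suc.prems by simp
  moreover have "x \<otimes> (y' \<otimes> z) \<in> P (Suc m + n)" using P_x Suc y by simp
  ultimately show ?case using P_add by simp
qed (simp add: P_scale)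

lemma P_pow: "x [^] n \<in> P n"
proof (induction n)
  case (Suc n)
  then show ?case using P_x[OF Suc] by (simp add: m_comm del: poly_vals.simps)
qed (simp add: W_one)

text \<open>The recursion exposes the constant term; this exposes the leading one.\<close>

lemma P_top: "z \<in> P (Suc n) \<Longrightarrow> \<exists>y\<in>P n. \<exists>w\<in>W. z = y \<oplus> w \<otimes> x [^] Suc n"
proof (induction n arbitrary: z)
  case 0
  then obtain w y where "w \<in> W" "y \<in> P 0" "w \<in> carrier R" "y \<in> carrier R" "z = w \<oplus> x \<otimes> y" by (rule P_SucE)
  then show ?case using m_comm[of x y] by (intro bexI[of _ w] bexI[of _ y]) auto
next
  case (Suc n)
  obtain w y where y: "w \<in> W" "y \<in> P (Suc n)" "w \<in> carrier R" "y \<in> carrier R" "z = w \<oplus> x \<otimes> y"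
    using Suc.prems(1) by (rule P_SucE)
  obtain y' v where v: "y' \<in> P n" "v \<in> W" "y = y' \<oplus> v \<otimes> x [^] Suc n" using Suc.IH[OF y(2)] by blast
  have "x [^] Suc n \<in> carrier R" by (rule nat_pow_closed) simp
  then have "z = (w \<oplus> x \<otimes> y') \<oplus> v \<otimes> (x [^] Suc n \<otimes> x)"
    unfolding y v using y(3) P_closed[OF v(1)] W_closed[OF v(2)] x_closed by algebra
  then have "z = (w \<oplus> x \<otimes> y') \<oplus> v \<otimes> x [^] Suc (Suc n)" by simp
  then show ?case using P_SucI[OF y(1) v(1)] v(2) by blast
qed

definition adj where "adj = (\<Union>n. P n)"

lemma adj_subring: "subring adj R"
proof (rule subringI)
  show "adj \<subseteq> carrier R" using P_closed by (auto simp: adj_def)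
  show "\<one> \<in> adj" using W_P[OF W_one, of 0] unfolding adj_def by blast
  show "\<ominus> h \<in> adj" if "h \<in> adj" for h using that P_neg by (auto simp: adj_def)
  fix h k assume "h \<in> adj" "k \<in> adj"
  then obtain m n where "h \<in> P m" "k \<in> P n" by (auto simp: adj_def)
  then show "h \<otimes> k \<in> adj" "h \<oplus> k \<in> adj"
    using P_mult[of h m k n] P_add[of h "max m n" k] P_mono[of m "max m n" h] P_mono[of n "max m n" k]
    unfolding adj_def by auto
qed

lemma W_adj: "w \<in> W \<Longrightarrow> w \<in> adj" using W_P[of w 0] unfolding adj_def by blast
lemma x_adj: "x \<in> adj" using P_pow[of 1] unfolding adj_def by auto

text \<open>Reversal of polynomials: here \<open>z = 1/x\<close>, and multiplying by
  \<open>x^n\<close> turns powers of \<open>1/x\<close> of degree at most \<open>n\<close> into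
  powers of \<open>x\<close>.\<close>

lemma P_reverse:
  assumes z: "z \<in> carrier R" "x \<otimes> z = \<one>"
  shows "\<lbrakk>m \<le> n; y \<in> poly_vals R W z m\<rbrakk> \<Longrightarrow> x [^] n \<otimes> y \<in> P n"
proof (induction m arbitrary: n y)
  case 0
  then show ?case using P_scale[OF _ P_pow, of y n] W_closed by (simp add: m_comm)
next
  case (Suc m)
  obtain n' where n: "n = Suc n'" using Suc.prems by (cases n) auto
  obtain w y' where y: "w \<in> W" "y' \<in> poly_vals R W z m" "y = w \<oplus> z \<otimes> y'" using Suc.prems by (auto simp: poly_vals.simps(2))
  interpret Z: subring_elem R W z by (intro subring_elem.intro subring_elem_axioms.intro is_cring subW z)
  have c: "w \<in> carrier R" "y' \<in> carrier R" "x [^] n' \<in> carrier R" using y W_closed Z.P_closed by auto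
  have "x [^] n \<otimes> y = w \<otimes> x [^] n \<oplus> (x [^] n' \<otimes> y') \<otimes> (x \<otimes> z)"
    unfolding y n nat_pow_Suc using c z(1) x_closed by algebra
  also have "\<dots> = w \<otimes> x [^] n \<oplus> x [^] n' \<otimes> y'" using c z by simp
  finally show ?case
    using P_add[OF P_scale[OF y(1) P_pow, of n] P_mono[of n' n]] Suc.IH[of n' y'] Suc.prems y n by simp
qed

end

text \<open>Lifts an integral equation for \<open>h x\<close> to \<open>R\<close>, coefficient by
  coefficient.\<close>

lemma (in ring_hom_cring) poly_vals_hom:
  assumes "C \<subseteq> carrier R" "x \<in> carrier R"
  shows "y \<in> poly_vals S (h ` C) (h x) n \<Longrightarrow> \<exists>z\<in>poly_vals R C x n \<inter> carrier R. y = h z"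
proof (induction n arbitrary: y)
  case 0
  then show ?case using assms by auto
next
  case (Suc n)
  then obtain c y' where c: "c \<in> C" "y' \<in> poly_vals S (h ` C) (h x) n" "y = h c \<oplus>\<^bsub>S\<^esub> h x \<otimes>\<^bsub>S\<^esub> y'" by (auto simp: poly_vals.simps(2))
  obtain z where z: "z \<in> poly_vals R C x n" "z \<in> carrier R" "y' = h z" using Suc.IH[OF c(2)] by blast
  have cc: "c \<in> carrier R" using c assms by auto
  have "y = h (c \<oplus> x \<otimes> z)" using c z assms cc by simp
  moreover have "c \<oplus> x \<otimes> z \<in> poly_vals R C x (Suc n)" using c z by (auto simp: poly_vals.simps(2))
  ultimately show ?case using cc z assms by (intro bexI[of _ "c \<oplus> x \<otimes> z"]) auto
qed

section \<open>Zorn's lemma for ideals and subrings\<close>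

lemma (in cring) exists_maximalideal:
  assumes "\<one> \<noteq> \<zero>"
  shows "\<exists>I. maximalideal I R"
proof -
  define Z where "Z = {I. ideal I R \<and> \<one> \<notin> I}"
  have ne: "Z \<noteq> {}" using zeroideal assms by (auto simp: Z_def)
  have "\<Union>Cc \<in> Z" if Cc: "Cc \<noteq> {}" "subset.chain Z Cc" for Cc
  proof -
    have id: "\<And>I. I \<in> Cc \<Longrightarrow> ideal I R \<and> \<one> \<notin> I" and ch: "\<And>I J. \<lbrakk>I \<in> Cc; J \<in> Cc\<rbrakk> \<Longrightarrow> I \<subseteq> J \<or> J \<subseteq> I"
      using Cc by (auto simp: subset.chain_def Z_def)
    have "ideal (\<Union>Cc) R"
    proof (rule idealI[OF ring_axioms])
      show "subgroup (\<Union>Cc) (add_monoid R)"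
      proof (rule add.subgroupI)
        show "\<Union>Cc \<subseteq> carrier R" using id by (meson UnionE ideal.Icarr subsetI)
        show "\<Union>Cc \<noteq> {}"
          using Cc(1) id additive_subgroup.zero_closed ideal.axioms(1) by blast
        show "\<ominus> a \<in> \<Union>Cc" if a: "a \<in> \<Union>Cc" for a
        proof -
          obtain I where I: "I \<in> Cc" "a \<in> I" using a by blast
          have "ideal I R" using id[OF I(1)] by simp
          then have "\<ominus> \<one> \<otimes> a \<in> I" "a \<in> carrier R" using ideal.I_l_closed[of I R a "\<ominus> \<one>"] ideal.Icarr I by auto
          then have "\<ominus> a \<in> I" by (simp add: l_minus)
          then show ?thesis using I(1) by blast
        qed
        show "a \<oplus> b \<in> \<Union>Cc" if ab: "a \<in> \<Union>Cc" "b \<in> \<Union>Cc" for a b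
        proof -
          obtain I J where IJ: "I \<in> Cc" "J \<in> Cc" "a \<in> I" "b \<in> J" using ab by blast
          then obtain Q where Q: "Q \<in> Cc" "a \<in> Q" "b \<in> Q" using ch[OF IJ(1,2)] by blast
          have iQ: "ideal Q R" using id[OF Q(1)] by simp
          have "a \<oplus> b \<in> Q" by (rule additive_subgroup.a_closed[OF ideal.axioms(1)[OF iQ] Q(2,3)])
          then show ?thesis using Q(1) by blast
        qed
      qed
      show "x \<otimes> a \<in> \<Union>Cc" if "a \<in> \<Union>Cc" "x \<in> carrier R" for a x
        using that id by (meson UnionE UnionI ideal.I_l_closed)
      show "a \<otimes> x \<in> \<Union>Cc" if "a \<in> \<Union>Cc" "x \<in> carrier R" for a x
        using that id by (meson UnionE UnionI ideal.I_r_closed)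
    qed
    then show ?thesis using id by (auto simp: Z_def)
  qed
  from subset_Zorn_nonempty[OF ne this] obtain I where I: "I \<in> Z" "\<And>J. \<lbrakk>J \<in> Z; I \<subseteq> J\<rbrakk> \<Longrightarrow> J = I" by blast
  have "maximalideal I R"
  proof (rule maximalidealI)
    show "ideal I R" using I by (simp add: Z_def)
    show "carrier R \<noteq> I" using I by (auto simp: Z_def)
    show "J = I \<or> J = carrier R" if J: "ideal J R" "I \<subseteq> J" "J \<subseteq> carrier R" for J
      using I(2)[of J] J ideal.one_imp_carrier[OF J(1)] by (auto simp: Z_def)
  qed
  then show ?thesis by blast
qed


lemma (in cring) Union_chain_subring:
  assumes "Cc \<noteq> {}" "\<And>I. I \<in> Cc \<Longrightarrow> subring I R" "\<And>I J. \<lbrakk>I \<in> Cc; J \<in> Cc\<rbrakk> \<Longrightarrow> I \<subseteq> J \<or> J \<subseteq> I"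
  shows "subring (\<Union>Cc) R"
proof (rule subringI)
  show "\<Union>Cc \<subseteq> carrier R" using assms(2) subringE(1) by blast
  obtain V where V: "V \<in> Cc" using assms(1) by blast
  then show "\<one> \<in> \<Union>Cc" using subringE(3)[OF assms(2)[OF V]] by blast
  show "\<ominus> h \<in> \<Union>Cc" if h: "h \<in> \<Union>Cc" for h
  proof -
    obtain I where I: "I \<in> Cc" "h \<in> I" using h by blast
    show ?thesis using subringE(5)[OF assms(2)[OF I(1)] I(2)] I(1) by blast
  qed
  fix a b assume ab: "a \<in> \<Union>Cc" "b \<in> \<Union>Cc"
  then obtain I J where IJ: "I \<in> Cc" "J \<in> Cc" "a \<in> I" "b \<in> J" by blast
  then obtain Q where Q: "Q \<in> Cc" "a \<in> Q" "b \<in> Q" using assms(3)[OF IJ(1,2)] by blast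
  show "a \<otimes> b \<in> \<Union>Cc" using subringE(6)[OF assms(2)[OF Q(1)] Q(2,3)] Q(1) by blast
  show "a \<oplus> b \<in> \<Union>Cc" using subringE(7)[OF assms(2)[OF Q(1)] Q(2,3)] Q(1) by blast
qed

text \<open>Here \<open>u = 1/F\<close>. As \<open>W\<close> avoids \<open>F\<close>, the element
  \<open>u\<close> is a nonunit of \<open>W\<close>; maximality will put it into the Jacobson
  radical of \<open>W\<close> and force \<open>W\<close> to be a valuation ring.\<close>

locale maximal_avoiding = field R for R (structure) +
  fixes W F u
  assumes subW: "subring W R"
    and u_W: "u \<in> W" and F_closed [simp]: "F \<in> carrier R" and Fu: "F \<otimes> u = \<one>"
    and F_notin: "F \<notin> W"
    and maximal: "\<lbrakk>subring V R; W \<subseteq> V; F \<notin> V\<rbrakk> \<Longrightarrow> V = W"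
begin

lemmas W_sub = subringE(1)[OF subW]
lemmas W_zero = subringE(2)[OF subW]
lemmas W_one = subringE(3)[OF subW]
lemmas W_neg = subringE(5)[OF subW]
lemmas W_mult = subringE(6)[OF subW]
lemmas W_add = subringE(7)[OF subW]

lemma W_closed: "w \<in> W \<Longrightarrow> w \<in> carrier R" using W_sub by auto

lemma u_closed [simp]: "u \<in> carrier R" using u_W W_closed by auto

lemma one_not_uW: assumes "w \<in> W" shows "u \<otimes> w \<noteq> \<one>"
proof
  assume "u \<otimes> w = \<one>"
  then have "F = F \<otimes> (u \<otimes> w)" by simp
  also have "\<dots> = w" using assms W_closed Fu by (simp add: m_assoc[symmetric])
  finally show False using F_notin assms by simp
qed

lemma W_diff: "\<lbrakk>a \<in> W; b \<in> W\<rbrakk> \<Longrightarrow> a \<ominus> b \<in> W" by (simp add: a_minus_def W_add W_neg)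

text \<open>\<open>V\<close> is the localization of \<open>W\<close> at the multiplicative set
  \<open>1 - uW\<close>. It still avoids \<open>F\<close>, because
  \<open>F (1 - u v) = F - v\<close> lies in \<open>W\<close> only if \<open>F\<close> does. So
  \<open>V = W\<close> by maximality, and \<open>1 - u w\<close> is invertible in
  \<open>W\<close>.\<close>

lemma one_minus_unit: assumes w: "w \<in> W" shows "\<exists>e\<in>W. e \<otimes> (\<one> \<ominus> u \<otimes> w) = \<one>"
proof -
  define V where "V = {y \<in> carrier R. \<exists>w\<in>W. y \<otimes> (\<one> \<ominus> u \<otimes> w) \<in> W}"
  have prod: "\<exists>w\<in>W. (\<one> \<ominus> u \<otimes> w1) \<otimes> (\<one> \<ominus> u \<otimes> w2) = \<one> \<ominus> u \<otimes> w" if "w1 \<in> W" "w2 \<in> W" for w1 w2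
  proof
    show "w1 \<oplus> w2 \<ominus> u \<otimes> (w1 \<otimes> w2) \<in> W" using that u_W by (simp add: W_diff W_add W_mult)
    show "(\<one> \<ominus> u \<otimes> w1) \<otimes> (\<one> \<ominus> u \<otimes> w2) = \<one> \<ominus> u \<otimes> (w1 \<oplus> w2 \<ominus> u \<otimes> (w1 \<otimes> w2))"
      using W_closed[OF that(1)] W_closed[OF that(2)] u_closed by algebra
  qed
  have mem: "\<one> \<ominus> u \<otimes> w \<in> W" if "w \<in> W" for w using that u_W by (simp add: W_diff W_one W_mult)
  have "subring V R"
  proof (rule subringI)
    show "V \<subseteq> carrier R" by (auto simp: V_def)
    show "\<one> \<in> V" unfolding V_def using mem[OF W_zero] W_zero by (auto intro!: bexI[of _ \<zero>])
    show "\<ominus> h \<in> V" if "h \<in> V" for h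
    proof -
      obtain w where "w \<in> W" "h \<otimes> (\<one> \<ominus> u \<otimes> w) \<in> W" "h \<in> carrier R" using \<open>h \<in> V\<close> by (auto simp: V_def)
      then show ?thesis unfolding V_def using W_neg[of "h \<otimes> (\<one> \<ominus> u \<otimes> w)"] W_closed[of w]
        by (auto simp: l_minus intro!: bexI[of _ w])
    qed
    fix h k assume "h \<in> V" "k \<in> V"
    obtain w1 where 1: "w1 \<in> W" "h \<otimes> (\<one> \<ominus> u \<otimes> w1) \<in> W" "h \<in> carrier R" using \<open>h \<in> V\<close> by (auto simp: V_def)
    obtain w2 where 2: "w2 \<in> W" "k \<otimes> (\<one> \<ominus> u \<otimes> w2) \<in> W" "k \<in> carrier R" using \<open>k \<in> V\<close> by (auto simp: V_def)
    define a b where "a = \<one> \<ominus> u \<otimes> w1" and "b = \<one> \<ominus> u \<otimes> w2"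
    have ab: "a \<in> W" "b \<in> W" "a \<in> carrier R" "b \<in> carrier R" "h \<otimes> a \<in> W" "k \<otimes> b \<in> W"
      using 1 2 mem W_closed unfolding a_def b_def by auto
    obtain w where w: "w \<in> W" "a \<otimes> b = \<one> \<ominus> u \<otimes> w" using prod[OF 1(1) 2(1)] unfolding a_def b_def by blast
    have "(h \<otimes> k) \<otimes> (a \<otimes> b) = (h \<otimes> a) \<otimes> (k \<otimes> b)" using 1(3) 2(3) ab(3,4) by algebra
    then have "(h \<otimes> k) \<otimes> (a \<otimes> b) \<in> W" using W_mult ab by simp
    then show "h \<otimes> k \<in> V" unfolding V_def using w 1 2 by (auto intro!: bexI[of _ w])
    have "(h \<oplus> k) \<otimes> (a \<otimes> b) = (h \<otimes> a) \<otimes> b \<oplus> (k \<otimes> b) \<otimes> a" using 1(3) 2(3) ab(3,4) by algebra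
    then have "(h \<oplus> k) \<otimes> (a \<otimes> b) \<in> W" using W_mult W_add ab by simp
    then show "h \<oplus> k \<in> V" unfolding V_def using w 1 2 by (auto intro!: bexI[of _ w])
  qed
  moreover have "W \<subseteq> V"
  proof
    fix y assume "y \<in> W"
    then show "y \<in> V" unfolding V_def using W_mult[OF _ mem[OF W_zero]] W_zero W_closed by blast
  qed
  moreover have "F \<notin> V"
  proof
    assume "F \<in> V"
    then obtain v where v: "v \<in> W" "F \<otimes> (\<one> \<ominus> u \<otimes> v) \<in> W" by (auto simp: V_def)
    have vc: "v \<in> carrier R" using v W_closed by auto
    have "F \<otimes> (\<one> \<ominus> u \<otimes> v) = F \<ominus> v"
      using vc by (simp add: a_minus_def r_distr r_minus m_assoc[symmetric] Fu)
    then have "F \<otimes> (\<one> \<ominus> u \<otimes> v) \<oplus> v = F" using vc by (simp add: a_minus_def a_assoc l_neg)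
    then show False using W_add[OF v(2,1)] F_notin by simp
  qed
  ultimately have V: "V = W" using maximal by blast
  define d where "d = \<one> \<ominus> u \<otimes> w"
  have d: "d \<in> carrier R" unfolding d_def using w W_closed by simp
  have "d \<noteq> \<zero>" unfolding d_def using one_not_uW[OF w] w W_closed by simp
  then have id: "inv d \<in> carrier R" "inv d \<otimes> d = \<one>" using d field_Units by auto
  have "inv d \<otimes> (\<one> \<ominus> u \<otimes> w) \<in> W" using id(2) W_one unfolding d_def by simp
  then have "inv d \<in> V" unfolding V_def using w id(1) by blast
  then show ?thesis using V id(2) unfolding d_def by auto
qed

text \<open>Chevalley's argument: \<open>\<one> = u \<otimes> f(\<one>/x)\<close> expresses \<open>x\<^sup>n\<close> through lower powers of \<open>x\<close>, which shortens
  \<open>\<one> = u \<otimes> g(x)\<close>.\<close>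

lemma reduce_degree:
  assumes x: "x \<in> carrier R" "z \<in> carrier R" "x \<otimes> z = \<one>"
    and n: "y \<in> poly_vals R W x (Suc n)" "u \<otimes> y = \<one>"
    and m: "y' \<in> poly_vals R W z (Suc m)" "u \<otimes> y' = \<one>" and mn: "m \<le> n"
  shows "\<exists>y\<in>poly_vals R W x n. u \<otimes> y = \<one>"
proof -
  interpret X: subring_elem R W x by (intro subring_elem.intro subring_elem_axioms.intro is_cring subW x)
  interpret Z: subring_elem R W z by (intro subring_elem.intro subring_elem_axioms.intro is_cring subW x)
  obtain w v where w: "w \<in> W" "v \<in> poly_vals R W z m" "w \<in> carrier R" "v \<in> carrier R" "y' = w \<oplus> z \<otimes> v"
    using m(1) by (rule Z.P_SucE)
  obtain e where e: "e \<in> W" "e \<otimes> (\<one> \<ominus> u \<otimes> w) = \<one>" using one_minus_unit[OF w(1)] by blast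
  have ec: "e \<in> carrier R" using e W_closed by auto
  have "\<one> \<ominus> u \<otimes> w = u \<otimes> y' \<ominus> u \<otimes> w" using m(2) by simp
  also have "\<dots> = u \<otimes> (z \<otimes> v)" unfolding w(5) using w(3,4) x(2) u_closed by algebra
  finally have "e \<otimes> (u \<otimes> (z \<otimes> v)) = \<one>" using e(2) by simp
  then have one: "u \<otimes> (z \<otimes> (e \<otimes> v)) = \<one>" using ec w(3,4) x by (simp add: m_lcomm)
  have ev: "e \<otimes> v \<in> poly_vals R W z m" "e \<otimes> v \<in> carrier R" using Z.P_scale[OF e(1) w(2)] ec w by auto
  have xn: "x [^] n \<in> carrier R" using x by simp
  define q where "q = x [^] n \<otimes> (e \<otimes> v)"
  have q: "q \<in> poly_vals R W x n" unfolding q_def by (rule X.P_reverse[OF x(2,3) mn ev(1)])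
  have "x [^] Suc n = x [^] Suc n \<otimes> (u \<otimes> (z \<otimes> (e \<otimes> v)))" unfolding one using x by simp
  also have "\<dots> = u \<otimes> ((x \<otimes> z) \<otimes> (x [^] n \<otimes> (e \<otimes> v)))"
    unfolding nat_pow_Suc using xn x(1,2) ev(2) u_closed by (simp add: m_assoc m_lcomm)
  also have "\<dots> = u \<otimes> q" using x(3) xn ev by (simp add: q_def)
  finally have xq: "x [^] Suc n = u \<otimes> q" .
  obtain r c where r: "r \<in> poly_vals R W x n" "c \<in> W" "y = r \<oplus> c \<otimes> x [^] Suc n" using X.P_top[OF n(1)] by blast
  have "c \<otimes> x [^] Suc n = (c \<otimes> u) \<otimes> q" unfolding xq using W_closed[OF r(2)] X.P_closed[OF q] by (simp add: m_assoc)
  then have "y \<in> poly_vals R W x n" using r q X.P_add[OF r(1)] X.P_scale[OF W_mult[OF r(2) u_W] q] by simp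
  then show ?thesis using n(2) by blast
qed

text \<open>The relation of larger degree is shortened by means of the other one until one of the
  two has degree zero, which contradicts \<open>u\<close> being a nonunit.\<close>

lemma no_common_relation:
  assumes x: "x \<in> carrier R" "z \<in> carrier R" "x \<otimes> z = \<one>"
  shows "\<lbrakk>y \<in> poly_vals R W x n; u \<otimes> y = \<one>; y' \<in> poly_vals R W z m; u \<otimes> y' = \<one>\<rbrakk> \<Longrightarrow> False"
proof (induction "n + m" arbitrary: n m y y' rule: less_induct)
  case less
  have "n \<noteq> 0" "m \<noteq> 0" using less.prems one_not_uW by (metis poly_vals.simps(1))+
  then obtain n' m' where nm: "n = Suc n'" "m = Suc m'" by (metis not0_implies_Suc)
  have zx: "z \<otimes> x = \<one>" using x m_comm by simp
  show False
  proof (cases "m' \<le> n'")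
    case True
    then show ?thesis
      using reduce_degree[OF x less.prems(1)[unfolded nm] less.prems(2) less.prems(3)[unfolded nm] less.prems(4)]
        less.hyps[of n' m] less.prems nm by auto
  next
    case False
    then show ?thesis
      using reduce_degree[OF x(2,1) zx less.prems(3)[unfolded nm] less.prems(4) less.prems(1)[unfolded nm] less.prems(2)]
        less.hyps[of n m'] less.prems nm by auto
  qed
qed

text \<open>By maximality \<open>W[x]\<close> contains \<open>F\<close>, and
  \<open>u F = 1\<close>.\<close>

lemma not_mem_relation: assumes "x \<in> carrier R" "x \<notin> W"
  shows "\<exists>n. \<exists>y\<in>poly_vals R W x n. u \<otimes> y = \<one>"
proof -
  interpret X: subring_elem R W x by (intro subring_elem.intro subring_elem_axioms.intro is_cring subW assms)
  have "F \<in> X.adj"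
    using maximal[OF X.adj_subring] X.W_adj X.x_adj assms by blast
  then show ?thesis using Fu m_comm[of u F] unfolding X.adj_def by auto
qed

lemma valuation_subring: assumes "x \<in> carrier R" "z \<in> carrier R" "x \<otimes> z = \<one>" shows "x \<in> W \<or> z \<in> W"
proof (rule ccontr)
  assume "\<not> (x \<in> W \<or> z \<in> W)"
  then have n: "x \<notin> W" "z \<notin> W" by auto
  obtain n y where 1: "y \<in> poly_vals R W x n" "u \<otimes> y = \<one>" using not_mem_relation[OF assms(1) n(1)] by blast
  obtain m y' where 2: "y' \<in> poly_vals R W z m" "u \<otimes> y' = \<one>" using not_mem_relation[OF assms(2) n(2)] by blast
  show False by (rule no_common_relation[OF assms 1 2])
qed

end

text \<open>Nonintegrality keeps \<open>F\<close> out of \<open>C[1/F]\<close>, since multiplying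
  \<open>F = f(1/F)\<close> by a power of \<open>F\<close> would give an integral equation.
  \<open>W\<close> is then a maximal subring that contains \<open>C[1/F]\<close> and avoids
  \<open>F\<close>.\<close>

lemma (in field) exists_valuation_subring:
  assumes C: "subring C R" and F: "F \<in> carrier R" and nonint: "\<And>k. F [^] Suc k \<notin> poly_vals R C F k"
  obtains W where "subring W R" "C \<subseteq> W" "F \<notin> W"
    "\<And>x z. \<lbrakk>x \<in> carrier R; z \<in> carrier R; x \<otimes> z = \<one>\<rbrakk> \<Longrightarrow> x \<in> W \<or> z \<in> W"
proof -
  have "F \<noteq> \<zero>" using nonint[of 0] subringE(2)[OF C] by auto
  then have u: "inv F \<in> carrier R" "F \<otimes> inv F = \<one>" using F field_Units by auto
  interpret U: subring_elem R C "inv F" by (intro subring_elem.intro subring_elem_axioms.intro is_cring C u)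
  interpret FF: subring_elem R C F by (intro subring_elem.intro subring_elem_axioms.intro is_cring C F)
  have FU: "F \<notin> U.adj"
  proof
    assume "F \<in> U.adj"
    then obtain k where "F \<in> poly_vals R C (inv F) k" by (auto simp: U.adj_def)
    then have "F [^] k \<otimes> F \<in> poly_vals R C F k" using FF.P_reverse[OF u] by blast
    then show False using nonint[of k] by simp
  qed
  define Z where "Z = {W. subring W R \<and> U.adj \<subseteq> W \<and> F \<notin> W}"
  have ne: "Z \<noteq> {}" using FU U.adj_subring by (auto simp: Z_def)
  have "\<Union>Cc \<in> Z" if Cc: "Cc \<noteq> {}" "subset.chain Z Cc" for Cc
  proof -
    have "subring (\<Union>Cc) R"
      using Cc by (intro Union_chain_subring) (auto simp: subset.chain_def Z_def)
    then show ?thesis using Cc by (auto simp: subset.chain_def Z_def)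
  qed
  from subset_Zorn_nonempty[OF ne this] obtain W where W: "W \<in> Z" "\<And>V. \<lbrakk>V \<in> Z; W \<subseteq> V\<rbrakk> \<Longrightarrow> V = W" by blast
  interpret M: maximal_avoiding R W F "inv F"
  proof (intro maximal_avoiding.intro maximal_avoiding_axioms.intro field_axioms F u(2))
    show "subring W R" "inv F \<in> W" "F \<notin> W" using W U.x_adj by (auto simp: Z_def)
    show "V = W" if "subring V R" "W \<subseteq> V" "F \<notin> V" for V
      using W that by (auto simp: Z_def)
  qed
  show thesis
  proof (rule that)
    show "C \<subseteq> W" using U.W_adj W by (auto simp: Z_def)
  qed (use M.subW M.F_notin M.valuation_subring in auto)
qed

text \<open>The field is a residue field of the localization at \<open>M\<close>: elements of
  \<open>M\<close> become units there and cannot vanish in a quotient. It provides the field that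
  Chevalley's theorem works in, since \<open>R\<close> may have zero divisors.\<close>

lemma (in cring) exists_field_hom:
  assumes "M \<subseteq> carrier R" "\<one> \<in> M" "\<And>s u. \<lbrakk>s \<in> M; u \<in> M\<rbrakk> \<Longrightarrow> s \<otimes> u \<in> M" "\<zero> \<notin> M"
  obtains L :: "'a loc set ring" and \<phi> where "field L" "ring_hom_cring R L \<phi>" "\<And>s. s \<in> M \<Longrightarrow> \<phi> s \<noteq> \<zero>\<^bsub>L\<^esub>"
proof -
  interpret localizing_set R M by (intro localizing_set.intro localizing_set_axioms.intro is_cring assms)
  define L1 where "L1 = localization R M"
  interpret L1: cring L1 unfolding L1_def by (rule localization_cring)
  have "\<one>\<^bsub>L1\<^esub> \<noteq> \<zero>\<^bsub>L1\<^esub>"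
    unfolding L1_def loc_one loc_zero using assms S_closed by (subst frac_eq_iff) auto
  then obtain I where I: "maximalideal I L1" using L1.exists_maximalideal by blast
  interpret I: maximalideal I L1 by (rule I)
  have fld: "field (L1 Quot I)" using I.quotient_is_field[OF L1.is_cring] .
  interpret LL: field "L1 Quot I" by (rule fld)
  define \<phi> where "\<phi> = (\<lambda>a. I +>\<^bsub>L1\<^esub> to_loc R M a)"
  have "(\<lambda>a. I +>\<^bsub>L1\<^esub> a) \<circ> to_loc R M \<in> ring_hom R (L1 Quot I)"
    using ring_hom_trans[OF to_loc_hom[folded L1_def] I.rcos_ring_hom] .
  then have hom: "\<phi> \<in> ring_hom R (L1 Quot I)" unfolding \<phi>_def comp_def .
  interpret \<phi>: ring_hom_cring R "L1 Quot I" \<phi>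
    by (intro ring_hom_cring.intro ring_hom_cring_axioms.intro is_cring LL.is_cring hom)
  have "\<phi> s \<noteq> \<zero>\<^bsub>L1 Quot I\<^esub>" if s: "s \<in> M" for s
  proof
    assume z: "\<phi> s = \<zero>\<^bsub>L1 Quot I\<^esub>"
    have "to_loc R M s \<in> Units L1" using to_loc_Units[OF s] by (simp add: L1_def)
    then obtain y where y: "y \<in> carrier L1" "to_loc R M s \<otimes>\<^bsub>L1\<^esub> y = \<one>\<^bsub>L1\<^esub>" "to_loc R M s \<in> carrier L1"
      unfolding Units_def by auto
    have "\<phi> s \<otimes>\<^bsub>L1 Quot I\<^esub> (I +>\<^bsub>L1\<^esub> y) = \<one>\<^bsub>L1 Quot I\<^esub>"
      unfolding \<phi>_def using ring_hom_mult[OF I.rcos_ring_hom y(3,1)] ring_hom_one[OF I.rcos_ring_hom] y(2) by simp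
    then show False using z ring_hom_closed[OF I.rcos_ring_hom y(1)] by simp
  qed
  then show thesis using that fld \<phi>.ring_hom_cring_axioms by blast
qed

text \<open>The monic expressions in \<open>F\<close> over \<open>C\<close> form a multiplicative set without \<open>\<zero>\<close>; in a residue field of
  the localization at this set, the image of \<open>F\<close> is still not integral.\<close>

lemma (in cring) exists_val_relation:
  assumes C: "subring C R" and F: "F \<in> carrier R" and nonint: "\<And>k. F [^] Suc k \<notin> poly_vals R C F k"
  obtains le where "val_relation R le" "\<And>c. c \<in> C \<Longrightarrow> le c \<one>" "\<not> le F \<one>"
proof -
  interpret FF: subring_elem R C F by (intro subring_elem.intro subring_elem_axioms.intro is_cring C F)
  define M where "M = insert \<one> (\<Union>k. {F [^] Suc k \<ominus> y | y. y \<in> poly_vals R C F k})"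
  have M0: "\<zero> \<notin> M"
  proof
    assume "\<zero> \<in> M"
    moreover have "\<zero> \<noteq> \<one>"
    proof
      assume z: "\<zero> = \<one>"
      have "F [^] Suc 0 = F \<otimes> \<one>" using F by simp
      also have "\<dots> = \<zero>" unfolding z[symmetric] using F by simp
      finally have "F [^] Suc 0 = \<zero>" .
      then show False using nonint[of 0] FF.W_zero by simp
    qed
    ultimately obtain k y where ky: "\<zero> = F [^] Suc k \<ominus> y" "y \<in> poly_vals R C F k" by (auto simp: M_def)
    have "F [^] Suc k \<in> carrier R" by (rule nat_pow_closed) (rule F)
    then have "F [^] Suc k = y" using ky FF.P_closed by (metis r_right_minus_eq)
    then show False using nonint[of k] ky(2) by simp
  qed
  have Mc: "M \<subseteq> carrier R" using F FF.P_closed by (auto simp: M_def)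
  have Mmult: "s \<otimes> u \<in> M" if "s \<in> M" "u \<in> M" for s u
  proof (cases "s = \<one> \<or> u = \<one>")
    case True then show ?thesis using that Mc by auto
  next
    case False
    then obtain k y where s: "s = F [^] Suc k \<ominus> y" "y \<in> poly_vals R C F k" using \<open>s \<in> M\<close> unfolding M_def by blast
    from False obtain l z where u: "u = F [^] Suc l \<ominus> z" "z \<in> poly_vals R C F l" using \<open>u \<in> M\<close> unfolding M_def by blast
    have c: "F [^] Suc k \<in> carrier R" "F [^] Suc l \<in> carrier R" "y \<in> carrier R" "z \<in> carrier R"
      using s u FF.P_closed nat_pow_closed[OF F] by blast+
    \<comment> \<open>The product is monic of degree \<open>k + l + 2\<close>, so its lower terms
      must be expressed with degree at most \<open>k + l + 1\<close>.\<close>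
    have p: "F [^] Suc k \<otimes> z \<in> poly_vals R C F (Suc (k + l))" "F [^] Suc l \<otimes> y \<in> poly_vals R C F (Suc (k + l))"
      using FF.P_mult[OF FF.P_pow[of "Suc k"] u(2)] FF.P_mult[OF FF.P_pow[of "Suc l"] s(2)] by (simp_all add: add.commute)
    have "y \<otimes> z \<in> poly_vals R C F (Suc (k + l))" using FF.P_Suc[OF FF.P_mult[OF s(2) u(2)]] .
    then have q: "F [^] Suc k \<otimes> z \<oplus> F [^] Suc l \<otimes> y \<oplus> \<ominus> (y \<otimes> z) \<in> poly_vals R C F (Suc (k + l))"
      using p by (intro FF.P_add FF.P_neg) auto
    have "s \<otimes> u = F [^] Suc k \<otimes> F [^] Suc l \<ominus> (F [^] Suc k \<otimes> z \<oplus> F [^] Suc l \<otimes> y \<oplus> \<ominus> (y \<otimes> z))"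
      unfolding s u using c by algebra
    also have "F [^] Suc k \<otimes> F [^] Suc l = F [^] Suc (Suc (k + l))" using F nat_pow_mult[of F "Suc k" "Suc l"] by simp
    finally show ?thesis using q unfolding M_def by blast
  qed
  have M1: "\<one> \<in> M" by (simp add: M_def)
  obtain L :: "'a loc set ring" and \<phi> where L: "field L" "ring_hom_cring R L \<phi>" "\<And>s. s \<in> M \<Longrightarrow> \<phi> s \<noteq> \<zero>\<^bsub>L\<^esub>"
    using exists_field_hom[OF Mc M1 Mmult M0] by blast
  interpret L: field L by (rule L(1))
  interpret \<phi>: ring_hom_cring R L \<phi> by (rule L(2))
  have subC: "subring (\<phi> ` C) L"
    using ring_hom_ring.img_is_subring[OF ring_hom_ringI2[OF ring_axioms L.ring_axioms \<phi>.homh] C] .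
  have nonint': "\<phi> F [^]\<^bsub>L\<^esub> Suc k \<notin> poly_vals L (\<phi> ` C) (\<phi> F) k" for k
  proof
    assume "\<phi> F [^]\<^bsub>L\<^esub> Suc k \<in> poly_vals L (\<phi> ` C) (\<phi> F) k"
    then obtain z where z: "z \<in> poly_vals R C F k" "z \<in> carrier R" "\<phi> F [^]\<^bsub>L\<^esub> Suc k = \<phi> z"
      using \<phi>.poly_vals_hom[OF FF.W_sub F] by blast
    have Fk: "F [^] Suc k \<in> carrier R" by (rule nat_pow_closed) (rule F)
    have "\<phi> (F [^] Suc k) = \<phi> z" unfolding z(3)[symmetric] using \<phi>.hom_pow[OF F, of "Suc k"] by simp
    then have "\<phi> (F [^] Suc k \<ominus> z) = \<zero>\<^bsub>L\<^esub>" using Fk z(2) by (simp only: a_minus_def \<phi>.hom_add \<phi>.hom_a_inv a_inv_closed L.r_neg \<phi>.hom_closed)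
    moreover have "F [^] Suc k \<ominus> z \<in> M" using z unfolding M_def by blast
    ultimately show False using L(3) by blast
  qed
  obtain W where W: "subring W L" "\<phi> ` C \<subseteq> W" "\<phi> F \<notin> W"
    "\<And>x z. \<lbrakk>x \<in> carrier L; z \<in> carrier L; x \<otimes>\<^bsub>L\<^esub> z = \<one>\<^bsub>L\<^esub>\<rbrakk> \<Longrightarrow> x \<in> W \<or> z \<in> W"
    using L.exists_valuation_subring[OF subC \<phi>.hom_closed[OF F] nonint'] by blast
  \<comment> \<open>The valuation of the valuation ring \<open>W\<close>, pulled back along \<phi>;
    the kernel of \<phi> receives the value zero.\<close>
  define le where "le = (\<lambda>a b. \<exists>w\<in>W. \<phi> a = w \<otimes>\<^bsub>L\<^esub> \<phi> b)"
  have Wc: "w \<in> carrier L" if "w \<in> W" for w using that subringE(1)[OF W(1)] by auto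
  have "val_relation R le"
  proof
    fix a b assume ab: "a \<in> carrier R" "b \<in> carrier R"
    show "le a b \<or> le b a"
    proof (cases "\<phi> a = \<zero>\<^bsub>L\<^esub> \<or> \<phi> b = \<zero>\<^bsub>L\<^esub>")
      case True
      have "\<zero>\<^bsub>L\<^esub> \<in> W" by (rule subringE(2)[OF W(1)])
      moreover have "\<zero>\<^bsub>L\<^esub> \<otimes>\<^bsub>L\<^esub> \<phi> a = \<zero>\<^bsub>L\<^esub>" "\<zero>\<^bsub>L\<^esub> \<otimes>\<^bsub>L\<^esub> \<phi> b = \<zero>\<^bsub>L\<^esub>" using ab by simp_all
      ultimately show ?thesis using True unfolding le_def by metis
    next
      case False
      define x z where "x = \<phi> a \<otimes>\<^bsub>L\<^esub> inv\<^bsub>L\<^esub> \<phi> b" and "z = \<phi> b \<otimes>\<^bsub>L\<^esub> inv\<^bsub>L\<^esub> \<phi> a"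
      have u: "\<phi> a \<in> Units L" "\<phi> b \<in> Units L" using False ab L.field_Units by auto
      have xz: "x \<in> carrier L" "z \<in> carrier L" using u ab by (auto simp: x_def z_def)
      have e: "\<phi> a = x \<otimes>\<^bsub>L\<^esub> \<phi> b" "\<phi> b = z \<otimes>\<^bsub>L\<^esub> \<phi> a"
        using u ab by (simp_all add: x_def z_def L.m_assoc)
      have "(c \<otimes>\<^bsub>L\<^esub> d) \<otimes>\<^bsub>L\<^esub> (e \<otimes>\<^bsub>L\<^esub> f) = (c \<otimes>\<^bsub>L\<^esub> f) \<otimes>\<^bsub>L\<^esub> (e \<otimes>\<^bsub>L\<^esub> d)"
        if "c \<in> carrier L" "d \<in> carrier L" "e \<in> carrier L" "f \<in> carrier L" for c d e f
        using that by (simp add: L.m_ac)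
      then have "x \<otimes>\<^bsub>L\<^esub> z = (\<phi> a \<otimes>\<^bsub>L\<^esub> inv\<^bsub>L\<^esub> \<phi> a) \<otimes>\<^bsub>L\<^esub> (\<phi> b \<otimes>\<^bsub>L\<^esub> inv\<^bsub>L\<^esub> \<phi> b)"
        unfolding x_def z_def using u ab by simp
      then have "x \<otimes>\<^bsub>L\<^esub> z = \<one>\<^bsub>L\<^esub>" using u by simp
      then show ?thesis unfolding le_def using W(4)[OF xz] e by blast
    qed
  next
    fix a b c assume h: "le a b" "le b c" "a \<in> carrier R" "b \<in> carrier R" "c \<in> carrier R"
    then obtain w v where "w \<in> W" "v \<in> W" "\<phi> a = w \<otimes>\<^bsub>L\<^esub> \<phi> b" "\<phi> b = v \<otimes>\<^bsub>L\<^esub> \<phi> c" by (auto simp: le_def)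
    then show "le a c" unfolding le_def using h Wc subringE(6)[OF W(1), of w v]
      by (intro bexI[of _ "w \<otimes>\<^bsub>L\<^esub> v"]) (auto simp: L.m_assoc)
  next
    fix a b c assume h: "le a c" "le b c" "a \<in> carrier R" "b \<in> carrier R" "c \<in> carrier R"
    then obtain w v where "w \<in> W" "v \<in> W" "\<phi> a = w \<otimes>\<^bsub>L\<^esub> \<phi> c" "\<phi> b = v \<otimes>\<^bsub>L\<^esub> \<phi> c" by (auto simp: le_def)
    then show "le (a \<oplus> b) c" unfolding le_def using h Wc subringE(7)[OF W(1), of w v]
      by (intro bexI[of _ "w \<oplus>\<^bsub>L\<^esub> v"]) (auto simp: L.l_distr)
  next
    fix a b c assume h: "le a b" "a \<in> carrier R" "b \<in> carrier R" "c \<in> carrier R"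
    then obtain w where "w \<in> W" "\<phi> a = w \<otimes>\<^bsub>L\<^esub> \<phi> b" by (auto simp: le_def)
    then show "le (a \<otimes> c) (b \<otimes> c)" unfolding le_def using h Wc
      by (intro bexI[of _ w]) (auto simp: L.m_assoc)
  next
    fix a b c assume h: "le (a \<otimes> c) (b \<otimes> c)" "\<not> le c \<zero>" "a \<in> carrier R" "b \<in> carrier R" "c \<in> carrier R"
    then obtain w where w: "w \<in> W" "\<phi> a \<otimes>\<^bsub>L\<^esub> \<phi> c = w \<otimes>\<^bsub>L\<^esub> (\<phi> b \<otimes>\<^bsub>L\<^esub> \<phi> c)" by (auto simp: le_def)
    have "\<phi> c \<noteq> \<zero>\<^bsub>L\<^esub>" using h(2) subringE(2)[OF W(1)] unfolding le_def by (auto intro: bexI[of _ "\<zero>\<^bsub>L\<^esub>"])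
    moreover have "\<phi> a \<otimes>\<^bsub>L\<^esub> \<phi> c = (w \<otimes>\<^bsub>L\<^esub> \<phi> b) \<otimes>\<^bsub>L\<^esub> \<phi> c" using w h Wc by (simp add: L.m_assoc)
    ultimately have "\<phi> a = w \<otimes>\<^bsub>L\<^esub> \<phi> b" using L.m_rcancel[of "\<phi> c" "\<phi> a" "w \<otimes>\<^bsub>L\<^esub> \<phi> b"] h Wc w by auto
    then show "le a b" unfolding le_def using w by blast
  next
    show "\<not> le \<one> \<zero>" unfolding le_def using Wc by auto
  qed
  moreover have "le c \<one>" if "c \<in> C" for c
    unfolding le_def using that W(2) FF.W_closed by (intro bexI[of _ "\<phi> c"]) auto
  moreover have "\<not> le F \<one>" unfolding le_def using W(3) Wc by auto
  ultimately show thesis using that by blast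
qed

text \<open>The relation given by Chevalley's theorem need not be continuous; restricting the value group to the convex
  subgroup generated by the value of \<open>w\<close> makes it so.\<close>

lemma (in adic_ring) exists_adic_val_relation:
  assumes F: "F \<in> carrier R" and nonint: "\<And>k. F [^] Suc k \<notin> poly_vals R B F k"
  obtains le where "adic_val_relation R B w le" "\<not> le F \<one>"
proof -
  obtain le where le: "val_relation R le" "\<And>c. c \<in> B \<Longrightarrow> le c \<one>" "\<not> le F \<one>"
    using exists_val_relation[OF subB F nonint] by blast
  interpret V: val_relation R le by (rule le(1))
  \<comment> \<open>Elements below all powers of \<open>w\<close> are given the value zero, which is
    what restriction to the convex subgroup means for the relation. No value is too large for the
    subgroup, because \<open>absorb\<close> bounds every element by a power of
    \<open>1/w\<close>.\<close>
  define le' where "le' = (\<lambda>a b. le a b \<or> (\<forall>n::nat. le a (w [^] n)))"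
  have wp: "w [^] n \<in> carrier R" for n :: nat by simp
  have wne: "\<not> le (w [^] n) \<zero>" for n :: nat
  proof
    assume h: "le (w [^] n) \<zero>"
    have wu: "w [^] n \<in> Units R" using w_unit Units_pow_closed by auto
    have "le (w [^] n \<otimes> inv (w [^] n)) (\<zero> \<otimes> inv (w [^] n))" using h wu by (intro V.le_mult_right) auto
    then show False using wu V.not_one_le_zero by simp
  qed
  have trans: "le a c" if "le a b" "le b c" "a \<in> carrier R" "b \<in> carrier R" "c \<in> carrier R" for a b c
    using V.le_trans that by blast
  obtain i :: nat where i: "w [^] i \<otimes> F \<in> B" using absorb F by blast
  have V': "val_relation R le'"
  proof
    fix a b assume "a \<in> carrier R" "b \<in> carrier R"
    then show "le' a b \<or> le' b a" using V.le_total by (auto simp: le'_def)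
  next
    fix a b c assume h: "le' a b" "le' b c" "a \<in> carrier R" "b \<in> carrier R" "c \<in> carrier R"
    then show "le' a c" unfolding le'_def using trans wp by blast
  next
    fix a b c assume h: "le' a c" "le' b c" "a \<in> carrier R" "b \<in> carrier R" "c \<in> carrier R"
    show "le' (a \<oplus> b) c"
    proof (cases "\<forall>n::nat. le c (w [^] n)")
      case True
      then have "le a (w [^] n)" "le b (w [^] n)" for n :: nat using h trans wp unfolding le'_def by blast+
      then show ?thesis unfolding le'_def using V.le_add h wp by blast
    next
      case False
      then obtain n :: nat where "le (w [^] n) c" using V.le_total h wp by blast
      then have "le a c" "le b c" using h trans wp unfolding le'_def by blast+
      then show ?thesis unfolding le'_def using V.le_add h by blast
    qed
  next
    fix a b c assume h: "le' a b" "a \<in> carrier R" "b \<in> carrier R" "c \<in> carrier R"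
    show "le' (a \<otimes> c) (b \<otimes> c)"
    proof (cases "le a b")
      case True then show ?thesis using V.le_mult_right h unfolding le'_def by blast
    next
      case False
      then have all: "le a (w [^] n)" for n :: nat using h unfolding le'_def by blast
      obtain j :: nat where j: "w [^] j \<otimes> c \<in> B" using absorb h by blast
      have "le (a \<otimes> c) (w [^] n)" for n :: nat
      proof -
        have "le (a \<otimes> c) (w [^] (n + j) \<otimes> c)" using V.le_mult_right[OF all] h wp by blast
        moreover have "w [^] (n + j) \<otimes> c = (w [^] j \<otimes> c) \<otimes> w [^] n"
          using h(4) by (simp add: nat_pow_mult[symmetric] m_assoc m_comm m_lcomm)
        moreover have "le ((w [^] j \<otimes> c) \<otimes> w [^] n) (w [^] n)"
          using V.le_mult_right[OF le(2)[OF j], of "w [^] n"] h by simp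
        ultimately show ?thesis using trans[of "a \<otimes> c" "(w [^] j \<otimes> c) \<otimes> w [^] n" "w [^] n"] h by simp
      qed
      then show ?thesis unfolding le'_def by blast
    qed
  next
    fix a b c assume h: "le' (a \<otimes> c) (b \<otimes> c)" "\<not> le' c \<zero>" "a \<in> carrier R" "b \<in> carrier R" "c \<in> carrier R"
    obtain j :: nat where j: "le (w [^] j) c" using h(2) V.le_total h(5) wp unfolding le'_def by blast
    show "le' a b"
    proof (cases "le (a \<otimes> c) (b \<otimes> c)")
      case True then show ?thesis using V.le_cancel h unfolding le'_def by blast
    next
      case False
      have "le a (w [^] n)" for n :: nat
      proof -
        have "le (a \<otimes> w [^] j) (a \<otimes> c)" using V.le_mult_right[OF j, of a] h by (simp add: m_comm)
        moreover have "le (a \<otimes> c) (w [^] n \<otimes> w [^] j)" using False h unfolding le'_def by (simp add: nat_pow_mult)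
        ultimately have "le (a \<otimes> w [^] j) (w [^] n \<otimes> w [^] j)" using trans[of "a \<otimes> w [^] j" "a \<otimes> c"] h by simp
        then show ?thesis using V.le_cancel wne h wp by blast
      qed
      then show ?thesis unfolding le'_def by blast
    qed
  next
    show "\<not> le' \<one> \<zero>"
    proof
      assume "le' \<one> \<zero>"
      \<comment> \<open>Since \<open>w^i F\<close> lies in \<open>B\<close>, a value of
        \<open>w^i\<close> of at least 1 would force \<open>|F| \<le> 1\<close>.\<close>
      then have "le \<one> (w [^] i)" using V.not_one_le_zero unfolding le'_def by blast
      then have "le F (w [^] i \<otimes> F)" using V.le_mult_right[of \<one> "w [^] i" F] F by simp
      then show False using le(3) le(2)[OF i] trans F by simp
    qed
  qed
  have "adic_val_relation R B w le'"
  proof (intro adic_val_relation.intro adic_val_relation_axioms.intro V' adic_ring_axioms)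
    show "le' b \<one>" if "b \<in> B" for b using le(2)[OF that] by (simp add: le'_def)
    fix x assume x: "x \<in> carrier R" "\<not> le' x \<zero>"
    then obtain n :: nat where "\<not> le x (w [^] n)" unfolding le'_def by blast
    then show "\<exists>n::nat. \<not> le' x (w [^] n)" unfolding le'_def by blast
  qed
  moreover have "\<not> le' F \<one>"
  proof
    assume "le' F \<one>"
    then have "le F (w [^] (0::nat))" using le(3) unfolding le'_def by blast
    then show False using le(3) by simp
  qed
  ultimately show thesis using that by blast
qed

section \<open>The Frobenius on polynomial expressions\<close>

text \<open>The value of a polynomial with its coefficients kept as a function.
  \<open>poly_vals\<close> forgets them, but the Frobenius argument raises the coefficients to
  \<open>p\<close>-th powers one by one.\<close>

primrec horner :: "('a, 'm) ring_scheme \<Rightarrow> (nat \<Rightarrow> 'a) \<Rightarrow> 'a \<Rightarrow> nat \<Rightarrow> 'a" where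
  "horner R a x 0 = a 0"
| "horner R a x (Suc n) = a 0 \<oplus>\<^bsub>R\<^esub> x \<otimes>\<^bsub>R\<^esub> horner R (\<lambda>i. a (Suc i)) x n"

context cring
begin

section \<open>Polynomial expressions with chosen coefficients\<close>

abbreviation hn where "hn \<equiv> horner R"

lemma horner_closed [simp]: "\<lbrakk>\<And>i. a i \<in> carrier R; x \<in> carrier R\<rbrakk> \<Longrightarrow> hn a x n \<in> carrier R"
  by (induction n arbitrary: a) auto

lemma horner_add:
  "\<lbrakk>\<And>i. a i \<in> carrier R; \<And>i. b i \<in> carrier R; x \<in> carrier R\<rbrakk> \<Longrightarrow>
    hn (\<lambda>i. a i \<oplus> b i) x n = hn a x n \<oplus> hn b x n"
proof (induction n arbitrary: a b)
  case (Suc n)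
  have c: "a 0 \<in> carrier R" "b 0 \<in> carrier R" "hn (\<lambda>i. a (Suc i)) x n \<in> carrier R" "hn (\<lambda>i. b (Suc i)) x n \<in> carrier R"
    using Suc.prems by auto
  show ?case using Suc.IH[of "\<lambda>i. a (Suc i)" "\<lambda>i. b (Suc i)"] Suc.prems c by (simp add: r_distr a_ac)
qed simp

lemma horner_scale:
  "\<lbrakk>\<And>i. a i \<in> carrier R; c \<in> carrier R; x \<in> carrier R\<rbrakk> \<Longrightarrow> hn (\<lambda>i. c \<otimes> a i) x n = c \<otimes> hn a x n"
proof (induction n arbitrary: a)
  case (Suc n)
  then show ?case using Suc.IH[of "\<lambda>i. a (Suc i)"] by (simp add: r_distr m_lcomm)
qed simp

lemma horner_diff:
  assumes "\<And>i. a i \<in> carrier R" "\<And>i. b i \<in> carrier R" "x \<in> carrier R"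
  shows "hn (\<lambda>i. a i \<ominus> b i) x n = hn a x n \<ominus> hn b x n"
proof -
  have "hn (\<lambda>i. a i \<oplus> \<ominus> \<one> \<otimes> b i) x n = hn a x n \<oplus> \<ominus> \<one> \<otimes> hn b x n"
    using horner_add[of a "\<lambda>i. \<ominus> \<one> \<otimes> b i"] horner_scale[of b "\<ominus> \<one>"] assms by simp
  then show ?thesis using assms by (simp add: l_minus a_minus_def)
qed

lemma horner_cong: "(\<And>i. i \<le> n \<Longrightarrow> a i = b i) \<Longrightarrow> hn a x n = hn b x n"
proof (induction n arbitrary: a b)
  case (Suc n)
  have "hn (\<lambda>i. a (Suc i)) x n = hn (\<lambda>i. b (Suc i)) x n" by (rule Suc.IH) (simp add: Suc.prems)
  then show ?case using Suc.prems[of 0] by simp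
qed simp

lemma horner_zero: "x \<in> carrier R \<Longrightarrow> hn (\<lambda>i. \<zero>) x n = \<zero>"
  by (induction n) auto

text \<open>Brings expressions of different lengths to a common length so that they can be
  subtracted coefficientwise.\<close>

lemma horner_pad:
  "\<lbrakk>\<And>i. a i \<in> carrier R; x \<in> carrier R; n \<le> m\<rbrakk> \<Longrightarrow> hn (\<lambda>i. if i \<le> n then a i else \<zero>) x m = hn a x n"
proof (induction n arbitrary: a m)
  case 0
  then show ?case by (cases m) (simp_all add: horner_zero)
next
  case (Suc n)
  then obtain k where m: "m = Suc k" by (cases m) auto
  show ?case unfolding m using Suc.IH[of "\<lambda>i. a (Suc i)" k] Suc.prems m by simp
qed

text \<open>The witness \<open>b\<close> is \<open>a\<close> interleaved with zeros.\<close>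

lemma horner_spread:
  assumes p: "(p::nat) > 0" and W: "subring W R"
  shows "(\<And>i. a i \<in> W) \<Longrightarrow> \<exists>b m. (\<forall>i. b i \<in> W) \<and> (\<forall>x\<in>carrier R. hn a (x [^] p) n = hn b x m \<and>
           hn (\<lambda>i. a i [^] p) (x [^] p) n = hn (\<lambda>i. b i [^] p) x m)"
proof (induction n arbitrary: a)
  case 0
  then show ?case by (intro exI[of _ a] exI[of _ "0::nat"]) auto
next
  case (Suc n)
  have Wc: "w \<in> carrier R" if "w \<in> W" for w using that subringE(1)[OF W] by auto
  obtain b m where b: "\<And>i. b i \<in> W" and e: "\<And>x. x \<in> carrier R \<Longrightarrow> hn (\<lambda>i. a (Suc i)) (x [^] p) n = hn b x m"
    "\<And>x. x \<in> carrier R \<Longrightarrow> hn (\<lambda>i. a (Suc i) [^] p) (x [^] p) n = hn (\<lambda>i. b i [^] p) x m"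
    using Suc.IH[of "\<lambda>i. a (Suc i)"] Suc.prems by blast
  \<comment> \<open>\<open>s k\<close> puts \<open>k\<close> zeros in front of \<open>b\<close>,
    which multiplies the value by \<open>x^k\<close>. With \<open>k = p - 1\<close> zeros after
    \<open>a 0\<close>, the next coefficient of \<open>a\<close> lands in degree
    \<open>p\<close>.\<close>
  define s where "s k = ((case_nat \<zero>) ^^ k) b" for k :: nat
  have s: "s k i \<in> W" for k i
    by (induction k arbitrary: i) (auto simp: s_def b subringE(2)[OF W] split: nat.split)
  have sx: "hn (s k) x (k + m) = x [^] k \<otimes> hn b x m"
    "hn (\<lambda>i. s k i [^] p) x (k + m) = x [^] k \<otimes> hn (\<lambda>i. b i [^] p) x m" if x: "x \<in> carrier R" for k x
  proof (induction k)
    case 0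
    have "hn b x m \<in> carrier R" "hn (\<lambda>i. b i [^] p) x m \<in> carrier R" using x Wc[OF b] by auto
    then show "hn (s 0) x (0 + m) = x [^] (0::nat) \<otimes> hn b x m"
      "hn (\<lambda>i. s 0 i [^] p) x (0 + m) = x [^] (0::nat) \<otimes> hn (\<lambda>i. b i [^] p) x m"
      by (simp_all add: s_def)
  next
    case (Suc k)
    have c: "hn b x m \<in> carrier R" "hn (\<lambda>i. b i [^] p) x m \<in> carrier R" using x Wc[OF b] by auto
    have "\<zero> [^] p = \<zero>" using p by (simp add: nat_pow_zero)
    moreover have "s (Suc k) 0 = \<zero>" "s (Suc k) (Suc i) = s k i" for i by (simp_all add: s_def)
    moreover have "x \<otimes> hn (s k) x (k + m) \<in> carrier R" "x \<otimes> hn (\<lambda>i. s k i [^] p) x (k + m) \<in> carrier R"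
      using x s Wc by auto
    ultimately show "hn (s (Suc k)) x (Suc k + m) = x [^] Suc k \<otimes> hn b x m"
      "hn (\<lambda>i. s (Suc k) i [^] p) x (Suc k + m) = x [^] Suc k \<otimes> hn (\<lambda>i. b i [^] p) x m"
      using Suc x c by (simp_all add: m_assoc m_lcomm)
  qed
  obtain p' where p': "p = Suc p'" using p by (cases p) auto
  define d where "d = case_nat (a 0) (s p')"
  have d: "d i \<in> W" for i using s Suc.prems by (auto simp: d_def split: nat.split)
  have "hn a (x [^] p) (Suc n) = hn d x (Suc (p' + m)) \<and>
    hn (\<lambda>i. a i [^] p) (x [^] p) (Suc n) = hn (\<lambda>i. d i [^] p) x (Suc (p' + m))" if x: "x \<in> carrier R" for x
  proof -
    have c: "hn b x m \<in> carrier R" "hn (\<lambda>i. b i [^] p) x m \<in> carrier R" using x Wc[OF b] by auto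
    have xp: "x [^] p = x \<otimes> x [^] p'" using x unfolding p' by (simp add: m_comm)
    show ?thesis
      using x c e[OF x] sx[OF x, of p'] by (simp add: d_def) (simp add: xp m_assoc)
  qed
  then show ?case using d by (intro exI[of _ d] exI[of _ "Suc (p' + m)"]) auto
qed

lemma poly_vals_horner:
  assumes "\<And>i. a i \<in> W" shows "hn a x n \<in> poly_vals R W x n"
  using assms
proof (induction n arbitrary: a)
  case (Suc n)
  have "hn (\<lambda>i. a (Suc i)) x n \<in> poly_vals R W x n" by (rule Suc.IH) (rule Suc.prems)
  then show ?case using Suc.prems[of 0] unfolding poly_vals.simps(2) horner.simps(2) by blast
qed simp

lemma horner_poly_vals: "y \<in> poly_vals R W x n \<Longrightarrow> W \<noteq> {} \<Longrightarrow> \<exists>a. (\<forall>i. a i \<in> W) \<and> y = hn a x n"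
proof (induction n arbitrary: y)
  case 0
  then show ?case by (intro exI[of _ "\<lambda>i. y"]) auto
next
  case (Suc n)
  then obtain w z where "w \<in> W" "z \<in> poly_vals R W x n" "y = w \<oplus> x \<otimes> z" by (auto simp: poly_vals.simps(2))
  moreover then obtain a where "\<forall>i. a i \<in> W" "z = hn a x n" using Suc by blast
  ultimately show ?case by (intro exI[of _ "case_nat w a"]) (auto split: nat.split)
qed

text \<open>The form \<open>sum_k f k x^k y^(n-k)\<close> with natural coefficients; the binomial
  theorem becomes Pascal's rule for \<open>f\<close>, and truncations in \<open>n\<close> can be
  handled by induction.\<close>

primrec bin_form :: "(nat \<Rightarrow> nat) \<Rightarrow> 'a \<Rightarrow> 'a \<Rightarrow> nat \<Rightarrow> 'a" where
  "bin_form f x y 0 = [f 0] \<cdot> \<one>"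
| "bin_form f x y (Suc n) = y \<otimes> bin_form f x y n \<oplus> [f (Suc n)] \<cdot> (x [^] Suc n)"

lemma bin_form_closed [simp]: "\<lbrakk>x \<in> carrier R; y \<in> carrier R\<rbrakk> \<Longrightarrow> bin_form f x y n \<in> carrier R"
  by (induction n) auto

lemma bin_form_add: "\<lbrakk>x \<in> carrier R; y \<in> carrier R\<rbrakk> \<Longrightarrow>
    bin_form (\<lambda>k. f k + g k) x y n = bin_form f x y n \<oplus> bin_form g x y n"
proof (induction n)
  case 0
  then show ?case by (simp add: add.nat_pow_mult)
next
  case (Suc n)
  have "[(f (Suc n) + g (Suc n))] \<cdot> (x [^] Suc n) = [f (Suc n)] \<cdot> (x [^] Suc n) \<oplus> [g (Suc n)] \<cdot> (x [^] Suc n)"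
    using Suc.prems by (simp add: add.nat_pow_mult)
  then show ?case using Suc by (simp add: r_distr a_ac)
qed

lemma bin_form_x: "\<lbrakk>x \<in> carrier R; y \<in> carrier R\<rbrakk> \<Longrightarrow>
    x \<otimes> bin_form f x y n = bin_form (case_nat 0 f) x y (Suc n)"
proof (induction n)
  case 0
  then show ?case by (simp add: add_pow_rdistr)
next
  case (Suc n)
  have "x \<otimes> bin_form f x y (Suc n) = y \<otimes> (x \<otimes> bin_form f x y n) \<oplus> [f (Suc n)] \<cdot> (x \<otimes> x [^] Suc n)"
    using Suc.prems by (simp add: r_distr m_lcomm add_pow_rdistr)
  also have "x \<otimes> x [^] Suc n = x [^] Suc (Suc n)" using Suc.prems by (simp add: m_comm)
  finally show ?case using Suc by simp
qed

lemma bin_form_cong: "(\<And>k. k \<le> n \<Longrightarrow> f k = g k) \<Longrightarrow> bin_form f x y n = bin_form g x y n"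
  by (induction n) auto

lemma binomial_form: assumes xy: "x \<in> carrier R" "y \<in> carrier R"
  shows "(x \<oplus> y) [^] n = bin_form (\<lambda>k. n choose k) x y n"
proof (induction n)
  case (Suc n)
  have 1: "y \<otimes> bin_form (\<lambda>k. n choose k) x y n = bin_form (\<lambda>k. n choose k) x y (Suc n)"
    using xy by (simp add: binomial_eq_0)
  have "(x \<oplus> y) [^] Suc n = x \<otimes> bin_form (\<lambda>k. n choose k) x y n \<oplus> y \<otimes> bin_form (\<lambda>k. n choose k) x y n"
    using Suc xy by (simp add: m_comm[of _ "x \<oplus> y"] l_distr)
  also have "\<dots> = bin_form (\<lambda>k. case_nat 0 (\<lambda>k. n choose k) k + (n choose k)) x y (Suc n)"
    unfolding bin_form_x[OF xy] 1 bin_form_add[OF xy] ..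
  also have "\<dots> = bin_form (\<lambda>k. Suc n choose k) x y (Suc n)"
    by (rule bin_form_cong) (simp split: nat.split)
  finally show ?case .
qed simp

lemma frobenius_add:
  assumes V: "subring V R" and p: "prime (p::nat)" and xy: "x \<in> V" "y \<in> V"
  shows "\<exists>z\<in>V. (x \<oplus> y) [^] p = x [^] p \<oplus> y [^] p \<oplus> [p] \<cdot> z"
proof -
  have Vc: "v \<in> carrier R" if "v \<in> V" for v using that subringE(1)[OF V] by auto
  have c: "x \<in> carrier R" "y \<in> carrier R" using xy Vc by auto
  have pw: "v [^] n \<in> V" if "v \<in> V" for v and n :: nat
    by (induction n) (use that subringE[OF V] in auto)
  have mu: "[n] \<cdot> v \<in> V" if "v \<in> V" for v and n :: nat
    by (induction n) (use that Vc subringE[OF V] in auto)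
  \<comment> \<open>Among the coefficients of index \<open>n < p\<close> only the one of index 0 is
    not divisible by \<open>p\<close>; the final step to degree \<open>p\<close> contributes
    \<open>x^p\<close>.\<close>
  have "\<exists>z\<in>V. bin_form (\<lambda>k. p choose k) x y n = y [^] n \<oplus> [p] \<cdot> z" if "n < p" for n
    using that
  proof (induction n)
    case 0
    then show ?case using subringE(2)[OF V] by (intro bexI[of _ \<zero>]) auto
  next
    case (Suc n)
    then obtain z where z: "z \<in> V" "bin_form (\<lambda>k. p choose k) x y n = y [^] n \<oplus> [p] \<cdot> z" by auto
    obtain q where q: "p choose Suc n = p * q" using dvd_choose_prime[of "Suc n" p] p Suc.prems by auto
    have "bin_form (\<lambda>k. p choose k) x y (Suc n) = y \<otimes> (y [^] n \<oplus> [p] \<cdot> z) \<oplus> [(p * q)] \<cdot> (x [^] Suc n)"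
      using z q by simp
    also have "\<dots> = y [^] Suc n \<oplus> [p] \<cdot> (y \<otimes> z \<oplus> [q] \<cdot> (x [^] Suc n))"
      using c Vc[OF z(1)]
      by (simp add: r_distr m_comm[of y "y [^] n"] add_pow_rdistr add.nat_pow_distrib a_assoc add.nat_pow_pow mult.commute)
    finally show ?case
      using z xy pw[OF xy(1), of "Suc n"] mu subringE(6,7)[OF V] by (intro bexI[of _ "y \<otimes> z \<oplus> [q] \<cdot> (x [^] Suc n)"]) auto
  qed
  then obtain p' z where p': "p = Suc p'" and z: "z \<in> V" "bin_form (\<lambda>k. p choose k) x y p' = y [^] p' \<oplus> [p] \<cdot> z"
    using p prime_gt_0_nat[OF p] by (metis Suc_pred lessI)
  have "(x \<oplus> y) [^] p = bin_form (\<lambda>k. p choose k) x y (Suc p')" unfolding binomial_form[OF c] using p' by simp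
  also have "\<dots> = y \<otimes> (y [^] p' \<oplus> [p] \<cdot> z) \<oplus> x [^] p" using z(2) p' c by simp
  also have "\<dots> = x [^] p \<oplus> y [^] p \<oplus> [p] \<cdot> (y \<otimes> z)"
    using c Vc[OF z(1)] by (simp add: r_distr add_pow_rdistr a_ac p' m_comm[of y "y [^] p'"])
  finally show ?thesis using subringE(6)[OF V xy(2) z(1)] by blast
qed

text \<open>Frobenius is additive modulo \<open>p V\<close>, applied at each step of the recursion.
  The error is recorded with a witness in \<open>V\<close>, since \<open>p\<close> may be invertible
  in \<open>R\<close> and a congruence modulo \<open>p R\<close> would then say nothing.\<close>

lemma horner_frobenius:
  assumes V: "subring V R" and p: "prime (p::nat)" and x: "x \<in> V"
  shows "(\<And>i. a i \<in> V) \<Longrightarrow> \<exists>z\<in>V. hn a x n [^] p = hn (\<lambda>i. a i [^] p) (x [^] p) n \<oplus> [p] \<cdot> z"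
proof (induction n arbitrary: a)
  case 0
  have "a 0 \<in> carrier R" using 0 subringE(1)[OF V] by auto
  then show ?case using subringE(2)[OF V] by (intro bexI[of _ \<zero>]) auto
next
  case (Suc n)
  have Vc: "v \<in> carrier R" if "v \<in> V" for v using that subringE(1)[OF V] by auto
  have pw: "v [^] n \<in> V" if "v \<in> V" for v and n :: nat
    by (induction n) (use that subringE[OF V] in auto)
  define y where "y = hn (\<lambda>i. a (Suc i)) x n"
  have "poly_vals R V x n \<subseteq> V"
  proof
    fix v show "v \<in> poly_vals R V x n \<Longrightarrow> v \<in> V"
      by (induction n arbitrary: v) (use x subringE(6,7)[OF V] in \<open>auto simp: poly_vals.simps(2)\<close>)
  qed
  moreover have "y \<in> poly_vals R V x n" unfolding y_def by (rule poly_vals_horner) (rule Suc.prems)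
  ultimately have y: "y \<in> V" by blast
  obtain z where z: "z \<in> V" "y [^] p = hn (\<lambda>i. a (Suc i) [^] p) (x [^] p) n \<oplus> [p] \<cdot> z"
    unfolding y_def using Suc.IH[of "\<lambda>i. a (Suc i)"] Suc.prems by blast
  define q where "q = hn (\<lambda>i. a (Suc i) [^] p) (x [^] p) n"
  have q: "q \<in> carrier R" unfolding q_def using Suc.prems Vc x by (intro horner_closed) auto
  obtain z' where z': "z' \<in> V" "(a 0 \<oplus> x \<otimes> y) [^] p = a 0 [^] p \<oplus> (x \<otimes> y) [^] p \<oplus> [p] \<cdot> z'"
    using frobenius_add[OF V p, of "a 0" "x \<otimes> y"] Suc.prems x y subringE(6)[OF V] by blast
  have c: "a 0 \<in> carrier R" "x \<in> carrier R" "y \<in> carrier R" "z \<in> carrier R" "z' \<in> carrier R"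
    using Vc Suc.prems x y z z' by auto
  have "hn a x (Suc n) [^] p = a 0 [^] p \<oplus> x [^] p \<otimes> (q \<oplus> [p] \<cdot> z) \<oplus> [p] \<cdot> z'"
    using z'(2) z(2) c by (simp add: y_def[symmetric] q_def nat_pow_distrib)
  also have "\<dots> = (a 0 [^] p \<oplus> x [^] p \<otimes> q) \<oplus> [p] \<cdot> (x [^] p \<otimes> z \<oplus> z')"
    using c q by (simp add: r_distr add_pow_rdistr add.nat_pow_distrib a_assoc)
  finally show ?case
    using z z' pw[OF x, of p] subringE(6,7)[OF V] unfolding q_def by (intro bexI[of _ "x [^] p \<otimes> z \<oplus> z'"]) auto
qed

end

section \<open>Perfectoid charts\<close>

text \<open>\<open>R\<close> plays the role of \<open>A[1/tg]\<close> and \<open>A0\<close> that of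
  the image of \<open>A\<close>. The axioms collect what the computation uses of \<open>A\<close>.
  Working inside one ring in which \<open>t\<close> and \<open>g\<close> are units turns
  divisibility into membership of a quotient in a subring.\<close>

locale perfectoid_chart = cring R for R (structure) +
  fixes A0 and p :: nat and ts gs :: "nat \<Rightarrow> 'a"
  assumes subA0: "subring A0 R"
    and p_prime: "prime p"
    and ts_A0: "ts k \<in> A0" and ts_root: "ts (Suc k) [^] p = ts k" and t_unit: "ts 0 \<in> Units R"
    and gs_A0: "gs k \<in> A0" and gs_root: "gs (Suc k) [^] p = gs k" and g_unit: "gs 0 \<in> Units R"
    and frobenius_inj: "\<lbrakk>a \<in> A0; b \<in> A0; a [^] p = ts 0 \<otimes> b\<rbrakk> \<Longrightarrow> \<exists>c\<in>A0. a = ts 1 \<otimes> c"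
    and frobenius_surj: "a \<in> A0 \<Longrightarrow> \<exists>b\<in>A0. \<exists>c\<in>A0. a = b [^] p \<oplus> ts 0 \<otimes> c"
    and p_multiple: "\<exists>c\<in>A0. [p] \<cdot> \<one> = ts 0 \<otimes> c"
    and almost_nonzerodivisor:
      "\<lbrakk>a \<in> A0; b \<in> A0; gs 0 \<otimes> a = ts 0 [^] (m::nat) \<otimes> b\<rbrakk> \<Longrightarrow> \<exists>c\<in>A0. ts k \<otimes> a = ts 0 [^] m \<otimes> c"
    and denominators: "r \<in> carrier R \<Longrightarrow> \<exists>(i::nat) (j::nat). ts 0 [^] i \<otimes> (gs 0 [^] j \<otimes> r) \<in> A0"
begin

lemmas A0_sub = subringE(1)[OF subA0]
lemmas A0_zero = subringE(2)[OF subA0]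
lemmas A0_one = subringE(3)[OF subA0]
lemmas A0_neg = subringE(5)[OF subA0]
lemmas A0_mult = subringE(6)[OF subA0]
lemmas A0_add = subringE(7)[OF subA0]

lemma A0_closed: "a \<in> A0 \<Longrightarrow> a \<in> carrier R" using A0_sub by auto
lemma A0_diff: "\<lbrakk>a \<in> A0; b \<in> A0\<rbrakk> \<Longrightarrow> a \<ominus> b \<in> A0" by (simp add: a_minus_def A0_add A0_neg)
lemma A0_pow: "a \<in> A0 \<Longrightarrow> a [^] (n::nat) \<in> A0"
  by (induction n) (auto simp: A0_one A0_mult)

lemma ts_closed [simp]: "ts k \<in> carrier R" using ts_A0 A0_closed by auto
lemma gs_closed [simp]: "gs k \<in> carrier R" using gs_A0 A0_closed by auto

lemma p_gt_1: "p > 1" using p_prime prime_gt_1_nat by auto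

section \<open>Roots, units and almost cancellation of \<open>g\<close>\<close>

lemma root_pow: assumes "\<And>k. f k \<in> carrier R" "\<And>k. f (Suc k) [^] p = f k"
  shows "f (k + j) [^] (p ^ j) = f k"
proof (induction j)
  case 0
  then show ?case using assms by simp
next
  case (Suc j)
  have "f (k + Suc j) [^] (p ^ Suc j) = (f (Suc (k + j)) [^] p) [^] (p ^ j)"
    using assms(1)[of "Suc (k + j)"] by (simp add: nat_pow_pow)
  then show ?case using Suc assms(2) by simp
qed

lemmas ts_pow = root_pow[of ts, OF ts_closed ts_root]
lemmas gs_pow = root_pow[of gs, OF gs_closed gs_root]

lemma unit_of_pow: assumes "x \<in> carrier R" "x [^] (n::nat) \<in> Units R" "n > 0" shows "x \<in> Units R"
proof -
  obtain m where m: "n = Suc m" using assms(3) by (cases n) auto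
  define y where "y = x [^] m \<otimes> inv (x [^] n)"
  have y: "y \<in> carrier R" unfolding y_def using assms by simp
  have "x \<otimes> y = (x [^] m \<otimes> x) \<otimes> inv (x [^] n)"
    unfolding y_def using assms(1,2) by (simp add: m_ac)
  also have "\<dots> = \<one>" using assms(2) by (simp add: m)
  finally have "x \<otimes> y = \<one>" .
  moreover from this have "y \<otimes> x = \<one>" using m_comm assms(1) y by simp
  ultimately show ?thesis unfolding Units_def using assms(1) y by blast
qed

lemma ts_unit: "ts k \<in> Units R"
  using unit_of_pow[of "ts k" "p ^ k"] ts_pow[of 0 k] t_unit p_gt_1 by auto
lemma gs_unit: "gs k \<in> Units R"
  using unit_of_pow[of "gs k" "p ^ k"] gs_pow[of 0 k] g_unit p_gt_1 by auto

lemma unit_cancel: "\<lbrakk>u \<in> Units R; u \<otimes> x = u \<otimes> y; x \<in> carrier R; y \<in> carrier R\<rbrakk> \<Longrightarrow> x = y"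
  using Units_l_cancel by blast

text \<open>As \<open>p \<ge> 2\<close>, losing \<open>ts (Suc k)\<close> twice costs no more than
  \<open>ts k\<close>. This is how almost statements are composed throughout.\<close>

lemma ts_square: obtains e where "e \<in> A0" "ts k = ts (Suc k) \<otimes> (ts (Suc k) \<otimes> e)"
proof -
  define q where "q = p - 2"
  have q: "p = Suc (Suc q)" using p_gt_1 by (simp add: q_def)
  have "ts k = ts (Suc k) \<otimes> (ts (Suc k) \<otimes> ts (Suc k) [^] q)"
    using ts_root[of k] ts_closed[of "Suc k"] unfolding q by (simp add: m_comm)
  then show ?thesis using that A0_pow ts_A0 by blast
qed

text \<open>Each factor \<open>g\<close> is cancelled at the price of one root of \<open>t\<close>,
  and \<open>ts_square\<close> keeps the accumulated loss below \<open>ts k\<close>.\<close>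

lemma almost_nonzerodivisor_pow:
  "\<lbrakk>y \<in> A0; b \<in> A0; gs 0 [^] (a::nat) \<otimes> y = ts 0 [^] (m::nat) \<otimes> b\<rbrakk> \<Longrightarrow> \<exists>c\<in>A0. ts k \<otimes> y = ts 0 [^] m \<otimes> c"
proof (induction a arbitrary: y b k)
  case 0
  have "ts k \<otimes> y = ts 0 [^] m \<otimes> (ts k \<otimes> b)" using 0 A0_closed by (simp add: m_lcomm)
  then show ?case using A0_mult ts_A0 0 by blast
next
  case (Suc a)
  have yc: "y \<in> carrier R" using Suc A0_closed by auto
  have "gs 0 [^] a \<otimes> (gs 0 \<otimes> y) = ts 0 [^] m \<otimes> b" using Suc.prems yc by (simp add: m_assoc)
  then obtain c where c: "c \<in> A0" "ts (Suc k) \<otimes> (gs 0 \<otimes> y) = ts 0 [^] m \<otimes> c"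
    using Suc.IH[of "gs 0 \<otimes> y" b "Suc k"] Suc.prems A0_mult gs_A0 by blast
  have "gs 0 \<otimes> (ts (Suc k) \<otimes> y) = ts 0 [^] m \<otimes> c" using c yc by (simp add: m_lcomm)
  then obtain d where d: "d \<in> A0" "ts (Suc k) \<otimes> (ts (Suc k) \<otimes> y) = ts 0 [^] m \<otimes> d"
    using almost_nonzerodivisor[of "ts (Suc k) \<otimes> y" c] c(1) Suc.prems A0_mult ts_A0 by blast
  obtain e where e: "e \<in> A0" "ts k = ts (Suc k) \<otimes> (ts (Suc k) \<otimes> e)" by (rule ts_square)
  note cc = A0_closed[OF d(1)] A0_closed[OF e(1)]
  have "ts k \<otimes> y = (ts (Suc k) \<otimes> (ts (Suc k) \<otimes> y)) \<otimes> e"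
    using yc cc arg_cong[OF e(2), of "\<lambda>z. z \<otimes> y"] by (simp add: m_assoc m_comm m_lcomm)
  also have "\<dots> = ts 0 [^] m \<otimes> (d \<otimes> e)" unfolding d(2) using cc by (simp add: m_assoc)
  finally show ?case using A0_mult d e by blast
qed

text \<open>The almost form of \<open>A[1/g] \<inter> A[1/t] = A\<close>: regularity of powers of
  \<open>g\<close> modulo \<open>t^m\<close> is applied to \<open>t^m r\<close>, and then
  \<open>t^m\<close> is cancelled.\<close>

lemma almost_integral:
  assumes "r \<in> carrier R" "gs 0 [^] (a::nat) \<otimes> r \<in> A0" "ts 0 [^] (m::nat) \<otimes> r \<in> A0"
  shows "ts k \<otimes> r \<in> A0"
proof -
  have "gs 0 [^] a \<otimes> (ts 0 [^] m \<otimes> r) = ts 0 [^] m \<otimes> (gs 0 [^] a \<otimes> r)" using assms by (simp add: m_lcomm)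
  then obtain c where c: "c \<in> A0" "ts k \<otimes> (ts 0 [^] m \<otimes> r) = ts 0 [^] m \<otimes> c"
    using almost_nonzerodivisor_pow assms by blast
  have "ts 0 [^] m \<otimes> (ts k \<otimes> r) = ts 0 [^] m \<otimes> c" using c assms by (simp add: m_lcomm)
  then have "ts k \<otimes> r = c"
    using unit_cancel[OF Units_pow_closed[OF t_unit]] assms A0_closed[OF c(1)] by simp
  then show ?thesis using c by simp
qed

section \<open>The roots of \<open>t^n/g\<close> and the rings that they generate\<close>

definition X where "X n k = ts k [^] (n::nat) \<otimes> inv (gs k)"

lemma X_closed [simp]: "X n k \<in> carrier R" unfolding X_def using gs_unit by simp

lemma gs_X: "gs k \<otimes> X n k = ts k [^] n"
proof -
  have "gs k \<otimes> X n k = ts k [^] n \<otimes> (gs k \<otimes> inv (gs k))"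
    unfolding X_def using gs_unit[of k] by (intro m_lcomm) auto
  then show ?thesis using gs_unit[of k] by simp
qed

lemma X_root: "X n (Suc k) [^] p = X n k"
proof (rule unit_cancel[OF gs_unit[of k]])
  have "gs k \<otimes> X n (Suc k) [^] p = (gs (Suc k) \<otimes> X n (Suc k)) [^] p"
    using gs_root[of k] by (simp add: nat_pow_distrib)
  also have "\<dots> = (ts (Suc k) [^] p) [^] n" unfolding gs_X by (simp add: nat_pow_pow mult.commute)
  also have "\<dots> = gs k \<otimes> X n k" unfolding gs_X ts_root ..
  finally show "gs k \<otimes> X n (Suc k) [^] p = gs k \<otimes> X n k" .
qed simp_all

lemmas X_pow = root_pow[of "X n" for n, OF X_closed X_root]

lemma subring_elem_X: "subring_elem R A0 (X n k)"
  by (intro subring_elem.intro subring_elem_axioms.intro is_cring subA0 X_closed)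

text \<open>\<open>PX n k\<close> is \<open>A0[(t^n/g)^(1/p^k)]\<close>. The union
  \<open>Binf n\<close> over all \<open>k\<close> is the ring \<open>B_n\<close> of the overview, in
  contrast to the later \<open>Bn n\<close>, which is generated by \<open>t^n/g\<close> without its
  roots.\<close>

definition PX where "PX n k = (\<Union>N. poly_vals R A0 (X n k) N)"
definition Binf where "Binf n = (\<Union>k. PX n k)"

lemma PX_subring: "subring (PX n k) R"
proof -
  interpret E: subring_elem R A0 "X n k" by (rule subring_elem_X)
  show ?thesis using E.adj_subring unfolding E.adj_def PX_def .
qed

lemma A0_PX: "a \<in> A0 \<Longrightarrow> a \<in> PX n k"
proof -
  interpret E: subring_elem R A0 "X n k" by (rule subring_elem_X)
  show "a \<in> A0 \<Longrightarrow> a \<in> PX n k" using E.W_adj unfolding E.adj_def PX_def .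
qed

lemma X_PX: "X n k \<in> PX n k"
proof -
  interpret E: subring_elem R A0 "X n k" by (rule subring_elem_X)
  show "X n k \<in> PX n k" using E.x_adj unfolding E.adj_def PX_def .
qed

lemma poly_vals_subring:
  assumes "subring V R" "A0 \<subseteq> V" "x \<in> V" shows "y \<in> poly_vals R A0 x N \<Longrightarrow> y \<in> V"
proof (induction N arbitrary: y)
  case 0
  then show ?case using assms by auto
next
  case (Suc N)
  then obtain w z where wz: "w \<in> A0" "z \<in> poly_vals R A0 x N" "y = w \<oplus> x \<otimes> z" by (auto simp: poly_vals.simps(2))
  have "x \<otimes> z \<in> V" using subringE(6)[OF assms(1,3)] Suc.IH[OF wz(2)] by blast
  then show ?case unfolding wz(3) using subringE(7)[OF assms(1)] wz(1) assms(2) by blast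
qed

lemma PX_Suc: "PX n k \<subseteq> PX n (Suc k)"
proof
  fix y assume "y \<in> PX n k"
  then obtain N where y: "y \<in> poly_vals R A0 (X n k) N" by (auto simp: PX_def)
  interpret V: subring_elem R "PX n (Suc k)" "X n (Suc k)"
    by (intro subring_elem.intro subring_elem_axioms.intro is_cring PX_subring X_closed)
  have "x [^] (j::nat) \<in> PX n (Suc k)" if "x \<in> PX n (Suc k)" for x j
    by (induction j) (use that V.W_mult V.W_one in auto)
  from this[OF X_PX, of p] have "X n k \<in> PX n (Suc k)" unfolding X_root .
  then show "y \<in> PX n (Suc k)" using poly_vals_subring[OF PX_subring _ _ y] A0_PX by blast
qed

lemma PX_mono: "k \<le> l \<Longrightarrow> PX n k \<subseteq> PX n l"
  using lift_Suc_mono_le[of "PX n"] PX_Suc by blast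

lemma Binf_subring: "subring (Binf n) R"
proof -
  have "I \<subseteq> J \<or> J \<subseteq> I" if "I \<in> range (PX n)" "J \<in> range (PX n)" for I J
    using that PX_mono nat_le_linear by blast
  then show ?thesis unfolding Binf_def using PX_subring by (intro Union_chain_subring) auto
qed

lemmas Binf_sub = subringE(1)[OF Binf_subring]
lemmas Binf_zero = subringE(2)[OF Binf_subring]
lemmas Binf_one = subringE(3)[OF Binf_subring]
lemmas Binf_mult = subringE(6)[OF Binf_subring]
lemmas Binf_add = subringE(7)[OF Binf_subring]

lemma Binf_closed: "b \<in> Binf n \<Longrightarrow> b \<in> carrier R" using Binf_sub by auto
lemma A0_Binf: "a \<in> A0 \<Longrightarrow> a \<in> Binf n" unfolding Binf_def using A0_PX by blast
lemma X_Binf: "X n k \<in> Binf n" unfolding Binf_def using X_PX by blast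
lemma Binf_pow: "a \<in> Binf n \<Longrightarrow> a [^] (j::nat) \<in> Binf n"
  by (induction j) (auto simp: Binf_one Binf_mult)

lemma Binf_levelE: assumes "y \<in> Binf n" obtains k where "\<And>l. k \<le> l \<Longrightarrow> y \<in> PX n l"
proof -
  obtain k where "y \<in> PX n k" using assms by (auto simp: Binf_def)
  then show ?thesis using that[of k] PX_mono by blast
qed

lemma poly_vals_denominator: "y \<in> poly_vals R A0 (X n k) N \<Longrightarrow> gs k [^] N \<otimes> y \<in> A0"
proof (induction N arbitrary: y)
  case 0
  then show ?case using A0_closed by simp
next
  case (Suc N)
  interpret E: subring_elem R A0 "X n k" by (rule subring_elem_X)
  obtain w z where w: "w \<in> A0" "z \<in> poly_vals R A0 (X n k) N" "w \<in> carrier R" "z \<in> carrier R" "y = w \<oplus> X n k \<otimes> z"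
    using Suc.prems by (rule E.P_SucE)
  have "gs k [^] Suc N \<otimes> y = gs k [^] Suc N \<otimes> w \<oplus> (gs k \<otimes> X n k) \<otimes> (gs k [^] N \<otimes> z)"
    unfolding w(5) using w(3,4) by (simp add: r_distr m_assoc m_lcomm)
  then show ?case unfolding gs_X using Suc.IH[OF w(2)] w(1) A0_add A0_mult A0_pow gs_A0 ts_A0 by metis
qed

lemma gs_mult_A0: assumes "r \<in> carrier R" "gs k [^] (N::nat) \<otimes> r \<in> A0" shows "gs 0 [^] N \<otimes> r \<in> A0"
proof -
  obtain q where q: "p ^ k = Suc q" using p_gt_1 by (metis not0_implies_Suc power_not_zero not_one_less_zero)
  have "gs 0 = gs k [^] q \<otimes> gs k" using gs_pow[of 0 k] q by simp
  then have "gs 0 [^] N = (gs k [^] q) [^] N \<otimes> gs k [^] N" by (simp add: nat_pow_distrib)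
  then have "gs 0 [^] N \<otimes> r = (gs k [^] q) [^] N \<otimes> (gs k [^] N \<otimes> r)" using assms(1) by (simp add: m_assoc)
  then show ?thesis using A0_mult A0_pow gs_A0 assms(2) by metis
qed

lemma ts_mult_A0: assumes "r \<in> carrier R" "ts k [^] (N::nat) \<otimes> r \<in> A0" shows "ts 0 [^] N \<otimes> r \<in> A0"
proof -
  obtain q where q: "p ^ k = Suc q" using p_gt_1 by (metis not0_implies_Suc power_not_zero not_one_less_zero)
  have "ts 0 = ts k [^] q \<otimes> ts k" using ts_pow[of 0 k] q by simp
  then have "ts 0 [^] N = (ts k [^] q) [^] N \<otimes> ts k [^] N" by (simp add: nat_pow_distrib)
  then have "ts 0 [^] N \<otimes> r = (ts k [^] q) [^] N \<otimes> (ts k [^] N \<otimes> r)" using assms(1) by (simp add: m_assoc)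
  then show ?thesis using A0_mult A0_pow ts_A0 assms(2) by metis
qed

lemma Binf_denominator: assumes "y \<in> Binf n" shows "\<exists>N::nat. gs 0 [^] N \<otimes> y \<in> A0"
proof -
  obtain k N where "y \<in> poly_vals R A0 (X n k) N" using assms by (auto simp: Binf_def PX_def)
  then show ?thesis using poly_vals_denominator gs_mult_A0 Binf_closed[OF assms] by blast
qed

section \<open>Relations among the roots, and the Frobenius\<close>

lemma horner_PX: "(\<And>i. a i \<in> A0) \<Longrightarrow> hn a (X n k) N \<in> PX n k"
  unfolding PX_def using poly_vals_horner by blast

text \<open>Almost, the relations among the powers of \<open>X n l\<close> with coefficients in \<open>A0\<close> are generated by
  \<open>gs l \<otimes> X n l = ts l [^] n\<close>: a vanishing polynomial is \<open>(gs l \<otimes> x \<ominus> ts l [^] n) \<otimes> \<Sum>i f (i + 1) x\<^sup>i\<close>.\<close>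

lemma relation_coeffs:
  assumes c: "\<And>i. c i \<in> A0" and c0: "\<And>i. i > M \<Longrightarrow> c i = \<zero>" and rel: "hn c (X n l) M = \<zero>"
  obtains f where "f 0 = \<zero>" "\<And>i. i > M \<Longrightarrow> f i = \<zero>" "\<And>i. f i \<in> carrier R"
    "\<And>i. gs l \<otimes> f i \<ominus> ts l [^] n \<otimes> f (Suc i) = c i" "\<And>i e. ts e \<otimes> f i \<in> A0"
proof -
  define x where "x = X n l"
  have x: "x \<in> carrier R" by (simp add: x_def)
  have cc: "c i \<in> carrier R" for i using c A0_closed by auto
  \<comment> \<open>Synthetic division at \<open>x\<close>: \<open>E i\<close> is the tail of the
    relation from degree \<open>i\<close> on, and \<open>f i\<close> is \<open>E i\<close> divided
    by \<open>gs l\<close>.\<close>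
  define E where "E i = (if i \<le> M then hn (\<lambda>j. c (i + j)) x (M - i) else \<zero>)" for i
  have Ec: "E i \<in> carrier R" for i using cc x by (auto simp: E_def)
  have E0: "E 0 = \<zero>" using rel by (simp add: E_def x_def)
  have Erec: "E i = c i \<oplus> x \<otimes> E (Suc i)" for i
  proof (cases "i < M")
    case True
    then obtain k where k: "M - i = Suc k" by (metis Suc_diff_Suc)
    then show ?thesis using True by (simp add: E_def) (metis Suc_diff_Suc diff_Suc_Suc k nat.inject)
  next
    case False
    then show ?thesis using c0 cc x by (cases "i = M") (auto simp: E_def)
  qed
  define f where "f i = inv (gs l) \<otimes> E i" for i
  have hu: "gs l \<in> Units R" by (rule gs_unit)
  have fc: "f i \<in> carrier R" for i using Ec hu by (simp add: f_def)
  have hf: "gs l \<otimes> f i = E i" for i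
    using Ec[of i] hu by (simp add: f_def m_assoc[symmetric])
  have xE: "x \<otimes> E i = ts l [^] n \<otimes> f i" for i
    using Ec[of i] hu by (simp add: f_def x_def X_def m_assoc)
  have frel: "gs l \<otimes> f i \<ominus> ts l [^] n \<otimes> f (Suc i) = c i" for i
  proof -
    have "gs l \<otimes> f i \<ominus> ts l [^] n \<otimes> f (Suc i) = (c i \<oplus> x \<otimes> E (Suc i)) \<ominus> x \<otimes> E (Suc i)"
      unfolding hf xE[symmetric] using Erec[of i] by simp
    also have "\<dots> = c i" using cc[of i] x Ec[of "Suc i"] by (simp add: a_minus_def a_assoc r_neg)
    finally show ?thesis .
  qed
  have fM: "f i = \<zero>" if "i > M" for i using that hu by (simp add: f_def E_def)
  have f0: "f 0 = \<zero>" using E0 hu by (simp add: f_def)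
  \<comment> \<open>Solving the recursion upwards from \<open>f 0 = 0\<close>, each step divides by
    \<open>ts l ^ n\<close> only, so a power of \<open>t\<close> clears the denominator of
    \<open>f i\<close>.\<close>
  have "(ts l [^] n) [^] i \<otimes> f i \<in> A0" for i
  proof (induction i)
    case 0
    then show ?case using f0 A0_zero by simp
  next
    case (Suc i)
    define u where "u = ts l [^] n"
    have u: "u \<in> A0" "u \<in> carrier R" unfolding u_def using A0_pow[OF ts_A0] by auto
    have "u \<otimes> f (Suc i) = gs l \<otimes> f i \<ominus> c i"
    proof -
      have "c i = gs l \<otimes> f i \<ominus> u \<otimes> f (Suc i)" using frel[of i] by (simp add: u_def)
      then show ?thesis using fc[of i] fc[of "Suc i"] u(2) by (simp add: a_minus_def minus_add a_assoc[symmetric] r_neg)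
    qed
    then have "u [^] Suc i \<otimes> f (Suc i) = u [^] i \<otimes> (gs l \<otimes> f i \<ominus> c i)"
      using u fc[of "Suc i"] by (simp add: m_assoc)
    also have "\<dots> = gs l \<otimes> (u [^] i \<otimes> f i) \<ominus> u [^] i \<otimes> c i"
      using u fc[of i] cc[of i] by (simp add: a_minus_def r_distr r_minus m_lcomm)
    finally show ?case using Suc u c[of i] unfolding u_def[symmetric] by (simp add: A0_diff A0_mult gs_A0 A0_pow)
  qed
  then have 1: "ts 0 [^] (n * i) \<otimes> f i \<in> A0" for i
    using ts_mult_A0[OF fc, of l "n * i"] by (simp add: nat_pow_pow)
  \<comment> \<open>On the other hand \<open>f i\<close> is a polynomial in \<open>X n l\<close>
    divided by \<open>gs l\<close>, so a power of \<open>g\<close> clears its denominator too, and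
    \<open>almost_integral\<close> applies.\<close>
  have "gs l [^] Suc M \<otimes> f i \<in> A0" for i
  proof (cases "i \<le> M")
    case False then show ?thesis using fM A0_zero by simp
  next
    case True
    interpret S: subring_elem R A0 x unfolding x_def by (rule subring_elem_X)
    have "E i \<in> poly_vals R A0 x (M - i)" using True poly_vals_horner[of "\<lambda>j. c (i + j)"] c by (simp add: E_def)
    then have "E i \<in> poly_vals R A0 x M" using S.P_mono[of "M - i" M] by simp
    then have "gs l [^] M \<otimes> E i \<in> A0" using poly_vals_denominator unfolding x_def by blast
    then show ?thesis using hf[of i] fc[of i] by (simp add: m_assoc)
  qed
  then have 2: "gs 0 [^] Suc M \<otimes> f i \<in> A0" for i
    using gs_mult_A0[OF fc] by blast
  have "ts e \<otimes> f i \<in> A0" for e i by (rule almost_integral[OF fc 2 1])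
  then show ?thesis using that f0 fM fc frel by blast
qed

text \<open>Frobenius is additive modulo \<open>t\<close> because \<open>p\<close> is a multiple of
  \<open>t\<close>. The sign needs care for \<open>p = 2\<close>; expanding
  \<open>(y - y)^p = 0\<close> settles it for all \<open>p\<close> at once.\<close>

lemma multiple_t_pow_sum:
  assumes "x \<in> A0" "y \<in> A0" "z \<in> A0"
  obtains d where "d \<in> A0" "(x \<ominus> y \<oplus> z) [^] p = x [^] p \<ominus> y [^] p \<oplus> z [^] p \<oplus> ts 0 \<otimes> d"
proof -
  obtain c where c: "c \<in> A0" "[p] \<cdot> \<one> = ts 0 \<otimes> c" using p_multiple by blast
  have pm: "[p] \<cdot> v = ts 0 \<otimes> (c \<otimes> v)" if "v \<in> A0" for v
    using c(2) A0_closed[OF that] A0_closed[OF c(1)] add_pow_ldistr[of \<one> v p] by (simp add: m_assoc)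
  have add: "\<exists>d\<in>A0. (a \<oplus> b) [^] p = a [^] p \<oplus> b [^] p \<oplus> ts 0 \<otimes> d" if "a \<in> A0" "b \<in> A0" for a b
    using frobenius_add[OF subA0 p_prime that] pm A0_mult c(1) by metis
  note cl = A0_closed[OF assms(1)] A0_closed[OF assms(2)] A0_closed[OF assms(3)]
  obtain d1 where d1: "d1 \<in> A0" "(y \<oplus> \<ominus> y) [^] p = y [^] p \<oplus> (\<ominus> y) [^] p \<oplus> ts 0 \<otimes> d1"
    using add[OF assms(2) A0_neg[OF assms(2)]] by blast
  have "(y \<oplus> \<ominus> y) [^] p = \<zero>" using cl p_gt_1 by (simp add: r_neg nat_pow_zero)
  then have z: "y [^] p \<oplus> (\<ominus> y) [^] p \<oplus> ts 0 \<otimes> d1 = \<zero>" using d1 by simp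
  have sol: "b = \<ominus> a \<ominus> c" if "a \<oplus> b \<oplus> c = \<zero>" "a \<in> carrier R" "b \<in> carrier R" "c \<in> carrier R" for a b c
  proof -
    have "b = (a \<oplus> b \<oplus> c) \<oplus> (\<ominus> a \<ominus> c)" using that(2-4) by algebra
    then show ?thesis unfolding that(1) using that(2-4) by simp
  qed
  have ny: "(\<ominus> y) [^] p = \<ominus> (y [^] p) \<ominus> ts 0 \<otimes> d1"
    using cl A0_closed[OF d1(1)] by (intro sol[OF z]) auto
  obtain d2 where d2: "d2 \<in> A0" "(x \<oplus> \<ominus> y) [^] p = x [^] p \<oplus> (\<ominus> y) [^] p \<oplus> ts 0 \<otimes> d2"
    using add[OF assms(1) A0_neg[OF assms(2)]] by blast
  obtain d3 where d3: "d3 \<in> A0" "(x \<oplus> \<ominus> y \<oplus> z) [^] p = (x \<oplus> \<ominus> y) [^] p \<oplus> z [^] p \<oplus> ts 0 \<otimes> d3"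
    using add[of "x \<oplus> \<ominus> y" z] assms A0_neg A0_add by blast
  note dc = A0_closed[OF d1(1)] A0_closed[OF d2(1)] A0_closed[OF d3(1)]
  define P Q S where "P = x [^] p" and "Q = y [^] p" and "S = z [^] p"
  have PQS: "P \<in> carrier R" "Q \<in> carrier R" "S \<in> carrier R" using cl by (auto simp: P_def Q_def S_def)
  have "(x \<ominus> y \<oplus> z) [^] p = P \<oplus> (\<ominus> Q \<ominus> ts 0 \<otimes> d1) \<oplus> ts 0 \<otimes> d2 \<oplus> S \<oplus> ts 0 \<otimes> d3"
    unfolding a_minus_def[of R x y] d3(2) d2(2) ny P_def Q_def S_def ..
  also have "\<dots> = P \<ominus> Q \<oplus> S \<oplus> ts 0 \<otimes> (d2 \<oplus> d3 \<ominus> d1)"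
    using PQS dc ts_closed[of 0] by algebra
  finally show ?thesis
    using that[of "d2 \<oplus> d3 \<ominus> d1"] d1(1) d2(1) d3(1) A0_add A0_diff unfolding P_def Q_def S_def by blast
qed

text \<open>With \<open>\<rho> i\<close> an approximate \<open>p\<close>-th root of the coefficient \<open>f i\<close> from \<open>relation_coeffs\<close>, subtracting
  \<open>(gs (Suc l) \<otimes> y \<ominus> ts (Suc l) [^] n) \<otimes> \<Sum>i \<rho> (i + 1) y\<^sup>i = \<zero>\<close> from the expression of \<open>ts (Suc e) \<otimes> b\<close> in
  \<open>y = X n (Suc l)\<close> makes the \<open>p\<close>-th power of every coefficient a multiple of \<open>ts 0\<close>.\<close>

lemma almost_frobenius_inj_level:
  assumes b: "b \<in> PX n l" and q: "q \<in> PX n l" and eq: "b [^] p = ts 0 \<otimes> q"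
  shows "\<exists>y\<in>Binf n. ts (Suc e) \<otimes> b = ts 1 \<otimes> y"
proof -
  define x where "x = X n l"
  define y where "y = X n (Suc l)"
  have xy: "x \<in> carrier R" "y \<in> carrier R" "y [^] p = x" unfolding x_def y_def using X_root by auto
  define V where "V = PX n l"
  have V: "subring V R" unfolding V_def by (rule PX_subring)
  have Vc: "v \<in> V \<Longrightarrow> v \<in> carrier R" for v using subringE(1)[OF V] by auto
  have A0V: "a \<in> A0 \<Longrightarrow> a \<in> V" for a unfolding V_def by (rule A0_PX)
  have xV: "x \<in> V" unfolding x_def V_def by (rule X_PX)
  have ne: "A0 \<noteq> {}" using A0_zero by auto
  obtain N where "b \<in> poly_vals R A0 x N" using b by (auto simp: PX_def x_def)
  then obtain a where a: "\<And>i. a i \<in> A0" "b = hn a x N" using horner_poly_vals[OF _ ne] by blast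
  obtain z where z: "z \<in> V" "hn a x N [^] p = hn (\<lambda>i. a i [^] p) (x [^] p) N \<oplus> [p] \<cdot> z"
    using horner_frobenius[OF V p_prime xV, of a N] a(1) A0V by blast
  obtain c0 where c0: "c0 \<in> A0" "[p] \<cdot> \<one> = ts 0 \<otimes> c0" using p_multiple by blast
  have pz: "[p] \<cdot> z = ts 0 \<otimes> (c0 \<otimes> z)"
    using c0 Vc[OF z(1)] A0_closed[OF c0(1)] add_pow_ldistr[of \<one> z p] by (simp add: m_assoc)
  define q2 where "q2 = q \<ominus> c0 \<otimes> z"
  have q2: "q2 \<in> V"
    unfolding q2_def a_minus_def using q subringE(5-7)[OF V] A0V[OF c0(1)] z(1) V_def by auto
  define H where "H = hn (\<lambda>i. a i [^] p) (x [^] p) N"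
  have Hc: "H \<in> carrier R" unfolding H_def using a(1) A0_closed xy(1) by (intro horner_closed) auto
  have "H \<oplus> ts 0 \<otimes> (c0 \<otimes> z) = ts 0 \<otimes> q" using z(2) eq a(2) pz unfolding H_def by simp
  moreover have "H = (H \<oplus> ts 0 \<otimes> (c0 \<otimes> z)) \<ominus> ts 0 \<otimes> (c0 \<otimes> z)"
    using Hc Vc[OF z(1)] A0_closed[OF c0(1)] by (simp add: a_minus_def a_assoc r_neg)
  ultimately have H: "H = ts 0 \<otimes> q2"
    using Vc[OF z(1)] A0_closed[OF c0(1)] Vc[of q] q
    by (simp add: q2_def V_def a_minus_def r_distr r_minus)
  obtain N2 where "q2 \<in> poly_vals R A0 x N2" using q2 by (auto simp: V_def PX_def x_def)
  then obtain q' where q': "\<And>i. q' i \<in> A0" "q2 = hn q' x N2" using horner_poly_vals[OF _ ne] by blast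
  \<comment> \<open>Aligns the two expansions: with \<open>x = y^p\<close> the same coefficients
    give \<open>b = sum B_j y^j\<close> and \<open>H = sum B_j^p x^j\<close>, so that
    \<open>b^p\<close> can be compared with \<open>b\<close> coefficient by coefficient.\<close>
  have "\<exists>b m. (\<forall>i. b i \<in> A0) \<and> (\<forall>x\<in>carrier R. hn a (x [^] p) N = hn b x m \<and>
      hn (\<lambda>i. a i [^] p) (x [^] p) N = hn (\<lambda>i. b i [^] p) x m)"
    using p_gt_1 a(1) by (intro horner_spread subA0) auto
  then obtain B m where B: "\<And>i. B i \<in> A0" and
    Be: "\<And>x. x \<in> carrier R \<Longrightarrow> hn a (x [^] p) N = hn B x m"
        "\<And>x. x \<in> carrier R \<Longrightarrow> hn (\<lambda>i. a i [^] p) (x [^] p) N = hn (\<lambda>i. B i [^] p) x m"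
    by blast
  define M where "M = max m N2"
  define B' where "B' i = (if i \<le> m then B i else \<zero>)" for i
  define Q where "Q i = (if i \<le> N2 then q' i else \<zero>)" for i
  have B'A: "B' i \<in> A0" and QA: "Q i \<in> A0" for i using B q' A0_zero by (auto simp: B'_def Q_def)
  note B'c = A0_closed[OF B'A] and Qc = A0_closed[OF QA]
  have zp: "\<zero> [^] p = \<zero>" using p_gt_1 by (simp add: nat_pow_zero)
  have hB: "hn B' y M = b"
    using horner_pad[of B y m M] A0_closed[OF B] xy Be(1)[of y] a(2) unfolding B'_def M_def by simp
  have hBp: "hn (\<lambda>i. B' i [^] p) x M = H"
  proof -
    have "(\<lambda>i. B' i [^] p) = (\<lambda>i. if i \<le> m then B i [^] p else \<zero>)" by (rule ext) (simp add: B'_def zp)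
    then show ?thesis using horner_pad[of "\<lambda>i. B i [^] p" x m M] A0_closed[OF B] xy Be(2)[of x]
      unfolding M_def H_def by simp
  qed
  have hQ: "hn Q x M = q2"
    using horner_pad[of q' x N2 M] A0_closed[OF q'(1)] xy q'(2) unfolding Q_def M_def by simp
  \<comment> \<open>The equation \<open>H = ts 0 q2\<close> read as a vanishing polynomial in
    \<open>x\<close>.\<close>
  define c where "c i = B' i [^] p \<ominus> ts 0 \<otimes> Q i" for i
  have cA: "c i \<in> A0" for i unfolding c_def by (intro A0_diff A0_pow A0_mult B'A QA ts_A0)
  have cM: "c i = \<zero>" if "i > M" for i using that zp by (simp add: c_def B'_def Q_def M_def a_minus_def)
  have "hn c x M = hn (\<lambda>i. B' i [^] p) x M \<ominus> hn (\<lambda>i. ts 0 \<otimes> Q i) x M"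
    unfolding c_def using B'c Qc xy by (intro horner_diff) auto
  also have "hn (\<lambda>i. ts 0 \<otimes> Q i) x M = ts 0 \<otimes> hn Q x M" using Qc xy by (intro horner_scale) auto
  finally have "hn c x M = \<zero>" unfolding hBp hQ H using Vc[OF q2] by (simp add: a_minus_def r_neg)
  then obtain f where f: "f 0 = \<zero>" "\<And>i. i > M \<Longrightarrow> f i = \<zero>" "\<And>i. f i \<in> carrier R"
    "\<And>i. gs l \<otimes> f i \<ominus> ts l [^] n \<otimes> f (Suc i) = c i" "\<And>i e. ts e \<otimes> f i \<in> A0"
    using relation_coeffs[of c M n l] cA cM unfolding x_def by blast
  \<comment> \<open>The roots are chosen zero wherever \<open>f\<close> vanishes. Then \<rho> starts
    at index 1 and ends at \<open>M\<close>, so that shifting its index loses no term.\<close>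
  have "\<exists>r. r \<in> A0 \<and> (f i = \<zero> \<longrightarrow> r = \<zero>) \<and> (\<exists>d\<in>A0. ts e \<otimes> f i = r [^] p \<oplus> ts 0 \<otimes> d)" for i
  proof (cases "f i = \<zero>")
    case True
    then have "ts e \<otimes> f i = \<zero> [^] p \<oplus> ts 0 \<otimes> \<zero>" using zp by simp
    then show ?thesis using A0_zero by blast
  next
    case False
    then show ?thesis using frobenius_surj[OF f(5)[of e i]] by blast
  qed
  then obtain \<rho> where \<rho>: "\<And>i. \<rho> i \<in> A0" "\<And>i. f i = \<zero> \<Longrightarrow> \<rho> i = \<zero>"
    "\<And>i. \<exists>d\<in>A0. ts e \<otimes> f i = \<rho> i [^] p \<oplus> ts 0 \<otimes> d" by metis
  define h' u' where "h' = gs (Suc l)" and "u' = ts (Suc l) [^] n"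
  have hu': "h' \<in> A0" "u' \<in> A0" unfolding h'_def u'_def by (auto intro: gs_A0 A0_pow ts_A0)
  note hu'c = hu'[THEN A0_closed]
  \<comment> \<open>The factor is \<open>ts (Suc e)\<close> because its \<open>p\<close>-th power is
    the \<open>ts e\<close> that makes \<open>f\<close> integral. Modulo \<open>ts 0\<close> the
    \<open>p\<close>-th power of \<gamma> is \<open>ts e\<close> times
    \<open>B' i ^ p - gs l f i + ts l ^ n f (Suc i)\<close>, and this is
    \<open>B' i ^ p - c i = ts 0 Q i\<close>.\<close>
  define \<gamma> where "\<gamma> i = ts (Suc e) \<otimes> B' i \<ominus> h' \<otimes> \<rho> i \<oplus> u' \<otimes> \<rho> (Suc i)" for i
  have \<gamma>A: "\<gamma> i \<in> A0" for i
    unfolding \<gamma>_def by (intro A0_add A0_diff A0_mult ts_A0 B'A hu' \<rho>(1))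
  have "\<exists>g\<in>A0. \<gamma> i = ts 1 \<otimes> g" for i
  proof -
    obtain d where d: "d \<in> A0" "\<gamma> i [^] p = (ts (Suc e) \<otimes> B' i) [^] p \<ominus> (h' \<otimes> \<rho> i) [^] p
        \<oplus> (u' \<otimes> \<rho> (Suc i)) [^] p \<oplus> ts 0 \<otimes> d"
      unfolding \<gamma>_def using multiple_t_pow_sum[of "ts (Suc e) \<otimes> B' i" "h' \<otimes> \<rho> i" "u' \<otimes> \<rho> (Suc i)"]
        A0_mult ts_A0 B'A hu' \<rho>(1) by blast
    obtain d1 where d1: "d1 \<in> A0" "ts e \<otimes> f i = \<rho> i [^] p \<oplus> ts 0 \<otimes> d1" using \<rho>(3) by blast
    obtain d2 where d2: "d2 \<in> A0" "ts e \<otimes> f (Suc i) = \<rho> (Suc i) [^] p \<oplus> ts 0 \<otimes> d2" using \<rho>(3) by blast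
    note dc = A0_closed[OF d(1)] A0_closed[OF d1(1)] A0_closed[OF d2(1)]
    note rc = A0_closed[OF \<rho>(1)]
    define h u where "h = gs l" and "u = ts l [^] n"
    have huA: "h \<in> A0" "u \<in> A0" unfolding h_def u_def by (auto intro: gs_A0 A0_pow ts_A0)
    note huc = huA[THEN A0_closed]
    have hp: "h' [^] p = h" unfolding h'_def h_def by (rule gs_root)
    have up: "u' [^] p = u"
      unfolding u'_def u_def using ts_root[of l] by (metis mult.commute nat_pow_pow ts_closed)
    define E1 E2 where "E1 = \<rho> i [^] p" and "E2 = \<rho> (Suc i) [^] p"
    have Ec: "E1 \<in> carrier R" "E2 \<in> carrier R" unfolding E1_def E2_def using rc by auto
    have sub: "E1 = ts e \<otimes> f i \<ominus> ts 0 \<otimes> d1" "E2 = ts e \<otimes> f (Suc i) \<ominus> ts 0 \<otimes> d2"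
      unfolding d1(2) d2(2) E1_def[symmetric] E2_def[symmetric]
      using Ec dc by (simp_all add: a_minus_def a_assoc r_neg)
    have ci: "gs l \<otimes> f i \<ominus> u \<otimes> f (Suc i) = B' i [^] p \<ominus> ts 0 \<otimes> Q i"
      using f(4)[of i] unfolding c_def u_def .
    define F1 F2 Bp where "F1 = f i" and "F2 = f (Suc i)" and "Bp = B' i [^] p"
    have Fc: "F1 \<in> carrier R" "F2 \<in> carrier R" "Bp \<in> carrier R" unfolding F1_def F2_def Bp_def using f(3) B'c by auto
    have "\<gamma> i [^] p = ts e \<otimes> Bp \<ominus> h \<otimes> E1 \<oplus> u \<otimes> E2 \<oplus> ts 0 \<otimes> d"
      unfolding d(2) using B'c[of i] rc hu'c ts_root[of e] by (simp add: nat_pow_distrib hp up E1_def E2_def Bp_def)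
    also have "\<dots> = ts e \<otimes> Bp \<ominus> ts e \<otimes> (h \<otimes> F1 \<ominus> u \<otimes> F2) \<oplus> ts 0 \<otimes> (h \<otimes> d1 \<ominus> u \<otimes> d2 \<oplus> d)"
      unfolding sub F1_def[symmetric] F2_def[symmetric] using Fc dc huc ts_closed[of e] ts_closed[of 0] by algebra
    also have "\<dots> = ts e \<otimes> Bp \<ominus> ts e \<otimes> (Bp \<ominus> ts 0 \<otimes> Q i) \<oplus> ts 0 \<otimes> (h \<otimes> d1 \<ominus> u \<otimes> d2 \<oplus> d)"
      using ci unfolding h_def[symmetric] F1_def F2_def Bp_def by simp
    also have "\<dots> = ts 0 \<otimes> (ts e \<otimes> Q i \<oplus> (h \<otimes> d1 \<ominus> u \<otimes> d2 \<oplus> d))"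
      using Fc(3) dc huc Qc[of i] ts_closed[of e] ts_closed[of 0] by algebra
    finally have "\<gamma> i [^] p = ts 0 \<otimes> (ts e \<otimes> Q i \<oplus> (h \<otimes> d1 \<ominus> u \<otimes> d2 \<oplus> d))" .
    moreover have "ts e \<otimes> Q i \<oplus> (h \<otimes> d1 \<ominus> u \<otimes> d2 \<oplus> d) \<in> A0"
      by (intro A0_add A0_diff A0_mult ts_A0 QA huA d(1) d1(1) d2(1))
    ultimately show ?thesis using frobenius_inj[OF \<gamma>A] by blast
  qed
  then obtain \<gamma>' where \<gamma>': "\<And>i. \<gamma>' i \<in> A0" "\<And>i. \<gamma> i = ts 1 \<otimes> \<gamma>' i" by metis
  note rc = A0_closed[OF \<rho>(1)]
  define Z where "Z = hn (\<lambda>i. \<rho> (Suc i)) y M"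
  have Zc: "Z \<in> carrier R" unfolding Z_def using rc xy by (intro horner_closed) auto
  have hr: "hn \<rho> y M = y \<otimes> Z"
  proof -
    have "hn \<rho> y M = hn (\<lambda>i. if i \<le> M then \<rho> i else \<zero>) y (Suc M)"
      using horner_pad[of \<rho> y M "Suc M"] rc xy by simp
    also have "\<dots> = hn \<rho> y (Suc M)" by (rule horner_cong) (use f(2) \<rho>(2) in auto)
    also have "\<dots> = y \<otimes> Z" using \<rho>(2)[OF f(1)] Zc xy by (simp add: Z_def)
    finally show ?thesis .
  qed
  have hy: "h' \<otimes> y = u'" unfolding h'_def y_def u'_def by (rule gs_X)
  have "hn \<gamma> y M = hn (\<lambda>i. ts (Suc e) \<otimes> B' i \<ominus> h' \<otimes> \<rho> i) y M \<oplus> hn (\<lambda>i. u' \<otimes> \<rho> (Suc i)) y M"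
    unfolding \<gamma>_def using B'c rc hu'c xy by (intro horner_add) auto
  also have "hn (\<lambda>i. ts (Suc e) \<otimes> B' i \<ominus> h' \<otimes> \<rho> i) y M
      = hn (\<lambda>i. ts (Suc e) \<otimes> B' i) y M \<ominus> hn (\<lambda>i. h' \<otimes> \<rho> i) y M"
    using B'c rc hu'c xy by (intro horner_diff) auto
  also have "hn (\<lambda>i. ts (Suc e) \<otimes> B' i) y M = ts (Suc e) \<otimes> b"
    unfolding hB[symmetric] using B'c xy by (intro horner_scale) auto
  also have "hn (\<lambda>i. h' \<otimes> \<rho> i) y M = h' \<otimes> (y \<otimes> Z)"
    unfolding hr[symmetric] using rc hu'c xy by (intro horner_scale) auto
  also have "hn (\<lambda>i. u' \<otimes> \<rho> (Suc i)) y M = u' \<otimes> Z"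
    unfolding Z_def using rc hu'c xy by (intro horner_scale) auto
  also have "h' \<otimes> (y \<otimes> Z) = u' \<otimes> Z" using Zc xy hu'c hy by (simp add: m_assoc[symmetric])
  also have "ts (Suc e) \<otimes> b \<ominus> u' \<otimes> Z \<oplus> u' \<otimes> Z = ts (Suc e) \<otimes> b"
    using Zc hu'c b Vc unfolding V_def by (simp add: a_minus_def a_assoc l_neg)
  finally have 1: "hn \<gamma> y M = ts (Suc e) \<otimes> b" .
  have "hn \<gamma> y M = ts 1 \<otimes> hn \<gamma>' y M"
    unfolding \<gamma>'(2) using A0_closed[OF \<gamma>'(1)] xy by (intro horner_scale) auto
  moreover have "hn \<gamma>' y M \<in> Binf n"
    unfolding y_def Binf_def using horner_PX[of \<gamma>' n "Suc l" M] \<gamma>'(1) by blast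
  ultimately show ?thesis using 1 by metis
qed

lemma almost_frobenius_inj:
  assumes b: "b \<in> Binf n" and q: "q \<in> Binf n" and eq: "b [^] p = ts 0 \<otimes> q"
  shows "\<exists>y\<in>Binf n. ts e \<otimes> b = ts 1 \<otimes> y"
proof -
  obtain k where k: "\<And>l. k \<le> l \<Longrightarrow> b \<in> PX n l" using b by (rule Binf_levelE) blast
  obtain k' where k': "\<And>l. k' \<le> l \<Longrightarrow> q \<in> PX n l" using q by (rule Binf_levelE) blast
  obtain y where y: "y \<in> Binf n" "ts (Suc e) \<otimes> b = ts 1 \<otimes> y"
    using almost_frobenius_inj_level[OF k[of "max k k'"] k'[of "max k k'"] eq] by auto
  obtain d where d: "d \<in> A0" "ts e = ts (Suc e) \<otimes> (ts (Suc e) \<otimes> d)" by (rule ts_square)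
  define s where "s = ts (Suc e) \<otimes> d"
  have s: "s \<in> A0" unfolding s_def using d A0_mult ts_A0 by auto
  have "ts e \<otimes> b = s \<otimes> (ts (Suc e) \<otimes> b)"
    unfolding d(2) s_def[symmetric] using A0_closed[OF s] Binf_closed[OF b] by (simp add: m_assoc m_lcomm)
  also have "\<dots> = ts 1 \<otimes> (s \<otimes> y)" unfolding y(2) using A0_closed[OF s] Binf_closed[OF y(1)] by (simp add: m_lcomm)
  finally show ?thesis using Binf_mult[OF A0_Binf[OF s] y(1)] by blast
qed

text \<open>Multiplying by a power of \<open>X n 0 = t^n/g\<close> trades each factor
  \<open>g\<close> needed to clear the denominator for a factor \<open>t^n\<close>.\<close>

lemma subring_bounded:
  assumes V: "subring V R" "A0 \<subseteq> V" "X n 0 \<in> V" and r: "r \<in> carrier R"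
  shows "\<exists>N::nat. ts 0 [^] N \<otimes> r \<in> V"
proof -
  have pow: "X n 0 [^] (j::nat) \<in> V" for j
    by (induction j) (use subringE(3,6)[OF V(1)] V(3) in auto)
  obtain i j :: nat where ij: "ts 0 [^] i \<otimes> (gs 0 [^] j \<otimes> r) \<in> A0" using denominators[OF r] by blast
  have "X n 0 [^] j \<otimes> (ts 0 [^] i \<otimes> (gs 0 [^] j \<otimes> r)) \<in> V"
    using subringE(6)[OF V(1) pow] V(2) ij by blast
  moreover have "X n 0 [^] j \<otimes> (ts 0 [^] i \<otimes> (gs 0 [^] j \<otimes> r)) = ts 0 [^] i \<otimes> ((gs 0 \<otimes> X n 0) [^] j \<otimes> r)"
    using r by (simp add: nat_pow_distrib m_ac)
  moreover have "\<dots> = ts 0 [^] (i + n * j) \<otimes> r"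
    unfolding gs_X using r by (simp add: nat_pow_pow nat_pow_mult[symmetric] m_assoc)
  ultimately show ?thesis by metis
qed

section \<open>Almost closure of \<open>Binf\<close> under roots\<close>

lemma Binf_bounded: "r \<in> carrier R \<Longrightarrow> \<exists>N::nat. ts 0 [^] N \<otimes> r \<in> Binf n"
  by (rule subring_bounded[OF Binf_subring _ X_Binf]) (auto intro: A0_Binf)

text \<open>Some \<open>t^N x\<close> lies in \<open>Binf n\<close>, and the factors
  \<open>ts 1\<close> in it are removed one at a time: the \<open>p\<close>-th power of
  \<open>ts (Suc e) ts 1^(c+1) x\<close> is \<open>t\<close> times an element of
  \<open>Binf n\<close>, so almost injectivity of Frobenius permits division by \<open>ts 1\<close>.
  Carrying the claim for all \<open>e\<close> through the induction keeps the loss arbitrarily small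
  after any number of steps.\<close>

lemma Binf_root_closed:
  assumes x: "x \<in> carrier R" and xp: "x [^] p \<in> Binf n"
  shows "ts e \<otimes> x \<in> Binf n"
proof -
  have t1p: "ts 1 [^] p = ts 0" using ts_root[of 0] by simp
  obtain N :: nat where "ts 0 [^] N \<otimes> x \<in> Binf n" using Binf_bounded[OF x] by blast
  moreover have "ts 0 [^] N = ts 1 [^] (p * N)" by (simp add: t1p[symmetric] nat_pow_pow)
  ultimately have start: "ts 1 [^] (p * N) \<otimes> x \<in> Binf n" by simp
  have step: "\<forall>e. ts e \<otimes> (ts 1 [^] c \<otimes> x) \<in> Binf n" if h: "\<forall>e. ts e \<otimes> (ts 1 [^] Suc c \<otimes> x) \<in> Binf n" for c
  proof
    fix e
    define b where "b = ts (Suc e) \<otimes> (ts 1 [^] Suc c \<otimes> x)"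
    have b: "b \<in> Binf n" using h by (simp add: b_def)
    have "b [^] p = ts (Suc e) [^] p \<otimes> ((ts 1 [^] p) [^] Suc c \<otimes> x [^] p)"
      unfolding b_def using x nat_pow_pow[of "ts 1" p "Suc c"] nat_pow_pow[of "ts 1" "Suc c" p]
      by (simp add: nat_pow_distrib mult.commute del: nat_pow_Suc)
    also have "\<dots> = ts 0 \<otimes> (ts e \<otimes> (ts 0 [^] c \<otimes> x [^] p))"
      unfolding ts_root t1p using x by (simp add: m_ac)
    finally have bp: "b [^] p = ts 0 \<otimes> (ts e \<otimes> (ts 0 [^] c \<otimes> x [^] p))" .
    have "ts e \<otimes> (ts 0 [^] c \<otimes> x [^] p) \<in> Binf n"
      by (intro Binf_mult xp A0_Binf ts_A0 A0_pow)
    then obtain y where y: "y \<in> Binf n" "ts (Suc e) \<otimes> b = ts 1 \<otimes> y"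
      using almost_frobenius_inj[OF b _ bp] by blast
    have "ts 1 \<otimes> (ts (Suc e) \<otimes> (ts (Suc e) \<otimes> (ts 1 [^] c \<otimes> x))) = ts 1 \<otimes> y"
      unfolding y(2)[symmetric] b_def using x by (simp add: m_ac)
    then have eq: "ts (Suc e) \<otimes> (ts (Suc e) \<otimes> (ts 1 [^] c \<otimes> x)) = y"
      using unit_cancel[OF ts_unit[of 1]] x Binf_closed[OF y(1)] by simp
    obtain d where d: "d \<in> A0" "ts e = ts (Suc e) \<otimes> (ts (Suc e) \<otimes> d)" by (rule ts_square)
    have "ts e \<otimes> (ts 1 [^] c \<otimes> x) = d \<otimes> (ts (Suc e) \<otimes> (ts (Suc e) \<otimes> (ts 1 [^] c \<otimes> x)))"
      unfolding d(2) using x A0_closed[OF d(1)] by (simp add: m_ac)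
    then show "ts e \<otimes> (ts 1 [^] c \<otimes> x) \<in> Binf n"
      unfolding eq using Binf_mult[OF A0_Binf[OF d(1)] y(1)] by simp
  qed
  have down: "(\<forall>e. ts e \<otimes> (ts 1 [^] c \<otimes> x) \<in> Binf n) \<longrightarrow> (\<forall>e. ts e \<otimes> x \<in> Binf n)" for c :: nat
  proof (induction c)
    case 0 then show ?case using x by simp
  next
    case (Suc c) then show ?case using step[of c] by blast
  qed
  have "\<forall>e. ts e \<otimes> (ts 1 [^] (p * N) \<otimes> x) \<in> Binf n"
    using Binf_mult[OF A0_Binf[OF ts_A0] start] by blast
  then show ?thesis using down[of "p * N"] by blast
qed

text \<open>Extracting a root of \<open>(ts (Suc e) x)^p = ts e x^p\<close> costs one more
  \<open>ts (Suc e)\<close>, and \<open>ts_square\<close> absorbs the two factors.\<close>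

lemma Binf_root_closed_iter:
  "\<lbrakk>x \<in> carrier R; x [^] (p ^ j) \<in> Binf n\<rbrakk> \<Longrightarrow> ts e \<otimes> x \<in> Binf n"
proof (induction j arbitrary: x e)
  case 0
  then show ?case using Binf_mult[OF A0_Binf[OF ts_A0]] by simp
next
  case (Suc j)
  have "(x [^] p) [^] (p ^ j) \<in> Binf n" using Suc.prems by (simp add: nat_pow_pow)
  then have "ts e \<otimes> x [^] p \<in> Binf n" using Suc.IH[of "x [^] p"] Suc.prems by blast
  then have "(ts (Suc e) \<otimes> x) [^] p \<in> Binf n" using Suc.prems ts_root[of e] by (simp add: nat_pow_distrib)
  then have 1: "ts (Suc e) \<otimes> (ts (Suc e) \<otimes> x) \<in> Binf n" using Binf_root_closed Suc.prems by simp
  obtain d where d: "d \<in> A0" "ts e = ts (Suc e) \<otimes> (ts (Suc e) \<otimes> d)" by (rule ts_square)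
  have "ts e \<otimes> x = d \<otimes> (ts (Suc e) \<otimes> (ts (Suc e) \<otimes> x))"
    unfolding d(2) using Suc.prems A0_closed[OF d(1)] by (simp add: m_ac)
  then show ?case using Binf_mult[OF A0_Binf[OF d(1)] 1] by simp
qed

text \<open>The \<open>p^j\<close>-th power of \<open>t^(N/p^j) s\<close> is
  \<open>t^N s^(p^j)\<close>, which lies in \<open>Binf n\<close>, so \<open>t^((N+1)/p^j) s\<close>
  does too. With \<open>j = e + N + 1\<close> this loss is less than \<open>t^(1/p^e)\<close>,
  because \<open>N + 1 < p^(N+1)\<close>.\<close>

lemma power_bounded_almost_Binf:
  assumes s: "s \<in> carrier R" and bd: "\<And>k. ts 0 [^] (N::nat) \<otimes> s [^] (k::nat) \<in> Binf n"
  shows "ts e \<otimes> s \<in> Binf n"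
proof -
  define j where "j = e + Suc N"
  have "(ts j [^] N \<otimes> s) [^] (p ^ j) = (ts j [^] (p ^ j)) [^] N \<otimes> s [^] (p ^ j)"
    using s by (simp add: nat_pow_distrib nat_pow_pow mult.commute)
  also have "ts j [^] (p ^ j) = ts 0" using ts_pow[of 0 j] by simp
  finally have "(ts j [^] N \<otimes> s) [^] (p ^ j) \<in> Binf n" using bd by simp
  then have 1: "ts j \<otimes> (ts j [^] N \<otimes> s) \<in> Binf n" using Binf_root_closed_iter s by simp
  have "Suc N < p ^ Suc N" using p_gt_1 power_gt_expt[of p "Suc N"] by simp
  then obtain q where q: "p ^ Suc N = Suc N + q" using less_imp_add_positive by metis
  have "ts e = ts j [^] (Suc N + q)" using ts_pow[of e "Suc N"] unfolding j_def q by simp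
  then have "ts e \<otimes> s = ts j [^] q \<otimes> (ts j \<otimes> (ts j [^] N \<otimes> s))"
    using s by (simp add: nat_pow_mult[symmetric] m_ac)
  then show ?thesis using Binf_mult[OF A0_Binf[OF A0_pow[OF ts_A0]] 1] by simp
qed

lemma almost_injective:
  assumes "a \<in> A0" "s \<in> carrier R" "a = ts 0 [^] (m::nat) \<otimes> s" "\<And>e. ts e \<otimes> s \<in> Binf n"
  shows "\<exists>c\<in>A0. ts e \<otimes> a = ts 0 [^] m \<otimes> c"
proof -
  have "ts e \<otimes> s \<in> A0" for e
  proof -
    have c: "ts (Suc e) \<otimes> s \<in> carrier R" using assms by simp
    obtain N :: nat where N: "gs 0 [^] N \<otimes> (ts (Suc e) \<otimes> s) \<in> A0" using Binf_denominator[OF assms(4)] by blast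
    \<comment> \<open>A power of \<open>t\<close> clears the denominator of \<open>s\<close> as
      well, because \<open>t^m s\<close> is the given \<open>a\<close>; this is the second
      hypothesis of \<open>almost_integral\<close>.\<close>
    have "ts 0 [^] m \<otimes> (ts (Suc e) \<otimes> s) = ts (Suc e) \<otimes> a" using assms(2,3) by (simp add: m_lcomm)
    then have "ts 0 [^] m \<otimes> (ts (Suc e) \<otimes> s) \<in> A0" using A0_mult ts_A0 assms(1) by simp
    then have 1: "ts (Suc e) \<otimes> (ts (Suc e) \<otimes> s) \<in> A0" using almost_integral[OF c N] by blast
    obtain d where d: "d \<in> A0" "ts e = ts (Suc e) \<otimes> (ts (Suc e) \<otimes> d)" by (rule ts_square)
    have "ts e \<otimes> s = d \<otimes> (ts (Suc e) \<otimes> (ts (Suc e) \<otimes> s))"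
      unfolding d(2) using assms(2) A0_closed[OF d(1)] by (simp add: m_ac)
    then show ?thesis using A0_mult[OF d(1) 1] by simp
  qed
  moreover have "ts e \<otimes> a = ts 0 [^] m \<otimes> (ts e \<otimes> s)" using assms(2,3) by (simp add: m_lcomm)
  ultimately show ?thesis by blast
qed

section \<open>Roots of \<open>g\<close> against the shift in \<open>n\<close>\<close>

lemma X_shift: "X (n + c) l = ts l [^] c \<otimes> X n l"
  unfolding X_def using gs_unit[of l] by (simp add: nat_pow_mult[symmetric] m_ac)

text \<open>For \<open>x = X (n + p\<^sup>k m) l\<close> the element \<open>gs k\<close> clears the denominator of \<open>x\<^sup>i\<close> when \<open>i \<le> p\<^sup>l\<^sup>-\<^sup>k\<close>, and \<open>x\<^sup>i\<close>
  is a multiple of \<open>ts 0 [^] m\<close> otherwise.\<close>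

lemma gs_root_Binf:
  assumes y: "y \<in> Binf (n + p ^ k * m)"
  shows "\<exists>a\<in>A0. \<exists>z\<in>Binf n. gs k \<otimes> y = a \<oplus> ts 0 [^] m \<otimes> z"
proof -
  \<comment> \<open>The target \<open>A0 + t^m Binf n\<close> is closed under addition, so monomials
    suffice.\<close>
  define T where "T = {a \<oplus> ts 0 [^] m \<otimes> z | a z. a \<in> A0 \<and> z \<in> Binf n}"
  have T_add: "v \<oplus> w \<in> T" if vw: "v \<in> T" "w \<in> T" for v w
  proof -
    obtain a z where 1: "a \<in> A0" "z \<in> Binf n" "v = a \<oplus> ts 0 [^] m \<otimes> z" using vw by (auto simp: T_def)
    obtain b y where 2: "b \<in> A0" "y \<in> Binf n" "w = b \<oplus> ts 0 [^] m \<otimes> y" using vw by (auto simp: T_def)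
    have "v \<oplus> w = (a \<oplus> b) \<oplus> ts 0 [^] m \<otimes> (z \<oplus> y)"
      unfolding 1 2 using 1(1,2) 2(1,2) A0_closed Binf_closed by (simp add: r_distr a_ac)
    then show ?thesis unfolding T_def using A0_add[OF 1(1) 2(1)] Binf_add[OF 1(2) 2(2)] by blast
  qed
  have A0_T: "a \<in> T" if "a \<in> A0" for a
    unfolding T_def using that A0_closed Binf_zero by (intro CollectI exI[of _ a] exI[of _ \<zero>]) auto
  have B_T: "ts 0 [^] m \<otimes> z \<in> T" if "z \<in> Binf n" for z
    unfolding T_def using that A0_zero Binf_closed by (intro CollectI exI[of _ \<zero>] exI[of _ z]) auto
  obtain k0 where "\<And>l. k0 \<le> l \<Longrightarrow> y \<in> PX (n + p ^ k * m) l" using y by (rule Binf_levelE) blast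
  \<comment> \<open>The level is raised to at least \<open>k\<close> so that \<open>gs k\<close> is
    a power of \<open>gs l\<close>.\<close>
  then have "y \<in> PX (n + p ^ k * m) (k + k0)" by simp
  moreover define l where "l = k + k0"
  ultimately obtain N where yN: "y \<in> poly_vals R A0 (X (n + p ^ k * m) l) N" by (auto simp: PX_def)
  define x where "x = X (n + p ^ k * m) l"
  have x: "x \<in> carrier R" by (simp add: x_def)
  interpret E: subring_elem R A0 x unfolding x_def by (rule subring_elem_X)
  define P where "P = p ^ k0"
  have gP: "gs k = gs l [^] P" unfolding l_def P_def using gs_pow[of k k0] by simp
  have mono: "gs k \<otimes> (w \<otimes> x [^] i) \<in> T" if w: "w \<in> A0" for w and i :: nat
  proof (cases "i \<le> P")
    case True
    have "gs k = gs l [^] (P - i) \<otimes> gs l [^] i" unfolding gP using True by (simp add: nat_pow_mult)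
    then have "gs k \<otimes> (w \<otimes> x [^] i) = w \<otimes> (gs l [^] (P - i) \<otimes> (gs l \<otimes> x) [^] i)"
      using A0_closed[OF w] x by (simp add: nat_pow_distrib m_ac)
    also have "\<dots> \<in> A0" unfolding x_def gs_X using w by (intro A0_mult A0_pow gs_A0 ts_A0)
    finally show ?thesis by (rule A0_T)
  next
    case False
    \<comment> \<open>Passing from \<open>n + p^k m\<close> to \<open>n\<close> pulls out
      \<open>p^k m i\<close> factors \<open>ts l\<close>; since \<open>i > p^(l-k)\<close>, at least
      \<open>m p^l\<close> of them are available, which make up \<open>t^m\<close>, and
      \<open>r\<close> counts the rest.\<close>
    define r where "r = p ^ k * m * i - m * p ^ l"
    have "m * p ^ l = p ^ k * m * P" by (simp add: l_def P_def power_add)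
    also have "\<dots> \<le> p ^ k * m * i" using False by simp
    finally have le: "p ^ k * m * i = p ^ l * m + r" by (simp add: r_def mult.commute)
    have "x [^] i = ts l [^] (p ^ k * m * i) \<otimes> X n l [^] i"
      unfolding x_def X_shift by (simp add: nat_pow_distrib nat_pow_pow)
    also have "ts l [^] (p ^ k * m * i) = (ts l [^] (p ^ l)) [^] m \<otimes> ts l [^] r"
      unfolding le by (simp add: nat_pow_mult[symmetric] nat_pow_pow)
    also have "ts l [^] (p ^ l) = ts 0" using ts_pow[of 0 l] by simp
    finally have "gs k \<otimes> (w \<otimes> x [^] i) = ts 0 [^] m \<otimes> (gs k \<otimes> (w \<otimes> (ts l [^] r \<otimes> X n l [^] i)))"
      using A0_closed[OF w] by (simp add: m_ac)
    moreover have "gs k \<otimes> (w \<otimes> (ts l [^] r \<otimes> X n l [^] i)) \<in> Binf n"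
      using w by (intro Binf_mult A0_Binf gs_A0 A0_pow ts_A0 Binf_pow X_Binf)
    ultimately show ?thesis using B_T by simp
  qed
  have "z \<in> poly_vals R A0 x N \<Longrightarrow> gs k \<otimes> z \<in> T" for z N
  proof (induction N arbitrary: z)
    case 0
    then show ?case using mono[of z 0] A0_closed by simp
  next
    case (Suc N)
    obtain v w where v: "v \<in> poly_vals R A0 x N" "w \<in> A0" "z = v \<oplus> w \<otimes> x [^] Suc N"
      using E.P_top[OF Suc.prems] by blast
    have "w \<otimes> x [^] Suc N \<in> carrier R" using A0_closed[OF v(2)] x by simp
    then have "gs k \<otimes> z = gs k \<otimes> v \<oplus> gs k \<otimes> (w \<otimes> x [^] Suc N)"
      unfolding v(3) using E.P_closed[OF v(1)] r_distr[of v "w \<otimes> x [^] Suc N" "gs k"] gs_closed by blast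
    then show ?case using T_add[OF Suc.IH[OF v(1)] mono[OF v(2), of "Suc N"]] by argo
  qed
  then have "gs k \<otimes> y \<in> T" using yN unfolding x_def by blast
  then show ?thesis by (auto simp: T_def)
qed

end

section \<open>Flatness\<close>

lemma keys_minus_minus:
  "Poly_Mapping.keys (a - b - c) \<subseteq> Poly_Mapping.keys a \<union> Poly_Mapping.keys b \<union> Poly_Mapping.keys (c :: 'a \<Rightarrow>\<^sub>0 int)"
  using keys_diff[of "a - b" c] keys_diff[of a b] by blast

lemma tensor_relations_cases:
  assumes "z \<in> tensor_relations R M N"
  obtains x x' y where "x \<in> carrier M" "x' \<in> carrier M" "y \<in> carrier N"
      "z = frag_of (x \<oplus>\<^bsub>M\<^esub> x', y) - frag_of (x, y) - frag_of (x', y)"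
    | x y y' where "x \<in> carrier M" "y \<in> carrier N" "y' \<in> carrier N"
      "z = frag_of (x, y \<oplus>\<^bsub>N\<^esub> y') - frag_of (x, y) - frag_of (x, y')"
    | r x y where "r \<in> carrier R" "x \<in> carrier M" "y \<in> carrier N"
      "z = frag_of (r \<odot>\<^bsub>M\<^esub> x, y) - frag_of (x, r \<odot>\<^bsub>N\<^esub> y)"
  using assms unfolding tensor_relations_def
  by (elim UnE CollectE exE conjE) (rule that(1) that(2) that(3); assumption)+

text \<open>If \<open>t \<odot> a = 0\<close> then \<open>1 \<otimes> a\<close> is killed by the map induced by multiplication by \<open>t\<close>.\<close>

lemma flat_module_torsion_free:
  fixes V :: "'k ring" and A :: "('k, 'a) module"
  assumes flat: "flat_module V A" and V: "cring V" and t: "t \<in> carrier V"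
    and reg: "\<And>x. \<lbrakk>x \<in> carrier V; t \<otimes>\<^bsub>V\<^esub> x = \<zero>\<^bsub>V\<^esub>\<rbrakk> \<Longrightarrow> x = \<zero>\<^bsub>V\<^esub>"
    and a: "a \<in> carrier A" "t \<odot>\<^bsub>A\<^esub> a = \<zero>\<^bsub>A\<^esub>"
  shows "a = \<zero>\<^bsub>A\<^esub>"
proof -
  interpret V: cring V by (rule V)
  interpret A: Module.module V A using flat by (simp add: flat_module_def)
  define N :: "('k, 'k) module" where "N = as_module id V"
  have N: "carrier N = carrier V" "\<And>x y. x \<oplus>\<^bsub>N\<^esub> y = x \<oplus>\<^bsub>V\<^esub> y" "\<And>x y. x \<odot>\<^bsub>N\<^esub> y = x \<otimes>\<^bsub>V\<^esub> y" "\<zero>\<^bsub>N\<^esub> = \<zero>\<^bsub>V\<^esub>"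
    by (simp_all add: N_def as_module_def)
  have modN: "Module.module V N"
  proof (rule moduleI)
    show "cring V" by (rule V)
    show "abelian_group N"
    proof (rule abelian_groupI)
      fix x assume "x \<in> carrier N"
      then show "\<exists>y\<in>carrier N. y \<oplus>\<^bsub>N\<^esub> x = \<zero>\<^bsub>N\<^esub>"
        unfolding N by (intro bexI[of _ "\<ominus>\<^bsub>V\<^esub> x"]) (auto simp: V.l_neg)
    qed (auto simp: N V.a_assoc intro: V.a_comm)
  qed (auto simp: N V.l_distr V.r_distr V.m_assoc)
  define f where "f = (\<lambda>x. t \<otimes>\<^bsub>V\<^esub> x)"
  have f: "f \<in> module_homs V N N"
    unfolding module_homs_def f_def using t by (auto simp: N V.r_distr V.m_lcomm)
  have finj: "inj_on f (carrier N)"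
  proof (rule inj_onI)
    fix x y assume xy: "x \<in> carrier N" "y \<in> carrier N" "f x = f y"
    then have "t \<otimes>\<^bsub>V\<^esub> (x \<ominus>\<^bsub>V\<^esub> y) = \<zero>\<^bsub>V\<^esub>"
      using t by (simp add: f_def N a_minus_def V.r_distr V.r_minus V.r_neg)
    then have "x \<ominus>\<^bsub>V\<^esub> y = \<zero>\<^bsub>V\<^esub>" using reg xy by (simp add: N)
    then show "x = y" using xy by (simp add: N)
  qed
  define F where "F = free_Abelian_group (carrier N \<times> carrier A)"
  define T where "T = tensor_subgroup V N A"
  have rel: "tensor_relations V N A \<subseteq> carrier F"
    unfolding F_def tensor_relations_def
    by (auto simp: N dest!: subsetD[OF keys_minus_minus] subsetD[OF keys_diff])
  interpret F: group F unfolding F_def by simp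
  have Tsub: "subgroup T F"
    unfolding T_def tensor_subgroup_def F_def[symmetric] by (rule F.generate_is_subgroup[OF rel])
  \<comment> \<open>The lift of \<open>f \<otimes> id\<close> to the free group; it descends because
    it maps relations to relations.\<close>
  define \<phi> where "\<phi> = frag_extend (\<lambda>(x, y::'a). frag_of (f x, y))"
  have \<phi>of: "\<phi> (frag_of (x, y)) = frag_of (f x, y)" for x y by (simp add: \<phi>_def)
  have \<phi>diff: "\<phi> (z - w) = \<phi> z - \<phi> w" and \<phi>add: "\<phi> (z + w) = \<phi> z + \<phi> w" and \<phi>minus: "\<phi> (- z) = - \<phi> z"
    and \<phi>0: "\<phi> 0 = 0" for z w
    by (simp_all add: \<phi>_def frag_extend_diff frag_extend_add frag_extend_minus)
  have fN: "f x \<in> carrier N" "f (x \<oplus>\<^bsub>N\<^esub> y) = f x \<oplus>\<^bsub>N\<^esub> f y" "r \<in> carrier V \<Longrightarrow> f (r \<odot>\<^bsub>N\<^esub> x) = r \<odot>\<^bsub>N\<^esub> f x"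
    if "x \<in> carrier N" "y \<in> carrier N" for x y r
    using f that by (auto simp: module_homs_def)
  have \<phi>rel: "\<phi> z \<in> tensor_relations V N A" if "z \<in> tensor_relations V N A" for z
  proof -
    from that show ?thesis
    proof (cases rule: tensor_relations_cases)
      case (1 x x' y)
      then have "\<phi> z = frag_of (f x \<oplus>\<^bsub>N\<^esub> f x', y) - frag_of (f x, y) - frag_of (f x', y)"
        using fN by (simp add: \<phi>diff \<phi>of)
      then show ?thesis unfolding tensor_relations_def using 1 fN by blast
    next
      case (2 x y y')
      then have "\<phi> z = frag_of (f x, y \<oplus>\<^bsub>A\<^esub> y') - frag_of (f x, y) - frag_of (f x, y')"
        by (simp add: \<phi>diff \<phi>of)
      then show ?thesis unfolding tensor_relations_def using 2 fN by blast
    next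
      case (3 r x y)
      then have "\<phi> z = frag_of (r \<odot>\<^bsub>N\<^esub> f x, y) - frag_of (f x, r \<odot>\<^bsub>A\<^esub> y)"
        using fN by (simp add: \<phi>diff \<phi>of)
      then show ?thesis unfolding tensor_relations_def using 3 fN by blast
    qed
  qed
  have \<phi>T: "\<phi> z \<in> T" if "z \<in> T" for z
    using that unfolding T_def tensor_subgroup_def F_def[symmetric]
  proof (induction rule: generate.induct)
    case one
    then show ?case using generate.one[of F] \<phi>0 by (simp add: F_def)
  next
    case (incl h)
    then show ?case using \<phi>rel generate.incl by metis
  next
    case (inv h)
    have "h \<in> carrier F" "\<phi> h \<in> carrier F" using rel \<phi>rel inv by blast+
    then have "inv\<^bsub>F\<^esub> h = - h" "inv\<^bsub>F\<^esub> \<phi> h = - \<phi> h" by (simp_all add: F_def)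
    then show ?case using generate.inv[of "\<phi> h" _ F] \<phi>rel[OF inv] \<phi>minus by metis
  next
    case (eng h1 h2)
    then show ?case using generate.eng[of "\<phi> h1" F _ "\<phi> h2"] \<phi>add by (simp add: F_def)
  qed
  define u where "u = frag_of (\<one>\<^bsub>V\<^esub>, a)"
  have uF: "u \<in> carrier F" unfolding u_def F_def using a by (simp add: N)
  have relT: "z \<in> T" if "z \<in> tensor_relations V N A" for z
    unfolding T_def tensor_subgroup_def using that generate.incl by metis
  have Tadd: "z + w \<in> T" if "z \<in> T" "w \<in> T" for z w
    using subgroup.m_closed[OF Tsub that] by (simp add: F_def)
  have Tinv: "- z \<in> T" if "z \<in> T" for z
    using subgroup.m_inv_closed[OF Tsub that] subgroup.mem_carrier[OF Tsub that] by (simp add: F_def)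
  have T0: "0 \<in> T" using subgroup.one_closed[OF Tsub] by (simp add: F_def)
  have "\<phi> u \<in> T"
  proof -
    \<comment> \<open>The biadditivity relation for \<open>0 + 0 = 0\<close> is minus the generator
      \<open>(1, 0)\<close>, so that generator lies in \<open>T\<close>. Hence
      \<open>t \<otimes> a\<close>, which equals \<open>1 \<otimes> t a\<close>, is zero.\<close>
    have 1: "frag_of (\<one>\<^bsub>V\<^esub>, \<zero>\<^bsub>A\<^esub> \<oplus>\<^bsub>A\<^esub> \<zero>\<^bsub>A\<^esub>) - frag_of (\<one>\<^bsub>V\<^esub>, \<zero>\<^bsub>A\<^esub>) - frag_of (\<one>\<^bsub>V\<^esub>, \<zero>\<^bsub>A\<^esub>) \<in> T"
      by (rule relT) (unfold tensor_relations_def, use N in blast)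
    then have 2: "frag_of (\<one>\<^bsub>V\<^esub>, \<zero>\<^bsub>A\<^esub>) \<in> T" using Tinv[OF 1] by simp
    have "frag_of (t \<odot>\<^bsub>N\<^esub> \<one>\<^bsub>V\<^esub>, a) - frag_of (\<one>\<^bsub>V\<^esub>, t \<odot>\<^bsub>A\<^esub> a) \<in> T"
      by (rule relT) (unfold tensor_relations_def, use N t a in blast)
    from Tadd[OF this 2] show ?thesis using a t by (simp add: u_def \<phi>of f_def N)
  qed
  have coset: "T #>\<^bsub>F\<^esub> z = T" if "z \<in> T" for z
    using subgroup.rcos_const[OF Tsub F.is_group that] .
  have map: "tensor_map_id V N A f Z = T" if Z: "Z = T #>\<^bsub>F\<^esub> z" "\<phi> z \<in> T" for Z z
  proof -
    have "\<phi> x \<in> T" if xZ: "x \<in> Z" for x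
    proof -
      obtain y where "y \<in> T" "x = y + z" using xZ Z by (auto simp: r_coset_def F_def)
      then show ?thesis using \<phi>T \<phi>add Tadd Z(2) by simp
    qed
    moreover have "z \<in> Z" using T0 Z by (auto simp: r_coset_def F_def)
    ultimately show ?thesis
      unfolding tensor_map_id_def F_def[symmetric] T_def[symmetric] \<phi>_def[symmetric] using coset by blast
  qed
  have car: "T #>\<^bsub>F\<^esub> z \<in> carrier (tensor_product V N A)" if "z \<in> carrier F" for z
    unfolding tensor_product_def F_def[symmetric] T_def[symmetric] FactGroup_def RCOSETS_def using that by auto
  have inj: "inj_on (tensor_map_id V N A f) (carrier (tensor_product V N A))"
    using flat modN f finj unfolding flat_module_def by blast
  have "0 \<in> carrier F" by (simp add: F_def)
  moreover have "tensor_map_id V N A f (T #>\<^bsub>F\<^esub> u) = tensor_map_id V N A f (T #>\<^bsub>F\<^esub> 0)"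
    using map[OF refl \<open>\<phi> u \<in> T\<close>] map[OF refl, of 0] \<phi>0 T0 by simp
  ultimately have "T #>\<^bsub>F\<^esub> u = T #>\<^bsub>F\<^esub> 0" using inj_onD[OF inj] car uF by blast
  then have uT: "u \<in> T" using F.coset_join1[OF _ uF Tsub] coset[OF T0] by simp
  \<comment> \<open>To conclude \<open>a = 0\<close> from \<open>1 \<otimes> a = 0\<close>, the
    action map \<open>V \<otimes> A \<rightarrow> A\<close> is built on the free group as \<psi> and
    shown to vanish on \<open>T\<close>.\<close>
  have AG: "group (add_monoid A)" using A.a_comm_group by (simp add: comm_group_def)
  have "(\<lambda>(x, y). x \<odot>\<^bsub>A\<^esub> y) ` (carrier N \<times> carrier A) \<subseteq> carrier (add_monoid A)"
    by (auto simp: N)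
  then obtain \<psi> where \<psi>: "\<psi> \<in> hom F (add_monoid A)"
    "\<And>z. z \<in> carrier N \<times> carrier A \<Longrightarrow> \<psi> (frag_of z) = (\<lambda>(x, y). x \<odot>\<^bsub>A\<^esub> y) z"
    using comm_group.free_Abelian_group_universal[OF A.a_comm_group] unfolding F_def by metis
  interpret \<psi>: group_hom F "add_monoid A" \<psi>
    by (intro group_hom.intro group_hom_axioms.intro F.is_group AG \<psi>(1))
  have \<psi>of: "\<psi> (frag_of (x, y)) = x \<odot>\<^bsub>A\<^esub> y" if "x \<in> carrier V" "y \<in> carrier A" for x y
    using \<psi>(2)[of "(x, y)"] that by (simp add: N)
  have \<psi>diff: "\<psi> (z - w) = \<psi> z \<ominus>\<^bsub>A\<^esub> \<psi> w" if "z \<in> carrier F" "w \<in> carrier F" for z w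
  proof -
    have "z - w = z \<otimes>\<^bsub>F\<^esub> inv\<^bsub>F\<^esub> w" using that by (simp add: F_def)
    then have "\<psi> (z - w) = \<psi> z \<otimes>\<^bsub>add_monoid A\<^esub> inv\<^bsub>add_monoid A\<^esub> \<psi> w" using that by simp
    then show ?thesis by (simp add: a_minus_def a_inv_def)
  qed
  have fragF: "frag_of (x, y) \<in> carrier F" if "x \<in> carrier V" "y \<in> carrier A" for x y
    using that by (simp add: F_def N)
  have \<psi>rel: "\<psi> z = \<zero>\<^bsub>A\<^esub>" if "z \<in> tensor_relations V N A" for z
  proof -
    have dc: "frag_of (x, y) - frag_of (x', y') \<in> carrier F"
      if "x \<in> carrier V" "y \<in> carrier A" "x' \<in> carrier V" "y' \<in> carrier A" for x y x' y'
      using that by (auto simp: F_def N dest!: subsetD[OF keys_diff])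
    have cancel: "(x \<oplus>\<^bsub>A\<^esub> y) \<ominus>\<^bsub>A\<^esub> x \<ominus>\<^bsub>A\<^esub> y = \<zero>\<^bsub>A\<^esub>" if "x \<in> carrier A" "y \<in> carrier A" for x y
    proof -
      have "(x \<oplus>\<^bsub>A\<^esub> y) \<ominus>\<^bsub>A\<^esub> x = (y \<oplus>\<^bsub>A\<^esub> x) \<ominus>\<^bsub>A\<^esub> x" using that by (simp add: A.a_comm)
      also have "\<dots> = y" using that by (simp add: a_minus_def A.a_assoc A.r_neg)
      finally show ?thesis using that by (simp add: a_minus_def A.r_neg)
    qed
    from that show ?thesis
    proof (cases rule: tensor_relations_cases)
      case (1 x x' y)
      then show ?thesis using dc cancel[of "x \<odot>\<^bsub>A\<^esub> y" "x' \<odot>\<^bsub>A\<^esub> y"]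
        by (simp add: \<psi>diff fragF \<psi>of N A.smult_l_distr)
    next
      case (2 x y y')
      then show ?thesis using dc cancel[of "x \<odot>\<^bsub>A\<^esub> y" "x \<odot>\<^bsub>A\<^esub> y'"]
        by (simp add: \<psi>diff fragF \<psi>of N A.smult_r_distr)
    next
      case (3 r x y)
      then have "(r \<otimes>\<^bsub>V\<^esub> x) \<odot>\<^bsub>A\<^esub> y = x \<odot>\<^bsub>A\<^esub> (r \<odot>\<^bsub>A\<^esub> y)"
        using A.smult_assoc1[of x r y] by (simp add: N V.m_comm)
      then show ?thesis using 3 by (simp add: \<psi>diff fragF \<psi>of N a_minus_def A.r_neg)
    qed
  qed
  have "\<psi> z = \<zero>\<^bsub>A\<^esub> \<and> z \<in> carrier F" if "z \<in> T" for z
    using that unfolding T_def tensor_subgroup_def F_def[symmetric]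
  proof (induction rule: generate.induct)
    case one
    then show ?case using \<psi>.hom_one by simp
  next
    case (incl h)
    then show ?case using \<psi>rel rel by blast
  next
    case (inv h)
    then have "h \<in> carrier F" "\<psi> h = \<zero>\<^bsub>A\<^esub>" using \<psi>rel rel by blast+
    then show ?case using \<psi>.hom_inv[of h] monoid.inv_one[OF group.is_monoid[OF AG]] by simp
  next
    case (eng h1 h2)
    then show ?case using \<psi>.hom_mult[of h1 h2] by simp
  qed
  then have "\<psi> u = \<zero>\<^bsub>A\<^esub>" using uT by blast
  then show ?thesis using \<psi>of[of "\<one>\<^bsub>V\<^esub>" a] a by (simp add: u_def)
qed

section \<open>Rational localizations of an integral perfectoid algebra\<close>

lemma generate_mono: assumes "H \<subseteq> K" "x \<in> generate G H" shows "x \<in> generate G K"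
  using assms(2) by (induction rule: generate.induct) (use assms(1) in \<open>auto intro: generate.intros\<close>)

lemma hom_Units: assumes h: "ring_hom_cring P Q h" and u: "u \<in> Units P" shows "h u \<in> Units Q"
proof -
  interpret h: ring_hom_cring P Q h by (rule h)
  obtain v where v: "v \<in> carrier P" "u \<in> carrier P" "u \<otimes>\<^bsub>P\<^esub> v = \<one>\<^bsub>P\<^esub>" "v \<otimes>\<^bsub>P\<^esub> u = \<one>\<^bsub>P\<^esub>"
    using u by (auto simp: Units_def)
  have "h u \<otimes>\<^bsub>Q\<^esub> h v = \<one>\<^bsub>Q\<^esub>" "h v \<otimes>\<^bsub>Q\<^esub> h u = \<one>\<^bsub>Q\<^esub>" using v h.hom_mult h.hom_one by metis+
  then show ?thesis using v unfolding Units_def by auto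
qed

text \<open>The facts of \<open>perfectoid_chart\<close> stated in \<open>A\<close> itself, together
  with regularity of \<open>t\<close> and \<open>g\<close>, which embeds \<open>A\<close> into
  \<open>A[1/tg]\<close>. The base field no longer appears: \<open>ts\<close> are the images in
  \<open>A\<close> of the chosen roots.\<close>

locale almost_perfectoid = cring A for A (structure) +
  fixes p :: nat and ts gs :: "nat \<Rightarrow> 'a"
  assumes p_prime: "prime p"
    and ts_closed [simp]: "ts k \<in> carrier A" and ts_root: "ts (Suc k) [^] p = ts k"
    and gs_closed [simp]: "gs k \<in> carrier A" and gs_root: "gs (Suc k) [^] p = gs k"
    and t_regular: "\<lbrakk>a \<in> carrier A; ts 0 \<otimes> a = \<zero>\<rbrakk> \<Longrightarrow> a = \<zero>"
    and g_regular: "\<lbrakk>a \<in> carrier A; gs 0 \<otimes> a = \<zero>\<rbrakk> \<Longrightarrow> a = \<zero>"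
    and frobenius_inj: "\<lbrakk>a \<in> carrier A; b \<in> carrier A; a [^] p = ts 0 \<otimes> b\<rbrakk> \<Longrightarrow> \<exists>c\<in>carrier A. a = ts 1 \<otimes> c"
    and frobenius_surj: "a \<in> carrier A \<Longrightarrow> \<exists>b\<in>carrier A. \<exists>c\<in>carrier A. a = b [^] p \<oplus> ts 0 \<otimes> c"
    and p_multiple: "\<exists>c\<in>carrier A. [p] \<cdot> \<one> = ts 0 \<otimes> c"
    and almost_nonzerodivisor:
      "\<lbrakk>a \<in> carrier A; b \<in> carrier A; gs 0 \<otimes> a = ts 0 [^] (m::nat) \<otimes> b\<rbrakk> \<Longrightarrow>
        \<exists>c\<in>carrier A. ts k \<otimes> a = ts 0 [^] m \<otimes> c"
begin

section \<open>The embedding of \<open>A\<close> into \<open>A[1/t][1/g]\<close>\<close>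

abbreviation t where "t \<equiv> ts 0"
abbreviation g where "g \<equiv> gs 0"
abbreviation R0 where "R0 \<equiv> invert A t"
abbreviation \<iota>0 where "\<iota>0 \<equiv> invert_map A t"
abbreviation R where "R \<equiv> rat_loc R0 (\<iota>0 g)"
abbreviation \<iota>1 where "\<iota>1 \<equiv> to_loc R0 (powers R0 (\<iota>0 g))"
definition \<iota> where "\<iota> a = \<iota>1 (\<iota>0 a)"

lemma pow_regular:
  assumes "h \<in> carrier A" "\<And>a. \<lbrakk>a \<in> carrier A; h \<otimes> a = \<zero>\<rbrakk> \<Longrightarrow> a = \<zero>"
  shows "\<lbrakk>a \<in> carrier A; h [^] (n::nat) \<otimes> a = \<zero>\<rbrakk> \<Longrightarrow> a = \<zero>"
proof (induction n arbitrary: a)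
  case (Suc n)
  have "h [^] n \<otimes> (h \<otimes> a) = \<zero>" using Suc.prems assms(1) by (simp add: m_assoc)
  then have "h \<otimes> a = \<zero>" using Suc.IH[of "h \<otimes> a"] Suc.prems(1) assms(1) by simp
  then show ?case by (rule assms(2)[OF Suc.prems(1)])
qed simp

sublocale L0: localizing_set A "powers A t" by (rule localizing_set_powers) simp

lemma R0_eq: "R0 = L0.L" and \<iota>0_eq: "\<iota>0 = L0.to" by (simp_all add: invert_def invert_map_def)

lemma R0_cring: "cring R0" unfolding R0_eq by (rule L0.localization_cring)

lemma \<iota>0_hom: "ring_hom_cring A R0 \<iota>0" unfolding R0_eq \<iota>0_eq by (rule L0.to_loc_cring_hom)

lemma \<iota>0_inj: "inj_on \<iota>0 (carrier A)"
  unfolding \<iota>0_eq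
proof (rule L0.to_loc_inj)
  fix s a assume s: "s \<in> powers A t" and a: "a \<in> carrier A" "s \<otimes> a = \<zero>"
  obtain n :: nat where n: "s = t [^] n" using s by (auto simp: powers_def)
  show "a = \<zero>" using pow_regular[OF ts_closed t_regular a(1), of 0 n] a(2) n by simp
qed

lemma \<iota>0_t_unit: "\<iota>0 t \<in> Units R0"
proof -
  have "t [^] (1::nat) \<in> powers A t" unfolding powers_def by blast
  then show ?thesis unfolding R0_eq \<iota>0_eq by (intro L0.to_loc_Units) simp
qed

lemma R0_denominator: assumes "x \<in> carrier R0"
  shows "\<exists>(k::nat). \<exists>a\<in>carrier A. \<iota>0 t [^]\<^bsub>R0\<^esub> k \<otimes>\<^bsub>R0\<^esub> x = \<iota>0 a"
proof -
  interpret \<iota>0: ring_hom_cring A R0 \<iota>0 by (rule \<iota>0_hom)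
  obtain a s where a: "a \<in> carrier A" "s \<in> powers A t" "x = L0.fr a s"
    using assms unfolding R0_eq by (rule L0.loc_carrierE)
  then obtain k :: nat where k: "s = t [^] k" by (auto simp: powers_def)
  have "\<iota>0 s \<otimes>\<^bsub>R0\<^esub> x = \<iota>0 a" unfolding a(3) R0_eq \<iota>0_eq by (rule L0.frac_eq_to[OF a(1,2)])
  moreover have "\<iota>0 s = \<iota>0 t [^]\<^bsub>R0\<^esub> k" unfolding k by simp
  ultimately show ?thesis using a(1) by metis
qed

lemma \<iota>0_g_closed: "\<iota>0 g \<in> carrier R0"
proof -
  interpret \<iota>0: ring_hom_cring A R0 \<iota>0 by (rule \<iota>0_hom)
  show ?thesis by simp
qed

sublocale L1: localizing_set R0 "powers R0 (\<iota>0 g)"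
  by (rule cring.localizing_set_powers[OF R0_cring \<iota>0_g_closed])

lemma R_eq: "R = L1.L" by (simp add: rat_loc_def)

lemma R_cring: "cring R" unfolding R_eq by (rule L1.localization_cring)

lemma \<iota>1_hom: "ring_hom_cring R0 R \<iota>1" unfolding R_eq by (rule L1.to_loc_cring_hom)

lemma \<iota>_hom: "ring_hom_cring A R \<iota>"
proof -
  interpret \<iota>0: ring_hom_cring A R0 \<iota>0 by (rule \<iota>0_hom)
  interpret \<iota>1: ring_hom_cring R0 R \<iota>1 by (rule \<iota>1_hom)
  show ?thesis
    by (intro ring_hom_cring.intro ring_hom_cring_axioms.intro is_cring R_cring ring_hom_memI)
      (auto simp: \<iota>_def)
qed

text \<open>\<open>g\<close> stays regular in \<open>A[1/t]\<close>: clear the power of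
  \<open>t\<close> in the denominator and use regularity in \<open>A\<close>.\<close>

lemma \<iota>1_inj: "inj_on \<iota>1 (carrier R0)"
proof (rule L1.to_loc_inj)
  interpret \<iota>0: ring_hom_cring A R0 \<iota>0 by (rule \<iota>0_hom)
  fix s x assume s: "s \<in> powers R0 (\<iota>0 g)" and x: "x \<in> carrier R0" and sx: "s \<otimes>\<^bsub>R0\<^esub> x = \<zero>\<^bsub>R0\<^esub>"
  obtain j :: nat where j: "s = \<iota>0 g [^]\<^bsub>R0\<^esub> j" using s by (auto simp: powers_def)
  obtain k :: nat and a where a: "a \<in> carrier A" "\<iota>0 t [^]\<^bsub>R0\<^esub> k \<otimes>\<^bsub>R0\<^esub> x = \<iota>0 a" using R0_denominator[OF x] by blast
  have sc: "s \<in> carrier R0" unfolding j by simp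
  have tk: "\<iota>0 t [^]\<^bsub>R0\<^esub> k \<in> Units R0" using L1.Units_pow_closed \<iota>0_t_unit by blast
  have "\<iota>0 (g [^] j \<otimes> a) = s \<otimes>\<^bsub>R0\<^esub> (\<iota>0 t [^]\<^bsub>R0\<^esub> k \<otimes>\<^bsub>R0\<^esub> x)" using a by (simp add: j)
  also have "\<dots> = \<iota>0 t [^]\<^bsub>R0\<^esub> k \<otimes>\<^bsub>R0\<^esub> (s \<otimes>\<^bsub>R0\<^esub> x)" using x sc by (intro L1.m_lcomm) auto
  also have "\<dots> = \<iota>0 \<zero>" unfolding sx by simp
  finally have "g [^] j \<otimes> a = \<zero>" using inj_onD[OF \<iota>0_inj] a by simp
  then have "a = \<zero>" using pow_regular[OF gs_closed g_regular a(1), of 0 j] by simp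
  then have "\<iota>0 t [^]\<^bsub>R0\<^esub> k \<otimes>\<^bsub>R0\<^esub> x = \<iota>0 t [^]\<^bsub>R0\<^esub> k \<otimes>\<^bsub>R0\<^esub> \<zero>\<^bsub>R0\<^esub>" using a(2) by simp
  then show "x = \<zero>\<^bsub>R0\<^esub>" using L1.Units_l_cancel[OF tk x L1.zero_closed] by blast
qed

lemma \<iota>_inj: "inj_on \<iota> (carrier A)"
proof -
  interpret \<iota>0: ring_hom_cring A R0 \<iota>0 by (rule \<iota>0_hom)
  show ?thesis using \<iota>0_inj \<iota>1_inj unfolding \<iota>_def inj_on_def by simp
qed

lemma \<iota>_eqD: "\<lbrakk>\<iota> a = \<iota> b; a \<in> carrier A; b \<in> carrier A\<rbrakk> \<Longrightarrow> a = b"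
  using \<iota>_inj by (auto dest: inj_onD)

lemma \<iota>1_g_unit: "\<iota>1 (\<iota>0 g) \<in> Units R"
proof -
  have "\<iota>0 g [^]\<^bsub>R0\<^esub> (1::nat) \<in> powers R0 (\<iota>0 g)" unfolding powers_def by blast
  then show ?thesis unfolding R_eq using \<iota>0_g_closed by (intro L1.to_loc_Units) simp
qed

abbreviation A0 where "A0 \<equiv> \<iota> ` carrier A"

lemma chart: "perfectoid_chart R A0 p (\<lambda>k. \<iota> (ts k)) (\<lambda>k. \<iota> (gs k))"
proof -
  interpret R: cring R by (rule R_cring)
  interpret \<iota>0: ring_hom_cring A R0 \<iota>0 by (rule \<iota>0_hom)
  interpret \<iota>1: ring_hom_cring R0 R \<iota>1 by (rule \<iota>1_hom)
  interpret \<iota>: ring_hom_cring A R \<iota> by (rule \<iota>_hom)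
  have sub: "subring A0 R"
    by (rule ring_hom_ring.img_is_subring[OF ring_hom_ringI2[OF ring_axioms R.ring_axioms \<iota>.homh] carrier_is_subring])
  show ?thesis
  proof (intro perfectoid_chart.intro perfectoid_chart_axioms.intro R_cring p_prime sub)
    show "\<iota> (ts k) \<in> A0" "\<iota> (gs k) \<in> A0" for k by auto
    show "\<iota> (ts (Suc k)) [^]\<^bsub>R\<^esub> p = \<iota> (ts k)" for k
      using \<iota>.hom_pow[of "ts (Suc k)" p] ts_root[of k] by simp
    show "\<iota> (gs (Suc k)) [^]\<^bsub>R\<^esub> p = \<iota> (gs k)" for k
      using \<iota>.hom_pow[of "gs (Suc k)" p] gs_root[of k] by simp
    show "\<iota> (ts 0) \<in> Units R" unfolding \<iota>_def by (rule hom_Units[OF \<iota>1_hom \<iota>0_t_unit])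
    show "\<iota> (gs 0) \<in> Units R" unfolding \<iota>_def by (rule \<iota>1_g_unit)
    show "\<exists>c\<in>A0. a = \<iota> (ts 1) \<otimes>\<^bsub>R\<^esub> c"
      if h: "a \<in> A0" "b \<in> A0" "a [^]\<^bsub>R\<^esub> p = \<iota> (ts 0) \<otimes>\<^bsub>R\<^esub> b" for a b
    proof -
      obtain a' b' where ab: "a' \<in> carrier A" "b' \<in> carrier A" "a = \<iota> a'" "b = \<iota> b'" using h by blast
      have "\<iota> (a' [^] p) = \<iota> (t \<otimes> b')" using h(3) ab by simp
      then have "a' [^] p = t \<otimes> b'" using \<iota>_eqD ab by simp
      then obtain c where "c \<in> carrier A" "a' = ts 1 \<otimes> c" using frobenius_inj ab by blast
      then show ?thesis using ab by auto
    qed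
    show "\<exists>b\<in>A0. \<exists>c\<in>A0. a = b [^]\<^bsub>R\<^esub> p \<oplus>\<^bsub>R\<^esub> \<iota> (ts 0) \<otimes>\<^bsub>R\<^esub> c" if a: "a \<in> A0" for a
    proof -
      obtain a' where a': "a' \<in> carrier A" "a = \<iota> a'" using a by blast
      obtain b c where bc: "b \<in> carrier A" "c \<in> carrier A" "a' = b [^] p \<oplus> t \<otimes> c" using frobenius_surj a' by blast
      have "a = \<iota> b [^]\<^bsub>R\<^esub> p \<oplus>\<^bsub>R\<^esub> \<iota> (ts 0) \<otimes>\<^bsub>R\<^esub> \<iota> c" using bc a' by simp
      then show ?thesis using bc by blast
    qed
    show "\<exists>c\<in>A0. [p] \<cdot>\<^bsub>R\<^esub> \<one>\<^bsub>R\<^esub> = \<iota> (ts 0) \<otimes>\<^bsub>R\<^esub> c"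
    proof -
      obtain c where c: "c \<in> carrier A" "[p] \<cdot> \<one> = t \<otimes> c" using p_multiple by blast
      have "\<iota> ([n] \<cdot> \<one>) = [n] \<cdot>\<^bsub>R\<^esub> \<one>\<^bsub>R\<^esub>" for n :: nat by (induction n) auto
      then have "[p] \<cdot>\<^bsub>R\<^esub> \<one>\<^bsub>R\<^esub> = \<iota> (t \<otimes> c)" using c(2) by metis
      then show ?thesis using c(1) by auto
    qed
    show "\<exists>c\<in>A0. \<iota> (ts k) \<otimes>\<^bsub>R\<^esub> a = \<iota> (ts 0) [^]\<^bsub>R\<^esub> m \<otimes>\<^bsub>R\<^esub> c"
      if h: "a \<in> A0" "b \<in> A0" "\<iota> (gs 0) \<otimes>\<^bsub>R\<^esub> a = \<iota> (ts 0) [^]\<^bsub>R\<^esub> m \<otimes>\<^bsub>R\<^esub> b" for a b k and m :: nat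
    proof -
      obtain a' b' where ab: "a' \<in> carrier A" "b' \<in> carrier A" "a = \<iota> a'" "b = \<iota> b'" using h by blast
      have "\<iota> (g \<otimes> a') = \<iota> (t [^] m \<otimes> b')" using h(3) ab by simp
      then have "g \<otimes> a' = t [^] m \<otimes> b'" using \<iota>_eqD ab by simp
      then obtain c where c: "c \<in> carrier A" "ts k \<otimes> a' = t [^] m \<otimes> c" using almost_nonzerodivisor ab by blast
      have "\<iota> (ts k) \<otimes>\<^bsub>R\<^esub> a = \<iota> (ts k \<otimes> a')" using ab by simp
      then show ?thesis unfolding c(2) using c(1) by auto
    qed
    show "\<exists>(i::nat) (j::nat). \<iota> (ts 0) [^]\<^bsub>R\<^esub> i \<otimes>\<^bsub>R\<^esub> (\<iota> (gs 0) [^]\<^bsub>R\<^esub> j \<otimes>\<^bsub>R\<^esub> r) \<in> A0" if r: "r \<in> carrier R" for r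
    proof -
      obtain x s where x: "x \<in> carrier R0" "s \<in> powers R0 (\<iota>0 g)" "r = L1.fr x s"
        using r unfolding R_eq by (rule L1.loc_carrierE)
      then obtain j :: nat where j: "s = \<iota>0 g [^]\<^bsub>R0\<^esub> j" by (auto simp: powers_def)
      have "\<iota>1 s \<otimes>\<^bsub>R\<^esub> r = \<iota>1 x" unfolding x(3) R_eq by (rule L1.frac_eq_to[OF x(1,2)])
      then have 1: "\<iota> (gs 0) [^]\<^bsub>R\<^esub> j \<otimes>\<^bsub>R\<^esub> r = \<iota>1 x" unfolding j \<iota>_def by simp
      obtain i :: nat and a where a: "a \<in> carrier A" "\<iota>0 t [^]\<^bsub>R0\<^esub> i \<otimes>\<^bsub>R0\<^esub> x = \<iota>0 a" using R0_denominator[OF x(1)] by blast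
      have "\<iota> (ts 0) [^]\<^bsub>R\<^esub> i \<otimes>\<^bsub>R\<^esub> \<iota>1 x = \<iota>1 (\<iota>0 t [^]\<^bsub>R0\<^esub> i \<otimes>\<^bsub>R0\<^esub> x)"
        unfolding \<iota>_def using x(1) by simp
      also have "\<dots> = \<iota> a" unfolding a(2) \<iota>_def ..
      finally show ?thesis using 1 a(1) by (metis imageI)
    qed
  qed
qed

sublocale C: perfectoid_chart R A0 p "\<lambda>k. \<iota> (ts k)" "\<lambda>k. \<iota> (gs k)" by (rule chart)

section \<open>Rings of definition of the rational subsets\<close>

abbreviation B where "B \<equiv> \<iota>0 ` carrier A"

lemma \<iota>1_B: "\<iota>1 ` B = A0" by (auto simp: \<iota>_def)

lemma adic_R0: "adic_ring R0 B (\<iota>0 t)"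
proof -
  interpret \<iota>0: ring_hom_cring A R0 \<iota>0 by (rule \<iota>0_hom)
  show ?thesis
  proof (intro adic_ring.intro adic_ring_axioms.intro R0_cring \<iota>0_t_unit)
    show "subring B R0"
      by (rule ring_hom_ring.img_is_subring[OF ring_hom_ringI2[OF ring_axioms L1.ring_axioms \<iota>0.homh] carrier_is_subring])
    show "\<iota>0 t \<in> B" by simp
    show "\<exists>k::nat. \<iota>0 t [^]\<^bsub>R0\<^esub> k \<otimes>\<^bsub>R0\<^esub> r \<in> B" if "r \<in> carrier R0" for r
      using R0_denominator[OF that] by (metis imageI)
  qed
qed

text \<open>The ring of definition \<open>A0[t^n/g]\<close> that \<open>rat_nbhd\<close> prescribes.
  It lies in \<open>C.Binf n\<close>, which adds the roots and describes the integral elements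
  almost exactly.\<close>

definition Bn where
  "Bn n = generate_ring R (\<iota>1 ` B \<union> {loc_frac R0 (powers R0 (\<iota>0 g)) (\<iota>0 (t [^] n)) (\<iota>0 g)})" for n :: nat

lemma frac_X: "loc_frac R0 (powers R0 (\<iota>0 g)) (\<iota>0 (t [^] n)) (\<iota>0 g) = C.X n 0" for n :: nat
proof -
  interpret \<iota>0: ring_hom_cring A R0 \<iota>0 by (rule \<iota>0_hom)
  interpret \<iota>: ring_hom_cring A R \<iota> by (rule \<iota>_hom)
  define z where "z = L1.fr (\<iota>0 (t [^] n)) (\<iota>0 g)"
  have "\<iota>0 g [^]\<^bsub>R0\<^esub> (1::nat) \<in> powers R0 (\<iota>0 g)" unfolding powers_def by blast
  then have gp: "\<iota>0 g \<in> powers R0 (\<iota>0 g)" by simp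
  have zc: "z \<in> carrier R" unfolding z_def R_eq using gp by (intro L1.frac_closed) auto
  have "\<iota>1 (\<iota>0 g) \<otimes>\<^bsub>R\<^esub> z = \<iota>1 (\<iota>0 (t [^] n))"
    unfolding z_def R_eq using gp by (intro L1.frac_eq_to) auto
  then have "\<iota> g \<otimes>\<^bsub>R\<^esub> z = \<iota> t [^]\<^bsub>R\<^esub> n" unfolding \<iota>_def[symmetric] by simp
  then have "\<iota> g \<otimes>\<^bsub>R\<^esub> z = \<iota> g \<otimes>\<^bsub>R\<^esub> C.X n 0" using C.gs_X[of 0 n] by simp
  then show ?thesis using C.unit_cancel[OF C.g_unit] zc unfolding z_def by simp
qed

lemma Bn_eq: "Bn n = generate_ring R (A0 \<union> {C.X n 0})"
  unfolding Bn_def frac_X \<iota>1_B ..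

lemma Bn_gen_sub: "A0 \<union> {C.X n 0} \<subseteq> carrier R" using C.A0_sub by auto

lemma Bn_subring: "subring (Bn n) R" unfolding Bn_eq by (rule C.generate_ring_is_subring[OF Bn_gen_sub])

lemma A0_Bn: "a \<in> A0 \<Longrightarrow> a \<in> Bn n" and X_Bn: "C.X n 0 \<in> Bn n"
  unfolding Bn_eq by (auto intro: generate_ring.incl)

lemma Bn_min: "\<lbrakk>subring V R; A0 \<subseteq> V; C.X n 0 \<in> V\<rbrakk> \<Longrightarrow> Bn n \<subseteq> V"
  unfolding Bn_eq by (rule C.generate_ring_min_subring1[OF Bn_gen_sub]) auto

lemma Bn_Binf: "Bn n \<subseteq> C.Binf n"
  by (rule Bn_min[OF C.Binf_subring _ C.X_Binf]) (auto intro: C.A0_Binf)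

lemma Bn_Suc: "Bn (Suc n) \<subseteq> Bn n"
proof (rule Bn_min[OF Bn_subring])
  show "A0 \<subseteq> Bn n" using A0_Bn by blast
  show "C.X (Suc n) 0 \<in> Bn n"
    using C.X_shift[of n 1 0] subringE(6)[OF Bn_subring A0_Bn[OF C.ts_A0] X_Bn, of 0 n] C.ts_closed[of 0] by simp
qed

lemma adic_R: "adic_ring R (Bn n) (\<iota> t)"
proof (intro adic_ring.intro adic_ring_axioms.intro R_cring Bn_subring C.t_unit)
  show "\<iota> t \<in> Bn n" by (rule A0_Bn[OF C.ts_A0])
  show "\<exists>k::nat. \<iota> t [^]\<^bsub>R\<^esub> k \<otimes>\<^bsub>R\<^esub> r \<in> Bn n" if "r \<in> carrier R" for r
    using C.subring_bounded[OF Bn_subring _ X_Bn that] A0_Bn by blast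
qed

lemma coarsening: "adic_coarsening R (Bn (Suc n)) (\<iota> t) (Bn n)"
  by (intro adic_coarsening.intro adic_coarsening_axioms.intro adic_R Bn_Suc)

lemma rat_nbhd_eq:
  "rat_nbhd R0 B (\<iota>0 t) (\<iota>0 (t [^] n)) (\<iota>0 g) = adic_nbhd R (Bn n) (\<iota> t)" for n :: nat
  unfolding rat_nbhd_def Bn_def \<iota>_def ..

end

lemma (in ring_hom_cring) val_relation_pullback:
  fixes le assumes "val_relation S le" shows "val_relation R (\<lambda>a b. le (h a) (h b))"
proof -
  interpret V: val_relation S le by (rule assms)
  show ?thesis
  proof
    show "\<not> le (h \<one>) (h \<zero>)" using V.not_one_le_zero by simp
    fix a b assume ab: "a \<in> carrier R" "b \<in> carrier R"
    show "le (h a) (h b) \<or> le (h b) (h a)" using V.le_total ab by simp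
    fix c assume c: "c \<in> carrier R"
    show "le (h a) (h c)" if "le (h a) (h b)" "le (h b) (h c)"
      using V.le_trans[OF that] ab c by simp
    show "le (h (a \<otimes> c)) (h (b \<otimes> c))" if "le (h a) (h b)"
      using V.le_mult_right[OF that, of "h c"] ab c by simp
    show "le (h a) (h b)" if "le (h (a \<otimes> c)) (h (b \<otimes> c))" "\<not> le (h c) (h \<zero>)"
      using V.le_cancel[of "h a" "h c" "h b"] ab c that by simp
    show "le (h (a \<oplus> b)) (h c)" if "le (h a) (h c)" "le (h b) (h c)"
      using V.le_add[OF that] ab c by simp
  qed
qed

text \<open>Since \<open>y\<^sup>k\<^sup>+\<^sup>1\<close> is a \<open>B\<close>-linear combination of lower powers, so are all powers of \<open>y\<close>.\<close>

lemma (in adic_ring) integral_bounded: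
  assumes y: "y \<in> carrier R" and int: "y [^] Suc k \<in> poly_vals R B y k"
  shows "\<exists>N::nat. \<forall>j::nat. w [^] N \<otimes> y [^] j \<in> B"
proof -
  interpret E: subring_elem R B y
    by (intro subring_elem.intro subring_elem_axioms.intro is_cring subB y)
  have pow: "y [^] (j::nat) \<in> E.P k" for j
  proof (induction j)
    case 0
    then show ?case using E.W_P[OF B_one] by simp
  next
    case (Suc j)
    have "y \<otimes> y [^] j \<in> E.P (Suc k)" by (rule E.P_x[OF Suc])
    then obtain z v where z: "z \<in> E.P k" "v \<in> B" "y \<otimes> y [^] j = z \<oplus> v \<otimes> y [^] Suc k" using E.P_top by blast
    have "y [^] Suc j = y \<otimes> y [^] j" using y by (simp add: m_comm)
    then show ?case unfolding z(3) using E.P_add[OF z(1) E.P_scale[OF z(2) int]] by simp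
  qed
  obtain M :: nat where M: "w [^] M \<otimes> y \<in> B" using absorb y by blast
  have "\<exists>N::nat. \<forall>z\<in>E.P k. w [^] N \<otimes> z \<in> B" for k
  proof (induction k)
    case 0
    show ?case by (intro exI[of _ 0]) (simp add: B_closed)
  next
    case (Suc k)
    then obtain N :: nat where N: "\<And>z. z \<in> E.P k \<Longrightarrow> w [^] N \<otimes> z \<in> B" by blast
    have "w [^] (M + N) \<otimes> z \<in> B" if z: "z \<in> E.P (Suc k)" for z
    proof -
      obtain v x where v: "v \<in> B" "x \<in> E.P k" "v \<in> carrier R" "x \<in> carrier R" "z = v \<oplus> y \<otimes> x" using z by (rule E.P_SucE)
      have "w [^] (M + N) \<otimes> z = w [^] (M + N) \<otimes> v \<oplus> (w [^] M \<otimes> y) \<otimes> (w [^] N \<otimes> x)"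
        unfolding v(5) using v(3,4) y by (simp add: r_distr nat_pow_mult[symmetric] m_ac)
      then show ?thesis using B_add[OF B_mult[OF B_pow[OF w_B] v(1)] B_mult[OF M N[OF v(2)]]] by simp
    qed
    then show ?case by blast
  qed
  then show ?thesis using pow by blast
qed

context almost_perfectoid
begin

section \<open>Integral sections\<close>

abbreviation SR where "SR n \<equiv> completion R (adic_nbhd R (Bn n) (\<iota> t))"
abbreviation SN where "SN n \<equiv> compl_nbhd R (adic_nbhd R (Bn n) (\<iota> t))"
definition \<kappa> where "\<kappa> n r = compl_class R (adic_nbhd R (Bn n) (\<iota> t)) (\<lambda>i. r)"
text \<open>\<open>OP n\<close> is \<open>A\<langle>t^n/g\<rangle>\<close> as a subset of the
  completed ring of sections \<open>SR n\<close>.\<close>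

definition OP where "OP n = sections_plus R0 B (\<iota>0 t) B (\<iota>0 (t [^] (n::nat))) (\<iota>0 g)"

lemma sections_eq: "sections R0 B (\<iota>0 t) (\<iota>0 (t [^] n)) (\<iota>0 g) = SR n" for n :: nat
  unfolding sections_def rat_nbhd_eq ..

lemma to_sections_eq: "to_sections R0 B (\<iota>0 t) (\<iota>0 (t [^] n)) (\<iota>0 g) = (\<lambda>x. \<kappa> n (\<iota>1 x))" for n :: nat
  unfolding to_sections_def rat_nbhd_eq \<kappa>_def ..

definition admissible :: "nat \<Rightarrow> 'c monoid \<Rightarrow> ('c \<times> 'c) set \<Rightarrow> ('a sect \<Rightarrow> 'c option) \<Rightarrow> bool" where
  "admissible n G L v \<longleftrightarrow> continuous_valuation (SR n) (SN n) G L v \<and>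
     val_point R0 L (v \<circ> (\<lambda>x. \<kappa> n (\<iota>1 x)))
       \<in> rational_subset (spa R0 (adic_nbhd R0 B (\<iota>0 t)) B) (\<iota>0 (t [^] n)) (\<iota>0 g)"

lemma OP_iff: "F \<in> OP n \<longleftrightarrow> F \<in> carrier (SR n) \<and>
    (\<forall>(G :: ('a sect \<times> 'a sect) set monoid) L v. admissible n G L v \<longrightarrow> val_le L (v F) (Some \<one>\<^bsub>G\<^esub>))"
  unfolding OP_def sections_plus_def admissible_def sections_eq to_sections_eq rat_nbhd_eq by blast

lemma \<kappa>_hom: "ring_hom_cring R (SR n) (\<kappa> n)"
proof -
  interpret D: adic_ring R "Bn n" "\<iota> t" by (rule adic_R)
  show ?thesis unfolding \<kappa>_def[abs_def] by (rule D.\<iota>_cring_hom)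
qed

lemma SR_cring: "cring (SR n)"
  by (rule adic_ring.completion_cring[OF adic_R])

lemma \<kappa>_\<iota>1_hom: "ring_hom_cring R0 (SR n) (\<lambda>x. \<kappa> n (\<iota>1 x))"
proof -
  interpret \<iota>1: ring_hom_cring R0 R \<iota>1 by (rule \<iota>1_hom)
  interpret \<kappa>: ring_hom_cring R "SR n" "\<kappa> n" by (rule \<kappa>_hom)
  show ?thesis
    by (intro ring_hom_cring.intro ring_hom_cring_axioms.intro R0_cring SR_cring ring_hom_memI) auto
qed

lemma \<kappa>_SN_iff: "r \<in> carrier R \<Longrightarrow> \<kappa> n r \<in> SN n k \<longleftrightarrow> r \<in> adic_nbhd R (Bn n) (\<iota> t) k"
  unfolding \<kappa>_def by (rule adic_ring.\<iota>_CN_iff[OF adic_R])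

lemma \<kappa>_SN_0_iff: "r \<in> carrier R \<Longrightarrow> \<kappa> n r \<in> SN n 0 \<longleftrightarrow> r \<in> Bn n"
  using \<kappa>_SN_iff[of r n 0] adic_ring.N_0[OF adic_R] by simp

lemma SN_mono: assumes "F \<in> SN n k" shows "F \<in> SN n 0"
proof -
  interpret D: adic_ring R "Bn n" "\<iota> t" by (rule adic_R)
  obtain s where s: "s \<in> D.CS" "F = D.cls s" using D.CN_closed[OF assms] by (rule D.S_carrierE)
  then obtain M where "\<forall>i\<ge>M. s i \<in> D.N k" using assms D.cls_CN_iff by blast
  then have "\<forall>i\<ge>M. s i \<in> D.N 0" using D.N_mono[of 0 k] by blast
  then show ?thesis unfolding s(2) using D.cls_CN_iff[OF s(1)] by blast
qed

lemma \<iota>1_tn: "\<iota>1 (\<iota>0 (t [^] n)) = \<iota> g \<otimes>\<^bsub>R\<^esub> C.X n 0" for n :: nat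
proof -
  interpret \<iota>: ring_hom_cring A R \<iota> by (rule \<iota>_hom)
  have "\<iota>1 (\<iota>0 (t [^] n)) = \<iota> (t [^] n)" by (simp add: \<iota>_def)
  then show ?thesis using C.gs_X[of 0 n] by simp
qed

text \<open>A point of the rational subset is at most 1 on \<open>A\<close> and on
  \<open>t^n/g\<close>, hence on the roots of \<open>t^n/g\<close> and on all of
  \<open>Binf n\<close>. Continuity and density extend the bound to the closure of the ring of
  definition.\<close>

lemma admissible_rel:
  fixes le
  assumes adm: "admissible n G L v"
  defines "le \<equiv> \<lambda>F H. val_le L (v F) (v H)"
  shows "val_relation (SR n) le" "val_le L (v F) (Some \<one>\<^bsub>G\<^esub>) \<longleftrightarrow> le F \<one>\<^bsub>SR n\<^esub>"
    "b \<in> C.Binf n \<Longrightarrow> le (\<kappa> n b) \<one>\<^bsub>SR n\<^esub>" "H \<in> SN n 0 \<Longrightarrow> le H \<one>\<^bsub>SR n\<^esub>"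
proof -
  interpret D: adic_ring R "Bn n" "\<iota> t" by (rule adic_R)
  interpret S: cring "SR n" by (rule SR_cring)
  interpret \<kappa>: ring_hom_cring R "SR n" "\<kappa> n" by (rule \<kappa>_hom)
  have v: "is_valuation (SR n) G L v" and cont: "\<And>c. c \<in> generate G {c. Some c \<in> v ` carrier (SR n)} \<Longrightarrow>
      lin_open (SR n) (SN n) {a \<in> carrier (SR n). val_less L (v a) (Some c)}"
    using adm unfolding admissible_def continuous_valuation_def by auto
  show rel: "val_relation (SR n) le"
    unfolding le_def by (rule S.val_relation_of_valuation[OF v])
  have v1: "v \<one>\<^bsub>SR n\<^esub> = Some \<one>\<^bsub>G\<^esub>" and v0: "v \<zero>\<^bsub>SR n\<^esub> = None" using v by (auto simp: is_valuation_def)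
  show one: "val_le L (v F) (Some \<one>\<^bsub>G\<^esub>) \<longleftrightarrow> le F \<one>\<^bsub>SR n\<^esub>" for F by (simp add: le_def v1)
  interpret V: val_relation "SR n" le by (rule rel)
  interpret \<kappa>\<iota>: ring_hom_cring R0 "SR n" "\<lambda>x. \<kappa> n (\<iota>1 x)" by (rule \<kappa>_\<iota>1_hom)
  define pt where "pt = val_point R0 L (v \<circ> (\<lambda>x. \<kappa> n (\<iota>1 x)))"
  have pt_iff: "(x, y) \<in> pt \<longleftrightarrow> x \<in> carrier R0 \<and> y \<in> carrier R0 \<and> le (\<kappa> n (\<iota>1 x)) (\<kappa> n (\<iota>1 y))" for x y
    by (simp add: pt_def val_point_def le_def)
  have pt: "pt \<in> spa R0 (adic_nbhd R0 B (\<iota>0 t)) B" "(\<iota>0 (t [^] n), \<iota>0 g) \<in> pt"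
    using adm unfolding admissible_def pt_def rational_subset_def by auto
  \<comment> \<open>Points of \<open>spa\<close> are relations, so the bound on \<open>B\<close> is
    known for some other representing valuation \<open>v'\<close> and has to be transported through
    \<open>pt\<close>.\<close>
  obtain G' :: "('a loc \<times> 'a loc) set monoid" and L' v' where v': "pt = val_point R0 L' v'" "is_valuation R0 G' L' v'"
    "\<And>a. a \<in> B \<Longrightarrow> val_le L' (v' a) (Some \<one>\<^bsub>G'\<^esub>)"
    using pt(1) unfolding spa_def continuous_valuation_def by blast
  have Ble: "le (\<kappa> n a) \<one>\<^bsub>SR n\<^esub>" if aA: "a \<in> A0" for a
  proof -
    obtain b where b: "b \<in> B" "a = \<iota>1 b" using aA by (auto simp: \<iota>_def)
    have bc: "b \<in> carrier R0" using b(1) adic_ring.B_closed[OF adic_R0] by blast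
    have "v' \<one>\<^bsub>R0\<^esub> = Some \<one>\<^bsub>G'\<^esub>" using v'(2) by (simp add: is_valuation_def)
    then have "(b, \<one>\<^bsub>R0\<^esub>) \<in> pt" using v'(3)[OF b(1)] bc unfolding v'(1) val_point_def by simp
    then show ?thesis using b(2) by (simp add: pt_iff)
  qed
  have Xle: "le (\<kappa> n (C.X n 0)) \<one>\<^bsub>SR n\<^esub>"
  proof -
    have gu: "\<kappa> n (\<iota> g) \<in> Units (SR n)" by (rule hom_Units[OF \<kappa>_hom C.g_unit])
    have gc: "\<kappa> n (\<iota> g) \<in> carrier (SR n)" using gu by blast
    have "\<not> le (\<kappa> n (\<iota> g)) \<zero>\<^bsub>SR n\<^esub>"
    proof
      assume "le (\<kappa> n (\<iota> g)) \<zero>\<^bsub>SR n\<^esub>"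
      then have "le (\<kappa> n (\<iota> g) \<otimes>\<^bsub>SR n\<^esub> inv\<^bsub>SR n\<^esub> \<kappa> n (\<iota> g)) (\<zero>\<^bsub>SR n\<^esub> \<otimes>\<^bsub>SR n\<^esub> inv\<^bsub>SR n\<^esub> \<kappa> n (\<iota> g))"
        using gu gc by (intro V.le_mult_right) auto
      then show False using gu V.not_one_le_zero by simp
    qed
    moreover have "le (\<kappa> n (\<iota> g \<otimes>\<^bsub>R\<^esub> C.X n 0)) (\<kappa> n (\<iota> g))"
      using pt(2) unfolding pt_iff \<iota>1_tn by (simp add: \<iota>_def)
    then have "le (\<kappa> n (C.X n 0) \<otimes>\<^bsub>SR n\<^esub> \<kappa> n (\<iota> g)) (\<one>\<^bsub>SR n\<^esub> \<otimes>\<^bsub>SR n\<^esub> \<kappa> n (\<iota> g))"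
      using C.gs_closed[of 0] S.m_comm gc by simp
    ultimately show ?thesis using V.le_cancel[of "\<kappa> n (C.X n 0)" "\<kappa> n (\<iota> g)" "\<one>\<^bsub>SR n\<^esub>"] gc by simp
  qed
  define W where "W = {r \<in> carrier R. le (\<kappa> n r) \<one>\<^bsub>SR n\<^esub>}"
  have W: "subring W R"
  proof (rule C.subringI)
    show "W \<subseteq> carrier R" by (auto simp: W_def)
    show "\<one>\<^bsub>R\<^esub> \<in> W" by (simp add: W_def V.le_refl)
    show "\<ominus>\<^bsub>R\<^esub> h \<in> W" if "h \<in> W" for h using that V.le_one_neg by (auto simp: W_def)
    fix h k assume "h \<in> W" "k \<in> W"
    then show "h \<otimes>\<^bsub>R\<^esub> k \<in> W" "h \<oplus>\<^bsub>R\<^esub> k \<in> W"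
      using V.le_one_mult V.le_add[of "\<kappa> n h" "\<one>\<^bsub>SR n\<^esub>" "\<kappa> n k"] by (auto simp: W_def)
  qed
  have AW: "A0 \<subseteq> W" using Ble C.A0_closed by (auto simp: W_def)
  have XW: "C.X n k \<in> W" for k
  proof -
    have "\<kappa> n (C.X n k) [^]\<^bsub>SR n\<^esub> (p ^ k) = \<kappa> n (C.X n 0)"
      using C.X_pow[of n 0 k] \<kappa>.hom_pow[of "C.X n k" "p ^ k"] by simp
    then have "le (\<kappa> n (C.X n k)) \<one>\<^bsub>SR n\<^esub>"
      using V.le_one_root[of "\<kappa> n (C.X n k)" "p ^ k"] Xle C.p_gt_1 by simp
    then show ?thesis by (simp add: W_def)
  qed
  have BW: "C.Binf n \<subseteq> W"
    unfolding C.Binf_def C.PX_def using C.poly_vals_subring[OF W AW XW] by blast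
  then show "b \<in> C.Binf n \<Longrightarrow> le (\<kappa> n b) \<one>\<^bsub>SR n\<^esub>" by (auto simp: W_def)
  show "le H \<one>\<^bsub>SR n\<^esub>" if H: "H \<in> SN n 0"
  proof -
    have "lin_open (SR n) (SN n) {a \<in> carrier (SR n). val_less L (v a) (Some \<one>\<^bsub>G\<^esub>)}"
      by (intro cont generate.one)
    moreover have "val_less L (v \<zero>\<^bsub>SR n\<^esub>) (Some \<one>\<^bsub>G\<^esub>)" by (simp add: v0 val_less_def)
    \<comment> \<open>By continuity at zero, values on \<open>SN n k\<close> are below 1; up to such
      an error \<open>H\<close> is replaced by an element of \<open>R\<close>, which then lies in
      \<open>Bn n\<close>.\<close>
    ultimately obtain k where k: "\<And>b. b \<in> SN n k \<Longrightarrow> val_less L (v (\<zero>\<^bsub>SR n\<^esub> \<oplus>\<^bsub>SR n\<^esub> b)) (Some \<one>\<^bsub>G\<^esub>)"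
      unfolding lin_open_def by blast
    have Hc: "H \<in> carrier (SR n)" using D.CN_closed[OF H] .
    obtain r where r: "r \<in> carrier R" "H \<ominus>\<^bsub>SR n\<^esub> \<kappa> n r \<in> SN n k"
      using D.dense[OF Hc] unfolding \<kappa>_def by blast
    define E where "E = H \<ominus>\<^bsub>SR n\<^esub> \<kappa> n r"
    have Ec: "E \<in> carrier (SR n)" and E0: "E \<in> SN n 0"
      using D.CN_closed r(2) SN_mono[OF r(2)] by (auto simp: E_def)
    have "val_less L (v E) (Some \<one>\<^bsub>G\<^esub>)" using k[OF r(2)] Ec by (simp add: E_def)
    then have leE: "le E \<one>\<^bsub>SR n\<^esub>" using one[of E] by (simp add: val_less_def)
    have kr: "\<kappa> n r \<in> carrier (SR n)" using r by simp
    have "H \<oplus>\<^bsub>SR n\<^esub> \<ominus>\<^bsub>SR n\<^esub> E = \<kappa> n r"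
      unfolding E_def a_minus_def using Hc kr by (simp add: S.minus_add S.a_assoc[symmetric] S.r_neg)
    then have "\<kappa> n r \<in> SN n 0" using D.CN_add[OF H D.CN_neg[OF E0]] by simp
    then have "r \<in> C.Binf n" using \<kappa>_SN_0_iff r(1) Bn_Binf by blast
    then have "le (\<kappa> n r) \<one>\<^bsub>SR n\<^esub>" using BW by (auto simp: W_def)
    moreover have "H = E \<oplus>\<^bsub>SR n\<^esub> \<kappa> n r" unfolding E_def a_minus_def using Hc kr by (simp add: S.a_assoc S.l_neg)
    ultimately show ?thesis using V.le_add[OF leE, of "\<kappa> n r"] Ec kr by simp
  qed
qed

lemma OP_subring: "subring (OP n) (SR n)"
proof -
  interpret S: cring "SR n" by (rule SR_cring)
  have rel: "val_relation (SR n) (\<lambda>F H. val_le L (v F) (v H))"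
    and one: "val_le L (v F) (Some \<one>\<^bsub>G\<^esub>) \<longleftrightarrow> val_le L (v F) (v \<one>\<^bsub>SR n\<^esub>)"
    if "admissible n G L v" for G :: "('a sect \<times> 'a sect) set monoid" and L v F
    using admissible_rel(1,2)[OF that] by auto
  show ?thesis
  proof (rule S.subringI)
    show "OP n \<subseteq> carrier (SR n)" by (auto simp: OP_iff)
    show "\<one>\<^bsub>SR n\<^esub> \<in> OP n" using one val_relation.le_refl[OF rel] by (auto simp: OP_iff)
    show "\<ominus>\<^bsub>SR n\<^esub> h \<in> OP n" if "h \<in> OP n" for h
      using that one val_relation.le_one_neg[OF rel] by (auto simp: OP_iff)
    fix h k assume "h \<in> OP n" "k \<in> OP n"
    then show "h \<otimes>\<^bsub>SR n\<^esub> k \<in> OP n" "h \<oplus>\<^bsub>SR n\<^esub> k \<in> OP n"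
      using one val_relation.le_one_mult[OF rel] val_relation.le_add[OF rel, of _ _ _ h "\<one>\<^bsub>SR n\<^esub>" k]
      by (auto simp: OP_iff)
  qed
qed

lemma Binf_OP: "b \<in> C.Binf n \<Longrightarrow> \<kappa> n b \<in> OP n"
proof -
  interpret \<kappa>: ring_hom_cring R "SR n" "\<kappa> n" by (rule \<kappa>_hom)
  assume b: "b \<in> C.Binf n"
  then have "val_le L (v (\<kappa> n b)) (Some \<one>\<^bsub>G\<^esub>)" if "admissible n G L v"
    for G :: "('a sect \<times> 'a sect) set monoid" and L v
    using admissible_rel(2,3)[OF that] by blast
  then show ?thesis unfolding OP_iff using C.Binf_closed[OF b] by simp
qed

lemma SN_OP: "F \<in> SN n 0 \<Longrightarrow> F \<in> OP n"
  unfolding OP_iff using admissible_rel(2,4) adic_ring.CN_closed[OF adic_R] by blast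

text \<open>By contraposition, Chevalley's theorem in the completion supplies a valuation that
  exceeds 1 at \<open>s\<close>. The work lies in its admissibility: it must be continuous for
  \<open>SN n\<close>, and its restriction to \<open>A[1/t]\<close> must be a point of
  \<open>X\<close> with \<open>|t^n| \<le> |g|\<close>.\<close>

lemma OP_const_integral:
  assumes s: "s \<in> carrier R" and F: "\<kappa> n s \<in> OP n"
  shows "\<exists>k. \<kappa> n s [^]\<^bsub>SR n\<^esub> Suc k \<in> poly_vals (SR n) (SN n 0) (\<kappa> n s) k"
proof (rule ccontr)
  assume "\<not> ?thesis"
  then have nonint: "\<And>k. \<kappa> n s [^]\<^bsub>SR n\<^esub> Suc k \<notin> poly_vals (SR n) (SN n 0) (\<kappa> n s) k" by blast
  interpret D: adic_ring R "Bn n" "\<iota> t" by (rule adic_R)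
  have ad: "adic_ring (SR n) (SN n 0) (\<kappa> n (\<iota> t))" unfolding \<kappa>_def by (rule D.adic_completion)
  interpret S: adic_ring "SR n" "SN n 0" "\<kappa> n (\<iota> t)" by (rule ad)
  interpret \<kappa>: ring_hom_cring R "SR n" "\<kappa> n" by (rule \<kappa>_hom)
  interpret \<kappa>\<iota>: ring_hom_cring R0 "SR n" "\<lambda>x. \<kappa> n (\<iota>1 x)" by (rule \<kappa>_\<iota>1_hom)
  obtain le where le: "adic_val_relation (SR n) (SN n 0) (\<kappa> n (\<iota> t)) le" "\<not> le (\<kappa> n s) \<one>\<^bsub>SR n\<^esub>"
    using S.exists_adic_val_relation[OF \<kappa>.hom_closed[OF s] nonint] by blast
  interpret V: adic_val_relation "SR n" "SN n 0" "\<kappa> n (\<iota> t)" le by (rule le(1))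
  define le0 where "le0 = (\<lambda>x y. le (\<kappa> n (\<iota>1 x)) (\<kappa> n (\<iota>1 y)))"
  have t0: "\<kappa> n (\<iota>1 (\<iota>0 t)) = \<kappa> n (\<iota> t)" by (simp add: \<iota>_def)
  have Ble: "le0 b \<one>\<^bsub>R0\<^esub>" if b: "b \<in> B" for b
  proof -
    have "\<iota>1 b \<in> A0" using b \<iota>1_B by blast
    then have "\<kappa> n (\<iota>1 b) \<in> SN n 0" using \<kappa>_SN_0_iff A0_Bn C.A0_closed by blast
    then show ?thesis using V.B_le_one by (simp add: le0_def)
  qed
  have avr: "adic_val_relation R0 B (\<iota>0 t) le0"
  proof (intro adic_val_relation.intro adic_val_relation_axioms.intro adic_R0)
    show "val_relation R0 le0" unfolding le0_def by (rule \<kappa>\<iota>.val_relation_pullback[OF V.val_relation_axioms])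
    show "le0 b \<one>\<^bsub>R0\<^esub>" if "b \<in> B" for b using Ble[OF that] .
    fix x assume x: "x \<in> carrier R0" "\<not> le0 x \<zero>\<^bsub>R0\<^esub>"
    then have "\<not> le (\<kappa> n (\<iota>1 x)) \<zero>\<^bsub>SR n\<^esub>" by (simp add: le0_def)
    then obtain m :: nat where m: "\<not> le (\<kappa> n (\<iota>1 x)) (\<kappa> n (\<iota> t) [^]\<^bsub>SR n\<^esub> m)"
      using V.cofinal[OF \<kappa>\<iota>.hom_closed[OF x(1)]] by blast
    have "\<iota>0 t \<in> carrier R0" using adic_ring.w_closed[OF adic_R0] .
    then have "\<kappa> n (\<iota>1 (\<iota>0 t [^]\<^bsub>R0\<^esub> m)) = \<kappa> n (\<iota> t) [^]\<^bsub>SR n\<^esub> m"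
      using \<kappa>\<iota>.hom_pow[of "\<iota>0 t" m] t0 by simp
    then show "\<exists>m::nat. \<not> le0 x (\<iota>0 t [^]\<^bsub>R0\<^esub> m)" using m unfolding le0_def by metis
  qed
  have pt: "val_point R0 V.value_order (V.val \<circ> (\<lambda>x. \<kappa> n (\<iota>1 x))) = {(a, b) \<in> carrier R0 \<times> carrier R0. le0 a b}"
    unfolding val_point_def le0_def comp_def using V.val_le_iff \<kappa>\<iota>.hom_closed by blast
  have "{(a, b) \<in> carrier R0 \<times> carrier R0. le0 a b} \<in> spa R0 (adic_nbhd R0 B (\<iota>0 t)) B"
    by (rule adic_val_relation.relation_in_spa[OF avr]) (use Ble adic_ring.B_closed[OF adic_R0] in blast)
  moreover have "le0 (\<iota>0 (t [^] n)) (\<iota>0 g)"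
  proof -
    have "\<kappa> n (C.X n 0) \<in> SN n 0" using \<kappa>_SN_0_iff X_Bn by simp
    then have "le (\<kappa> n (C.X n 0)) \<one>\<^bsub>SR n\<^esub>" using V.B_le_one by blast
    moreover have gi: "\<iota>1 (\<iota>0 g) = \<iota> g" by (simp add: \<iota>_def)
    ultimately show ?thesis
      unfolding le0_def \<iota>1_tn gi using C.gs_closed[of 0] V.le_mult_right[of "\<kappa> n (C.X n 0)" "\<one>\<^bsub>SR n\<^esub>" "\<kappa> n (\<iota> g)"]
      by (simp add: S.m_comm)
  qed
  moreover have "\<iota>0 (t [^] n) \<in> carrier R0" "\<iota>0 g \<in> carrier R0"
    using adic_ring.B_closed[OF adic_R0] by auto
  ultimately have "val_point R0 V.value_order (V.val \<circ> (\<lambda>x. \<kappa> n (\<iota>1 x)))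
      \<in> rational_subset (spa R0 (adic_nbhd R0 B (\<iota>0 t)) B) (\<iota>0 (t [^] n)) (\<iota>0 g)"
    unfolding pt rational_subset_def by simp
  \<comment> \<open>The valuation is continuous for the adic neighbourhoods, whereas admissibility
    asks for those of the completion.\<close>
  moreover have "adic_nbhd (SR n) (SN n 0) (\<kappa> n (\<iota> t)) = SN n"
    by (rule ext) (rule D.CN_eq[folded \<kappa>_def, symmetric])
  ultimately have "admissible n V.value_group V.value_order V.val"
    unfolding admissible_def using V.val_continuous by simp
  then have "val_le V.value_order (V.val (\<kappa> n s)) (Some \<one>\<^bsub>V.value_group\<^esub>)"
    using F unfolding OP_iff by blast
  then show False using V.val_le_one_iff[OF \<kappa>.hom_closed[OF s]] le(2) by simp
qed

lemma OP_const_almost_Binf: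
  assumes s: "s \<in> carrier R" and F: "\<kappa> n s \<in> OP n"
  shows "\<iota> (ts e) \<otimes>\<^bsub>R\<^esub> s \<in> C.Binf n"
proof -
  interpret D: adic_ring R "Bn n" "\<iota> t" by (rule adic_R)
  have ad: "adic_ring (SR n) (SN n 0) (\<kappa> n (\<iota> t))" unfolding \<kappa>_def by (rule D.adic_completion)
  interpret S: adic_ring "SR n" "SN n 0" "\<kappa> n (\<iota> t)" by (rule ad)
  interpret \<kappa>: ring_hom_cring R "SR n" "\<kappa> n" by (rule \<kappa>_hom)
  obtain k where "\<kappa> n s [^]\<^bsub>SR n\<^esub> Suc k \<in> poly_vals (SR n) (SN n 0) (\<kappa> n s) k"
    using OP_const_integral[OF assms] by blast
  then obtain N :: nat where N: "\<And>j::nat. \<kappa> n (\<iota> t) [^]\<^bsub>SR n\<^esub> N \<otimes>\<^bsub>SR n\<^esub> \<kappa> n s [^]\<^bsub>SR n\<^esub> j \<in> SN n 0"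
    using S.integral_bounded[OF \<kappa>.hom_closed[OF s]] by blast
  have tc: "\<iota> t \<in> carrier R" using C.ts_closed[of 0] .
  \<comment> \<open>The bound on powers descends from the completion, since a constant section in
    \<open>SN n 0\<close> comes from \<open>Bn n\<close>.\<close>
  have "\<iota> t [^]\<^bsub>R\<^esub> N \<otimes>\<^bsub>R\<^esub> s [^]\<^bsub>R\<^esub> j \<in> C.Binf n" for j :: nat
  proof -
    have "\<kappa> n (\<iota> t [^]\<^bsub>R\<^esub> N \<otimes>\<^bsub>R\<^esub> s [^]\<^bsub>R\<^esub> j) \<in> SN n 0"
      using N[of j] tc s \<kappa>.hom_pow[OF tc, of N] \<kappa>.hom_pow[OF s, of j] by simp
    moreover have "\<iota> t [^]\<^bsub>R\<^esub> N \<otimes>\<^bsub>R\<^esub> s [^]\<^bsub>R\<^esub> j \<in> carrier R" using tc s by simp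
    ultimately show ?thesis using \<kappa>_SN_0_iff subsetD[OF Bn_Binf] by metis
  qed
  then show ?thesis using C.power_bounded_almost_Binf[OF s] by blast
qed

section \<open>Restriction maps\<close>

definition \<rho> where "\<rho> n = compl_coarsen R (adic_nbhd R (Bn n) (\<iota> t))"

lemma \<rho>_hom: "ring_hom_cring (SR (Suc n)) (SR n) (\<rho> n)"
proof -
  interpret D: adic_coarsening R "Bn (Suc n)" "\<iota> t" "Bn n" by (rule coarsening)
  show ?thesis unfolding \<rho>_def
    by (intro ring_hom_cring.intro ring_hom_cring_axioms.intro SR_cring D.coarsen_hom)
qed

lemma \<rho>_\<kappa>: "r \<in> carrier R \<Longrightarrow> \<rho> n (\<kappa> (Suc n) r) = \<kappa> n r"
proof -
  interpret D: adic_coarsening R "Bn (Suc n)" "\<iota> t" "Bn n" by (rule coarsening)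
  show "r \<in> carrier R \<Longrightarrow> ?thesis" unfolding \<rho>_def \<kappa>_def by (rule D.coarsen_cls[OF D.const_CS])
qed

lemma \<rho>_SN: "F \<in> SN (Suc n) k \<Longrightarrow> \<rho> n F \<in> SN n k"
  unfolding \<rho>_def by (rule adic_coarsening.coarsen_CN[OF coarsening])

text \<open>Geometrically the inclusion of rational subsets: \<open>|t| \<le> 1\<close> gives
  \<open>|t^(n+1)| \<le> |t^n| \<le> |g|\<close>. It makes restriction preserve integral sections.
  Continuity is inherited because \<rho> respects neighbourhoods and the pulled-back valuation takes
  no new values.\<close>

lemma admissible_restrict:
  assumes adm: "admissible n G L v" shows "admissible (Suc n) G L (v \<circ> \<rho> n)"
proof -
  interpret \<rho>: ring_hom_cring "SR (Suc n)" "SR n" "\<rho> n" by (rule \<rho>_hom)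
  interpret \<kappa>: ring_hom_cring R "SR n" "\<kappa> n" by (rule \<kappa>_hom)
  interpret \<iota>1: ring_hom_cring R0 R \<iota>1 by (rule \<iota>1_hom)
  have v: "is_valuation (SR n) G L v" and cont: "\<And>c. c \<in> generate G {c. Some c \<in> v ` carrier (SR n)} \<Longrightarrow>
      lin_open (SR n) (SN n) {a \<in> carrier (SR n). val_less L (v a) (Some c)}"
    using adm unfolding admissible_def continuous_valuation_def by auto
  have v': "is_valuation (SR (Suc n)) G L (v \<circ> \<rho> n)"
    using v unfolding is_valuation_def by simp
  have sub: "{c. Some c \<in> (v \<circ> \<rho> n) ` carrier (SR (Suc n))} \<subseteq> {c. Some c \<in> v ` carrier (SR n)}"
    by auto
  have "lin_open (SR (Suc n)) (SN (Suc n)) {a \<in> carrier (SR (Suc n)). val_less L ((v \<circ> \<rho> n) a) (Some c)}"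
    if c: "c \<in> generate G {c. Some c \<in> (v \<circ> \<rho> n) ` carrier (SR (Suc n))}" for c
  proof -
    have o: "lin_open (SR n) (SN n) {a \<in> carrier (SR n). val_less L (v a) (Some c)}"
      by (rule cont[OF generate_mono[OF sub c]])
    show ?thesis
      unfolding lin_open_def
    proof (intro conjI ballI)
      fix a assume a: "a \<in> {a \<in> carrier (SR (Suc n)). val_less L ((v \<circ> \<rho> n) a) (Some c)}"
      then have "\<rho> n a \<in> {a \<in> carrier (SR n). val_less L (v a) (Some c)}" by simp
      then obtain k where k: "\<And>b. b \<in> SN n k \<Longrightarrow> \<rho> n a \<oplus>\<^bsub>SR n\<^esub> b \<in> {a \<in> carrier (SR n). val_less L (v a) (Some c)}"
        using o unfolding lin_open_def by blast
      have "a \<oplus>\<^bsub>SR (Suc n)\<^esub> b \<in> {a \<in> carrier (SR (Suc n)). val_less L ((v \<circ> \<rho> n) a) (Some c)}"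
        if b: "b \<in> SN (Suc n) k" for b
      proof -
        have bc: "b \<in> carrier (SR (Suc n))" using adic_ring.CN_closed[OF adic_R b] .
        show ?thesis using k[OF \<rho>_SN[OF b]] a bc by simp
      qed
      then show "\<exists>k. \<forall>b\<in>SN (Suc n) k. a \<oplus>\<^bsub>SR (Suc n)\<^esub> b \<in> {a \<in> carrier (SR (Suc n)). val_less L ((v \<circ> \<rho> n) a) (Some c)}"
        by blast
    qed auto
  qed
  then have cv: "continuous_valuation (SR (Suc n)) (SN (Suc n)) G L (v \<circ> \<rho> n)"
    unfolding continuous_valuation_def using v' by blast
  define pt where "pt = val_point R0 L (v \<circ> (\<lambda>x. \<kappa> n (\<iota>1 x)))"
  have pt: "val_point R0 L (v \<circ> \<rho> n \<circ> (\<lambda>x. \<kappa> (Suc n) (\<iota>1 x))) = pt"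
    unfolding pt_def val_point_def using \<rho>_\<kappa> by auto
  have rs: "pt \<in> spa R0 (adic_nbhd R0 B (\<iota>0 t)) B" "(\<iota>0 (t [^] n), \<iota>0 g) \<in> pt"
    using adm unfolding admissible_def pt_def rational_subset_def by auto
  have "(\<iota>0 (t [^] Suc n), \<iota>0 g) \<in> pt"
  proof -
    define le where "le = (\<lambda>F H. val_le L (v F) (v H))"
    interpret V: val_relation "SR n" le unfolding le_def by (rule admissible_rel(1)[OF adm])
    have t1: "le (\<kappa> n (\<iota> t)) \<one>\<^bsub>SR n\<^esub>"
      unfolding le_def using admissible_rel(3)[OF adm C.A0_Binf[OF C.ts_A0, of 0]] .
    have c: "\<iota> t \<in> carrier R" "\<iota> g \<in> carrier R" "\<iota>1 (\<iota>0 (t [^] n)) \<in> carrier R"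
      using C.ts_closed[of 0] C.gs_closed[of 0] adic_ring.B_closed[OF adic_R0] by auto
    have "le (\<kappa> n (\<iota>1 (\<iota>0 (t [^] n)))) (\<kappa> n (\<iota> g))"
      using rs(2) unfolding pt_def val_point_def le_def \<iota>_def by simp
    from V.le_mult_mono[OF this t1]
    have 1: "le (\<kappa> n (\<iota>1 (\<iota>0 (t [^] n)) \<otimes>\<^bsub>R\<^esub> \<iota> t)) (\<kappa> n (\<iota> g))" using c by simp
    have eq: "\<iota>1 (\<iota>0 (t [^] n)) \<otimes>\<^bsub>R\<^esub> \<iota> t = \<iota>1 (\<iota>0 (t [^] Suc n))"
    proof -
      interpret \<iota>: ring_hom_cring A R \<iota> by (rule \<iota>_hom)
      have e: "\<iota>1 (\<iota>0 (t [^] k)) = \<iota> (t [^] k)" for k :: nat by (simp add: \<iota>_def)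
      show ?thesis unfolding e by simp
    qed
    have "val_le L (v (\<kappa> n (\<iota>1 (\<iota>0 (t [^] Suc n))))) (v (\<kappa> n (\<iota>1 (\<iota>0 g))))"
      using 1[unfolded eq] unfolding le_def \<iota>_def .
    moreover have "\<iota>0 (t [^] Suc n) \<in> carrier R0" "\<iota>0 g \<in> carrier R0"
      using adic_ring.B_closed[OF adic_R0] by auto
    ultimately show ?thesis unfolding pt_def val_point_def comp_def by blast
  qed
  then show ?thesis unfolding admissible_def using cv rs(1) pt by (simp add: rational_subset_def)
qed

lemma \<rho>_OP: assumes "F \<in> OP (Suc n)" shows "\<rho> n F \<in> OP n"
proof -
  interpret \<rho>: ring_hom_cring "SR (Suc n)" "SR n" "\<rho> n" by (rule \<rho>_hom)
  show ?thesis using assms admissible_restrict unfolding OP_iff by fastforce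
qed

end

section \<open>Quotients and the comparison map\<close>

text \<open>The part of the module axioms that quotients and their maps rely on.
  \<open>quot_module\<close> preserves it, so the cokernel, a quotient of a quotient, is treated by
  the same lemmas.\<close>

locale scalar_group = abelian_group M for M :: "('a, 'b) module" (structure) +
  fixes S :: "'a set"
  assumes smult_closed: "\<lbrakk>a \<in> S; x \<in> carrier M\<rbrakk> \<Longrightarrow> a \<odot> x \<in> carrier M"
    and smult_add: "\<lbrakk>a \<in> S; x \<in> carrier M; y \<in> carrier M\<rbrakk> \<Longrightarrow> a \<odot> (x \<oplus> y) = a \<odot> x \<oplus> a \<odot> y"

locale scalar_quotient = scalar_group M S for M (structure) and S + fixes H
  assumes sub: "additive_subgroup H M" and stable: "\<lbrakk>a \<in> S; x \<in> H\<rbrakk> \<Longrightarrow> a \<odot> x \<in> H"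
begin

abbreviation Q where "Q \<equiv> quot_module M H"
abbreviation cos where "cos x \<equiv> H +> x"

lemma abelian_sub: "abelian_subgroup H M"
  by (rule abelian_subgroupI3[OF sub abelian_group_axioms])

lemma H_closed: "x \<in> H \<Longrightarrow> x \<in> carrier M" by (rule additive_subgroup.a_Hcarr[OF sub])

lemma cos_closed: "x \<in> carrier M \<Longrightarrow> cos x \<in> carrier Q"
  unfolding quot_module_def A_RCOSETS_def' by auto

lemma cosE: assumes "X \<in> carrier Q" obtains x where "x \<in> carrier M" "X = cos x"
  using assms unfolding quot_module_def A_RCOSETS_def' by auto

lemma cos_eq_iff: assumes "x \<in> carrier M" "y \<in> carrier M" shows "cos x = cos y \<longleftrightarrow> x \<ominus> y \<in> H"
proof
  interpret A: abelian_subgroup H M by (rule abelian_sub)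
  assume "cos x = cos y"
  then have "x \<in> cos y" using A.a_rcos_self[OF assms(1)] by simp
  then show "x \<ominus> y \<in> H" using A.a_rcos_module[OF assms(2,1)] by (simp add: a_minus_def)
next
  interpret A: abelian_subgroup H M by (rule abelian_sub)
  assume "x \<ominus> y \<in> H"
  then have "x \<in> cos y" using A.a_rcos_module[OF assms(2,1)] by (simp add: a_minus_def)
  then show "cos x = cos y" using a_repr_independence[OF _ assms(2) additive_subgroup.a_subgroup[OF sub]] by simp
qed

lemma zero_Q: "\<zero>\<^bsub>Q\<^esub> = H" by (simp add: quot_module_def)

lemma cos_zero_iff: assumes "x \<in> carrier M" shows "cos x = \<zero>\<^bsub>Q\<^esub> \<longleftrightarrow> x \<in> H"
proof -
  interpret A: abelian_subgroup H M by (rule abelian_sub)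
  have "H = cos \<zero>" using a_coset_add_zero[OF A.a_subset] by simp
  have m0: "\<ominus> \<zero> = \<zero>" by (rule minus_equality) simp_all
  have "x \<ominus> \<zero> = x" unfolding a_minus_def m0 using assms by simp
  then show ?thesis unfolding zero_Q using cos_eq_iff[OF assms zero_closed] \<open>H = cos \<zero>\<close> by simp
qed

lemma add_cos: "\<lbrakk>x \<in> carrier M; y \<in> carrier M\<rbrakk> \<Longrightarrow> cos x \<oplus>\<^bsub>Q\<^esub> cos y = cos (x \<oplus> y)"
  using abelian_subgroup.a_rcos_sum[OF abelian_sub] by (simp add: quot_module_def)

lemma smult_cos: assumes "a \<in> S" "x \<in> carrier M" shows "a \<odot>\<^bsub>Q\<^esub> cos x = cos (a \<odot> x)"
proof -
  interpret A: abelian_subgroup H M by (rule abelian_sub)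
  have "cos (a \<odot> y) = cos (a \<odot> x)" if y: "y \<in> cos x" for y
  proof -
    obtain z where z: "z \<in> H" "y = z \<oplus> x" using y unfolding a_r_coset_def' by auto
    have zc: "z \<in> carrier M" using z H_closed by auto
    have "a \<odot> y \<ominus> a \<odot> x = a \<odot> z"
      unfolding z(2) using assms zc by (simp add: smult_add smult_closed a_minus_def a_assoc r_neg)
    then show ?thesis using stable[OF assms(1) z(1)] assms zc z(2) by (subst cos_eq_iff) (auto simp: smult_closed)
  qed
  moreover have "x \<in> cos x" using A.a_rcos_self[OF assms(2)] .
  ultimately have "(\<Union>y\<in>cos x. cos (a \<odot> y)) = cos (a \<odot> x)" by blast
  then show ?thesis by (simp add: quot_module_def)
qed

lemma Q_scalar_group: "scalar_group Q S"
proof -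
  interpret A: abelian_subgroup H M by (rule abelian_sub)
  have H0: "H = cos \<zero>" using a_coset_add_zero[OF A.a_subset] by simp
  have "abelian_group Q"
  proof (rule abelian_groupI)
    fix X Y assume XY: "X \<in> carrier Q" "Y \<in> carrier Q"
    obtain x where x: "x \<in> carrier M" "X = cos x" using XY(1) by (rule cosE)
    obtain y where y: "y \<in> carrier M" "Y = cos y" using XY(2) by (rule cosE)
    show "X \<oplus>\<^bsub>Q\<^esub> Y \<in> carrier Q" using x y by (simp add: add_cos cos_closed)
    show "X \<oplus>\<^bsub>Q\<^esub> Y = Y \<oplus>\<^bsub>Q\<^esub> X" using x y by (simp add: add_cos a_comm)
    show "\<zero>\<^bsub>Q\<^esub> \<oplus>\<^bsub>Q\<^esub> X = X" unfolding zero_Q x(2) using x(1) by (subst H0) (simp add: add_cos)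
    have "cos (\<ominus> x) \<oplus>\<^bsub>Q\<^esub> X = \<zero>\<^bsub>Q\<^esub>" unfolding zero_Q x(2) using x(1) H0 by (simp add: add_cos l_neg)
    then show "\<exists>Y\<in>carrier Q. Y \<oplus>\<^bsub>Q\<^esub> X = \<zero>\<^bsub>Q\<^esub>" using x(1) by (intro bexI[of _ "cos (\<ominus> x)"] cos_closed) auto
    fix Z assume "Z \<in> carrier Q"
    then obtain z where z: "z \<in> carrier M" "Z = cos z" by (rule cosE)
    show "(X \<oplus>\<^bsub>Q\<^esub> Y) \<oplus>\<^bsub>Q\<^esub> Z = X \<oplus>\<^bsub>Q\<^esub> (Y \<oplus>\<^bsub>Q\<^esub> Z)" using x y z by (simp add: add_cos a_assoc)
  next
    have "cos \<zero> \<in> carrier Q" by (intro cos_closed) simp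
    then show "\<zero>\<^bsub>Q\<^esub> \<in> carrier Q" unfolding zero_Q using H0 by simp
  qed
  then show ?thesis
  proof (intro scalar_group.intro scalar_group_axioms.intro)
    show "a \<odot>\<^bsub>Q\<^esub> X \<in> carrier Q" if aX: "a \<in> S" "X \<in> carrier Q" for a X
    proof -
      obtain x where "x \<in> carrier M" "X = cos x" using aX(2) by (rule cosE)
      then show ?thesis using aX(1) by (simp add: smult_cos cos_closed smult_closed)
    qed
    show "a \<odot>\<^bsub>Q\<^esub> (X \<oplus>\<^bsub>Q\<^esub> Y) = a \<odot>\<^bsub>Q\<^esub> X \<oplus>\<^bsub>Q\<^esub> a \<odot>\<^bsub>Q\<^esub> Y"
      if aX: "a \<in> S" "X \<in> carrier Q" "Y \<in> carrier Q" for a X Y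
    proof -
      obtain x where x: "x \<in> carrier M" "X = cos x" using aX(2) by (rule cosE)
      obtain y where y: "y \<in> carrier M" "Y = cos y" using aX(3) by (rule cosE)
      show ?thesis using aX(1) x y by (simp add: smult_cos add_cos smult_closed smult_add)
    qed
  qed
qed

end

lemma quot_map_cos:
  assumes "scalar_quotient N S K" "scalar_quotient M S' H"
    and f: "\<And>x. x \<in> carrier N \<Longrightarrow> f x \<in> carrier M"
      "\<And>x y. \<lbrakk>x \<in> carrier N; y \<in> carrier N\<rbrakk> \<Longrightarrow> f (x \<oplus>\<^bsub>N\<^esub> y) = f x \<oplus>\<^bsub>M\<^esub> f y"
      "\<And>x. x \<in> K \<Longrightarrow> f x \<in> H"
    and x: "x \<in> carrier N"
  shows "quot_map M H f (K +>\<^bsub>N\<^esub> x) = H +>\<^bsub>M\<^esub> f x"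
proof -
  interpret N: scalar_quotient N S K by (rule assms(1))
  interpret M: scalar_quotient M S' H by (rule assms(2))
  interpret A: abelian_subgroup K N by (rule N.abelian_sub)
  have "H +>\<^bsub>M\<^esub> f y = H +>\<^bsub>M\<^esub> f x" if y: "y \<in> K +>\<^bsub>N\<^esub> x" for y
  proof -
    obtain z where z: "z \<in> K" "y = z \<oplus>\<^bsub>N\<^esub> x" using y unfolding a_r_coset_def' by auto
    have zc: "z \<in> carrier N" using z N.H_closed by auto
    have "f y \<ominus>\<^bsub>M\<^esub> f x = f z"
      unfolding z(2) using x zc f by (simp add: a_minus_def M.a_assoc M.r_neg)
    then show ?thesis using f x zc z by (subst M.cos_eq_iff) auto
  qed
  moreover have "x \<in> K +>\<^bsub>N\<^esub> x" using A.a_rcos_self[OF x] .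
  ultimately show ?thesis unfolding quot_map_def by blast
qed

lemma (in scalar_group) image_quotient:
  assumes "scalar_group N S" "\<And>x. x \<in> carrier N \<Longrightarrow> f x \<in> carrier M"
    "\<And>x y. \<lbrakk>x \<in> carrier N; y \<in> carrier N\<rbrakk> \<Longrightarrow> f (x \<oplus>\<^bsub>N\<^esub> y) = f x \<oplus> f y"
    "\<And>a x. \<lbrakk>a \<in> S; x \<in> carrier N\<rbrakk> \<Longrightarrow> f (a \<odot>\<^bsub>N\<^esub> x) = a \<odot> f x"
  shows "scalar_quotient M S (f ` carrier N)"
proof -
  interpret N: scalar_group N S by (rule assms(1))
  have hom: "f \<in> hom (add_monoid N) (add_monoid M)" using assms(2,3) by (auto simp: hom_def)
  have "group_hom (add_monoid N) (add_monoid M) f"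
    by (intro group_hom.intro group_hom_axioms.intro N.a_group a_group hom)
  then have "subgroup (f ` carrier N) (add_monoid M)" using group_hom.img_is_subgroup by fastforce
  then show ?thesis
    by (intro scalar_quotient.intro scalar_quotient_axioms.intro additive_subgroup.intro scalar_group_axioms)
      (use assms(4) N.smult_closed in \<open>auto simp: image_iff\<close>, metis)
qed

context almost_perfectoid
begin

section \<open>The modules of the statement in terms of \<open>SR\<close> and
  \<open>OP\<close>\<close>

lemma rat_map_eq: "rat_map A t g n a = \<kappa> n (\<iota> a)"
  unfolding rat_map_def to_sections_eq \<iota>_def ..

lemma rat_ring_eq: "rat_ring A t g n = SR n\<lparr>carrier := OP n\<rparr>"
  unfolding rat_ring_def Let_def sections_eq OP_def ..

abbreviation RM where "RM n \<equiv> rat_module A t g n"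

lemma RM_simps: "carrier (RM n) = OP n" "x \<oplus>\<^bsub>RM n\<^esub> y = x \<oplus>\<^bsub>SR n\<^esub> y" "\<zero>\<^bsub>RM n\<^esub> = \<zero>\<^bsub>SR n\<^esub>"
  "a \<odot>\<^bsub>RM n\<^esub> x = \<kappa> n (\<iota> a) \<otimes>\<^bsub>SR n\<^esub> x"
  by (simp_all add: rat_module_def as_module_def rat_ring_eq rat_map_eq)

abbreviation AM where "AM \<equiv> as_module id A"

lemma AM_simps: "carrier AM = carrier A" "x \<oplus>\<^bsub>AM\<^esub> y = x \<oplus> y" "\<zero>\<^bsub>AM\<^esub> = \<zero>" "a \<odot>\<^bsub>AM\<^esub> x = a \<otimes> x"
  by (simp_all add: as_module_def)

lemmas OP_sub = subringE(1)[OF OP_subring]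
lemmas OP_zero = subringE(2)[OF OP_subring]
lemmas OP_neg = subringE(5)[OF OP_subring]
lemmas OP_mult = subringE(6)[OF OP_subring]
lemmas OP_add = subringE(7)[OF OP_subring]

lemma OP_closed: "F \<in> OP n \<Longrightarrow> F \<in> carrier (SR n)" using OP_sub by blast

lemma \<kappa>\<iota>_hom: "ring_hom_cring A (SR n) (\<lambda>a. \<kappa> n (\<iota> a))"
proof -
  interpret \<iota>: ring_hom_cring A R \<iota> by (rule \<iota>_hom)
  interpret \<kappa>: ring_hom_cring R "SR n" "\<kappa> n" by (rule \<kappa>_hom)
  show ?thesis
    by (intro ring_hom_cring.intro ring_hom_cring_axioms.intro is_cring SR_cring ring_hom_memI) auto
qed

lemma A_OP: "a \<in> carrier A \<Longrightarrow> \<kappa> n (\<iota> a) \<in> OP n"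
  using Binf_OP C.A0_Binf by blast

lemma AM_scalar: "scalar_group AM (carrier A)"
proof -
  have "abelian_group AM"
  proof (rule abelian_groupI)
    fix x assume "x \<in> carrier AM"
    then show "\<exists>y\<in>carrier AM. y \<oplus>\<^bsub>AM\<^esub> x = \<zero>\<^bsub>AM\<^esub>"
      unfolding AM_simps by (intro bexI[of _ "\<ominus> x"]) (auto simp: l_neg)
  qed (auto simp: AM_simps a_assoc intro: a_comm)
  then show ?thesis
    by (intro scalar_group.intro scalar_group_axioms.intro) (auto simp: AM_simps r_distr)
qed

lemma RM_scalar: "scalar_group (RM n) (carrier A)"
proof -
  interpret S: cring "SR n" by (rule SR_cring)
  have "abelian_group (RM n)"
  proof (rule abelian_groupI)
    fix x assume "x \<in> carrier (RM n)"
    then show "\<exists>y\<in>carrier (RM n). y \<oplus>\<^bsub>RM n\<^esub> x = \<zero>\<^bsub>RM n\<^esub>"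
      unfolding RM_simps using OP_neg OP_closed by (intro bexI[of _ "\<ominus>\<^bsub>SR n\<^esub> x"]) (auto simp: S.l_neg)
  qed (auto simp: RM_simps OP_add OP_zero S.a_ac OP_closed)
  then show ?thesis
    by (intro scalar_group.intro scalar_group_axioms.intro)
      (auto simp: RM_simps S.r_distr OP_closed A_OP OP_mult)
qed

lemma multiples_quotient:
  assumes M: "scalar_group M (carrier A)" and c: "c \<in> carrier A"
    and comm: "\<And>a x. \<lbrakk>a \<in> carrier A; x \<in> carrier M\<rbrakk> \<Longrightarrow> c \<odot>\<^bsub>M\<^esub> (a \<odot>\<^bsub>M\<^esub> x) = a \<odot>\<^bsub>M\<^esub> (c \<odot>\<^bsub>M\<^esub> x)"
  shows "scalar_quotient M (carrier A) (multiples M c)"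
proof -
  interpret M: scalar_group M "carrier A" by (rule M)
  show ?thesis unfolding multiples_def
    by (rule M.image_quotient[OF M]) (use c M.smult_closed M.smult_add comm in auto)
qed

lemma AM_quotient: "scalar_quotient AM (carrier A) (multiples AM (t [^] (m::nat)))"
  by (rule multiples_quotient[OF AM_scalar]) (auto simp: AM_simps m_lcomm)

lemma RM_quotient: "scalar_quotient (RM n) (carrier A) (multiples (RM n) (t [^] (m::nat)))"
proof (rule multiples_quotient[OF RM_scalar])
  interpret S: cring "SR n" by (rule SR_cring)
  interpret \<kappa>\<iota>: ring_hom_cring A "SR n" "\<lambda>a. \<kappa> n (\<iota> a)" by (rule \<kappa>\<iota>_hom)
  show "t [^] m \<odot>\<^bsub>RM n\<^esub> (a \<odot>\<^bsub>RM n\<^esub> x) = a \<odot>\<^bsub>RM n\<^esub> (t [^] m \<odot>\<^bsub>RM n\<^esub> x)"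
    if "a \<in> carrier A" "x \<in> carrier (RM n)" for a x
    using that OP_closed unfolding RM_simps by (intro S.m_lcomm) auto
qed simp

abbreviation cos0 where "cos0 m a \<equiv> multiples AM (t [^] (m::nat)) +>\<^bsub>AM\<^esub> a"
abbreviation cos1 where "cos1 m n F \<equiv> multiples (RM n) (t [^] (m::nat)) +>\<^bsub>RM n\<^esub> F"

abbreviation Src where "Src m \<equiv> source_module A t m"
abbreviation Tgt where "Tgt m n \<equiv> target_module A t g m n"
abbreviation cmp where "cmp m n \<equiv> comparison_map A t g m n"

lemma cos0_zero_iff: "a \<in> carrier A \<Longrightarrow> cos0 m a = \<zero>\<^bsub>Src m\<^esub> \<longleftrightarrow> (\<exists>b\<in>carrier A. a = t [^] m \<otimes> b)"
  using scalar_quotient.cos_zero_iff[OF AM_quotient, of a m]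
  by (auto simp: source_module_def reduction_def AM_simps multiples_def)

lemma cos0_smult: "\<lbrakk>a \<in> carrier A; x \<in> carrier A\<rbrakk> \<Longrightarrow> a \<odot>\<^bsub>Src m\<^esub> cos0 m x = cos0 m (a \<otimes> x)"
  using scalar_quotient.smult_cos[OF AM_quotient, of a x m]
  by (simp add: source_module_def reduction_def AM_simps)

lemma SrcE: assumes "X \<in> carrier (Src m)" obtains a where "a \<in> carrier A" "X = cos0 m a"
  using scalar_quotient.cosE[OF AM_quotient, of X m] assms
  by (auto simp: source_module_def reduction_def AM_simps)

lemma cos0_closed: "a \<in> carrier A \<Longrightarrow> cos0 m a \<in> carrier (Src m)"
  using scalar_quotient.cos_closed[OF AM_quotient, of a m]
  by (simp add: source_module_def reduction_def AM_simps)

lemma cos1_eq_iff: assumes "F \<in> OP n" "H \<in> OP n"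
  shows "cos1 m n F = cos1 m n H \<longleftrightarrow> (\<exists>E\<in>OP n. F = H \<oplus>\<^bsub>SR n\<^esub> \<kappa> n (\<iota> (t [^] m)) \<otimes>\<^bsub>SR n\<^esub> E)"
proof -
  interpret S: cring "SR n" by (rule SR_cring)
  interpret Q: scalar_quotient "RM n" "carrier A" "multiples (RM n) (t [^] m)" by (rule RM_quotient)
  interpret \<kappa>\<iota>: ring_hom_cring A "SR n" "\<lambda>a. \<kappa> n (\<iota> a)" by (rule \<kappa>\<iota>_hom)
  \<comment> \<open>Negatives in \<open>RM n\<close> are taken inside the smaller carrier
    \<open>OP n\<close>; uniqueness of negatives identifies them with those of
    \<open>SR n\<close>.\<close>
  have neg: "\<ominus>\<^bsub>RM n\<^esub> H = \<ominus>\<^bsub>SR n\<^esub> H"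
    using assms OP_neg[OF assms(2)] OP_closed[OF assms(2)]
    by (intro Q.minus_equality) (auto simp: RM_simps S.l_neg)
  have tc: "\<kappa> n (\<iota> (t [^] m)) \<in> carrier (SR n)" by (rule \<kappa>\<iota>.hom_closed) simp
  have "cos1 m n F = cos1 m n H \<longleftrightarrow> F \<ominus>\<^bsub>SR n\<^esub> H \<in> multiples (RM n) (t [^] m)"
    using Q.cos_eq_iff[of F H] assms by (simp add: RM_simps a_minus_def neg)
  also have "\<dots> \<longleftrightarrow> (\<exists>E\<in>OP n. F \<ominus>\<^bsub>SR n\<^esub> H = \<kappa> n (\<iota> (t [^] m)) \<otimes>\<^bsub>SR n\<^esub> E)"
    unfolding multiples_def RM_simps by auto
  also have "\<dots> \<longleftrightarrow> (\<exists>E\<in>OP n. F = H \<oplus>\<^bsub>SR n\<^esub> \<kappa> n (\<iota> (t [^] m)) \<otimes>\<^bsub>SR n\<^esub> E)"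
  proof (rule bex_cong[OF refl])
    fix E assume E: "E \<in> OP n"
    define Z where "Z = \<kappa> n (\<iota> (t [^] m)) \<otimes>\<^bsub>SR n\<^esub> E"
    have c: "F \<in> carrier (SR n)" "H \<in> carrier (SR n)" "Z \<in> carrier (SR n)"
      using assms OP_closed[OF E] OP_closed tc by (auto simp: Z_def)
    have "F = H \<oplus>\<^bsub>SR n\<^esub> (F \<ominus>\<^bsub>SR n\<^esub> H)"
      using c by (simp add: a_minus_def S.a_lcomm S.r_neg)
    moreover have "(H \<oplus>\<^bsub>SR n\<^esub> Z) \<ominus>\<^bsub>SR n\<^esub> H = Z"
      unfolding S.a_comm[OF c(2,3)] using c by (simp add: a_minus_def S.a_assoc S.r_neg)
    ultimately show "(F \<ominus>\<^bsub>SR n\<^esub> H = \<kappa> n (\<iota> (t [^] m)) \<otimes>\<^bsub>SR n\<^esub> E) = (F = H \<oplus>\<^bsub>SR n\<^esub> \<kappa> n (\<iota> (t [^] m)) \<otimes>\<^bsub>SR n\<^esub> E)"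
      unfolding Z_def[symmetric] by metis
  qed
  finally show ?thesis .
qed

lemma cos1_zero_iff: assumes "F \<in> OP n"
  shows "cos1 m n F = \<zero>\<^bsub>Tgt m n\<^esub> \<longleftrightarrow> (\<exists>E\<in>OP n. F = \<kappa> n (\<iota> (t [^] m)) \<otimes>\<^bsub>SR n\<^esub> E)"
  using scalar_quotient.cos_zero_iff[OF RM_quotient, of F n m] assms
  by (auto simp: target_module_def reduction_def RM_simps multiples_def)

lemma TgtE: assumes "X \<in> carrier (Tgt m n)" obtains F where "F \<in> OP n" "X = cos1 m n F"
  using scalar_quotient.cosE[OF RM_quotient, of X n m] assms
  by (auto simp: target_module_def reduction_def RM_simps)

lemma cos1_closed: "F \<in> OP n \<Longrightarrow> cos1 m n F \<in> carrier (Tgt m n)"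
  using scalar_quotient.cos_closed[OF RM_quotient, of F n m]
  by (simp add: target_module_def reduction_def RM_simps)

lemma cos1_smult: "\<lbrakk>a \<in> carrier A; F \<in> OP n\<rbrakk> \<Longrightarrow> a \<odot>\<^bsub>Tgt m n\<^esub> cos1 m n F = cos1 m n (\<kappa> n (\<iota> a) \<otimes>\<^bsub>SR n\<^esub> F)"
  using scalar_quotient.smult_cos[OF RM_quotient, of a F n m]
  by (simp add: target_module_def reduction_def RM_simps)

lemma cos1_add: "\<lbrakk>F \<in> OP n; H \<in> OP n\<rbrakk> \<Longrightarrow> cos1 m n F \<oplus>\<^bsub>Tgt m n\<^esub> cos1 m n H = cos1 m n (F \<oplus>\<^bsub>SR n\<^esub> H)"
  using scalar_quotient.add_cos[OF RM_quotient, of F n H m]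
  by (simp add: target_module_def reduction_def RM_simps)

lemma cmp_cos0: assumes "a \<in> carrier A" shows "cmp m n (cos0 m a) = cos1 m n (\<kappa> n (\<iota> a))"
proof -
  interpret \<kappa>\<iota>: ring_hom_cring A "SR n" "\<lambda>a. \<kappa> n (\<iota> a)" by (rule \<kappa>\<iota>_hom)
  have "quot_map (RM n) (multiples (RM n) (t [^] m)) (rat_map A t g n) (cos0 m a) = cos1 m n (rat_map A t g n a)"
  proof (rule quot_map_cos[OF AM_quotient RM_quotient])
    show "rat_map A t g n x \<in> multiples (RM n) (t [^] m)" if xm: "x \<in> multiples AM (t [^] m)" for x
    proof -
      obtain b where b: "b \<in> carrier A" "x = t [^] m \<otimes> b" using xm by (auto simp: multiples_def AM_simps)
      have "rat_map A t g n x = t [^] m \<odot>\<^bsub>RM n\<^esub> \<kappa> n (\<iota> b)"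
        unfolding rat_map_eq b(2) RM_simps using b(1) by (intro \<kappa>\<iota>.hom_mult) auto
      then show ?thesis using A_OP[OF b(1)] unfolding multiples_def RM_simps(1) by blast
    qed
  qed (use assms in \<open>auto simp: AM_simps RM_simps rat_map_eq A_OP\<close>)
  then show ?thesis unfolding comparison_map_def rat_map_eq .
qed

lemma rat_restrict_eq: "rat_restrict A t g n = \<rho> n"
  unfolding rat_restrict_def \<rho>_def rat_nbhd_eq ..

lemma target_transition_cos1:
  assumes "F \<in> OP (Suc n)" shows "target_transition A t g m n (cos1 m (Suc n) F) = cos1 m n (\<rho> n F)"
proof -
  interpret \<rho>: ring_hom_cring "SR (Suc n)" "SR n" "\<rho> n" by (rule \<rho>_hom)
  interpret \<iota>: ring_hom_cring A R \<iota> by (rule \<iota>_hom)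
  interpret \<kappa>: ring_hom_cring R "SR (Suc n)" "\<kappa> (Suc n)" by (rule \<kappa>_hom)
  show ?thesis unfolding target_transition_def rat_restrict_eq
  proof (rule quot_map_cos[OF RM_quotient RM_quotient])
    show "\<rho> n x \<in> multiples (RM n) (t [^] m)" if xm: "x \<in> multiples (RM (Suc n)) (t [^] m)" for x
    proof -
      obtain b where b: "b \<in> OP (Suc n)" "x = \<kappa> (Suc n) (\<iota> (t [^] m)) \<otimes>\<^bsub>SR (Suc n)\<^esub> b"
        using xm unfolding multiples_def RM_simps by blast
      have tc: "\<iota> (t [^] m) \<in> carrier R" by (rule \<iota>.hom_closed) simp
      have "\<rho> n x = \<rho> n (\<kappa> (Suc n) (\<iota> (t [^] m))) \<otimes>\<^bsub>SR n\<^esub> \<rho> n b"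
        using \<rho>.hom_mult[OF \<kappa>.hom_closed[OF tc] OP_closed[OF b(1)]] b(2) by argo
      then have "\<rho> n x = \<kappa> n (\<iota> (t [^] m)) \<otimes>\<^bsub>SR n\<^esub> \<rho> n b" using \<rho>_\<kappa>[OF tc, of n] by argo
      then show ?thesis using \<rho>_OP[OF b(1)] unfolding multiples_def RM_simps by blast
    qed
  qed (use assms in \<open>auto simp: RM_simps \<rho>_OP OP_closed\<close>)
qed

lemma Src_scalar: "scalar_group (Src m) (carrier A)"
  unfolding source_module_def reduction_def by (rule scalar_quotient.Q_scalar_group[OF AM_quotient])

lemma Tgt_scalar: "scalar_group (Tgt m n) (carrier A)"
  unfolding target_module_def reduction_def by (rule scalar_quotient.Q_scalar_group[OF RM_quotient])

lemma cmp_closed: "X \<in> carrier (Src m) \<Longrightarrow> cmp m n X \<in> carrier (Tgt m n)"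
  by (erule SrcE) (simp add: cmp_cos0 cos1_closed A_OP)

lemma cos0_add: "\<lbrakk>a \<in> carrier A; b \<in> carrier A\<rbrakk> \<Longrightarrow> cos0 m a \<oplus>\<^bsub>Src m\<^esub> cos0 m b = cos0 m (a \<oplus> b)"
  using scalar_quotient.add_cos[OF AM_quotient, of a b m]
  by (simp add: source_module_def reduction_def AM_simps)

lemma coker_quotient: "scalar_quotient (Tgt m n) (carrier A) (cmp m n ` carrier (Src m))"
proof (rule scalar_group.image_quotient[OF Tgt_scalar Src_scalar cmp_closed])
  interpret \<kappa>\<iota>: ring_hom_cring A "SR n" "\<lambda>a. \<kappa> n (\<iota> a)" by (rule \<kappa>\<iota>_hom)
  show "cmp m n (X \<oplus>\<^bsub>Src m\<^esub> Y) = cmp m n X \<oplus>\<^bsub>Tgt m n\<^esub> cmp m n Y"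
    if XY: "X \<in> carrier (Src m)" "Y \<in> carrier (Src m)" for X Y
  proof -
    obtain a where a: "a \<in> carrier A" "X = cos0 m a" using XY(1) by (rule SrcE)
    obtain b where b: "b \<in> carrier A" "Y = cos0 m b" using XY(2) by (rule SrcE)
    have "\<kappa> n (\<iota> (a \<oplus> b)) = \<kappa> n (\<iota> a) \<oplus>\<^bsub>SR n\<^esub> \<kappa> n (\<iota> b)" using \<kappa>\<iota>.hom_add[OF a(1) b(1)] .
    then show ?thesis using a b by (simp add: cos0_add cmp_cos0 cos1_add A_OP)
  qed
  show "cmp m n (a \<odot>\<^bsub>Src m\<^esub> X) = a \<odot>\<^bsub>Tgt m n\<^esub> cmp m n X"
    if aX: "a \<in> carrier A" "X \<in> carrier (Src m)" for a X
  proof -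
    obtain x where x: "x \<in> carrier A" "X = cos0 m x" using aX(2) by (rule SrcE)
    have "\<kappa> n (\<iota> (a \<otimes> x)) = \<kappa> n (\<iota> a) \<otimes>\<^bsub>SR n\<^esub> \<kappa> n (\<iota> x)" using \<kappa>\<iota>.hom_mult[OF aX(1) x(1)] .
    then show ?thesis using aX(1) x by (simp add: cos0_smult cmp_cos0 cos1_smult A_OP)
  qed
qed

section \<open>Cokernels and their transition maps\<close>

abbreviation Ck where "Ck m n \<equiv> coker_module (Src m) (Tgt m n) (cmp m n)"
abbreviation cl where "cl m n F \<equiv> (cmp m n ` carrier (Src m)) +>\<^bsub>Tgt m n\<^esub> cos1 m n F"

lemma Ck_eq: "Ck m n = quot_module (Tgt m n) (cmp m n ` carrier (Src m))"
  by (simp add: coker_module_def)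

lemma CkE: assumes "Z \<in> carrier (Ck m n)" obtains F where "F \<in> OP n" "Z = cl m n F"
proof -
  obtain X where "X \<in> carrier (Tgt m n)" "Z = (cmp m n ` carrier (Src m)) +>\<^bsub>Tgt m n\<^esub> X"
    using assms unfolding Ck_eq by (rule scalar_quotient.cosE[OF coker_quotient])
  then show thesis using that by (metis TgtE)
qed

lemma cl_smult: "\<lbrakk>a \<in> carrier A; F \<in> OP n\<rbrakk> \<Longrightarrow> a \<odot>\<^bsub>Ck m n\<^esub> cl m n F = cl m n (\<kappa> n (\<iota> a) \<otimes>\<^bsub>SR n\<^esub> F)"
  unfolding Ck_eq using scalar_quotient.smult_cos[OF coker_quotient, of a "cos1 m n F"]
  by (simp add: cos1_closed cos1_smult)

lemma cl_zero:
  assumes "F \<in> OP n" "a \<in> carrier A" "H \<in> OP n"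
    "F = \<kappa> n (\<iota> a) \<oplus>\<^bsub>SR n\<^esub> \<kappa> n (\<iota> (t [^] m)) \<otimes>\<^bsub>SR n\<^esub> H"
  shows "cl m n F = \<zero>\<^bsub>Ck m n\<^esub>"
proof -
  have "cos1 m n F = cos1 m n (\<kappa> n (\<iota> a))"
    using cos1_eq_iff[OF assms(1) A_OP[OF assms(2)]] assms(3,4) by blast
  also have "\<dots> = cmp m n (cos0 m a)" using cmp_cos0[OF assms(2)] by simp
  finally have "cos1 m n F \<in> cmp m n ` carrier (Src m)" using cos0_closed[OF assms(2)] by blast
  then show ?thesis unfolding Ck_eq
    using scalar_quotient.cos_zero_iff[OF coker_quotient cos1_closed[OF assms(1)]] by blast
qed

abbreviation tt where "tt m \<equiv> target_transition A t g m"
abbreviation dC where "dC m \<equiv> coker_transition (\<lambda>n. Src m) (Tgt m) (cmp m) (tt m)"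

lemma dC_cl: assumes F: "F \<in> OP (Suc n)" shows "dC m n (cl m (Suc n) F) = cl m n (\<rho> n F)"
proof -
  interpret \<rho>: ring_hom_cring "SR (Suc n)" "SR n" "\<rho> n" by (rule \<rho>_hom)
  have "quot_map (Tgt m n) (cmp m n ` carrier (Src m)) (tt m n) (cl m (Suc n) F)
      = (cmp m n ` carrier (Src m)) +>\<^bsub>Tgt m n\<^esub> tt m n (cos1 m (Suc n) F)"
  proof (rule quot_map_cos[OF coker_quotient coker_quotient _ _ _ cos1_closed[OF F]])
    show "tt m n X \<in> carrier (Tgt m n)" if "X \<in> carrier (Tgt m (Suc n))" for X
      using that by (rule TgtE) (simp add: target_transition_cos1 cos1_closed \<rho>_OP)
    show "tt m n (X \<oplus>\<^bsub>Tgt m (Suc n)\<^esub> Y) = tt m n X \<oplus>\<^bsub>Tgt m n\<^esub> tt m n Y"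
      if XY: "X \<in> carrier (Tgt m (Suc n))" "Y \<in> carrier (Tgt m (Suc n))" for X Y
    proof -
      obtain G where G: "G \<in> OP (Suc n)" "X = cos1 m (Suc n) G" using XY(1) by (rule TgtE)
      obtain H where H: "H \<in> OP (Suc n)" "Y = cos1 m (Suc n) H" using XY(2) by (rule TgtE)
      show ?thesis using G H by (simp add: cos1_add target_transition_cos1 OP_add \<rho>_OP OP_closed)
    qed
    show "tt m n X \<in> cmp m n ` carrier (Src m)" if X: "X \<in> cmp m (Suc n) ` carrier (Src m)" for X
    proof -
      obtain a where a: "a \<in> carrier A" "X = cos1 m (Suc n) (\<kappa> (Suc n) (\<iota> a))"
        using X by (auto elim!: SrcE simp: cmp_cos0)
      have "\<iota> a \<in> carrier R" using a(1) C.A0_closed by blast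
      then have "tt m n X = cmp m n (cos0 m a)"
        using a by (simp add: target_transition_cos1 A_OP \<rho>_\<kappa> cmp_cos0)
      then show ?thesis using cos0_closed[OF a(1)] by blast
    qed
  qed
  then show ?thesis unfolding coker_transition_def by (simp add: target_transition_cos1 F)
qed

definition \<rho>s where "\<rho>s n c = transition \<rho> n c"

text \<open>The clauses are bundled so that one induction on \<open>c\<close> yields them all; the
  last one reduces transition maps of cokernels to restriction of sections.\<close>

lemma \<rho>s_props:
  "(F \<in> OP (n + c) \<longrightarrow> \<rho>s n c F \<in> OP n) \<and>
   (F \<in> carrier (SR (n + c)) \<longrightarrow> H \<in> carrier (SR (n + c)) \<longrightarrow>
     \<rho>s n c F \<in> carrier (SR n) \<and> \<rho>s n c (F \<oplus>\<^bsub>SR (n + c)\<^esub> H) = \<rho>s n c F \<oplus>\<^bsub>SR n\<^esub> \<rho>s n c H) \<and>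
   (r \<in> carrier R \<longrightarrow> \<rho>s n c (\<kappa> (n + c) r) = \<kappa> n r) \<and>
   (F \<in> SN (n + c) k \<longrightarrow> \<rho>s n c F \<in> SN n k) \<and>
   (F \<in> OP (n + c) \<longrightarrow> transition (dC m) n c (cl m (n + c) F) = cl m n (\<rho>s n c F))"
proof (induction c arbitrary: F H)
  case 0
  then show ?case by (simp add: \<rho>s_def)
next
  case (Suc c)
  interpret \<rho>: ring_hom_cring "SR (Suc (n + c))" "SR (n + c)" "\<rho> (n + c)" by (rule \<rho>_hom)
  have e: "\<rho>s n (Suc c) F = \<rho>s n c (\<rho> (n + c) F)" for F by (simp add: \<rho>s_def)
  show ?case
    using Suc.IH[of "\<rho> (n + c) F" "\<rho> (n + c) H"] Suc.IH[of "\<kappa> (n + c) r" "\<kappa> (n + c) r"]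
    by (simp add: e \<rho>_OP \<rho>_\<kappa> \<rho>_SN dC_cl)
qed

text \<open>Up to a multiple of \<open>t^m\<close>, \<open>F\<close> is a constant section
  \<open>r\<close>. Almost, \<open>r\<close> lies in \<open>Binf (n + p^k m)\<close>, where
  \<open>gs k\<close> carries it into \<open>A0 + t^m Binf n\<close>: the first summand comes from
  the source, the second vanishes modulo \<open>t^m\<close>.\<close>

lemma coker_killed:
  assumes F: "F \<in> OP (n + p ^ k * m)"
  shows "ts e \<odot>\<^bsub>Ck m n\<^esub> (gs k \<odot>\<^bsub>Ck m n\<^esub> transition (dC m) n (p ^ k * m) (cl m (n + p ^ k * m) F)) = \<zero>\<^bsub>Ck m n\<^esub>"
proof -
  define c where "c = p ^ k * m"
  interpret D: adic_ring R "Bn (n + c)" "\<iota> t" by (rule adic_R)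
  interpret Sc: cring "SR (n + c)" by (rule SR_cring)
  interpret S: cring "SR n" by (rule SR_cring)
  interpret \<kappa>: ring_hom_cring R "SR n" "\<kappa> n" by (rule \<kappa>_hom)
  interpret \<kappa>c: ring_hom_cring R "SR (n + c)" "\<kappa> (n + c)" by (rule \<kappa>_hom)
  interpret \<iota>: ring_hom_cring A R \<iota> by (rule \<iota>_hom)
  have F': "F \<in> OP (n + c)" using F by (simp add: c_def)
  \<comment> \<open>Precision \<open>m\<close> suffices: the error restricts to \<open>t^m\<close>
    times an element of \<open>SN n 0\<close>, which consists of integral sections.\<close>
  obtain r where r: "r \<in> carrier R" "F \<ominus>\<^bsub>SR (n + c)\<^esub> \<kappa> (n + c) r \<in> SN (n + c) m"
    using D.dense[OF OP_closed[OF F']] unfolding \<kappa>_def by blast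
  define E where "E = F \<ominus>\<^bsub>SR (n + c)\<^esub> \<kappa> (n + c) r"
  have E: "E \<in> SN (n + c) m" using r(2) by (simp add: E_def)
  then have EO: "E \<in> OP (n + c)" using SN_OP SN_mono by blast
  note Ec = OP_closed[OF EO] and Fc = OP_closed[OF F']
  have kr: "\<kappa> (n + c) r \<in> carrier (SR (n + c))" using r by simp
  have "\<kappa> (n + c) r = F \<oplus>\<^bsub>SR (n + c)\<^esub> \<ominus>\<^bsub>SR (n + c)\<^esub> E"
    unfolding E_def a_minus_def using Fc kr by (simp add: Sc.minus_add Sc.a_assoc[symmetric] Sc.r_neg)
  then have rO: "\<kappa> (n + c) r \<in> OP (n + c)" using OP_add[OF F' OP_neg[OF EO]] by simp
  have Fdec: "F = \<kappa> (n + c) r \<oplus>\<^bsub>SR (n + c)\<^esub> E"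
    unfolding E_def a_minus_def using Fc kr by (simp add: Sc.a_lcomm Sc.r_neg)
  have res: "\<rho>s n c F = \<kappa> n r \<oplus>\<^bsub>SR n\<^esub> \<rho>s n c E"
    using \<rho>s_props[of "\<kappa> (n + c) r" n c E r] kr Ec r(1) Fdec by simp
  have "\<rho>s n c E \<in> SN n m" using \<rho>s_props[of E n c] E by blast
  then have "\<rho>s n c E \<in> adic_nbhd (SR n) (SN n 0) (\<kappa> n (\<iota> t)) m"
    unfolding \<kappa>_def using adic_ring.CN_eq[OF adic_R] by blast
  then obtain E' where E': "E' \<in> SN n 0" "\<rho>s n c E = \<kappa> n (\<iota> t) [^]\<^bsub>SR n\<^esub> m \<otimes>\<^bsub>SR n\<^esub> E'"
    unfolding adic_nbhd_def by blast
  note E'O = SN_OP[OF E'(1)]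
  note E'c = OP_closed[OF E'O]
  have tsr: "\<iota> (ts e) \<otimes>\<^bsub>R\<^esub> r \<in> C.Binf (n + p ^ k * m)"
    using OP_const_almost_Binf[OF r(1) rO] unfolding c_def .
  obtain a0 z where az: "a0 \<in> A0" "z \<in> C.Binf n"
    "\<iota> (gs k) \<otimes>\<^bsub>R\<^esub> (\<iota> (ts e) \<otimes>\<^bsub>R\<^esub> r) = a0 \<oplus>\<^bsub>R\<^esub> \<iota> t [^]\<^bsub>R\<^esub> m \<otimes>\<^bsub>R\<^esub> z"
    using C.gs_root_Binf[OF tsr] by blast
  obtain a where a: "a \<in> carrier A" "a0 = \<iota> a" using az(1) by blast
  note zc = C.Binf_closed[OF az(2)] and zO = Binf_OP[OF az(2)]
  define T where "T = \<kappa> n (\<iota> (t [^] m))"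
  define P where "P = \<kappa> n (\<iota> (ts e))"
  define G where "G = \<kappa> n (\<iota> (gs k))"
  have c: "T \<in> carrier (SR n)" "P \<in> carrier (SR n)" "G \<in> carrier (SR n)" "P \<in> OP n" "G \<in> OP n"
    using A_OP OP_closed unfolding T_def P_def G_def by auto
  have Tt: "\<kappa> n (\<iota> t) [^]\<^bsub>SR n\<^esub> m = T" unfolding T_def by simp
  have main: "P \<otimes>\<^bsub>SR n\<^esub> (G \<otimes>\<^bsub>SR n\<^esub> \<kappa> n r) = \<kappa> n (\<iota> a) \<oplus>\<^bsub>SR n\<^esub> T \<otimes>\<^bsub>SR n\<^esub> \<kappa> n z"
  proof -
    have "P \<otimes>\<^bsub>SR n\<^esub> (G \<otimes>\<^bsub>SR n\<^esub> \<kappa> n r) = G \<otimes>\<^bsub>SR n\<^esub> (P \<otimes>\<^bsub>SR n\<^esub> \<kappa> n r)"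
      using c r(1) by (intro S.m_lcomm) auto
    also have "\<dots> = \<kappa> n (\<iota> (gs k) \<otimes>\<^bsub>R\<^esub> (\<iota> (ts e) \<otimes>\<^bsub>R\<^esub> r))"
      unfolding P_def G_def using r(1) by simp
    also have "\<dots> = \<kappa> n (\<iota> a) \<oplus>\<^bsub>SR n\<^esub> T \<otimes>\<^bsub>SR n\<^esub> \<kappa> n z"
      unfolding az(3) a(2) Tt[symmetric] using a(1) zc by simp
    finally show ?thesis .
  qed
  \<comment> \<open>Collects the two contributions divisible by \<open>t^m\<close>, from the
    approximation error and from \<open>gs_root_Binf\<close>.\<close>
  define H where "H = \<kappa> n z \<oplus>\<^bsub>SR n\<^esub> P \<otimes>\<^bsub>SR n\<^esub> (G \<otimes>\<^bsub>SR n\<^esub> E')"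
  have HO: "H \<in> OP n" unfolding H_def using c zO E'O by (intro OP_add OP_mult)
  have kc: "\<kappa> n r \<in> carrier (SR n)" "\<kappa> n z \<in> carrier (SR n)" "\<kappa> n (\<iota> a) \<in> carrier (SR n)"
    using r zc a by auto
  have \<rho>O: "\<rho>s n c F \<in> OP n" using \<rho>s_props[of F n c] F' by blast
  have "P \<otimes>\<^bsub>SR n\<^esub> (G \<otimes>\<^bsub>SR n\<^esub> \<rho>s n c F)
      = P \<otimes>\<^bsub>SR n\<^esub> (G \<otimes>\<^bsub>SR n\<^esub> \<kappa> n r) \<oplus>\<^bsub>SR n\<^esub> P \<otimes>\<^bsub>SR n\<^esub> (G \<otimes>\<^bsub>SR n\<^esub> (T \<otimes>\<^bsub>SR n\<^esub> E'))"
    unfolding res E'(2) Tt using c kc E'c by (simp add: S.r_distr)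
  also have "P \<otimes>\<^bsub>SR n\<^esub> (G \<otimes>\<^bsub>SR n\<^esub> (T \<otimes>\<^bsub>SR n\<^esub> E')) = T \<otimes>\<^bsub>SR n\<^esub> (P \<otimes>\<^bsub>SR n\<^esub> (G \<otimes>\<^bsub>SR n\<^esub> E'))"
    using S.m_lcomm[of G T E'] S.m_lcomm[of P T "G \<otimes>\<^bsub>SR n\<^esub> E'"] c E'c by simp
  also have "P \<otimes>\<^bsub>SR n\<^esub> (G \<otimes>\<^bsub>SR n\<^esub> \<kappa> n r) \<oplus>\<^bsub>SR n\<^esub> T \<otimes>\<^bsub>SR n\<^esub> (P \<otimes>\<^bsub>SR n\<^esub> (G \<otimes>\<^bsub>SR n\<^esub> E')) = \<kappa> n (\<iota> a) \<oplus>\<^bsub>SR n\<^esub> T \<otimes>\<^bsub>SR n\<^esub> H"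
    unfolding main H_def using c kc E'c by (simp add: S.r_distr S.a_assoc)
  finally have eq: "P \<otimes>\<^bsub>SR n\<^esub> (G \<otimes>\<^bsub>SR n\<^esub> \<rho>s n c F) = \<kappa> n (\<iota> a) \<oplus>\<^bsub>SR n\<^esub> T \<otimes>\<^bsub>SR n\<^esub> H" .
  have PO: "P \<otimes>\<^bsub>SR n\<^esub> (G \<otimes>\<^bsub>SR n\<^esub> \<rho>s n c F) \<in> OP n" using c \<rho>O by (intro OP_mult)
  have "ts e \<odot>\<^bsub>Ck m n\<^esub> (gs k \<odot>\<^bsub>Ck m n\<^esub> cl m n (\<rho>s n c F)) = cl m n (P \<otimes>\<^bsub>SR n\<^esub> (G \<otimes>\<^bsub>SR n\<^esub> \<rho>s n c F))"
    unfolding P_def G_def using \<rho>O OP_mult[OF c(5) \<rho>O] by (simp add: cl_smult G_def)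
  also have "\<dots> = \<zero>\<^bsub>Ck m n\<^esub>" by (rule cl_zero[OF PO a(1) HO eq[unfolded T_def]])
  finally show ?thesis using \<rho>s_props[of F n c] F' unfolding c_def by simp
qed

text \<open>If \<open>a = t^m F\<close> with \<open>F\<close> in \<open>OP n\<close>, cancelling the
  unit \<open>t^m\<close> in the completion shows that \<open>F\<close> is the constant section
  \<open>a/t^m\<close>, to which the description of constant sections applies.\<close>

lemma kernel_killed:
  assumes a: "a \<in> carrier A" and ker: "cmp m n (cos0 m a) = \<zero>\<^bsub>Tgt m n\<^esub>"
  shows "ts e \<odot>\<^bsub>Src m\<^esub> cos0 m a = \<zero>\<^bsub>Src m\<^esub>"
proof -
  interpret S: cring "SR n" by (rule SR_cring)
  interpret \<kappa>: ring_hom_cring R "SR n" "\<kappa> n" by (rule \<kappa>_hom)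
  interpret \<iota>: ring_hom_cring A R \<iota> by (rule \<iota>_hom)
  have "cos1 m n (\<kappa> n (\<iota> a)) = \<zero>\<^bsub>Tgt m n\<^esub>" using ker by (simp add: cmp_cos0[OF a])
  then obtain F where F: "F \<in> OP n" "\<kappa> n (\<iota> a) = \<kappa> n (\<iota> (t [^] m)) \<otimes>\<^bsub>SR n\<^esub> F"
    using cos1_zero_iff[OF A_OP[OF a]] by blast
  define u where "u = \<iota> t [^]\<^bsub>R\<^esub> m"
  have u: "u \<in> Units R" unfolding u_def using C.Units_pow_closed C.t_unit by blast
  have ut: "\<iota> (t [^] m) = u" unfolding u_def by simp
  define s where "s = inv\<^bsub>R\<^esub> u \<otimes>\<^bsub>R\<^esub> \<iota> a"
  have s: "s \<in> carrier R" unfolding s_def using u a by simp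
  have us: "\<iota> a = u \<otimes>\<^bsub>R\<^esub> s"
  proof -
    have "u \<otimes>\<^bsub>R\<^esub> s = (u \<otimes>\<^bsub>R\<^esub> inv\<^bsub>R\<^esub> u) \<otimes>\<^bsub>R\<^esub> \<iota> a" unfolding s_def using u a C.Units_closed by (intro C.m_assoc[symmetric]) auto
    then show ?thesis using u a by simp
  qed
  have "\<kappa> n u \<otimes>\<^bsub>SR n\<^esub> \<kappa> n s = \<kappa> n u \<otimes>\<^bsub>SR n\<^esub> F"
    using F(2)[unfolded ut us] \<kappa>.hom_mult[OF C.Units_closed[OF u] s] by argo
  then have "\<kappa> n s = F"
    using S.Units_l_cancel[OF hom_Units[OF \<kappa>_hom u] \<kappa>.hom_closed[OF s] OP_closed[OF F(1)]] by blast
  then have Bs: "\<And>e. \<iota> (ts e) \<otimes>\<^bsub>R\<^esub> s \<in> C.Binf n" using OP_const_almost_Binf[OF s] F(1) by blast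
  obtain c0 where c0: "c0 \<in> A0" "\<iota> (ts e) \<otimes>\<^bsub>R\<^esub> \<iota> a = \<iota> t [^]\<^bsub>R\<^esub> m \<otimes>\<^bsub>R\<^esub> c0"
    using C.almost_injective[OF imageI[OF a] s us[unfolded u_def] Bs, of e] by blast
  then obtain c where c: "c \<in> carrier A" "c0 = \<iota> c" by blast
  have "\<iota> (ts e \<otimes> a) = \<iota> (t [^] m \<otimes> c)" using c0(2) c a by simp
  then have "ts e \<otimes> a = t [^] m \<otimes> c" using \<iota>_eqD a c by simp
  then show ?thesis using a c(1) cos0_zero_iff[of "ts e \<otimes> a" m] by (simp add: cos0_smult) blast
qed

lemma Src_zero_smult: "b \<in> carrier A \<Longrightarrow> b \<odot>\<^bsub>Src m\<^esub> \<zero>\<^bsub>Src m\<^esub> = \<zero>\<^bsub>Src m\<^esub>"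
proof -
  assume b: "b \<in> carrier A"
  have "\<exists>b\<in>carrier A. \<zero> = t [^] m \<otimes> b" by (rule bexI[of _ \<zero>]) auto
  then have z: "cos0 m \<zero> = \<zero>\<^bsub>Src m\<^esub>" using cos0_zero_iff[of \<zero> m] by blast
  show ?thesis using cos0_smult[OF b zero_closed, of m] b unfolding z[symmetric] by simp
qed

lemma comparison_almost_pro_iso:
  "\<forall>n\<ge>1. almost_zero ts (ker_module (Src m) (Tgt m n) (cmp m n))"
  "shift_almost_killed ts (gs k) (\<lambda>n. Ck m n) (dC m) (p ^ k * m)"
  "almost_pro_iso (\<lambda>k. ts k \<otimes> gs k) (\<lambda>n. Src m) (\<lambda>n. id) (Tgt m) (tt m) (cmp m)"
proof -
  show ker: "\<forall>n\<ge>1. almost_zero ts (ker_module (Src m) (Tgt m n) (cmp m n))"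
    unfolding almost_zero_def ker_module_def a_kernel_def'
    using kernel_killed by (auto elim!: SrcE)
  have killed: "ts e \<odot>\<^bsub>Ck m n\<^esub> (gs k \<odot>\<^bsub>Ck m n\<^esub> transition (dC m) n (p ^ k * m) x) = \<zero>\<^bsub>Ck m n\<^esub>"
    if x: "x \<in> carrier (Ck m (n + p ^ k * m))" for x n k e
  proof -
    obtain F where "F \<in> OP (n + p ^ k * m)" "x = cl m (n + p ^ k * m) F" using x by (rule CkE)
    then show ?thesis using coker_killed by blast
  qed
  show "shift_almost_killed ts (gs k) (\<lambda>n. Ck m n) (dC m) (p ^ k * m)"
    unfolding shift_almost_killed_def almost_zero_def using killed by auto
  \<comment> \<open>Each kernel is almost zero already, so \<open>n' = n\<close> serves, and the
    remaining factor \<open>gs k\<close> acts on zero.\<close>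
  have "almost_pro_zero (\<lambda>k. ts k \<otimes> gs k) (\<lambda>n. ker_module (Src m) (Tgt m n) (cmp m n)) (\<lambda>n. id)"
    unfolding almost_pro_zero_def
  proof (intro allI impI)
    fix k n :: nat
    have "(ts k \<otimes> gs k) \<odot>\<^bsub>Src m\<^esub> X = \<zero>\<^bsub>Src m\<^esub>" if X: "X \<in> carrier (Src m)" "cmp m n X = \<zero>\<^bsub>Tgt m n\<^esub>" for X
    proof -
      obtain a where a: "a \<in> carrier A" "X = cos0 m a" using X(1) by (rule SrcE)
      have "(ts k \<otimes> gs k) \<odot>\<^bsub>Src m\<^esub> X = gs k \<odot>\<^bsub>Src m\<^esub> (ts k \<odot>\<^bsub>Src m\<^esub> X)"
        unfolding a(2) using a(1) by (simp add: cos0_smult m_ac)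
      also have "\<dots> = \<zero>\<^bsub>Src m\<^esub>" using kernel_killed[OF a(1)] X(2) a(2) by (simp add: Src_zero_smult)
      finally show ?thesis .
    qed
    then have "\<forall>x\<in>carrier (ker_module (Src m) (Tgt m n) (cmp m n)).
        (ts k \<otimes> gs k) \<odot>\<^bsub>ker_module (Src m) (Tgt m n) (cmp m n)\<^esub> transition (\<lambda>n. id) n (n - n) x
          = \<zero>\<^bsub>ker_module (Src m) (Tgt m n) (cmp m n)\<^esub>"
      by (auto simp: ker_module_def a_kernel_def')
    then show "\<exists>n'\<ge>n. \<forall>x\<in>carrier (ker_module (Src m) (Tgt m n') (cmp m n')).
        (ts k \<otimes> gs k) \<odot>\<^bsub>ker_module (Src m) (Tgt m n) (cmp m n)\<^esub> transition (\<lambda>n. id) n (n' - n) x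
          = \<zero>\<^bsub>ker_module (Src m) (Tgt m n) (cmp m n)\<^esub>" by blast
  qed
  moreover have "almost_pro_zero (\<lambda>k. ts k \<otimes> gs k) (\<lambda>n. Ck m n) (dC m)"
    unfolding almost_pro_zero_def
  proof (intro allI impI)
    fix k n :: nat
    have "(ts k \<otimes> gs k) \<odot>\<^bsub>Ck m n\<^esub> transition (dC m) n (n + p ^ k * m - n) x = \<zero>\<^bsub>Ck m n\<^esub>"
      if x: "x \<in> carrier (Ck m (n + p ^ k * m))" for x
    proof -
      obtain F where F: "F \<in> OP (n + p ^ k * m)" "x = cl m (n + p ^ k * m) F" using x by (rule CkE)
      define H where "H = \<rho>s n (p ^ k * m) F"
      have H: "transition (dC m) n (p ^ k * m) x = cl m n H" "H \<in> OP n"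
        using \<rho>s_props[of F n "p ^ k * m"] F unfolding H_def by simp_all
      interpret S: cring "SR n" by (rule SR_cring)
      interpret \<kappa>\<iota>: ring_hom_cring A "SR n" "\<lambda>a. \<kappa> n (\<iota> a)" by (rule \<kappa>\<iota>_hom)
      have "\<kappa> n (\<iota> (ts k \<otimes> gs k)) = \<kappa> n (\<iota> (ts k)) \<otimes>\<^bsub>SR n\<^esub> \<kappa> n (\<iota> (gs k))"
        using \<kappa>\<iota>.hom_mult[OF ts_closed gs_closed] .
      then have "(ts k \<otimes> gs k) \<odot>\<^bsub>Ck m n\<^esub> cl m n H = ts k \<odot>\<^bsub>Ck m n\<^esub> (gs k \<odot>\<^bsub>Ck m n\<^esub> cl m n H)"
        using H(2) OP_closed[OF H(2)] OP_mult[OF A_OP[OF gs_closed] H(2)] by (simp add: cl_smult S.m_assoc)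
      then show ?thesis using killed[OF x, of k] H(1) by simp
    qed
    then show "\<exists>n'\<ge>n. \<forall>x\<in>carrier (Ck m n'). (ts k \<otimes> gs k) \<odot>\<^bsub>Ck m n\<^esub> transition (dC m) n (n' - n) x = \<zero>\<^bsub>Ck m n\<^esub>"
      using le_add1 by blast
  qed
  ultimately show "almost_pro_iso (\<lambda>k. ts k \<otimes> gs k) (\<lambda>n. Src m) (\<lambda>n. id) (Tgt m) (tt m) (cmp m)"
    unfolding almost_pro_iso_def by blast
qed

end

section \<open>Integral perfectoid algebras\<close>

lemma cgenideal_iff: "x \<in> PIdl\<^bsub>A\<^esub> c \<longleftrightarrow> (\<exists>y\<in>carrier A. x = y \<otimes>\<^bsub>A\<^esub> c)"
  unfolding cgenideal_def by auto

context field
begin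

section \<open>The residue characteristic\<close>

lemma abs_val_one: assumes "ultrametric_abs_val R nrm" shows "nrm \<one> = 1"
proof -
  have "nrm (\<one> \<otimes> \<one>) = nrm \<one> * nrm \<one>" "nrm \<one> \<noteq> 0"
    using assms one_closed one_not_zero unfolding ultrametric_abs_val_def by blast+
  then show ?thesis by simp
qed

lemma abs_val_nat_le_one: assumes "ultrametric_abs_val R nrm" shows "nrm ([(n::nat)] \<cdot> \<one>) \<le> 1"
proof (induction n)
  case 0
  have "nrm \<zero> = 0" using assms unfolding ultrametric_abs_val_def by auto
  then show ?case by simp
next
  case (Suc n)
  have "nrm ([n] \<cdot> \<one> \<oplus> \<one>) \<le> max (nrm ([n] \<cdot> \<one>)) (nrm \<one>)"
    using assms unfolding ultrametric_abs_val_def by auto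
  then show ?case using Suc abs_val_one[OF assms] by simp
qed

text \<open>For the least positive \<open>q\<close> that vanishes in the field, \<open>p\<close> not
  dividing \<open>q\<close> would give \<open>p x = 1\<close> with \<open>|x| \<le> 1\<close>,
  against \<open>|p| < 1\<close>. So \<open>q = p m\<close>, and \<open>m\<close> does not vanish by
  minimality. Hence outside characteristic 0, \<open>p\<close> is zero and trivially a multiple of
  \<open>t\<close>.\<close>

lemma residue_char_zero_or_eq:
  assumes nv: "ultrametric_abs_val R nrm" and p: "prime (p::nat)" and lt: "nrm ([p] \<cdot> \<one>) < 1"
    and n: "n > 0" "[(n::nat)] \<cdot> \<one> = \<zero>"
  shows "[p] \<cdot> \<one> = \<zero>"
proof -
  have mul: "[(a * b)] \<cdot> \<one> = [a] \<cdot> \<one> \<otimes> [b] \<cdot> \<one>" for a b :: nat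
    by (simp add: add_pow_ldistr add.nat_pow_pow mult.commute)
  define q where "q = (LEAST n. n > 0 \<and> [(n::nat)] \<cdot> \<one> = \<zero>)"
  have q: "q > 0" "[q] \<cdot> \<one> = \<zero>" unfolding q_def using LeastI[of "\<lambda>n. n > 0 \<and> [(n::nat)] \<cdot> \<one> = \<zero>"] n by blast+
  have min: "\<And>k. \<lbrakk>k > 0; [(k::nat)] \<cdot> \<one> = \<zero>\<rbrakk> \<Longrightarrow> q \<le> k" unfolding q_def by (intro Least_le) auto
  have "p dvd q"
  proof (rule ccontr)
    assume "\<not> p dvd q"
    then have cop: "coprime p q" using p prime_imp_coprime by blast
    have "p \<noteq> 0" using p by auto
    then obtain x y where xy: "p * x = q * y + 1" using bezout_nat[of p q] cop by auto
    have "[(p * x)] \<cdot> \<one> = [(q * y)] \<cdot> \<one> \<oplus> \<one>" unfolding xy by (simp add: add.nat_pow_mult[symmetric])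
    then have "[p] \<cdot> \<one> \<otimes> [x] \<cdot> \<one> = \<one>" unfolding mul q(2) by simp
    moreover have "nrm ([p] \<cdot> \<one> \<otimes> [x] \<cdot> \<one>) = nrm ([p] \<cdot> \<one>) * nrm ([x] \<cdot> \<one>)" "0 \<le> nrm ([p] \<cdot> \<one>)"
      using nv unfolding ultrametric_abs_val_def by auto
    moreover have "nrm ([p] \<cdot> \<one>) * nrm ([x] \<cdot> \<one>) \<le> nrm ([p] \<cdot> \<one>)"
      using mult_left_mono[OF abs_val_nat_le_one[OF nv, of x] \<open>0 \<le> nrm ([p] \<cdot> \<one>)\<close>] by simp
    ultimately show False using lt abs_val_one[OF nv] by simp
  qed
  then obtain m where m: "q = p * m" by auto
  have "m > 0" "m < q" using q(1) m prime_gt_1_nat[OF p] by (auto intro: gr0I)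
  then have "[m] \<cdot> \<one> \<noteq> \<zero>" using min[of m] by auto
  then show ?thesis using q(2) integral[of "[p] \<cdot> \<one>" "[m] \<cdot> \<one>"] unfolding m mul by auto
qed

end

text \<open>Regularity of \<open>t\<close> comes from flatness over a domain, that of
  \<open>g\<close> from almost regularity modulo all powers of \<open>t\<close> and separatedness of
  \<open>A\<close>. That \<open>p\<close> is a multiple of \<open>t\<close> comes from the
  normalization of \<open>t\<close>, and the Frobenius axioms unfold the isomorphism of
  quotients.\<close>

lemma almost_perfectoid_of_integral_perfectoid:
  fixes p :: nat and K :: "'k ring" and nrm :: "'k \<Rightarrow> real" and t :: 'k and tr :: "nat \<Rightarrow> 'k"
    and A :: "('k, 'a) module" and g :: 'a and gr :: "nat \<Rightarrow> 'a"
  assumes p: "prime p" and K: "perfectoid_field p K nrm"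
    and t: "t \<in> carrier (int_ring K nrm)" "t \<noteq> \<zero>\<^bsub>K\<^esub>"
    and tr: "compatible_roots (int_ring K nrm) p t tr"
    and char: "char_zero K \<longrightarrow> nrm t = nrm (nat_elem K p)"
    and A: "integral_perfectoid p (int_ring K nrm) t tr A"
    and g: "g \<in> carrier A" "compatible_roots A p g gr"
    and nzd: "\<forall>m::nat. almost_nonzerodivisor_mod A (\<lambda>k. alg_map A (tr k)) (alg_map A t [^]\<^bsub>A\<^esub> m) g"
  shows "almost_perfectoid A p (\<lambda>k. alg_map A (tr k)) gr"
proof -
  define V where "V = int_ring K nrm"
  interpret K: field K using K by (simp add: perfectoid_field_def)
  have nv: "ultrametric_abs_val K nrm" and plt: "nrm (nat_elem K p) < 1" using K by (auto simp: perfectoid_field_def)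
  have nmult: "nrm (x \<otimes>\<^bsub>K\<^esub> y) = nrm x * nrm y" if "x \<in> carrier K" "y \<in> carrier K" for x y
    using nv that by (simp add: ultrametric_abs_val_def)
  have nzero: "nrm x = 0 \<longleftrightarrow> x = \<zero>\<^bsub>K\<^esub>" and npos: "0 \<le> nrm x" if "x \<in> carrier K" for x
    using nv that by (auto simp: ultrametric_abs_val_def)
  have algA: "Module.algebra V A" using A by (simp add: integral_perfectoid_def V_def)
  interpret A: cring A using algA by (rule Module.algebra.axioms(2))
  interpret V: cring V using algA[THEN Module.algebra.axioms(1)] by (rule module.axioms(1))
  interpret Alg: Module.algebra V A by (rule algA)
  have Vs: "carrier V = {x \<in> carrier K. nrm x \<le> 1}" "\<And>x y. x \<otimes>\<^bsub>V\<^esub> y = x \<otimes>\<^bsub>K\<^esub> y" "\<And>x y. x \<oplus>\<^bsub>V\<^esub> y = x \<oplus>\<^bsub>K\<^esub> y"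
    "\<one>\<^bsub>V\<^esub> = \<one>\<^bsub>K\<^esub>" "\<zero>\<^bsub>V\<^esub> = \<zero>\<^bsub>K\<^esub>"
    by (simp_all add: V_def int_ring_def)
  define \<alpha> where "\<alpha> = alg_map A"
  have \<alpha>s: "\<alpha> x \<otimes>\<^bsub>A\<^esub> a = x \<odot>\<^bsub>A\<^esub> a" if "x \<in> carrier V" "a \<in> carrier A" for x a
    using Alg.smult_assoc2[of x "\<one>\<^bsub>A\<^esub>" a] that by (simp add: \<alpha>_def alg_map_def)
  have \<alpha>hom: "\<alpha> \<in> ring_hom V A"
  proof (rule ring_hom_memI)
    show "\<alpha> x \<in> carrier A" if "x \<in> carrier V" for x using that by (simp add: \<alpha>_def alg_map_def)
    show "\<alpha> (x \<otimes>\<^bsub>V\<^esub> y) = \<alpha> x \<otimes>\<^bsub>A\<^esub> \<alpha> y" if "x \<in> carrier V" "y \<in> carrier V" for x y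
      using \<alpha>s[of x "\<alpha> y"] that by (simp add: \<alpha>_def alg_map_def Alg.smult_assoc1)
    show "\<alpha> (x \<oplus>\<^bsub>V\<^esub> y) = \<alpha> x \<oplus>\<^bsub>A\<^esub> \<alpha> y" if "x \<in> carrier V" "y \<in> carrier V" for x y
      using that by (simp add: \<alpha>_def alg_map_def Alg.smult_l_distr)
    show "\<alpha> \<one>\<^bsub>V\<^esub> = \<one>\<^bsub>A\<^esub>" by (simp add: \<alpha>_def alg_map_def)
  qed
  interpret \<alpha>: ring_hom_cring V A \<alpha>
    by (intro ring_hom_cring.intro ring_hom_cring_axioms.intro V.cring_axioms A.cring_axioms \<alpha>hom)
  have tV: "t \<in> carrier V" and trV: "\<And>k. tr k \<in> carrier V" "tr 0 = t" "\<And>k. tr (Suc k) [^]\<^bsub>V\<^esub> p = tr k"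
    using t tr by (auto simp: compatible_roots_def V_def)
  define T where "T = \<alpha> t"
  have Tc: "T \<in> carrier A" using tV by (simp add: T_def)
  have flat: "flat_module V A" using A by (simp add: integral_perfectoid_def V_def)
  have t_reg: "a = \<zero>\<^bsub>A\<^esub>" if "a \<in> carrier A" "T \<otimes>\<^bsub>A\<^esub> a = \<zero>\<^bsub>A\<^esub>" for a
  proof (rule flat_module_torsion_free[OF flat V.cring_axioms tV])
    show "x = \<zero>\<^bsub>V\<^esub>" if "x \<in> carrier V" "t \<otimes>\<^bsub>V\<^esub> x = \<zero>\<^bsub>V\<^esub>" for x
      using that K.integral[of t x] tV t(2) by (auto simp: Vs)
    show "t \<odot>\<^bsub>A\<^esub> a = \<zero>\<^bsub>A\<^esub>" using that \<alpha>s[OF tV, of a] by (simp add: T_def)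
  qed (use that in auto)
  have sep: "a = \<zero>\<^bsub>A\<^esub>" if a: "a \<in> carrier A" and d: "\<And>n::nat. \<exists>b\<in>carrier A. a = T [^]\<^bsub>A\<^esub> n \<otimes>\<^bsub>A\<^esub> b" for a
  proof -
    \<comment> \<open>Separatedness is uniqueness of the limit of the constant sequence
      zero.\<close>
    have ex1: "\<exists>!x. x \<in> carrier A \<and> (\<forall>n. x \<ominus>\<^bsub>A\<^esub> \<zero>\<^bsub>A\<^esub> \<in> PIdl\<^bsub>A\<^esub> (T [^]\<^bsub>A\<^esub> (n::nat)))"
    proof -
      have "adically_complete A T" using A by (simp add: integral_perfectoid_def T_def \<alpha>_def)
      moreover have "\<zero>\<^bsub>A\<^esub> \<ominus>\<^bsub>A\<^esub> \<zero>\<^bsub>A\<^esub> \<in> PIdl\<^bsub>A\<^esub> (T [^]\<^bsub>A\<^esub> n)" for n :: nat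
        unfolding cgenideal_iff using Tc by (intro bexI[of _ "\<zero>\<^bsub>A\<^esub>"]) (auto simp: a_minus_def)
      ultimately show ?thesis unfolding adically_complete_def by (elim allE[of _ "\<lambda>n. \<zero>\<^bsub>A\<^esub>"]) auto
    qed
    have "a \<ominus>\<^bsub>A\<^esub> \<zero>\<^bsub>A\<^esub> \<in> PIdl\<^bsub>A\<^esub> (T [^]\<^bsub>A\<^esub> n)" for n :: nat
    proof -
      obtain b where b: "b \<in> carrier A" "a = T [^]\<^bsub>A\<^esub> n \<otimes>\<^bsub>A\<^esub> b" using d by blast
      have "a \<ominus>\<^bsub>A\<^esub> \<zero>\<^bsub>A\<^esub> = b \<otimes>\<^bsub>A\<^esub> T [^]\<^bsub>A\<^esub> n" using b a Tc A.m_comm by (simp add: a_minus_def)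
      then show ?thesis unfolding cgenideal_iff using b(1) by blast
    qed
    moreover have "\<zero>\<^bsub>A\<^esub> \<ominus>\<^bsub>A\<^esub> \<zero>\<^bsub>A\<^esub> \<in> PIdl\<^bsub>A\<^esub> (T [^]\<^bsub>A\<^esub> n)" for n :: nat
      unfolding cgenideal_iff using Tc by (intro bexI[of _ "\<zero>\<^bsub>A\<^esub>"]) (auto simp: a_minus_def)
    ultimately show ?thesis using ex1 a A.zero_closed by blast
  qed
  define T1 where "T1 = \<alpha> (tr 1)"
  have T1c: "T1 \<in> carrier A" using trV by (simp add: T1_def)
  define I where "I = PIdl\<^bsub>A\<^esub> T"
  define I1 where "I1 = PIdl\<^bsub>A\<^esub> T1"
  have idI: "ideal I A" and idI1: "ideal I1 A" unfolding I_def I1_def using Tc T1c A.cgenideal_ideal by auto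
  interpret I: ideal I A by (rule idI)
  interpret I1: ideal I1 A by (rule idI1)
  define \<Phi> where "\<Phi> = frobenius_map A p T"
  have \<Phi>: "\<Phi> \<in> ring_hom (A Quot I1) (A Quot I)" "bij_betw \<Phi> (carrier (A Quot I1)) (carrier (A Quot I))"
    using A unfolding integral_perfectoid_def ring_iso_def \<Phi>_def T_def I_def I1_def T1_def \<alpha>_def by auto
  have qI: "carrier (A Quot I) = (\<lambda>x. I +>\<^bsub>A\<^esub> x) ` carrier A" and qI1: "carrier (A Quot I1) = (\<lambda>x. I1 +>\<^bsub>A\<^esub> x) ` carrier A"
    by (auto simp: FactRing_def A_RCOSETS_def')
  \<comment> \<open>\<open>frobenius_map\<close> of a coset is by definition a union of cosets. That
    it is a single one is known only because \<Phi> maps into the quotient; the element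
    \<open>a^p\<close> then identifies it.\<close>
  have \<Phi>_cos: "\<Phi> (I1 +>\<^bsub>A\<^esub> a) = I +>\<^bsub>A\<^esub> (a [^]\<^bsub>A\<^esub> p)" if a: "a \<in> carrier A" for a
  proof -
    have "\<Phi> (I1 +>\<^bsub>A\<^esub> a) \<in> carrier (A Quot I)" using ring_hom_closed[OF \<Phi>(1)] a by (auto simp: qI1)
    then obtain c where c: "c \<in> carrier A" "\<Phi> (I1 +>\<^bsub>A\<^esub> a) = I +>\<^bsub>A\<^esub> c" by (auto simp: qI)
    have "a \<in> I1 +>\<^bsub>A\<^esub> a" by (rule I1.a_rcos_self[OF a])
    then have "I +>\<^bsub>A\<^esub> (a [^]\<^bsub>A\<^esub> p) \<subseteq> I +>\<^bsub>A\<^esub> c" using c(2) unfolding \<Phi>_def frobenius_map_def I_def by blast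
    moreover have "a [^]\<^bsub>A\<^esub> p \<in> I +>\<^bsub>A\<^esub> (a [^]\<^bsub>A\<^esub> p)" using a by (intro I.a_rcos_self) auto
    ultimately have "a [^]\<^bsub>A\<^esub> p \<in> I +>\<^bsub>A\<^esub> c" by blast
    then have "I +>\<^bsub>A\<^esub> c = I +>\<^bsub>A\<^esub> (a [^]\<^bsub>A\<^esub> p)" using A.a_repr_independence[OF _ c(1) I.a_subgroup] by blast
    then show ?thesis using c by simp
  qed
  have cosI: "I +>\<^bsub>A\<^esub> x = I +>\<^bsub>A\<^esub> y \<longleftrightarrow> x \<ominus>\<^bsub>A\<^esub> y \<in> I" if "x \<in> carrier A" "y \<in> carrier A" for x y
    using A.quotient_eq_iff_same_a_r_cos[OF idI that] by simp
  have cosI1: "I1 +>\<^bsub>A\<^esub> x = I1 +>\<^bsub>A\<^esub> y \<longleftrightarrow> x \<ominus>\<^bsub>A\<^esub> y \<in> I1" if "x \<in> carrier A" "y \<in> carrier A" for x y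
    using A.quotient_eq_iff_same_a_r_cos[OF idI1 that] by simp
  have p0: "p > 0" using p prime_gt_0_nat by auto
  have minus0: "x \<ominus>\<^bsub>A\<^esub> \<zero>\<^bsub>A\<^esub> = x" if "x \<in> carrier A" for x using that by (simp add: a_minus_def)
  have inI: "x \<in> I \<longleftrightarrow> (\<exists>b\<in>carrier A. x = T \<otimes>\<^bsub>A\<^esub> b)" for x
    unfolding I_def cgenideal_iff using Tc A.m_comm by metis
  have inI1: "x \<in> I1 \<longleftrightarrow> (\<exists>b\<in>carrier A. x = T1 \<otimes>\<^bsub>A\<^esub> b)" for x
    unfolding I1_def cgenideal_iff using T1c A.m_comm by metis
  have frob_inj: "\<exists>c\<in>carrier A. a = T1 \<otimes>\<^bsub>A\<^esub> c"
    if a: "a \<in> carrier A" "b \<in> carrier A" "a [^]\<^bsub>A\<^esub> p = T \<otimes>\<^bsub>A\<^esub> b" for a b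
  proof -
    have "a [^]\<^bsub>A\<^esub> p \<in> I" using a inI by blast
    moreover have "\<zero>\<^bsub>A\<^esub> [^]\<^bsub>A\<^esub> p = \<zero>\<^bsub>A\<^esub>" using p0 by (simp add: A.nat_pow_zero)
    ultimately have "\<Phi> (I1 +>\<^bsub>A\<^esub> a) = \<Phi> (I1 +>\<^bsub>A\<^esub> \<zero>\<^bsub>A\<^esub>)"
      using cosI[of "a [^]\<^bsub>A\<^esub> p" "\<zero>\<^bsub>A\<^esub>"] a(1) minus0 by (simp add: \<Phi>_cos)
    then have "I1 +>\<^bsub>A\<^esub> a = I1 +>\<^bsub>A\<^esub> \<zero>\<^bsub>A\<^esub>"
      using inj_onD[OF bij_betw_imp_inj_on[OF \<Phi>(2)]] a(1) A.zero_closed unfolding qI1 by blast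
    then show ?thesis using cosI1[of a "\<zero>\<^bsub>A\<^esub>"] a(1) minus0 inI1 by simp
  qed
  have frob_surj: "\<exists>b\<in>carrier A. \<exists>c\<in>carrier A. a = b [^]\<^bsub>A\<^esub> p \<oplus>\<^bsub>A\<^esub> T \<otimes>\<^bsub>A\<^esub> c" if a: "a \<in> carrier A" for a
  proof -
    have "I +>\<^bsub>A\<^esub> a \<in> \<Phi> ` carrier (A Quot I1)" using bij_betw_imp_surj_on[OF \<Phi>(2)] a unfolding qI by blast
    then obtain b where b: "b \<in> carrier A" "I +>\<^bsub>A\<^esub> a = \<Phi> (I1 +>\<^bsub>A\<^esub> b)" unfolding qI1 by blast
    then have "a \<ominus>\<^bsub>A\<^esub> b [^]\<^bsub>A\<^esub> p \<in> I" using cosI[of a "b [^]\<^bsub>A\<^esub> p"] a by (simp add: \<Phi>_cos)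
    then obtain c where c: "c \<in> carrier A" "a \<ominus>\<^bsub>A\<^esub> b [^]\<^bsub>A\<^esub> p = T \<otimes>\<^bsub>A\<^esub> c" using inI by blast
    have "a = b [^]\<^bsub>A\<^esub> p \<oplus>\<^bsub>A\<^esub> (a \<ominus>\<^bsub>A\<^esub> b [^]\<^bsub>A\<^esub> p)" using a b(1) by (simp add: a_minus_def A.a_lcomm A.r_neg)
    then show ?thesis unfolding c(2) using b(1) c(1) by blast
  qed
  have p_mult: "\<exists>c\<in>carrier A. [p] \<cdot>\<^bsub>A\<^esub> \<one>\<^bsub>A\<^esub> = T \<otimes>\<^bsub>A\<^esub> c"
  proof -
    have pK: "nat_elem K p \<in> carrier K" by (simp add: nat_elem_def)
    have tK: "t \<in> carrier K" using tV by (simp add: Vs)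
    have "\<exists>c\<in>carrier V. nat_elem K p = t \<otimes>\<^bsub>K\<^esub> c"
    proof (cases "char_zero K")
      case True
      \<comment> \<open>\<open>c\<close> is \<open>p/t\<close>, which has absolute value 1 by the
        normalization of \<open>t\<close>.\<close>
      define c where "c = inv\<^bsub>K\<^esub> t \<otimes>\<^bsub>K\<^esub> nat_elem K p"
      have tu: "t \<in> Units K" using tK t(2) K.field_Units by auto
      have cK: "c \<in> carrier K" using tu pK by (simp add: c_def)
      have "t \<otimes>\<^bsub>K\<^esub> c = (t \<otimes>\<^bsub>K\<^esub> inv\<^bsub>K\<^esub> t) \<otimes>\<^bsub>K\<^esub> nat_elem K p"
        unfolding c_def using tu pK tK by (intro K.m_assoc[symmetric]) auto
      then have tc: "t \<otimes>\<^bsub>K\<^esub> c = nat_elem K p" using tu pK by simp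
      have "nrm t * nrm c = nrm t" using nmult[OF tK cK] tc char True by simp
      then have "nrm c = 1" using nzero[OF tK] t(2) by simp
      then show ?thesis using cK tc by (intro bexI[of _ c]) (auto simp: Vs)
    next
      case False
      then obtain n :: nat where n: "n > 0" "[n] \<cdot>\<^bsub>K\<^esub> \<one>\<^bsub>K\<^esub> = \<zero>\<^bsub>K\<^esub>" unfolding char_zero_def by auto
      have "nat_elem K p = \<zero>\<^bsub>K\<^esub>"
        using K.residue_char_zero_or_eq[OF nv p _ n] plt unfolding nat_elem_def by blast
      then show ?thesis using tK nzero[of "\<zero>\<^bsub>K\<^esub>"] by (intro bexI[of _ "\<zero>\<^bsub>K\<^esub>"]) (auto simp: Vs)
    qed
    then obtain c where c: "c \<in> carrier V" "nat_elem K p = t \<otimes>\<^bsub>K\<^esub> c" by blast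
    have "[n] \<cdot>\<^bsub>K\<^esub> \<one>\<^bsub>K\<^esub> \<in> carrier V \<and> \<alpha> ([n] \<cdot>\<^bsub>K\<^esub> \<one>\<^bsub>K\<^esub>) = [n] \<cdot>\<^bsub>A\<^esub> \<one>\<^bsub>A\<^esub>" for n :: nat
    proof (induction n)
      case 0
      then show ?case using \<alpha>.hom_zero V.zero_closed unfolding Vs(5) by simp
    next
      case (Suc n)
      have "\<alpha> ([n] \<cdot>\<^bsub>K\<^esub> \<one>\<^bsub>K\<^esub> \<oplus>\<^bsub>V\<^esub> \<one>\<^bsub>V\<^esub>) = [n] \<cdot>\<^bsub>A\<^esub> \<one>\<^bsub>A\<^esub> \<oplus>\<^bsub>A\<^esub> \<one>\<^bsub>A\<^esub>"
        using Suc \<alpha>.hom_add \<alpha>.hom_one V.one_closed by metis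
      moreover have "[n] \<cdot>\<^bsub>K\<^esub> \<one>\<^bsub>K\<^esub> \<oplus>\<^bsub>V\<^esub> \<one>\<^bsub>V\<^esub> \<in> carrier V" using Suc by blast
      ultimately show ?case by (simp add: Vs(3,4))
    qed
    then have "[p] \<cdot>\<^bsub>A\<^esub> \<one>\<^bsub>A\<^esub> = \<alpha> (t \<otimes>\<^bsub>V\<^esub> c)" using c(2) unfolding nat_elem_def Vs(2) by metis
    then show ?thesis using tV c(1) unfolding T_def by auto
  qed
  have almost: "\<exists>c\<in>carrier A. \<alpha> (tr k) \<otimes>\<^bsub>A\<^esub> a = T [^]\<^bsub>A\<^esub> m \<otimes>\<^bsub>A\<^esub> c"
    if ab: "a \<in> carrier A" "b \<in> carrier A" "g \<otimes>\<^bsub>A\<^esub> a = T [^]\<^bsub>A\<^esub> m \<otimes>\<^bsub>A\<^esub> b" for a b k and m :: nat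
  proof -
    define M where "M = as_module id A"
    have Ms: "carrier M = carrier A" "\<And>x y. x \<oplus>\<^bsub>M\<^esub> y = x \<oplus>\<^bsub>A\<^esub> y" "\<zero>\<^bsub>M\<^esub> = \<zero>\<^bsub>A\<^esub>" "\<And>x y. x \<odot>\<^bsub>M\<^esub> y = x \<otimes>\<^bsub>A\<^esub> y"
      by (simp_all add: M_def as_module_def)
    have "abelian_group M"
    proof (rule abelian_groupI)
      fix x assume "x \<in> carrier M"
      then show "\<exists>y\<in>carrier M. y \<oplus>\<^bsub>M\<^esub> x = \<zero>\<^bsub>M\<^esub>"
        unfolding Ms by (intro bexI[of _ "\<ominus>\<^bsub>A\<^esub> x"]) (auto simp: A.l_neg)
    qed (auto simp: Ms A.a_assoc intro: A.a_comm)
    then have sg: "scalar_group M (carrier A)"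
      by (intro scalar_group.intro scalar_group_axioms.intro) (auto simp: Ms A.r_distr)
    define H where "H = multiples M (T [^]\<^bsub>A\<^esub> m)"
    have inH: "x \<in> H \<longleftrightarrow> (\<exists>c\<in>carrier A. x = T [^]\<^bsub>A\<^esub> m \<otimes>\<^bsub>A\<^esub> c)" for x by (auto simp: H_def multiples_def Ms)
    have "scalar_quotient M (carrier A) H"
      unfolding H_def multiples_def
      by (rule scalar_group.image_quotient[OF sg sg]) (use Tc in \<open>auto simp: Ms A.r_distr A.m_lcomm\<close>)
    then interpret Q: scalar_quotient M "carrier A" H .
    have red: "reduction M (T [^]\<^bsub>A\<^esub> m) = Q.Q" by (simp add: reduction_def H_def)
    have "almost_zero (\<lambda>k. \<alpha> (tr k)) (ker_module Q.Q Q.Q (\<lambda>x. g \<odot>\<^bsub>Q.Q\<^esub> x))"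
      using nzd[rule_format, of m]
      unfolding almost_nonzerodivisor_mod_def Let_def M_def[symmetric] T_def[symmetric] \<alpha>_def[symmetric] red .
    moreover have "Q.cos (g \<otimes>\<^bsub>A\<^esub> a) = \<zero>\<^bsub>Q.Q\<^esub>"
    proof -
      have "g \<otimes>\<^bsub>A\<^esub> a \<in> H" using inH ab by blast
      then show ?thesis using Q.cos_zero_iff[of "g \<otimes>\<^bsub>A\<^esub> a"] g(1) ab(1) by (simp add: Ms)
    qed
    then have "Q.cos a \<in> a_kernel Q.Q Q.Q (\<lambda>x. g \<odot>\<^bsub>Q.Q\<^esub> x)"
      unfolding a_kernel_def' using g(1) ab(1) Q.cos_closed[of a] Q.smult_cos[of g a] by (simp add: Ms)
    ultimately have "\<alpha> (tr k) \<odot>\<^bsub>Q.Q\<^esub> Q.cos a = \<zero>\<^bsub>Q.Q\<^esub>"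
      unfolding almost_zero_def ker_module_def by auto
    then show ?thesis using Q.smult_cos[of "\<alpha> (tr k)" a] Q.cos_zero_iff[of "\<alpha> (tr k) \<otimes>\<^bsub>A\<^esub> a"] ab(1) trV(1) inH
      by (simp add: Ms)
  qed
  have g_reg: "a = \<zero>\<^bsub>A\<^esub>" if a: "a \<in> carrier A" "g \<otimes>\<^bsub>A\<^esub> a = \<zero>\<^bsub>A\<^esub>" for a
  proof -
    \<comment> \<open>For \<open>k = 0\<close> the almost factor is \<open>t\<close> itself, so
      \<open>t a\<close> is divisible by every power of \<open>t\<close> and vanishes by
      separatedness.\<close>
    have "T \<otimes>\<^bsub>A\<^esub> a = \<zero>\<^bsub>A\<^esub>"
    proof (rule sep)
      fix n :: nat
      have "g \<otimes>\<^bsub>A\<^esub> a = T [^]\<^bsub>A\<^esub> n \<otimes>\<^bsub>A\<^esub> \<zero>\<^bsub>A\<^esub>" using a Tc by simp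
      then show "\<exists>b\<in>carrier A. T \<otimes>\<^bsub>A\<^esub> a = T [^]\<^bsub>A\<^esub> n \<otimes>\<^bsub>A\<^esub> b"
        using almost[OF a(1) A.zero_closed, of n 0] trV(2) by (simp add: T_def)
    qed (use a Tc in auto)
    then show ?thesis using t_reg a(1) by blast
  qed
  have gr: "gr 0 = g" "\<And>k. gr k \<in> carrier A" "\<And>k. gr (Suc k) [^]\<^bsub>A\<^esub> p = gr k"
    using g(2) by (auto simp: compatible_roots_def)
  show ?thesis
    unfolding \<alpha>_def[symmetric]
  proof (intro almost_perfectoid.intro almost_perfectoid_axioms.intro A.cring_axioms p)
    show "\<alpha> (tr (Suc k)) [^]\<^bsub>A\<^esub> p = \<alpha> (tr k)" for k
      using \<alpha>.hom_pow[OF trV(1), of "Suc k" p] trV(3)[of k] by simp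
  qed (use trV gr t_reg g_reg frob_inj frob_surj p_mult almost in \<open>auto simp: T_def T1_def\<close>)
qed

theorem theorem4p2:
  fixes p :: nat
    and K :: "'k ring" and nrm :: "'k \<Rightarrow> real"
    and t :: 'k and tr :: "nat \<Rightarrow> 'k"
    and A :: "('k, 'a) module"
    and g :: 'a and gr :: "nat \<Rightarrow> 'a"
  assumes "Factorial_Ring.prime p"
    and "perfectoid_field p K nrm"
    and "t \<in> carrier (int_ring K nrm)" and "t \<noteq> \<zero>\<^bsub>K\<^esub>" and "topologically_nilpotent K nrm t"
    and "compatible_roots (int_ring K nrm) p t tr"
    and "char_zero K \<longrightarrow> nrm t = nrm (nat_elem K p)"
    and "integral_perfectoid p (int_ring K nrm) t tr A"
    and "g \<in> carrier A" and "compatible_roots A p g gr"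
    and "\<forall>m::nat. almost_nonzerodivisor_mod A (\<lambda>k. alg_map A (tr k)) (alg_map A t [^]\<^bsub>A\<^esub> m) g"
  shows "\<forall>m::nat. let
      tA = alg_map A t;
      tAr = (\<lambda>k. alg_map A (tr k));
      M = (\<lambda>n::nat. source_module A tA m);
      M' = target_module A tA g m;
      d' = target_transition A tA g m;
      f = comparison_map A tA g m;
      C = (\<lambda>n. coker_module (M n) (M' n) (f n));
      dC = coker_transition M M' f d'
    in (\<forall>n\<ge>1. almost_zero tAr (ker_module (M n) (M' n) (f n))) \<and>
       uniformly_almost_pro_zero tAr gr C dC \<and>
       (\<forall>k. shift_almost_killed tAr (gr k) C dC (p ^ k * m)) \<and>
       almost_pro_iso (\<lambda>k. tAr k \<otimes>\<^bsub>A\<^esub> gr k) M (\<lambda>n. id) M' d' f"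
proof -
  interpret P: almost_perfectoid A p "\<lambda>k. alg_map A (tr k)" gr
    using almost_perfectoid_of_integral_perfectoid[OF assms(1-4,6-11)] .
  have eqs: "tr 0 = t" "gr 0 = g" using assms(6,10) by (auto simp: compatible_roots_def)
  note main = P.comparison_almost_pro_iso[unfolded eqs]
  show ?thesis
    unfolding Let_def uniformly_almost_pro_zero_def
    by (intro allI conjI exI) (use main(1) in blast, rule main(2), rule main(2), rule main(3))
qed

end
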